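(* Let $m\ge2$, $1<p_0<\infty$, $\frac1{p_0}+\frac1{p_0'}=1$, and let $T_\alpha$ be an $m$-linear fractional integral operator with generalized kernel on $\mathbb{R}^n$ (with constants $C_k$, $k\ge1$, in its smoothness condition) such that $\sum_{k=1}^\infty kC_k<\infty$. Let $p_1(\cdot),\ldots,p_m(\cdot)$ be such that $\frac{p_i(\cdot)}{p_0'}\in\mathscr P^{log}(\mathbb{R}^n)$ and $0<\alpha_i<\frac{n}{p_{i,+}}$ for $i=1,\ldots,m$, where $p_{i,+}=(p_i)_+$ and $\alpha=\alpha_1+\cdots+\alpha_m$. Let $\frac1{p(\cdot)}=\frac1{p_1(\cdot)}+\cdots+\frac1{p_m(\cdot)}$, $\frac1{q(\cdot)}=\frac1{p(\cdot)}-\frac\alpha n$, suppose $q(\cdot)\in\mathscr B(\mathbb{R}^n)$, and let $\vec b=(b_1,\ldots,b_m)\in\mathrm{BMO}^m$. Let $T_{\vec b,\alpha}$ be the $m$-linear commutator of $T_\alpha$ with $\vec b$. Then there exists a positive constant $C$, independent of $\vec f$ and $\vec b$, such that for all $f_j\in L^{p_j(\cdot)}(\mathbb{R}^n)$, $j=1,\ldots,m$, $$\left\|T_{\vec b,\alpha}(f_1,\ldots,f_m)\right\|_{L^{q(\cdot)}(\mathbb{R}^n)}\le C\,\|\vec b\|_{(\mathrm{BMO})^m}\prod_{j=1}^m\|f_j\|_{L^{p_j(\cdot)}(\mathbb{R}^n)}.$$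
   Context: Cubes in $\mathbb{R}^n$ have sides parallel to the axes; $Q(x,r)$ is the cube centered at $x$ with side length $r$; $|E|$ is Lebesgue measure; for a set $E$, $(E)^m=E\times\cdots\times E$ ($m$ factors); $\vec y=(y_1,\ldots,y_m)\in(\mathbb{R}^n)^m$, $d\vec y=dy_1\cdots dy_m$. Operator. Fix $1<p_0<\infty$, $\frac1{p_0}+\frac1{p_0'}=1$, and $\alpha$ with $0<\alpha p_0'<mn$. Let $K_\alpha(x,y_1,\ldots,y_m)$ be a locally integrable function defined away from the diagonal $x=y_1=\cdots=y_m$ in $(\mathbb{R}^n)^{m+1}$. Let $T_\alpha:\mathscr S(\mathbb{R}^n)\times\cdots\times\mathscr S(\mathbb{R}^n)\to\mathscr S'(\mathbb{R}^n)$ be $m$-linear with $$T_\alpha(\vec f)(x)=\int_{(\mathbb{R}^n)^m}K_\alpha(x,\vec y)\prod_{j=1}^m f_j(y_j)\,d\vec y\quad\text{for } x\notin\bigcap_{j=1}^m\operatorname{supp}f_j .$$ $T_\alpha$ is called an $m$-linear fractional integral operator with generalized kernel if: (1a) (size) for some $A>0$, $|K_\alpha(x,\vec y)|\le A\big(\sum_{j=1}^m|x-y_j|\big)^{-(mn-\alpha)}$; (1b) (smoothness) there are a constant $C>0$ and positive constants $C_k$, $k\in\{1,2,\ldots\}$, such that for all $k\geq 1$ and all $x\ne x'$ in $\mathbb{R}^n$, $$\left(\int_{Q(x,2^{k+2}\sqrt{mn}|x-x'|)^m\setminus Q(x,2^{k+1}\sqrt{mn}|x-x'|)^m}|K_\alpha(x,\vec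 y)-K_\alpha(x',\vec y)|^{p_0}d\vec y\right)^{1/p_0}\le C\,C_k\,2^{k(\alpha-\frac{mn}{p_0'})}|x-x'|^{\alpha-\frac{mn}{p_0'}};$$ (2) for some fixed $1\le s_1,\ldots,s_m\le p_0'$ with $\frac1s=\frac1{s_1}+\cdots+\frac1{s_m}$, $T_\alpha$ maps $L^{s_1}\times\cdots\times L^{s_m}$ boundedly into $L^{\frac{sn}{n-s\alpha},\infty}$. By (2), $T_\alpha$ is defined on $L^{s_1}\times\cdots\times L^{s_m}$, in particular on tuples of bounded measurable functions with compact support (also after multiplying one of them by a BMO function), and is still given there by the kernel formula. Norm estimates are understood in the usual sense: they hold for all bounded compactly supported measurable $f_j$, the operator on general tuples being the continuous extension from this dense class. Commutator. $T_{\vec b,\alpha}(\vec f)=\sum_{i=1}^m T^i_{\vec b,\alpha}(\vec f)$, where $T^i_{\vec b,\alpha}(\vec f)(x)=b_i(x)T_\alpha(f_1,\ldots,f_i,\ldots,f_m)(x)-T_\alpha(f_1,\ldots,b_if_i,\ldots,f_m)(x)$. BMO. $\|b\|_{\mathrm{BMO}}=\sup_Q\frac1{|Q|}\int_Q|b(x)-b_Q|dx$ with $b_Q=\frac1{|Q|}\int_Q b$, supremum over all cubes; $\vec b\in\mathrm{BMO}^m$ means each $b_j\in L^1_{loc}(\mathbb{R}^n)$ has $\|b_j\|_{\mathrm{BMO}}<\infty$; $\|\vec b\|_{(\mathrm{BMO})^m}=\max_{1\le i\le m}\|b_i\|_{\mathrm{BMO}}$. Variable exponents. For measurable $q(\cdot):\mathbb{R}^n\to[1,\infty)$,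 $L^{q(\cdot)}(\mathbb{R}^n)$ is the space of measurable $f$ with $\int_{\mathbb{R}^n}(|f(x)|/\eta)^{q(x)}dx<\infty$ for some $\eta>0$, with norm $\|f\|_{L^{q(\cdot)}(\mathbb{R}^n)}=\inf\{\eta>0:\int_{\mathbb{R}^n}(|f(x)|/\eta)^{q(x)}dx\le1\}$. Put $q_-=\operatorname{ess\,inf}_{x\in\mathbb{R}^n}q(x)$, $q_+=\operatorname{ess\,sup}_{x\in\mathbb{R}^n}q(x)$. - $\mathscr P(\mathbb{R}^n)$: measurable $q(\cdot):\mathbb{R}^n\to(1,\infty)$ with $1<q_-\le q(x)\le q_+<\infty$. - $\mathscr B(\mathbb{R}^n)$: those $q(\cdot)\in\mathscr P(\mathbb{R}^n)$ for which the Hardy--Littlewood maximal operator is bounded on $L^{q(\cdot)}(\mathbb{R}^n)$. - $\mathscr L^{log}(\mathbb{R}^n)$: real-valued functions $q(\cdot)$ on $\mathbb{R}^n$ that satisfy both, for constants $C,C_\infty>0$ not depending on $x,y$: $|q(x)-q(y)|\le\frac{-C}{\ln(|x-y|)}$ for $|x-y|\le1/2$; and $|q(x)-q_\infty|\le\frac{C_\infty}{\ln(e+|x|)}$ for all $x\in\mathbb{R}^n$, where $q_\infty=\lim_{|x|\to\infty}q(x)$. - $\mathscr P^{log}(\mathbb{R}^n)=\mathscr L^{log}(\mathbb{R}^n)\cap\mathscr P(\mathbb{R}^n)$. *)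

theory Defs
  imports "HOL-Analysis.Analysis" "HOL-Probability.Essential_Supremum"
begin

text \<open>
  Functions on \<open>R^n\<close> are complex valued and defined everywhere; equality of functions, where it
  matters, is stated almost everywhere.  A tuple \<open>(f_1, ..., f_m)\<close> is a function \<open>'m \<Rightarrow> _\<close> on a
  finite index type and a point of \<open>(R^n)^m\<close> is a value of type \<open>real^'n^'m\<close>, on which
  \<open>lebesgue\<close> is the product Lebesgue measure.
\<close>

type_synonym 'n cfun = "real^'n \<Rightarrow> complex"

section \<open>Cubes, supports, local integrability\<close>

text \<open>\<open>cube x r\<close> has \<^emph>\<open>side length\<close> \<open>r\<close>.\<close>

definition cube :: "real^'n \<Rightarrow> real \<Rightarrow> (real^'n) set" where
  "cube x r = {y. \<forall>i. \<bar>y $ i - x $ i\<bar> \<le> r / 2}"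

definition cube_power :: "real^'n \<Rightarrow> real \<Rightarrow> (real^'n^'m) set" where
  "cube_power x r = {y. \<forall>j. y $ j \<in> cube x r}"

definition supp :: "('a::topological_space \<Rightarrow> complex) \<Rightarrow> 'a set" where
  "supp f = closure {x. f x \<noteq> 0}"

definition locally_integrable_on ::
    "('a::euclidean_space \<Rightarrow> complex) \<Rightarrow> 'a set \<Rightarrow> bool" (infix "locally'_integrable'_on" 50) where
  "g locally_integrable_on U \<longleftrightarrow> (\<forall>C. compact C \<and> C \<subseteq> U \<longrightarrow> set_integrable lebesgue C g)"

text \<open>The class of bounded measurable functions with compact support.\<close>

definition Linf_c :: "'n::finite cfun set" where
  "Linf_c = {f \<in> borel_measurable lebesgue. (\<exists>M. \<forall>x. norm (f x) \<le> M) \<and> compact (supp f)}"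

section \<open>Schwartz functions and tempered distributions\<close>

definition partial_deriv :: "'n \<Rightarrow> 'n::finite cfun \<Rightarrow> 'n cfun" where
  "partial_deriv i f = (\<lambda>x. frechet_derivative f (at x) (axis i 1))"

text \<open>A differential monomial is given by the list of the directions of differentiation.\<close>

fun partial_derivs :: "'n list \<Rightarrow> 'n::finite cfun \<Rightarrow> 'n cfun" where
  "partial_derivs [] f = f"
| "partial_derivs (i # is) f = partial_deriv i (partial_derivs is f)"

definition schwartz :: "'n::finite cfun set" where
  "schwartz = {f. (\<forall>is x. partial_derivs is f differentiable (at x)) \<and>
     (\<forall>is N. bounded (range (\<lambda>x. (1 + norm x) ^ N *\<^sub>R partial_derivs is f x)))}"

definition schwartz_seminorm :: "nat \<Rightarrow> 'n::finite cfun \<Rightarrow> real" where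
  "schwartz_seminorm N f =
     (SUP (is, x) \<in> {is. length is \<le> N} \<times> UNIV. (1 + norm x) ^ N * norm (partial_derivs is f x))"

definition tempered_distribution :: "('n::finite cfun \<Rightarrow> complex) \<Rightarrow> bool" where
  "tempered_distribution u \<longleftrightarrow>
     (\<forall>f\<in>schwartz. \<forall>g\<in>schwartz. \<forall>a c. u (\<lambda>x. a * f x + c * g x) = a * u f + c * u g) \<and>
     (\<exists>N B. \<forall>f\<in>schwartz. norm (u f) \<le> B * schwartz_seminorm N f)"

text \<open>The distribution \<open>u\<close> coincides on the open set \<open>U\<close> with the function \<open>g\<close>.\<close>

definition coincides_on ::
    "('n::finite cfun \<Rightarrow> complex) \<Rightarrow> 'n cfun \<Rightarrow> (real^'n) set \<Rightarrow> bool" where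
  "coincides_on u g U \<longleftrightarrow> g locally_integrable_on U \<and>
     (\<forall>\<phi>\<in>schwartz. compact (supp \<phi>) \<and> supp \<phi> \<subseteq> U \<longrightarrow>
        u \<phi> = (LINT x:U|lebesgue. g x * \<phi> x))"

section \<open>Lebesgue, weak Lebesgue and BMO spaces\<close>

definition Lp_space :: "real \<Rightarrow> 'n::finite cfun set" where
  "Lp_space s = {f \<in> borel_measurable lebesgue. integrable lebesgue (\<lambda>x. norm (f x) powr s)}"

definition Lp_norm :: "real \<Rightarrow> 'n::finite cfun \<Rightarrow> real" where
  "Lp_norm s f = (LINT x|lebesgue. norm (f x) powr s) powr (1 / s)"

definition weak_Lp_space :: "real \<Rightarrow> 'n::finite cfun set" where
  "weak_Lp_space r = {f \<in> borel_measurable lebesgue.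
     (\<forall>t>0. {x. norm (f x) > t} \<in> fmeasurable lebesgue) \<and>
     bdd_above ((\<lambda>t. t * measure lebesgue {x. norm (f x) > t} powr (1 / r)) ` {0<..})}"

definition weak_Lp_norm :: "real \<Rightarrow> 'n::finite cfun \<Rightarrow> real" where
  "weak_Lp_norm r f = (SUP t\<in>{0<..}. t * measure lebesgue {x. norm (f x) > t} powr (1 / r))"

definition average :: "'n::finite cfun \<Rightarrow> (real^'n) set \<Rightarrow> complex" where
  "average b Q = (LINT x:Q|lebesgue. b x) / of_real (measure lebesgue Q)"

definition mean_osc :: "'n::finite cfun \<Rightarrow> (real^'n) set \<Rightarrow> real" where
  "mean_osc b Q = (LINT x:Q|lebesgue. norm (b x - average b Q)) / measure lebesgue Q"

definition BMO :: "'n::finite cfun set" where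
  "BMO = {b. b locally_integrable_on UNIV \<and>
     bdd_above ((\<lambda>(x, r). mean_osc b (cube x r)) ` (UNIV \<times> {0<..}))}"

definition BMO_norm :: "'n::finite cfun \<Rightarrow> real" where
  "BMO_norm b = (SUP (x, r) \<in> UNIV \<times> {0<..}. mean_osc b (cube x r))"

definition BMO_tuple_norm :: "('m::finite \<Rightarrow> 'n::finite cfun) \<Rightarrow> real" where
  "BMO_tuple_norm b = Max (range (\<lambda>i. BMO_norm (b i)))"

section \<open>Variable exponents\<close>

definition ess_upper :: "(real^'n::finite \<Rightarrow> real) \<Rightarrow> ereal" where
  "ess_upper q = esssup lebesgue (\<lambda>x. ereal (q x))"

definition ess_lower :: "(real^'n::finite \<Rightarrow> real) \<Rightarrow> ereal" where
  "ess_lower q = - esssup lebesgue (\<lambda>x. - ereal (q x))"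

definition var_modular ::
    "(real^'n::finite \<Rightarrow> real) \<Rightarrow> 'n cfun \<Rightarrow> real \<Rightarrow> ennreal" where
  "var_modular q f \<eta> = (\<integral>\<^sup>+ x. ennreal ((norm (f x) / \<eta>) powr q x) \<partial>lebesgue)"

definition var_Lp_space :: "(real^'n::finite \<Rightarrow> real) \<Rightarrow> 'n cfun set" where
  "var_Lp_space q = {f \<in> borel_measurable lebesgue. \<exists>\<eta>>0. var_modular q f \<eta> < \<infinity>}"

definition var_Lp_norm :: "(real^'n::finite \<Rightarrow> real) \<Rightarrow> 'n cfun \<Rightarrow> real" where
  "var_Lp_norm q f = Inf {\<eta>. \<eta> > 0 \<and> var_modular q f \<eta> \<le> 1}"

text \<open>The bounds of \<open>q\<close> by its essential infimum and supremum hold almost everywhere for every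
  measurable \<open>q\<close> and so are not repeated.\<close>

definition exponents :: "(real^'n::finite \<Rightarrow> real) set" where
  "exponents = {q \<in> borel_measurable lebesgue.
     (\<forall>x. 1 < q x) \<and> 1 < ess_lower q \<and> ess_upper q < \<infinity>}"

definition maximal_fun :: "'n::finite cfun \<Rightarrow> real^'n \<Rightarrow> ennreal" where
  "maximal_fun f x = (SUP (z, r) \<in> {(z, r). r > 0 \<and> x \<in> cube z r}.
     (\<integral>\<^sup>+ y \<in> cube z r. ennreal (norm (f y)) \<partial>lebesgue) / emeasure lebesgue (cube z r))"

definition exponents_B :: "(real^'n::finite \<Rightarrow> real) set" where
  "exponents_B = {q \<in> exponents. \<exists>C. \<forall>f\<in>var_Lp_space q.
     (AE x in lebesgue. maximal_fun f x < \<infinity>) \<and>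
     (\<lambda>x. of_real (enn2real (maximal_fun f x))) \<in> var_Lp_space q \<and>
     var_Lp_norm q (\<lambda>x. of_real (enn2real (maximal_fun f x))) \<le> C * var_Lp_norm q f}"

text \<open>For \<open>x = y\<close> the first inequality reads \<open>0 \<le> 0\<close>, because \<open>ln 0 = 0\<close> and \<open>- C / 0 = 0\<close>.\<close>

definition log_Hoelder :: "(real^'n::finite \<Rightarrow> real) set" where
  "log_Hoelder = {q.
     (\<exists>C>0. \<forall>x y. norm (x - y) \<le> 1/2 \<longrightarrow> \<bar>q x - q y\<bar> \<le> - C / ln (norm (x - y))) \<and>
     (\<exists>q_inf. (q \<longlongrightarrow> q_inf) at_infinity \<and>
        (\<exists>C_inf>0. \<forall>x. \<bar>q x - q_inf\<bar> \<le> C_inf / ln (exp 1 + norm x)))}"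

definition exponents_log :: "(real^'n::finite \<Rightarrow> real) set" where
  "exponents_log = log_Hoelder \<inter> exponents"

section \<open>Multilinear fractional integral operators with generalized kernel\<close>

text \<open>Multilinearity on tuples with \<open>j\<close>-th component in \<open>D j\<close>, up to the identification \<open>eq\<close> of
  values.\<close>

definition multilinear_on ::
    "('b \<Rightarrow> complex) rel \<Rightarrow> ('m \<Rightarrow> 'n::finite cfun set) \<Rightarrow>
     (('m \<Rightarrow> 'n cfun) \<Rightarrow> 'b \<Rightarrow> complex) \<Rightarrow> bool" where
  "multilinear_on eq D T \<longleftrightarrow>
     (\<forall>f i u v a c. (\<forall>j. f j \<in> D j) \<and> u \<in> D i \<and> v \<in> D i \<longrightarrow>
        (T (f(i := \<lambda>x. a * u x + c * v x)),
         \<lambda>z. a * T (f(i := u)) z + c * T (f(i := v)) z) \<in> eq)"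

definition eq_ae :: "'n::finite cfun rel" where
  "eq_ae = {(g, h). AE x in lebesgue. g x = h x}"

definition eq_distr :: "('n::finite cfun \<Rightarrow> complex) rel" where
  "eq_distr = {(u, v). \<forall>\<phi>\<in>schwartz. u \<phi> = v \<phi>}"

definition off_diagonal :: "((real^'n) \<times> (real^'n^'m)) set" where
  "off_diagonal = {(x, y). \<exists>j. y $ j \<noteq> x}"

definition kernel_integral ::
    "(real^'n::finite \<Rightarrow> real^'n^'m::finite \<Rightarrow> complex) \<Rightarrow> ('m \<Rightarrow> 'n cfun) \<Rightarrow> 'n cfun" where
  "kernel_integral K f x = (LINT y|lebesgue. K x y * (\<Prod>j\<in>UNIV. f j (y $ j)))"

definition size_condition ::
    "real \<Rightarrow> (real^'n::finite \<Rightarrow> real^'n^'m::finite \<Rightarrow> complex) \<Rightarrow> bool" where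
  "size_condition \<alpha> K \<longleftrightarrow> (\<exists>A>0. \<forall>x y. (x, y) \<in> off_diagonal \<longrightarrow>
     norm (K x y) \<le> A * (\<Sum>j\<in>UNIV. norm (x - y $ j)) powr (- (real CARD('m) * real CARD('n) - \<alpha>)))"

definition smoothness_condition ::
    "real \<Rightarrow> real \<Rightarrow> real \<Rightarrow> (nat \<Rightarrow> real) \<Rightarrow>
     (real^'n::finite \<Rightarrow> real^'n^'m::finite \<Rightarrow> complex) \<Rightarrow> bool" where
  "smoothness_condition p0 p0' \<alpha> c K \<longleftrightarrow>
     (\<forall>k\<ge>1. c k > 0) \<and>
     (\<exists>C>0. \<forall>k\<ge>1. \<forall>x x'. x \<noteq> x' \<longrightarrow>
        (let mn = real CARD('m) * real CARD('n); d = norm (x - x');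
             R = (cube_power x (2 ^ (k + 2) * sqrt mn * d) - cube_power x (2 ^ (k + 1) * sqrt mn * d)
                  :: (real^'n^'m) set)
         in set_integrable lebesgue R (\<lambda>y. norm (K x y - K x' y) powr p0) \<and>
            (LINT y:R|lebesgue. norm (K x y - K x' y) powr p0) powr (1 / p0)
              \<le> C * c k * 2 powr (real k * (\<alpha> - mn / p0')) * d powr (\<alpha> - mn / p0')))"

text \<open>\<open>T\<close> is the given operator from tuples of Schwartz functions to tempered distributions.\<close>

definition has_kernel ::
    "(('m::finite \<Rightarrow> 'n::finite cfun) \<Rightarrow> 'n cfun \<Rightarrow> complex) \<Rightarrow>
     (real^'n \<Rightarrow> real^'n^'m \<Rightarrow> complex) \<Rightarrow> bool" where
  "has_kernel T K \<longleftrightarrow>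
     (\<forall>f. (\<forall>j. f j \<in> schwartz) \<longrightarrow>
        tempered_distribution (T f) \<and>
        coincides_on (T f) (kernel_integral K f) (- (\<Inter>j. supp (f j)))) \<and>
     multilinear_on eq_distr (\<lambda>_. schwartz) T"

text \<open>\<open>Te\<close> is the bounded extension of \<open>T\<close> to \<open>L^{s_1} \<times> ... \<times> L^{s_m}\<close> with values in weak
  \<open>L^r\<close>.\<close>

definition weak_bounded_extension ::
    "('m::finite \<Rightarrow> real) \<Rightarrow> real \<Rightarrow> (('m \<Rightarrow> 'n::finite cfun) \<Rightarrow> 'n cfun \<Rightarrow> complex) \<Rightarrow>
     (('m \<Rightarrow> 'n cfun) \<Rightarrow> 'n cfun) \<Rightarrow> bool" where
  "weak_bounded_extension s r T Te \<longleftrightarrow>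
     multilinear_on eq_ae (\<lambda>j. Lp_space (s j)) Te \<and>
     (\<exists>B. \<forall>f. (\<forall>j. f j \<in> Lp_space (s j)) \<longrightarrow>
        Te f \<in> weak_Lp_space r \<and> weak_Lp_norm r (Te f) \<le> B * (\<Prod>j\<in>UNIV. Lp_norm (s j) (f j))) \<and>
     (\<forall>f. (\<forall>j. f j \<in> schwartz) \<longrightarrow> coincides_on (T f) (Te f) UNIV)"

text \<open>The standing convention that the extension is still given by the kernel on tuples of bounded
  functions with compact support, also after multiplying one of them by a BMO function.\<close>

definition kernel_formula_at ::
    "(('m::finite \<Rightarrow> 'n::finite cfun) \<Rightarrow> 'n cfun) \<Rightarrow>
     (real^'n \<Rightarrow> real^'n^'m \<Rightarrow> complex) \<Rightarrow> ('m \<Rightarrow> 'n cfun) \<Rightarrow> bool" where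
  "kernel_formula_at Te K f \<longleftrightarrow>
     (AE x in lebesgue. x \<notin> (\<Inter>j. supp (f j)) \<longrightarrow> Te f x = kernel_integral K f x)"

definition kernel_formula ::
    "(('m::finite \<Rightarrow> 'n::finite cfun) \<Rightarrow> 'n cfun) \<Rightarrow>
     (real^'n \<Rightarrow> real^'n^'m \<Rightarrow> complex) \<Rightarrow> bool" where
  "kernel_formula Te K \<longleftrightarrow>
     (\<forall>f. (\<forall>j. f j \<in> Linf_c) \<longrightarrow> kernel_formula_at Te K f \<and>
        (\<forall>i. \<forall>b\<in>BMO. kernel_formula_at Te K (f(i := \<lambda>x. b x * f i x))))"

definition generalized_kernel_operator ::
    "real \<Rightarrow> real \<Rightarrow> real \<Rightarrow> (nat \<Rightarrow> real) \<Rightarrow>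
     (real^'n::finite \<Rightarrow> real^'n^'m::finite \<Rightarrow> complex) \<Rightarrow>
     (('m \<Rightarrow> 'n cfun) \<Rightarrow> 'n cfun \<Rightarrow> complex) \<Rightarrow> (('m \<Rightarrow> 'n cfun) \<Rightarrow> 'n cfun) \<Rightarrow> bool" where
  "generalized_kernel_operator p0 p0' \<alpha> c K T Te \<longleftrightarrow>
     0 < \<alpha> * p0' \<and> \<alpha> * p0' < real CARD('m) * real CARD('n) \<and>
     (\<lambda>(x, y). K x y) locally_integrable_on off_diagonal \<and>
     has_kernel T K \<and>
     size_condition \<alpha> K \<and>
     smoothness_condition p0 p0' \<alpha> c K \<and>
     (\<exists>sj s. (\<forall>j. 1 \<le> sj j \<and> sj j \<le> p0') \<and> 1 / s = (\<Sum>j\<in>UNIV. 1 / sj j) \<and>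
        weak_bounded_extension sj (s * real CARD('n) / (real CARD('n) - s * \<alpha>)) T Te) \<and>
     kernel_formula Te K"

section \<open>Commutators and extension from bounded compactly supported functions\<close>

definition commutator_entry ::
    "(('m \<Rightarrow> 'n::finite cfun) \<Rightarrow> 'n cfun) \<Rightarrow> ('m \<Rightarrow> 'n cfun) \<Rightarrow> 'm \<Rightarrow> ('m \<Rightarrow> 'n cfun) \<Rightarrow> 'n cfun" where
  "commutator_entry Te b i f x = b i x * Te f x - Te (f(i := \<lambda>y. b i y * f i y)) x"

definition commutator ::
    "(('m::finite \<Rightarrow> 'n::finite cfun) \<Rightarrow> 'n cfun) \<Rightarrow> ('m \<Rightarrow> 'n cfun) \<Rightarrow> ('m \<Rightarrow> 'n cfun) \<Rightarrow> 'n cfun" where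
  "commutator Te b f x = (\<Sum>i\<in>UNIV. commutator_entry Te b i f x)"

text \<open>\<open>S\<close> is the continuous extension of \<open>U\<close> from tuples of bounded compactly supported functions
  to \<open>L^{p_1(.)} \<times> ... \<times> L^{p_m(.)}\<close>, with values in \<open>L^{q(.)}\<close>.\<close>

definition continuous_extension ::
    "('m::finite \<Rightarrow> real^'n::finite \<Rightarrow> real) \<Rightarrow> (real^'n \<Rightarrow> real) \<Rightarrow>
     (('m \<Rightarrow> 'n cfun) \<Rightarrow> 'n cfun) \<Rightarrow> (('m \<Rightarrow> 'n cfun) \<Rightarrow> 'n cfun) \<Rightarrow> bool" where
  "continuous_extension p q U S \<longleftrightarrow>
     (\<forall>f. (\<forall>j. f j \<in> Linf_c) \<longrightarrow> (AE x in lebesgue. S f x = U f x)) \<and>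
     (\<forall>f. (\<forall>j. f j \<in> var_Lp_space (p j)) \<longrightarrow> S f \<in> var_Lp_space q) \<and>
     (\<forall>F f. (\<forall>k j. F k j \<in> var_Lp_space (p j)) \<and> (\<forall>j. f j \<in> var_Lp_space (p j)) \<and>
        (\<forall>j. (\<lambda>k. var_Lp_norm (p j) (\<lambda>x. F k j x - f j x)) \<longlonglongrightarrow> 0) \<longrightarrow>
        (\<lambda>k::nat. var_Lp_norm q (\<lambda>x. S (F k) x - S f x)) \<longlonglongrightarrow> 0)"

end

(* The size condition makes the kernel integral absolutely convergent.  If x, y_1, ..., y_m lie in a
   cube of a fixed grid whose side is comparable to the sum of the |x - y_j|, then K is bounded by the
   product of the factors side^(alpha_j - n), so that the commutator kernel applied to |f_1|, ..., |f_m|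
   is dominated by a sum of products of grid fractional integrals of the f_j, in which one factor is
   replaced by the fractional integral with |b_i(x) - b_i(y)|.  Each factor is bounded from
   L^{p_j(.)} to L^{q_j(.)}, 1/q_j = 1/p_j - alpha_j/n: after dualizing, log-Hoelder continuity turns
   averages with variable exponents into maximal functions with constant exponents, Hedberg's
   splitting sums over the scales, and the John-Nirenberg inequality absorbs the oscillation of b_i at
   the price of a slightly larger power of the average.  Since the 1/q_j add up to 1/q, Hoelder's
   inequality bounds the commutator kernel integral, and multilinearity gives its continuity.

   It remains to see that Te is given by the kernel everywhere and not only off the common support.
   On a dyadic cell the error Te f - I_K f does not change when every f_j is cut down to that cell.  On
   cells of side 2^-N the weak type bound makes the set where the cut operator exceeds t of total measure
   O(2^(Nn) 2^(-Nn r/s)), which tends to 0 because r > s, while the cut kernel integral tends to 0 by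
   absolute convergence.  Truncating b_i extends this to tuples with the entry b_i f_i. *)

theory Submission
  imports Defs
begin

text \<open>The grid cube holding x and all y_j is common to the factors, yet each factor may be
  given its own sum over all cubes, because Hedberg's splitting makes every such sum decay
  geometrically in the scale. This needs \<alpha> split into pieces: \<alpha>_j > 0 gives decay at
  small scales, \<alpha>_j < n / p_{j,+} at large ones. In the commutator |b(x) - b_Q| and |b(y) -
  b_Q| refer to the same cube, so after dualizing one oscillation sits on the dual function and the
  other on f; each costs a power t > 1 of the average, and t fits below the infima of both
  exponents.

  No constant may depend on f or b. Modulars are therefore kept at level 1 and rescaled, and the BMO
  norm enters through an arbitrary positive upper bound, so that norm 0 is no special case.

  In the identification of \<open>Te\<close>, r/s = n/(n - s\<alpha>) > 1 since \<alpha> > 0. For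
  \<alpha> = 0 an operator could differ from its kernel integral by a multiple of the product f_1
  ... f_m; the gain r > s is what excludes such a local term.\<close>

section \<open>Geometric series over all integer scales\<close>

lemma nn_integral_count_space_int_le:
  fixes f :: "int \<Rightarrow> ennreal"
  shows "(\<integral>\<^sup>+k. f k \<partial>count_space UNIV) \<le> (\<Sum>n. f (int n)) + (\<Sum>n. f (- int n))"
proof -
  have "(\<integral>\<^sup>+k. f k \<partial>count_space UNIV) \<le>
      (\<integral>\<^sup>+k. f k * indicator (range int) k + f k * indicator (range (\<lambda>n. - int n)) k \<partial>count_space UNIV)"
  proof (intro nn_integral_mono)
    fix k :: int
    have "k \<in> range int \<or> k \<in> range (\<lambda>n. - int n)"
      by (metis int_cases2 rangeI)
    then show "f k \<le> f k * indicator (range int) k + f k * indicator (range (\<lambda>n. - int n)) k"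
      by (auto simp: indicator_def)
  qed
  also have "\<dots> = (\<integral>\<^sup>+k. f k * indicator (range int) k \<partial>count_space UNIV)
      + (\<integral>\<^sup>+k. f k * indicator (range (\<lambda>n. - int n)) k \<partial>count_space UNIV)"
    by (rule nn_integral_add) auto
  also have "\<dots> = (\<integral>\<^sup>+k. f k \<partial>count_space (range int)) + (\<integral>\<^sup>+k. f k \<partial>count_space (range (\<lambda>n. - int n)))"
    by (simp add: nn_integral_count_space_indicator)
  also have "\<dots> = (\<integral>\<^sup>+n. f (int n) \<partial>count_space UNIV) + (\<integral>\<^sup>+n. f (- int n) \<partial>count_space UNIV)"
    by (intro arg_cong2[where f="(+)"] nn_integral_bij_count_space[symmetric])
       (auto simp: bij_betw_def inj_on_def)
  finally show ?thesis
    by (simp add: nn_integral_count_space_nat)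
qed

text \<open>Uniformity in the shift \<open>c\<close> is the point: in the applications
  \<open>c\<close> is built from the logarithm of a function value at the point considered.
  Replacing \<open>c\<close> by its floor changes the modulus by at most 1, and an integer shift
  only permutes the terms.\<close>

lemma int_geometric_sum_bound:
  fixes \<delta> :: real
  assumes "0 < \<delta>"
  obtains C where "0 \<le> C"
    "\<And>c. (\<integral>\<^sup>+k. ennreal (2 powr (- \<delta> * \<bar>real_of_int k + c\<bar>)) \<partial>count_space UNIV) \<le> ennreal C"
proof -
  define \<rho> where "\<rho> = 2 powr (- \<delta>)"
  have \<rho>: "0 < \<rho>" "\<rho> < 1"
    using assms by (auto simp: \<rho>_def powr_less_one)
  have pw: "2 powr (- \<delta> * \<bar>real n\<bar>) = \<rho> ^ n" for n
    by (simp add: \<rho>_def powr_powr flip: powr_realpow)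
  have geo: "(\<Sum>n. ennreal (\<rho> ^ n)) = ennreal (1 / (1 - \<rho>))"
    using \<rho> by (subst suminf_ennreal2) (auto simp: suminf_geometric summable_geometric)
  define C where "C = 2 powr \<delta> * (2 / (1 - \<rho>))"
  show thesis
  proof (rule that)
    show "0 \<le> C" using \<rho> by (auto simp: C_def)
    fix c :: real
    have "(\<integral>\<^sup>+k. ennreal (2 powr (- \<delta> * \<bar>real_of_int k + c\<bar>)) \<partial>count_space UNIV)
       \<le> (\<integral>\<^sup>+k. ennreal (2 powr \<delta>) * ennreal (2 powr (- \<delta> * \<bar>real_of_int (k + \<lfloor>c\<rfloor>)\<bar>)) \<partial>count_space UNIV)"
    proof (intro nn_integral_mono)
      fix k :: int
      have "\<bar>real_of_int (k + \<lfloor>c\<rfloor>)\<bar> \<le> \<bar>real_of_int k + c\<bar> + 1"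
        by linarith
      then have "\<delta> * \<bar>real_of_int (k + \<lfloor>c\<rfloor>)\<bar> \<le> \<delta> * (\<bar>real_of_int k + c\<bar> + 1)"
        using assms by (intro mult_left_mono) auto
      then have "- \<delta> * \<bar>real_of_int k + c\<bar> \<le> \<delta> + - \<delta> * \<bar>real_of_int (k + \<lfloor>c\<rfloor>)\<bar>"
        by (simp add: algebra_simps)
      then have "2 powr (- \<delta> * \<bar>real_of_int k + c\<bar>) \<le> 2 powr \<delta> * 2 powr (- \<delta> * \<bar>real_of_int (k + \<lfloor>c\<rfloor>)\<bar>)"
        by (simp flip: powr_add)
      then show "ennreal (2 powr (- \<delta> * \<bar>real_of_int k + c\<bar>))
        \<le> ennreal (2 powr \<delta>) * ennreal (2 powr (- \<delta> * \<bar>real_of_int (k + \<lfloor>c\<rfloor>)\<bar>))"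
        by (simp add: ennreal_mult'[symmetric] ennreal_leI)
    qed
    also have "\<dots> = ennreal (2 powr \<delta>) * (\<integral>\<^sup>+k. ennreal (2 powr (- \<delta> * \<bar>real_of_int (k + \<lfloor>c\<rfloor>)\<bar>)) \<partial>count_space UNIV)"
      by (simp add: nn_integral_cmult)
    also have "(\<integral>\<^sup>+k. ennreal (2 powr (- \<delta> * \<bar>real_of_int (k + \<lfloor>c\<rfloor>)\<bar>)) \<partial>count_space UNIV)
       = (\<integral>\<^sup>+k. ennreal (2 powr (- \<delta> * \<bar>real_of_int k\<bar>)) \<partial>count_space UNIV)"
      by (rule nn_integral_bij_count_space[where g="\<lambda>k. k + \<lfloor>c\<rfloor>"
            and f="\<lambda>k. ennreal (2 powr (- \<delta> * \<bar>real_of_int k\<bar>))"])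
         (auto simp: bij_betw_def inj_on_def surj_def intro: exI[of _ "_ - \<lfloor>c\<rfloor>"])
    also have "\<dots> \<le> ennreal (1 / (1 - \<rho>)) + ennreal (1 / (1 - \<rho>))"
      using nn_integral_count_space_int_le[of "\<lambda>k. ennreal (2 powr (- \<delta> * \<bar>real_of_int k\<bar>))"]
      by (simp add: pw[simplified] geo)
    also have "ennreal (2 powr \<delta>) * (ennreal (1 / (1 - \<rho>)) + ennreal (1 / (1 - \<rho>))) = ennreal C"
      using \<rho> by (simp add: C_def ennreal_mult'[symmetric] ennreal_plus[symmetric] del: ennreal_plus)
    finally show "(\<integral>\<^sup>+k. ennreal (2 powr (- \<delta> * \<bar>real_of_int k + c\<bar>)) \<partial>count_space UNIV) \<le> ennreal C"
      by (simp add: mult_left_mono)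
  qed
qed

section \<open>Grid cubes\<close>

lemma cube_eq_cbox:
  fixes x :: "real^'n::finite"
  shows "cube x r = cbox (x - (\<chi> i. r / 2)) (x + (\<chi> i. r / 2))"
proof -
  have "\<bar>y $ i - x $ i\<bar> \<le> r / 2 \<longleftrightarrow> x $ i - r / 2 \<le> y $ i \<and> y $ i \<le> x $ i + r / 2" for y :: "real^'n" and i
    by linarith
  then show ?thesis unfolding cube_def by (auto simp: mem_box_cart)
qed

lemma cube_sets [measurable, simp]: "cube (x :: real^'n::finite) r \<in> sets borel"
  and cube_sets_lebesgue [measurable, simp]: "cube x r \<in> sets lebesgue"
  and compact_cube [simp]: "compact (cube x r)"
  by (simp_all add: cube_eq_cbox)

lemma emeasure_cube:
  fixes x :: "real^'n::finite"
  assumes "0 \<le> r"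
  shows "emeasure lborel (cube x r) = ennreal (r ^ CARD('n))"
    and emeasure_cube_lebesgue: "emeasure lebesgue (cube x r) = ennreal (r ^ CARD('n))"
    and measure_cube: "measure lebesgue (cube x r) = r ^ CARD('n)"
proof -
  let ?a = "x - (\<chi> i. r / 2)" and ?b = "x + (\<chi> i. r / 2)"
  have "x \<in> cbox ?a ?b"
    using assms by (simp add: mem_box_cart)
  then have ne: "cbox ?a ?b \<noteq> {}" by blast
  have "measure lborel (cube x r) = r ^ CARD('n)"
    unfolding cube_eq_cbox content_cbox_cart[OF ne] by simp
  moreover have "emeasure lborel (cube x r) = ennreal (measure lborel (cube x r))"
    by (metis cube_eq_cbox emeasure_eq_ennreal_measure emeasure_lborel_cbox_finite
        infinity_ennreal_def less_irrefl)
  ultimately show *: "emeasure lborel (cube x r) = ennreal (r ^ CARD('n))" by simp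
  then show "emeasure lebesgue (cube x r) = ennreal (r ^ CARD('n))" by simp
  then show "measure lebesgue (cube x r) = r ^ CARD('n)"
    using assms by (simp add: measure_def)
qed

lemma cube_subset_ball:
  fixes x :: "real^'n::finite"
  assumes "0 < r"
  shows "cube x r \<subseteq> ball x (real CARD('n) * r)"
proof
  fix y assume "y \<in> cube x r"
  then have "\<And>i. \<bar>(y - x) $ i\<bar> \<le> r / 2" by (simp add: cube_def)
  then have "(\<Sum>i\<in>UNIV. \<bar>(y - x) $ i\<bar>) \<le> real CARD('n) * (r / 2)"
    using sum_bounded_above[of "UNIV :: 'n set" "\<lambda>i. \<bar>(y - x) $ i\<bar>" "r / 2"] by simp
  then have "norm (y - x) \<le> real CARD('n) * (r / 2)"
    using norm_le_l1_cart[of "y - x"] by linarith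
  also have "\<dots> < real CARD('n) * r" using assms by simp
  finally show "y \<in> ball x (real CARD('n) * r)" by (simp add: dist_norm norm_minus_commute)
qed

lemma cball_subset_cube:
  fixes x :: "real^'n::finite"
  shows "cball x r \<subseteq> cube x (2 * r)"
proof
  fix y assume "y \<in> cball x r"
  then have "norm (y - x) \<le> r" by (simp add: dist_norm norm_minus_commute)
  moreover have "\<bar>(y - x) $ i\<bar> \<le> norm (y - x)" for i by (rule component_le_norm_cart)
  ultimately show "y \<in> cube x (2 * r)" unfolding cube_def by (auto intro: order_trans)
qed

text \<open>The dilation by \<open>3\<close> of the dyadic grid: two points at distance at most \<open>2^k\<close> in the maximum
  norm lie in a common cube of generation \<open>k\<close>.\<close>

definition gside :: "int \<Rightarrow> real" where
  "gside k = 3 * 2 powr real_of_int k"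

definition gcube :: "int \<times> ('n \<Rightarrow> int) \<Rightarrow> (real^'n::finite) set" where
  "gcube q = cube (\<chi> i. 2 powr real_of_int (fst q) * real_of_int (snd q i)) (gside (fst q))"

lemma gside_pos [simp]: "0 < gside k" and gside_nonneg [simp]: "0 \<le> gside k"
  and gside_neq_0 [simp]: "gside k \<noteq> 0"
  by (auto simp: gside_def)

lemma gcube_sets [measurable, simp]: "gcube q \<in> sets borel"
  and gcube_sets_lebesgue [measurable, simp]: "gcube q \<in> sets lebesgue"
  and compact_gcube [simp]: "compact (gcube q)"
  by (auto simp: gcube_def)

lemma emeasure_gcube [simp]:
  fixes q :: "int \<times> ('n::finite \<Rightarrow> int)"
  shows "emeasure lborel (gcube q) = ennreal (gside (fst q) ^ CARD('n))"
    and "emeasure lebesgue (gcube q) = ennreal (gside (fst q) ^ CARD('n))"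
    and "measure lebesgue (gcube q) = gside (fst q) ^ CARD('n)"
  unfolding gcube_def
  by (simp_all only: emeasure_cube emeasure_cube_lebesgue measure_cube gside_nonneg)

text \<open>Rounding each coordinate puts x within half a grid step of a centre, so a point one step
  away from x is within 3/2 steps of that centre. This is half the side, which explains the factor 3
  in \<open>gside\<close>.\<close>

lemma gcube_exists:
  fixes x :: "real^'n::finite"
  obtains z where "x \<in> gcube (k, z)"
    "\<And>y. (\<And>i. \<bar>y $ i - x $ i\<bar> \<le> 2 powr real_of_int k) \<Longrightarrow> y \<in> gcube (k, z)"
proof -
  define s where "s = 2 powr real_of_int k"
  define z where "z i = round (x $ i / s)" for i
  have s: "s > 0" by (simp add: s_def)
  have 1: "\<bar>x $ i - s * real_of_int (z i)\<bar> \<le> s / 2" for i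
  proof -
    have "\<bar>real_of_int (z i) - x $ i / s\<bar> \<le> 1 / 2"
      unfolding z_def by (rule of_int_round_abs_le)
    then have "\<bar>real_of_int (z i) - x $ i / s\<bar> * s \<le> 1 / 2 * s"
      using s by (intro mult_right_mono) auto
    also have "\<bar>real_of_int (z i) - x $ i / s\<bar> * s = \<bar>(real_of_int (z i) - x $ i / s) * s\<bar>"
      using s by (simp add: abs_mult)
    also have "(real_of_int (z i) - x $ i / s) * s = - (x $ i - s * real_of_int (z i))"
      using s by (simp add: field_simps)
    finally show ?thesis by (simp add: abs_minus_commute)
  qed
  show thesis
  proof
    show "x \<in> gcube (k, z)"
    proof -
      have "\<bar>x $ i - s * real_of_int (z i)\<bar> \<le> 3 * s / 2" for i
        using 1[of i] s by linarith
      then show ?thesis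
        unfolding gcube_def cube_def gside_def by (simp add: s_def)
    qed
    fix y :: "real^'n" assume "\<And>i. \<bar>y $ i - x $ i\<bar> \<le> 2 powr real_of_int k"
    then have "\<And>i. \<bar>y $ i - x $ i\<bar> \<le> s" by (simp add: s_def)
    then have "\<bar>y $ i - s * real_of_int (z i)\<bar> \<le> 3 * s / 2" for i
      using 1[of i] by (smt (verit) field_sum_of_halves)
    then show "y \<in> gcube (k, z)"
      unfolding gcube_def cube_def gside_def by (simp add: s_def)
  qed
qed

text \<open>In each coordinate the admissible centres correspond to integers in a closed interval of
  length 3, and such an interval holds at most 4 of them.\<close>

lemma card_gcube_overlap:
  fixes x :: "real^'n::finite"
  shows "finite {z. x \<in> gcube (k, z)}" "card {z. x \<in> gcube (k, z)} \<le> 4 ^ CARD('n)"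
proof -
  define s where "s = 2 powr real_of_int k"
  have s: "s > 0" by (simp add: s_def)
  define A where "A i = {\<lceil>x $ i / s - 3/2\<rceil>..\<lfloor>x $ i / s + 3/2\<rfloor>}" for i
  have "{z. x \<in> gcube (k, z)} \<subseteq> PiE UNIV A"
  proof
    fix z assume "z \<in> {z. x \<in> gcube (k, z)}"
    then have *: "\<bar>x $ i - s * real_of_int (z i)\<bar> \<le> 3 * s / 2" for i
      unfolding gcube_def cube_def gside_def by (simp add: s_def)
    have "z i \<in> A i" for i
    proof -
      have "x $ i - s * real_of_int (z i) \<le> 3 * s / 2" "- (3 * s / 2) \<le> x $ i - s * real_of_int (z i)"
        using *[of i] by (simp_all only: abs_le_iff) linarith+
      then have "x $ i \<le> (real_of_int (z i) + 3/2) * s" "(real_of_int (z i) - 3/2) * s \<le> x $ i"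
        by (simp_all add: algebra_simps)
      then have "x $ i / s \<le> real_of_int (z i) + 3/2" "real_of_int (z i) - 3/2 \<le> x $ i / s"
        using s by (auto simp: field_simps)
      then show ?thesis unfolding A_def by (auto simp: ceiling_le_iff le_floor_iff)
    qed
    then show "z \<in> PiE UNIV A" by auto
  qed
  moreover have fin: "finite (PiE UNIV A)"
    by (intro finite_PiE) (auto simp: A_def)
  moreover have "card (PiE UNIV A) \<le> 4 ^ CARD('n)"
  proof -
    have "card (A i) \<le> 4" for i
    proof -
      have "\<lfloor>x $ i / s + 3/2\<rfloor> - \<lceil>x $ i / s - 3/2\<rceil> \<le> 3" by linarith
      then show ?thesis unfolding A_def by simp
    qed
    then have "(\<Prod>i\<in>UNIV. card (A i)) \<le> (\<Prod>i\<in>(UNIV::'n set). 4)"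
      by (intro prod_mono) auto
    then show ?thesis by (simp add: card_PiE)
  qed
  ultimately show "finite {z. x \<in> gcube (k, z)}" "card {z. x \<in> gcube (k, z)} \<le> 4 ^ CARD('n)"
    by (auto intro: finite_subset dest: card_mono order_trans)
qed

text \<open>Bounded overlap within a generation: a pointwise sum over cubes whose terms depend on
  the generation only becomes a sum over scales.\<close>

lemma nn_integral_gcube_overlap:
  fixes x :: "real^'n::finite" and F :: "int \<Rightarrow> ennreal"
  shows "(\<integral>\<^sup>+q. F (fst q) * indicator (gcube q) x \<partial>count_space UNIV)
    \<le> 4 ^ CARD('n) * (\<integral>\<^sup>+k. F k \<partial>count_space UNIV)"
proof -
  have "(\<integral>\<^sup>+q. F (fst q) * indicator (gcube q) x \<partial>count_space UNIV)
     = (\<integral>\<^sup>+k. \<integral>\<^sup>+z. F k * indicator {z. x \<in> gcube (k, z)} z \<partial>count_space UNIV \<partial>count_space UNIV)"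
    by (subst nn_integral_fst_count_space[symmetric]) (simp add: indicator_def)
  also have "\<dots> = (\<integral>\<^sup>+k. F k * of_nat (card {z. x \<in> gcube (k, z)}) \<partial>count_space UNIV)"
    by (simp add: nn_integral_cmult card_gcube_overlap)
  also have "\<dots> \<le> (\<integral>\<^sup>+k. F k * 4 ^ CARD('n) \<partial>count_space UNIV)"
  proof (intro nn_integral_mono mult_left_mono)
    fix k
    have "(of_nat (card {z. x \<in> gcube (k, z)}) :: ennreal) \<le> of_nat (4 ^ CARD('n))"
      using card_gcube_overlap(2)[of x k] by (simp only: of_nat_le_iff)
    then show "(of_nat (card {z. x \<in> gcube (k, z)}) :: ennreal) \<le> 4 ^ CARD('n)" by simp
  qed auto
  also have "\<dots> = 4 ^ CARD('n) * (\<integral>\<^sup>+k. F k \<partial>count_space UNIV)"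
    by (simp add: nn_integral_multc mult.commute)
  finally show ?thesis .
qed

section \<open>The strong type maximal inequality\<close>

text \<open>Vitali covering. The cubes are enclosed in balls, disjoint balls are selected, and the
  fivefold balls cover everything; since the selected cubes are disjoint, their integrals of
  \<open>G\<close> add up to at most the whole integral. The constant arises because the ball of
  radius 5 n times the side lies in a cube of 10 n times the side.\<close>

lemma gcube_weak_type:
  fixes G :: "real^'n::finite \<Rightarrow> ennreal"
  assumes [measurable]: "G \<in> borel_measurable lebesgue" and "0 < t"
  defines "K \<equiv> {q :: int \<times> ('n \<Rightarrow> int). ennreal t * emeasure lebesgue (gcube q :: (real^'n) set) < (\<integral>\<^sup>+y\<in>gcube q. G y \<partial>lebesgue)}"
  shows "ennreal t * emeasure lebesgue (\<Union>q\<in>K. gcube q) \<le> ennreal ((10 * real CARD('n)) ^ CARD('n)) * (\<integral>\<^sup>+y. G y \<partial>lebesgue)"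
proof (cases "(\<integral>\<^sup>+y. G y \<partial>lebesgue) = \<infinity>")
  case True
  then show ?thesis by (simp add: ennreal_mult_top)
next
  case False
  define n where "n = CARD('n)"
  have n: "0 < n" by (simp add: n_def)
  define I where "I = enn2real (\<integral>\<^sup>+y. G y \<partial>lebesgue)"
  have I: "(\<integral>\<^sup>+y. G y \<partial>lebesgue) = ennreal I" "0 \<le> I"
    using False by (auto simp: I_def less_top)
  define ctr where "ctr q = (\<chi> i. 2 powr real_of_int (fst q) * real_of_int (snd q i) :: real^'n)"
    for q :: "int \<times> ('n \<Rightarrow> int)"
  define r where "r q = real n * gside (fst q)" for q :: "int \<times> ('n \<Rightarrow> int)"
  have gcube_ball: "gcube q \<subseteq> ball (ctr q) (r q)" for q
    unfolding gcube_def ctr_def r_def n_def by (rule cube_subset_ball) simp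
  \<comment> \<open>Vitali's lemma needs bounded radii. A cube in \<open>K\<close> has measure below
    \<open>I / t\<close>, which bounds its side; the maximum with 1 absorbs the n-th root.\<close>
  have rB: "0 < r q \<and> r q \<le> real n * max 1 (I / t)" if "q \<in> K" for q
  proof -
    have "ennreal t * ennreal (gside (fst q) ^ n) < (\<integral>\<^sup>+y\<in>gcube q. G y \<partial>lebesgue)"
      using that by (simp add: K_def n_def)
    also have "\<dots> \<le> (\<integral>\<^sup>+y. G y \<partial>lebesgue)"
      by (intro nn_integral_mono) (auto simp: indicator_def)
    finally have "ennreal (t * gside (fst q) ^ n) < ennreal I"
      using \<open>0 < t\<close> by (simp add: I ennreal_mult)
    then have *: "gside (fst q) ^ n \<le> I / t"
      using \<open>0 < t\<close> I by (simp add: ennreal_less_iff field_simps)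
    have "gside (fst q) \<le> max 1 (I / t)"
    proof (cases "gside (fst q) \<le> 1")
      case False
      then have "gside (fst q) ^ 1 \<le> gside (fst q) ^ n"
        using n by (intro power_increasing) auto
      then show ?thesis using * by auto
    qed auto
    then show ?thesis unfolding r_def using n by (auto intro: mult_left_mono)
  qed
  obtain C where C: "countable C" "C \<subseteq> K"
     "pairwise (\<lambda>i j. disjnt (ball (ctr i) (r i)) (ball (ctr j) (r j))) C"
     "(\<Union>q\<in>K. gcube q) \<subseteq> (\<Union>i\<in>C. ball (ctr i) (5 * r i))"
  proof -
    have "(\<Union>q\<in>K. gcube q) \<subseteq> (\<Union>i\<in>K. ball (ctr i) (r i))"
      using gcube_ball by blast
    from Vitali_covering_lemma_balls[OF this rB] show ?thesis
      using that by blast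
  qed
  have disj: "(\<integral>\<^sup>+q. indicator (gcube q) x \<partial>count_space C) \<le> 1" for x :: "real^'n"
  proof (cases "\<exists>q\<in>C. x \<in> gcube q")
    case True
    then obtain q where q: "q \<in> C" "x \<in> gcube q" by blast
    have "q' = q" if "q' \<in> C" "x \<in> gcube q'" for q'
      using C(3) q that gcube_ball unfolding pairwise_def disjnt_def by blast
    then have "(\<integral>\<^sup>+q. indicator (gcube q) x \<partial>count_space C) \<le> (\<integral>\<^sup>+q'. indicator {q} q' \<partial>count_space C)"
      by (intro nn_integral_mono) (auto simp: indicator_def)
    also have "\<dots> = 1" using q by simp
    finally show ?thesis .
  next
    case False
    then have "(\<integral>\<^sup>+q. indicator (gcube q) x \<partial>count_space C) = (\<integral>\<^sup>+q. 0 \<partial>count_space C)"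
      by (intro nn_integral_cong) (auto simp: indicator_def)
    then show ?thesis by simp
  qed
  have "ennreal t * emeasure lebesgue (\<Union>q\<in>K. gcube q)
      \<le> ennreal t * emeasure lebesgue (\<Union>i\<in>C. ball (ctr i) (5 * r i))"
    by (intro mult_left_mono emeasure_mono C sets.countable_UN'' C) auto
  also have "\<dots> \<le> ennreal t * (\<integral>\<^sup>+x. \<integral>\<^sup>+q. indicator (ball (ctr q) (5 * r q)) x \<partial>count_space C \<partial>lebesgue)"
  proof -
    have "emeasure lebesgue (\<Union>i\<in>C. ball (ctr i) (5 * r i)) = (\<integral>\<^sup>+x. indicator (\<Union>i\<in>C. ball (ctr i) (5 * r i)) x \<partial>lebesgue)"
      by (intro nn_integral_indicator[symmetric] sets.countable_UN'' C) auto
    also have "\<dots> \<le> (\<integral>\<^sup>+x. \<integral>\<^sup>+q. indicator (ball (ctr q) (5 * r q)) x \<partial>count_space C \<partial>lebesgue)"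
    proof (intro nn_integral_mono)
      fix x
      show "indicator (\<Union>i\<in>C. ball (ctr i) (5 * r i)) x \<le> (\<integral>\<^sup>+q. indicator (ball (ctr q) (5 * r q)) x \<partial>count_space C)"
        (is "_ \<le> (\<integral>\<^sup>+q. ?f q \<partial>_)")
      proof (cases "x \<in> (\<Union>i\<in>C. ball (ctr i) (5 * r i))")
        case True
        then obtain q where q: "q \<in> C" "x \<in> ball (ctr q) (5 * r q)" by blast
        have "?f q \<le> (\<integral>\<^sup>+q. ?f q \<partial>count_space C)"
          by (rule nn_integral_ge_point) (rule q)
        then show ?thesis using True q by simp
      qed auto
    qed
    finally show ?thesis by (rule mult_left_mono) simp
  qed
  also have "\<dots> = ennreal t * (\<integral>\<^sup>+q. emeasure lebesgue (ball (ctr q) (5 * r q)) \<partial>count_space C)"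
    by (subst nn_integral_count_space_nn_integral)
       (auto simp: C nn_integral_indicator intro!: borel_measurable_indicator)
  also have "\<dots> \<le> ennreal t * (\<integral>\<^sup>+q. ennreal ((10 * real n) ^ n) * emeasure lebesgue (gcube q :: (real^'n) set) \<partial>count_space C)"
  proof (intro mult_left_mono nn_integral_mono)
    fix q
    have "ball (ctr q) (5 * r q) \<subseteq> cube (ctr q) (10 * r q)"
      using cball_subset_cube[of "ctr q" "5 * r q"] by auto
    then have "emeasure lebesgue (ball (ctr q) (5 * r q)) \<le> emeasure lebesgue (cube (ctr q) (10 * r q))"
      by (intro emeasure_mono) auto
    also have "\<dots> = ennreal ((10 * r q) ^ n)"
      unfolding n_def by (rule emeasure_cube_lebesgue) (simp add: r_def)
    also have "\<dots> = ennreal ((10 * real n) ^ n) * emeasure lebesgue (gcube q :: (real^'n) set)"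
      by (simp add: r_def n_def[symmetric] power_mult_distrib ennreal_mult mult.assoc)
    finally show "emeasure lebesgue (ball (ctr q) (5 * r q)) \<le> \<dots>" .
  qed auto
  also have "\<dots> = ennreal ((10 * real n) ^ n) * (\<integral>\<^sup>+q. ennreal t * emeasure lebesgue (gcube q :: (real^'n) set) \<partial>count_space C)"
  proof -
    have "ennreal t * (c * A) = c * (ennreal t * A)" for c A :: ennreal
      by (simp add: mult.left_commute)
    then show ?thesis by (simp only: nn_integral_cmult measurable_count_space_eq1 Pi_UNIV UNIV_I space_borel)
  qed
  also have "\<dots> \<le> ennreal ((10 * real n) ^ n) * (\<integral>\<^sup>+q. (\<integral>\<^sup>+y\<in>gcube q. G y \<partial>lebesgue) \<partial>count_space C)"
  proof (intro mult_left_mono nn_integral_mono)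
    fix q assume "q \<in> space (count_space C)"
    then show "ennreal t * emeasure lebesgue (gcube q :: (real^'n) set) \<le> (\<integral>\<^sup>+y\<in>gcube q. G y \<partial>lebesgue)"
      using C(2) unfolding K_def by auto
  qed auto
  also have "(\<integral>\<^sup>+q. (\<integral>\<^sup>+y\<in>gcube q. G y \<partial>lebesgue) \<partial>count_space C)
      = (\<integral>\<^sup>+y. \<integral>\<^sup>+q. G y * indicator (gcube q) y \<partial>count_space C \<partial>lebesgue)"
    by (subst nn_integral_count_space_nn_integral) (auto simp: C)
  also have "\<dots> = (\<integral>\<^sup>+y. G y * (\<integral>\<^sup>+q. indicator (gcube q) y \<partial>count_space C) \<partial>lebesgue)"
    by (simp add: nn_integral_cmult)
  also have "\<dots> \<le> (\<integral>\<^sup>+y. G y * 1 \<partial>lebesgue)"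
    by (intro nn_integral_mono mult_left_mono disj) auto
  finally show ?thesis by (simp add: n_def mult_left_mono)
qed

text \<open>Real valued through \<open>enn2real\<close>, hence 0 when the integral is infinite. This
  is why the comparison lemmas below carry finiteness premises.\<close>

definition mavg :: "(real^'n::finite \<Rightarrow> real) \<Rightarrow> (real^'n) set \<Rightarrow> real" where
  "mavg F A = enn2real (\<integral>\<^sup>+y\<in>A. ennreal (F y) \<partial>lebesgue) / measure lebesgue A"

lemma mavg_nonneg [simp]: "0 \<le> mavg F A"
  by (simp add: mavg_def)

lemma mavg_gcube:
  fixes F :: "real^'n::finite \<Rightarrow> real"
  assumes "(\<integral>\<^sup>+y\<in>gcube q. ennreal (F y) \<partial>lebesgue) < \<infinity>"
  shows "ennreal (mavg F (gcube q)) * ennreal (gside (fst q) ^ CARD('n)) = (\<integral>\<^sup>+y\<in>gcube q. ennreal (F y) \<partial>lebesgue)"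
proof -
  have "0 < gside (fst q) ^ CARD('n)" by simp
  then show ?thesis
    using assms by (simp add: mavg_def ennreal_mult'[symmetric] del: zero_less_power)
qed

lemma nn_integral_gcube_finite:
  fixes F :: "real^'n::finite \<Rightarrow> real"
  assumes [measurable]: "F \<in> borel_measurable lebesgue" and nn: "\<And>y. 0 \<le> F y"
    and "1 \<le> u" and "(\<integral>\<^sup>+y\<in>gcube q. ennreal (F y powr u) \<partial>lebesgue) < \<infinity>"
  shows "(\<integral>\<^sup>+y\<in>gcube q. ennreal (F y) \<partial>lebesgue) < \<infinity>"
proof -
  have "(\<integral>\<^sup>+y\<in>gcube q. ennreal (F y) \<partial>lebesgue) \<le> (\<integral>\<^sup>+y. indicator (gcube q) y + ennreal (F y powr u) * indicator (gcube q) y \<partial>lebesgue)"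
  proof (intro nn_integral_mono)
    fix y
    have "F y \<le> 1 + F y powr u"
    proof (cases "F y \<le> 1")
      case False
      then have "F y powr 1 \<le> F y powr u" using \<open>1 \<le> u\<close> by (intro powr_mono) auto
      then show ?thesis using False by simp
    qed (simp add: add_increasing2)
    then have "ennreal (F y) \<le> ennreal (1 + F y powr u)" by (rule ennreal_leI)
    then show "ennreal (F y) * indicator (gcube q) y \<le> indicator (gcube q) y + ennreal (F y powr u) * indicator (gcube q) y"
      by (auto simp: indicator_def)
  qed
  also have "\<dots> = emeasure lebesgue (gcube q :: (real^'n) set) + (\<integral>\<^sup>+y\<in>gcube q. ennreal (F y powr u) \<partial>lebesgue)"
    by (subst nn_integral_add) auto
  also have "\<dots> < \<infinity>" using assms(4) by (simp add: ennreal_add_eq_top less_top)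
  finally show ?thesis .
qed

text \<open>\<open>W\<close> plays the role of the \<open>u\<close>-th power of the maximal function of \<open>\<Phi>\<close>.\<close>

lemma strong_maximal:
  fixes u :: real
  assumes u: "1 < u"
  obtains C where "0 \<le> C"
    "\<And>\<Phi> :: real^'n::finite \<Rightarrow> real. \<Phi> \<in> borel_measurable lebesgue \<Longrightarrow> (\<And>y. 0 \<le> \<Phi> y) \<Longrightarrow>
       (\<integral>\<^sup>+y. ennreal (\<Phi> y powr u) \<partial>lebesgue) < \<infinity> \<Longrightarrow>
       \<exists>W \<in> borel_measurable lebesgue.
         (\<forall>q. \<forall>x\<in>gcube q. ennreal (mavg \<Phi> (gcube q) powr u) \<le> W x) \<and>
         (\<integral>\<^sup>+x. W x \<partial>lebesgue) \<le> ennreal C * (\<integral>\<^sup>+y. ennreal (\<Phi> y powr u) \<partial>lebesgue)"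
proof -
  define n where "n = CARD('n)"
  define cn where "cn = (10 * real n) ^ n"
  have cn: "0 \<le> cn" by (simp add: cn_def)
  obtain C0 where C0: "0 \<le> C0"
    "\<And>c. (\<integral>\<^sup>+k. ennreal (2 powr (- (u - 1) * \<bar>real_of_int k + c\<bar>)) \<partial>count_space UNIV) \<le> ennreal C0"
    using int_geometric_sum_bound[of "u - 1"] u by auto
  \<comment> \<open>The power 2 powr (u + 1) comes from dividing the layer height 2 powr ((j + 1) *
    u) by the level 2 powr (j - 1) of the weak type bound; the power of 4 comes from j - c \<le> 2 -
    |j - c| for j < c + 1, where 2 powr c is the value of \<open>\<Phi>\<close>.\<close>
  define D where "D = cn * 2 powr (u + 1) * 4 powr (u - 1)"
  have D: "0 \<le> D" using cn by (simp add: D_def)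
  show thesis
  proof (rule that)
    show "0 \<le> D * C0" using D C0 by simp
    fix \<Phi> :: "real^'n \<Rightarrow> real"
    assume [measurable]: "\<Phi> \<in> borel_measurable lebesgue" and nn: "\<And>y. 0 \<le> \<Phi> y"
      and fin: "(\<integral>\<^sup>+y. ennreal (\<Phi> y powr u) \<partial>lebesgue) < \<infinity>"
    define W where "W x = (SUP q. indicator (gcube q) x * ennreal (mavg \<Phi> (gcube q) powr u))" for x
    have finQ: "(\<integral>\<^sup>+y\<in>gcube q. ennreal (\<Phi> y) \<partial>lebesgue) < \<infinity>" for q
    proof (rule nn_integral_gcube_finite[where u=u])
      have "(\<integral>\<^sup>+y\<in>gcube q. ennreal (\<Phi> y powr u) \<partial>lebesgue) \<le> (\<integral>\<^sup>+y. ennreal (\<Phi> y powr u) \<partial>lebesgue)"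
        by (intro nn_integral_mono) (auto simp: indicator_def)
      then show "(\<integral>\<^sup>+y\<in>gcube q. ennreal (\<Phi> y powr u) \<partial>lebesgue) < \<infinity>" using fin by auto
    qed (use nn u in auto)
    \<comment> \<open>Marcinkiewicz truncation at half the level 2 powr j: the part of
      \<open>\<Phi>\<close> below half the level contributes at most half the level to any average,
      so the truncated part alone has an average above 2 powr (j - 1).\<close>
    define \<Phi>t where "\<Phi>t j y = ennreal (\<Phi> y) * indicator {y. 2 powr (real_of_int j - 1) < \<Phi> y} y" for j y
    define K where "K j = {q :: int \<times> ('n \<Rightarrow> int). ennreal (2 powr (real_of_int j - 1)) * emeasure lebesgue (gcube q :: (real^'n) set) < (\<integral>\<^sup>+y\<in>gcube q. \<Phi>t j y \<partial>lebesgue)}" for j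
    define E where "E j = (\<Union>q\<in>K j. gcube q)" for j
    have Em[measurable]: "E j \<in> sets lebesgue" for j
      unfolding E_def by (intro sets.countable_UN'') auto
    have \<Phi>tm[measurable]: "\<Phi>t j \<in> borel_measurable lebesgue" for j
      unfolding \<Phi>t_def by measurable
    have inK: "q \<in> K j" if "2 powr real_of_int j < mavg \<Phi> (gcube q)" for q j
    proof -
      let ?l = "2 powr (real_of_int j - 1)" and ?m = "gside (fst q) ^ CARD('n)"
      have m: "0 < ?m" by simp
      have fm: "finite_measure (restrict_space lebesgue (gcube q :: (real^'n) set))"
        by (intro finite_measureI) (simp add: emeasure_restrict_space)
      have "ennreal (2 powr real_of_int j * ?m) < ennreal (mavg \<Phi> (gcube q) * ?m)"
      proof (rule ennreal_lessI)
        have "0 < mavg \<Phi> (gcube q)"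
          using that powr_ge_zero[of 2 "real_of_int j"] by linarith
        then show "0 < mavg \<Phi> (gcube q) * ?m" using m by simp
        show "2 powr real_of_int j * ?m < mavg \<Phi> (gcube q) * ?m"
          using that m by (rule mult_strict_right_mono)
      qed
      also have "\<dots> = (\<integral>\<^sup>+y\<in>gcube q. ennreal (\<Phi> y) \<partial>lebesgue)"
        by (subst mavg_gcube[OF finQ, symmetric]) (simp add: ennreal_mult)
      also have "\<dots> \<le> (\<integral>\<^sup>+y. ennreal ?l * indicator (gcube q) y + \<Phi>t j y * indicator (gcube q) y \<partial>lebesgue)"
      proof (intro nn_integral_mono)
        fix y
        show "ennreal (\<Phi> y) * indicator (gcube q) y
          \<le> ennreal ?l * indicator (gcube q) y + \<Phi>t j y * indicator (gcube q) y"
        proof (cases "?l < \<Phi> y")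
          case True
          then have "\<Phi>t j y = ennreal (\<Phi> y)" by (simp add: \<Phi>t_def)
          then show ?thesis by (simp add: add_increasing)
        next
          case False
          then have "ennreal (\<Phi> y) \<le> ennreal ?l" by (intro ennreal_leI) simp
          then show ?thesis by (simp add: add_increasing2 mult_right_mono)
        qed
      qed
      also have "\<dots> = ennreal ?l * emeasure lebesgue (gcube q :: (real^'n) set) + (\<integral>\<^sup>+y\<in>gcube q. \<Phi>t j y \<partial>lebesgue)"
        by (subst nn_integral_add) (auto simp: nn_integral_cmult)
      finally have "ennreal (2 powr real_of_int j * ?m) < ennreal ?l * ennreal ?m + (\<integral>\<^sup>+y\<in>gcube q. \<Phi>t j y \<partial>lebesgue)"
        by simp
      moreover have "ennreal (2 powr real_of_int j * ?m) = ennreal ?l * ennreal ?m + ennreal ?l * ennreal ?m"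
      proof -
        have "2 powr real_of_int j * ?m = ?l * ?m + ?l * ?m" by (simp add: powr_diff)
        also have "ennreal (?l * ?m + ?l * ?m) = ennreal (?l * ?m) + ennreal (?l * ?m)"
          by (rule ennreal_plus) auto
        also have "ennreal (?l * ?m) = ennreal ?l * ennreal ?m"
          by (rule ennreal_mult) auto
        finally show ?thesis .
      qed
      ultimately have "ennreal ?l * ennreal ?m < (\<integral>\<^sup>+y\<in>gcube q. \<Phi>t j y \<partial>lebesgue)"
        using add_left_mono[of "\<integral>\<^sup>+y\<in>gcube q. \<Phi>t j y \<partial>lebesgue" "ennreal ?l * ennreal ?m" "ennreal ?l * ennreal ?m"]
        by (simp only: not_le[symmetric]) auto
      then show ?thesis unfolding K_def by simp
    qed
    have W_le: "W x \<le> (\<integral>\<^sup>+j. ennreal (2 powr ((real_of_int j + 1) * u)) * indicator (E j) x \<partial>count_space UNIV)" for x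
      unfolding W_def
    proof (intro SUP_least)
      fix q
      show "indicator (gcube q) x * ennreal (mavg \<Phi> (gcube q) powr u)
         \<le> (\<integral>\<^sup>+j. ennreal (2 powr ((real_of_int j + 1) * u)) * indicator (E j) x \<partial>count_space UNIV)"
        (is "_ \<le> (\<integral>\<^sup>+j. ?f j \<partial>_)")
      proof (cases "x \<in> gcube q \<and> 0 < mavg \<Phi> (gcube q)")
        case True
        define a where "a = mavg \<Phi> (gcube q)"
        \<comment> \<open>The dyadic level just below \<open>a\<close>: 2 powr j < a \<le> 2 powr (j
          + 1), with strict inequality on the left because membership in \<open>K j\<close> is
          strict.\<close>
        define j where "j = \<lceil>log 2 a\<rceil> - 1"
        have a: "0 < a" using True by (simp add: a_def)
        have "real_of_int j < log 2 a" "log 2 a \<le> real_of_int j + 1" unfolding j_def by linarith+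
        then have j: "2 powr real_of_int j < a" "a \<le> 2 powr (real_of_int j + 1)"
          using a by (auto simp: less_log_iff log_le_iff)
        have "a powr u \<le> 2 powr ((real_of_int j + 1) * u)"
          using powr_mono2[of u a "2 powr (real_of_int j + 1)"] j a u by (simp add: powr_powr)
        moreover have "x \<in> E j" unfolding E_def using inK[of j q] j True by (auto simp: a_def)
        ultimately have "indicator (gcube q) x * ennreal (a powr u) \<le> ?f j"
          using True by (simp add: ennreal_leI)
        also have "?f j \<le> (\<integral>\<^sup>+j. ?f j \<partial>count_space UNIV)"
          by (rule nn_integral_ge_point) simp
        finally show ?thesis by (simp add: a_def)
      next
        case False
        then have "x \<notin> gcube q \<or> mavg \<Phi> (gcube q) = 0"
          using mavg_nonneg[of \<Phi> "gcube q"] by linarith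
        then show ?thesis by auto
      qed
    qed
    have weak: "ennreal (2 powr ((real_of_int j + 1) * u)) * emeasure lebesgue (E j)
       \<le> (\<integral>\<^sup>+y. ennreal (cn * 2 powr (u + 1) * 2 powr (real_of_int j * (u - 1))) * \<Phi>t j y \<partial>lebesgue)" for j
    proof -
      let ?l = "2 powr (real_of_int j - 1)"
      have e: "2 powr ((real_of_int j + 1) * u) = 2 powr ((real_of_int j + 1) * u - (real_of_int j - 1)) * ?l"
        by (simp flip: powr_add)
      have "ennreal (2 powr ((real_of_int j + 1) * u)) * emeasure lebesgue (E j)
         = ennreal (2 powr ((real_of_int j + 1) * u - (real_of_int j - 1))) * (ennreal ?l * emeasure lebesgue (E j))"
        by (subst e) (simp add: ennreal_mult mult.assoc)
      also have "\<dots> \<le> ennreal (2 powr ((real_of_int j + 1) * u - (real_of_int j - 1))) * (ennreal cn * (\<integral>\<^sup>+y. \<Phi>t j y \<partial>lebesgue))"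
        unfolding E_def K_def cn_def n_def by (intro mult_left_mono gcube_weak_type) auto
      also have "\<dots> = (\<integral>\<^sup>+y. ennreal (2 powr ((real_of_int j + 1) * u - (real_of_int j - 1)) * cn) * \<Phi>t j y \<partial>lebesgue)"
        using cn by (simp add: nn_integral_cmult ennreal_mult mult.assoc)
      also have "2 powr ((real_of_int j + 1) * u - (real_of_int j - 1)) * cn = cn * 2 powr (u + 1) * 2 powr (real_of_int j * (u - 1))"
        by (simp add: mult.assoc powr_add[symmetric] algebra_simps)
      finally show ?thesis .
    qed
    \<comment> \<open>At fixed y only levels with 2 powr (j - 1) < \<Phi> y count. Since u > 1 this
      is a geometric series dominated by its top term, of order \<Phi> y powr (u - 1); the remaining
      factor \<Phi> y completes the power u.\<close>
    have pointwise: "(\<integral>\<^sup>+j. ennreal (cn * 2 powr (u + 1) * 2 powr (real_of_int j * (u - 1))) * \<Phi>t j y \<partial>count_space UNIV)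
        \<le> ennreal (D * C0) * ennreal (\<Phi> y powr u)" for y
    proof (cases "\<Phi> y = 0")
      case True
      then show ?thesis by (simp add: \<Phi>t_def)
    next
      case False
      then have pos: "0 < \<Phi> y" using nn[of y] by simp
      define c where "c = log 2 (\<Phi> y)"
      have c: "\<Phi> y = 2 powr c" using pos by (simp add: c_def)
      have "(\<integral>\<^sup>+j. ennreal (cn * 2 powr (u + 1) * 2 powr (real_of_int j * (u - 1))) * \<Phi>t j y \<partial>count_space UNIV)
        \<le> (\<integral>\<^sup>+j. ennreal (D * \<Phi> y powr u) * ennreal (2 powr (- (u - 1) * \<bar>real_of_int j + - c\<bar>)) \<partial>count_space UNIV)"
      proof (intro nn_integral_mono)
        fix j :: int
        show "ennreal (cn * 2 powr (u + 1) * 2 powr (real_of_int j * (u - 1))) * \<Phi>t j y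
          \<le> ennreal (D * \<Phi> y powr u) * ennreal (2 powr (- (u - 1) * \<bar>real_of_int j + - c\<bar>))"
        proof (cases "2 powr (real_of_int j - 1) < \<Phi> y")
          case True
          then have "real_of_int j - 1 < c" by (simp add: c)
          then have "real_of_int j - c \<le> 2 - \<bar>real_of_int j + - c\<bar>" by linarith
          then have "(real_of_int j - c) * (u - 1) \<le> (2 - \<bar>real_of_int j + - c\<bar>) * (u - 1)"
            using u by (intro mult_right_mono) auto
          then have "real_of_int j * (u - 1) + c \<le> 2 * (u - 1) + c * u + - (u - 1) * \<bar>real_of_int j + - c\<bar>"
            by (simp add: algebra_simps)
          then have "2 powr (real_of_int j * (u - 1)) * \<Phi> y \<le> 4 powr (u - 1) * \<Phi> y powr u * 2 powr (- (u - 1) * \<bar>real_of_int j + - c\<bar>)"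
            using powr_powr[of "2::real" 2 "u - 1"] by (simp add: c powr_powr flip: powr_add)
          then have "cn * 2 powr (u + 1) * (2 powr (real_of_int j * (u - 1)) * \<Phi> y)
            \<le> cn * 2 powr (u + 1) * (4 powr (u - 1) * \<Phi> y powr u * 2 powr (- (u - 1) * \<bar>real_of_int j + - c\<bar>))"
            using cn by (intro mult_left_mono) auto
          then have *: "cn * 2 powr (u + 1) * 2 powr (real_of_int j * (u - 1)) * \<Phi> y
            \<le> D * \<Phi> y powr u * 2 powr (- (u - 1) * \<bar>real_of_int j + - c\<bar>)"
            by (simp add: D_def mult_ac)
          have "\<Phi>t j y = ennreal (\<Phi> y)" using True by (simp add: \<Phi>t_def)
          then show ?thesis
            using * cn nn D by (simp add: ennreal_mult'[symmetric] ennreal_leI mult.assoc)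
        next
          case False
          then show ?thesis by (simp add: \<Phi>t_def)
        qed
      qed
      also have "\<dots> = ennreal (D * \<Phi> y powr u) * (\<integral>\<^sup>+j. ennreal (2 powr (- (u - 1) * \<bar>real_of_int j + - c\<bar>)) \<partial>count_space UNIV)"
        by (simp add: nn_integral_cmult)
      also have "\<dots> \<le> ennreal (D * \<Phi> y powr u) * ennreal C0"
        by (intro mult_left_mono C0) auto
      also have "\<dots> = ennreal (D * C0) * ennreal (\<Phi> y powr u)"
        using D C0 by (simp add: ennreal_mult'[symmetric] mult_ac)
      finally show ?thesis .
    qed
    show "\<exists>W \<in> borel_measurable lebesgue.
         (\<forall>q. \<forall>x\<in>gcube q. ennreal (mavg \<Phi> (gcube q) powr u) \<le> W x) \<and>
         (\<integral>\<^sup>+x. W x \<partial>lebesgue) \<le> ennreal (D * C0) * (\<integral>\<^sup>+y. ennreal (\<Phi> y powr u) \<partial>lebesgue)"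
    proof (intro bexI[of _ W] conjI allI ballI)
      show "W \<in> borel_measurable lebesgue"
        unfolding W_def[abs_def] by measurable
      fix q and x :: "real^'n" assume "x \<in> gcube q"
      then show "ennreal (mavg \<Phi> (gcube q) powr u) \<le> W x"
        unfolding W_def by (intro SUP_upper2[of q]) auto
    next
      have "(\<integral>\<^sup>+x. W x \<partial>lebesgue) \<le> (\<integral>\<^sup>+x. \<integral>\<^sup>+j. ennreal (2 powr ((real_of_int j + 1) * u)) * indicator (E j) x \<partial>count_space UNIV \<partial>lebesgue)"
        by (intro nn_integral_mono W_le)
      also have "\<dots> = (\<integral>\<^sup>+j. ennreal (2 powr ((real_of_int j + 1) * u)) * emeasure lebesgue (E j) \<partial>count_space UNIV)"
        by (subst nn_integral_count_space_nn_integral) (auto simp: nn_integral_cmult)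
      also have "\<dots> \<le> (\<integral>\<^sup>+j. \<integral>\<^sup>+y. ennreal (cn * 2 powr (u + 1) * 2 powr (real_of_int j * (u - 1))) * \<Phi>t j y \<partial>lebesgue \<partial>count_space UNIV)"
        by (intro nn_integral_mono weak)
      also have "\<dots> = (\<integral>\<^sup>+y. \<integral>\<^sup>+j. ennreal (cn * 2 powr (u + 1) * 2 powr (real_of_int j * (u - 1))) * \<Phi>t j y \<partial>count_space UNIV \<partial>lebesgue)"
        by (subst nn_integral_count_space_nn_integral) auto
      also have "\<dots> \<le> (\<integral>\<^sup>+y. ennreal (D * C0) * ennreal (\<Phi> y powr u) \<partial>lebesgue)"
        by (intro nn_integral_mono pointwise)
      finally show "(\<integral>\<^sup>+x. W x \<partial>lebesgue) \<le> ennreal (D * C0) * (\<integral>\<^sup>+y. ennreal (\<Phi> y powr u) \<partial>lebesgue)"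
        by (simp add: nn_integral_cmult)
    qed
  qed
qed

section \<open>Averages and logarithmically Hoelder continuous exponents\<close>

lemma mavg_mono:
  fixes F G :: "real^'n::finite \<Rightarrow> real"
  assumes "\<And>y. y \<in> A \<Longrightarrow> F y \<le> G y" "(\<integral>\<^sup>+y\<in>A. ennreal (G y) \<partial>lebesgue) < \<infinity>"
  shows "mavg F A \<le> mavg G A"
proof -
  have "(\<integral>\<^sup>+y\<in>A. ennreal (F y) \<partial>lebesgue) \<le> (\<integral>\<^sup>+y\<in>A. ennreal (G y) \<partial>lebesgue)"
    using assms(1) by (intro nn_integral_mono) (auto simp: indicator_def intro: ennreal_leI)
  then show ?thesis
    unfolding mavg_def using assms(2) by (intro divide_right_mono enn2real_mono) auto
qed

lemma mavg_cmult:
  fixes F :: "real^'n::finite \<Rightarrow> real"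
  assumes "F \<in> borel_measurable lebesgue" "0 \<le> c" "A \<in> sets lebesgue"
  shows "mavg (\<lambda>y. c * F y) A = c * mavg F A"
proof -
  have "(\<integral>\<^sup>+y\<in>A. ennreal (c * F y) \<partial>lebesgue) = ennreal c * (\<integral>\<^sup>+y\<in>A. ennreal (F y) \<partial>lebesgue)"
    using assms by (subst nn_integral_cmult[symmetric]) (auto simp: ennreal_mult' mult.assoc)
  then show ?thesis using assms by (simp add: mavg_def enn2real_mult)
qed

lemma mavg_gcube_ge_const:
  fixes F :: "real^'n::finite \<Rightarrow> real"
  assumes "\<And>y. y \<in> gcube q \<Longrightarrow> c \<le> F y" "(\<integral>\<^sup>+y\<in>gcube q. ennreal (F y) \<partial>lebesgue) < \<infinity>"
  shows "c \<le> mavg F (gcube q)"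
proof (cases "0 \<le> c")
  case True
  have "ennreal c * ennreal (gside (fst q) ^ CARD('n)) = (\<integral>\<^sup>+y\<in>gcube q. ennreal c \<partial>lebesgue)"
    by (simp add: nn_integral_cmult)
  also have "\<dots> \<le> (\<integral>\<^sup>+y\<in>gcube q. ennreal (F y) \<partial>lebesgue)"
    using assms(1) by (intro nn_integral_mono) (auto simp: indicator_def intro: ennreal_leI)
  also have "\<dots> = ennreal (mavg F (gcube q)) * ennreal (gside (fst q) ^ CARD('n))"
    using assms(2) by (rule mavg_gcube[symmetric])
  finally have "ennreal (c * gside (fst q) ^ CARD('n)) \<le> ennreal (mavg F (gcube q) * gside (fst q) ^ CARD('n))"
    using True by (simp add: ennreal_mult)
  then have "c * gside (fst q) ^ CARD('n) \<le> mavg F (gcube q) * gside (fst q) ^ CARD('n)"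
    by (subst (asm) ennreal_le_iff) auto
  then show ?thesis by (rule mult_right_le_imp_le) simp
next
  case False
  then show ?thesis using mavg_nonneg[of F "gcube q"] by linarith
qed

lemma mavg_gcube_le_const:
  fixes F :: "real^'n::finite \<Rightarrow> real"
  assumes "\<And>y. y \<in> gcube q \<Longrightarrow> F y \<le> c" "0 \<le> c"
  shows "mavg F (gcube q) \<le> c"
proof -
  have "mavg F (gcube q) \<le> mavg (\<lambda>_. c) (gcube q)"
    using assms by (intro mavg_mono) (auto simp: nn_integral_cmult ennreal_mult_less_top)
  also have "\<dots> = c"
    using assms by (simp add: mavg_def nn_integral_cmult enn2real_mult)
  finally show ?thesis .
qed

lemma mavg_gcube_add_le:
  fixes F G :: "real^'n::finite \<Rightarrow> real"
  assumes "F \<in> borel_measurable lebesgue" "G \<in> borel_measurable lebesgue"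
    "\<And>y. 0 \<le> F y" "\<And>y. 0 \<le> G y"
    "(\<integral>\<^sup>+y\<in>gcube q. ennreal (F y) \<partial>lebesgue) < \<infinity>" "(\<integral>\<^sup>+y\<in>gcube q. ennreal (G y) \<partial>lebesgue) < \<infinity>"
  shows "mavg (\<lambda>y. F y + G y) (gcube q) = mavg F (gcube q) + mavg G (gcube q)"
proof -
  have "(\<integral>\<^sup>+y\<in>gcube q. ennreal (F y + G y) \<partial>lebesgue) =
      (\<integral>\<^sup>+y\<in>gcube q. ennreal (F y) \<partial>lebesgue) + (\<integral>\<^sup>+y\<in>gcube q. ennreal (G y) \<partial>lebesgue)"
    using assms by (subst nn_integral_add[symmetric]) (auto simp: distrib_right)
  then show ?thesis
    using assms(5,6) by (simp add: mavg_def enn2real_plus add_divide_distrib)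
qed

text \<open>Jensen's inequality, obtained by averaging Young's inequality with the average
  \<open>A\<close> itself as the second variable: A powr (\<rho> - 1) * F \<le> (1 - 1/\<rho>) A
  powr \<rho> + F powr \<rho> / \<rho>. The left side averages to A powr \<rho>.\<close>

lemma mavg_gcube_powr_le:
  fixes F :: "real^'n::finite \<Rightarrow> real"
  assumes [measurable]: "F \<in> borel_measurable lebesgue" and nn: "\<And>y. 0 \<le> F y" and "1 \<le> \<rho>"
    and fin: "(\<integral>\<^sup>+y\<in>gcube q. ennreal (F y powr \<rho>) \<partial>lebesgue) < \<infinity>"
  shows "mavg F (gcube q) powr \<rho> \<le> mavg (\<lambda>y. F y powr \<rho>) (gcube q)"
proof (cases "\<rho> = 1 \<or> mavg F (gcube q) = 0")
  case True
  then show ?thesis using nn by auto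
next
  case False
  define A where "A = mavg F (gcube q)"
  define m where "m = gside (fst q) ^ CARD('n)"
  have m: "0 < m" by (simp add: m_def)
  have "A \<noteq> 0" using False by (simp add: A_def)
  moreover have "0 \<le> A" by (simp add: A_def)
  ultimately have A: "0 < A" by linarith
  have \<rho>: "1 < \<rho>" using False assms(3) by simp
  have finF: "(\<integral>\<^sup>+y\<in>gcube q. ennreal (F y) \<partial>lebesgue) < \<infinity>"
    by (rule nn_integral_gcube_finite[OF assms(1) nn assms(3) fin])
  have young: "A powr (\<rho> - 1) * F y \<le> (1 - 1 / \<rho>) * A powr \<rho> + 1 / \<rho> * F y powr \<rho>" for y
  proof -
    have e: "(\<rho> - 1) * (\<rho> / (\<rho> - 1)) = \<rho>" using \<rho> by simp
    have "F y * A powr (\<rho> - 1) \<le> F y powr \<rho> / \<rho> + (A powr (\<rho> - 1)) powr (\<rho> / (\<rho> - 1)) / (\<rho> / (\<rho> - 1))"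
    proof (rule Youngs_inequality)
      have "1 / (\<rho> / (\<rho> - 1)) = (\<rho> - 1) / \<rho>" by simp
      then show "1 / \<rho> + 1 / (\<rho> / (\<rho> - 1)) = 1"
        using \<rho> by (simp add: add_divide_distrib[symmetric])
      show "1 < \<rho> / (\<rho> - 1)" using \<rho> by (simp add: less_divide_eq)
    qed (use \<rho> nn in auto)
    also have "(A powr (\<rho> - 1)) powr (\<rho> / (\<rho> - 1)) = A powr \<rho>"
      by (simp only: powr_powr e)
    finally have "F y * A powr (\<rho> - 1) \<le> F y powr \<rho> / \<rho> + A powr \<rho> / (\<rho> / (\<rho> - 1))" .
    moreover have "A powr \<rho> / (\<rho> / (\<rho> - 1)) = (1 - 1 / \<rho>) * A powr \<rho>"
    proof -
      have "1 - 1 / \<rho> = (\<rho> - 1) / \<rho>" using \<rho> by (simp add: diff_divide_distrib)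
      then show ?thesis by simp
    qed
    ultimately show ?thesis by (simp add: mult.commute)
  qed
  have "ennreal (A powr (\<rho> - 1) * (A * m)) = ennreal (A powr (\<rho> - 1)) * (\<integral>\<^sup>+y\<in>gcube q. ennreal (F y) \<partial>lebesgue)"
    using A m by (simp add: mavg_gcube[OF finF, symmetric] A_def[symmetric] m_def[symmetric] ennreal_mult)
  also have "\<dots> = (\<integral>\<^sup>+y\<in>gcube q. ennreal (A powr (\<rho> - 1) * F y) \<partial>lebesgue)"
    using nn by (subst nn_integral_cmult[symmetric]) (auto simp: ennreal_mult mult.assoc)
  also have "\<dots> \<le> (\<integral>\<^sup>+y. ennreal ((1 - 1 / \<rho>) * A powr \<rho>) * indicator (gcube q) y
       + ennreal (1 / \<rho>) * (ennreal (F y powr \<rho>) * indicator (gcube q) y) \<partial>lebesgue)"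
  proof (intro nn_integral_mono)
    fix y
    have "ennreal (A powr (\<rho> - 1) * F y) \<le> ennreal ((1 - 1 / \<rho>) * A powr \<rho> + 1 / \<rho> * F y powr \<rho>)"
      by (intro ennreal_leI young)
    also have "\<dots> = ennreal ((1 - 1 / \<rho>) * A powr \<rho>) + ennreal (1 / \<rho>) * ennreal (F y powr \<rho>)"
    proof -
      have "ennreal (1 / \<rho> * F y powr \<rho>) = ennreal (1 / \<rho>) * ennreal (F y powr \<rho>)"
        using \<rho> by (intro ennreal_mult) auto
      moreover have "0 \<le> (1 - 1 / \<rho>) * A powr \<rho>" "0 \<le> 1 / \<rho> * F y powr \<rho>"
        using \<rho> by simp_all
      ultimately show ?thesis by (metis ennreal_plus)
    qed
    finally show "ennreal (A powr (\<rho> - 1) * F y) * indicator (gcube q) y \<le>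
       ennreal ((1 - 1 / \<rho>) * A powr \<rho>) * indicator (gcube q) y
       + ennreal (1 / \<rho>) * (ennreal (F y powr \<rho>) * indicator (gcube q) y)"
      by (auto simp: indicator_def)
  qed
  also have "\<dots> = ennreal ((1 - 1 / \<rho>) * A powr \<rho>) * ennreal m + ennreal (1 / \<rho>) * (\<integral>\<^sup>+y\<in>gcube q. ennreal (F y powr \<rho>) \<partial>lebesgue)"
    by (subst nn_integral_add) (auto simp: nn_integral_cmult m_def)
  also have "(\<integral>\<^sup>+y\<in>gcube q. ennreal (F y powr \<rho>) \<partial>lebesgue) = ennreal (mavg (\<lambda>y. F y powr \<rho>) (gcube q) * m)"
    using m by (simp add: mavg_gcube[OF fin, symmetric] m_def[symmetric] ennreal_mult)
  also have "ennreal ((1 - 1 / \<rho>) * A powr \<rho>) * ennreal m + ennreal (1 / \<rho>) * ennreal (mavg (\<lambda>y. F y powr \<rho>) (gcube q) * m)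
     = ennreal ((1 - 1 / \<rho>) * A powr \<rho> * m + 1 / \<rho> * (mavg (\<lambda>y. F y powr \<rho>) (gcube q) * m))"
  proof -
    have "0 \<le> (1 - 1 / \<rho>) * A powr \<rho>" using \<rho> by simp
    then have "ennreal ((1 - 1 / \<rho>) * A powr \<rho>) * ennreal m = ennreal ((1 - 1 / \<rho>) * A powr \<rho> * m)"
      using m by (intro ennreal_mult[symmetric]) auto
    moreover have "ennreal (1 / \<rho>) * ennreal (mavg (\<lambda>y. F y powr \<rho>) (gcube q) * m)
      = ennreal (1 / \<rho> * (mavg (\<lambda>y. F y powr \<rho>) (gcube q) * m))"
      using \<rho> m by (intro ennreal_mult[symmetric]) auto
    ultimately show ?thesis using \<rho> m by (simp only:) (rule ennreal_plus[symmetric]; simp)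
  qed
  finally have "A powr (\<rho> - 1) * (A * m) \<le> (1 - 1 / \<rho>) * A powr \<rho> * m + 1 / \<rho> * (mavg (\<lambda>y. F y powr \<rho>) (gcube q) * m)"
    using \<rho> m by (subst (asm) ennreal_le_iff) auto
  moreover have "A powr (\<rho> - 1) * (A * m) = A powr \<rho> * m"
    using A by (simp add: powr_diff)
  ultimately have "A powr \<rho> * m \<le> (1 - 1 / \<rho>) * (A powr \<rho> * m) + 1 / \<rho> * (mavg (\<lambda>y. F y powr \<rho>) (gcube q) * m)"
    by (simp only: mult.assoc)
  then have "A powr \<rho> * m / \<rho> \<le> mavg (\<lambda>y. F y powr \<rho>) (gcube q) * m / \<rho>"
    by (simp add: left_diff_distrib)
  then show ?thesis using \<rho> m by (simp add: A_def divide_le_cancel)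
qed

section \<open>The decay weight and averages with a log-Hoelder exponent\<close>

text \<open>The error function that the decay condition at infinity produces. It sits at the edge of
  integrability: not integrable itself, but each of its powers above 1 is, so it can be added to a
  function before the maximal theorem with exponent u > 1 is applied.\<close>

definition lweight :: "real^'n::finite \<Rightarrow> real" where
  "lweight y = (exp 1 + norm y) powr (- real CARD('n))"

lemma exp_1_plus_norm_ge: "2 \<le> exp 1 + norm y"
  using exp_ge_add_one_self[of "1::real"] norm_ge_zero[of y] by linarith

lemma lweight_bounds: "0 < lweight y" "lweight y \<le> 1"
proof -
  have "1 \<le> exp 1 + norm y" using exp_1_plus_norm_ge[of y] by simp
  then show "0 < lweight y" "lweight y \<le> 1"
    unfolding lweight_def by (auto simp: powr_minus inverse_le_1_iff intro!: ge_one_powr_ge_zero)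
qed

lemma lweight_nonneg [simp]: "0 \<le> lweight y"
  using lweight_bounds(1) by (rule less_imp_le)

lemma lweight_measurable [measurable]: "lweight \<in> borel_measurable lebesgue"
proof -
  have "lweight \<in> borel_measurable (lborel :: (real^'n) measure)"
    unfolding lweight_def[abs_def] by measurable
  then show ?thesis by (rule measurable_completion)
qed

text \<open>For \<open>s < lweight y\<close> the left-hand side is at most \<open>s\<close>; otherwise the decay condition bounds
  \<open>s powr (e1 - e2)\<close>.\<close>

lemma powr_exponent_change:
  fixes y :: "real^'n::finite"
  assumes "0 \<le> s" "s \<le> 1" "1 \<le> e1" "1 \<le> e2" "\<bar>e1 - e2\<bar> \<le> L / ln (exp 1 + norm y)"
  shows "s powr e1 \<le> exp (real CARD('n) * L) * s powr e2 + lweight y"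
proof (cases "s < lweight y")
  case True
  have "s powr e1 \<le> s powr 1" using assms by (intro powr_mono') auto
  then have "s powr e1 \<le> lweight y" using assms True by simp
  moreover have "0 \<le> exp (real CARD('n) * L) * s powr e2" by simp
  ultimately show ?thesis by linarith
next
  case False
  define w where "w = exp 1 + norm y"
  have w: "2 \<le> w" unfolding w_def by (rule exp_1_plus_norm_ge)
  have s: "0 < s" "lweight y \<le> s" using False lweight_bounds(1)[of y] by linarith+
  have lnw: "0 < ln w" using w by simp
  have "ln (lweight y) \<le> ln s" using s lweight_bounds(1)[of y] by simp
  moreover have "ln (lweight y) = - real CARD('n) * ln w"
    using w by (simp add: lweight_def w_def[symmetric] ln_powr)
  ultimately have lns: "- ln s \<le> real CARD('n) * ln w" by simp
  have lns0: "ln s \<le> 0" using s assms by simp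
  have "(e1 - e2) * ln s \<le> \<bar>e1 - e2\<bar> * (- ln s)"
  proof -
    have "(e1 - e2) * ln s \<le> \<bar>(e1 - e2) * ln s\<bar>" by (rule abs_ge_self)
    then show ?thesis using lns0 by (simp add: abs_mult)
  qed
  also have "\<dots> \<le> (L / ln w) * (real CARD('n) * ln w)"
    using assms(5) lns lns0 by (intro mult_mono) (auto simp: w_def)
  also have "\<dots> = real CARD('n) * L" using lnw by simp
  finally have "s powr (e1 - e2) \<le> exp (real CARD('n) * L)"
    using s by (simp add: powr_def)
  then have "s powr (e1 - e2) * s powr e2 \<le> exp (real CARD('n) * L) * s powr e2"
    by (rule mult_right_mono) simp
  then have "s powr e1 \<le> exp (real CARD('n) * L) * s powr e2"
    by (simp flip: powr_add)
  then show ?thesis using lweight_bounds(1)[of y] by linarith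
qed

lemma dist_in_gcube:
  fixes x y :: "real^'n::finite"
  assumes "x \<in> gcube q" "y \<in> gcube q"
  shows "norm (x - y) \<le> real CARD('n) * gside (fst q)"
proof -
  define c where "c = (\<chi> i. 2 powr real_of_int (fst q) * real_of_int (snd q i) :: real^'n)"
  have "\<bar>(x - y) $ i\<bar> \<le> gside (fst q)" for i
  proof -
    have "\<bar>x $ i - c $ i\<bar> \<le> gside (fst q) / 2" "\<bar>y $ i - c $ i\<bar> \<le> gside (fst q) / 2"
      using assms unfolding gcube_def cube_def c_def by auto
    then show ?thesis using abs_triangle_ineq4[of "x $ i - c $ i" "y $ i - c $ i"] by simp
  qed
  then have "(\<Sum>i\<in>UNIV. \<bar>(x - y) $ i\<bar>) \<le> real CARD('n) * gside (fst q)"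
    using sum_bounded_above[of "UNIV :: 'n set" "\<lambda>i. \<bar>(x - y) $ i\<bar>" "gside (fst q)"] by simp
  then show ?thesis using norm_le_l1_cart[of "x - y"] by linarith
qed

text \<open>The exponent against which averages over cubes of generation \<open>k\<close> are compared: the local value
  on small cubes and the limit at infinity on large ones.\<close>

definition gexp :: "(real^'n::finite \<Rightarrow> real) \<Rightarrow> real \<Rightarrow> int \<Rightarrow> real^'n \<Rightarrow> real" where
  "gexp r rinf k x = (if real CARD('n) * gside k \<le> 1/2 then r x else rinf)"

lemma add_powr_le:
  fixes a b :: real
  assumes "0 \<le> a" "0 \<le> b" "0 \<le> e" "e \<le> R"
  shows "(a + b) powr e \<le> 2 powr R * (a powr e + b powr e)"
proof -
  have "(a + b) powr e \<le> (2 * max a b) powr e"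
    using assms by (intro powr_mono2) auto
  also have "\<dots> = 2 powr e * (max a b) powr e"
    using assms by (intro powr_mult)
  also have "\<dots> \<le> 2 powr R * (a powr e + b powr e)"
    using assms by (intro mult_mono powr_mono) (auto simp: max_def)
  finally show ?thesis .
qed

text \<open>\<open>F\<close> is split at height 1. The part above 1 has integral at most 1 on the
  cube, so its average is at most 1/|Q|, and local log-Hoelder continuity says that 1/|Q| to the
  power of the oscillation of \<open>r\<close> stays bounded on small cubes. On large cubes that
  average is itself bounded. The part below 1 is compared with the limit exponent, at the price of
  \<open>lweight\<close>.\<close>

lemma log_Hoelder_average_bound:
  fixes r :: "real^'n::finite \<Rightarrow> real"
  assumes r: "r \<in> log_Hoelder" "r \<in> borel_measurable lebesgue" "\<And>x. 1 \<le> r x" "\<And>x. r x \<le> R"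
    and rinf: "(r \<longlongrightarrow> rinf) at_infinity"
  obtains C where "0 < C"
    "\<And>q x F. F \<in> borel_measurable lebesgue \<Longrightarrow> (\<And>y. 0 \<le> F y) \<Longrightarrow>
       (\<integral>\<^sup>+y\<in>gcube q. ennreal (if 1 < F y then F y else 0) \<partial>lebesgue) \<le> 1 \<Longrightarrow>
       (\<integral>\<^sup>+y\<in>gcube q. ennreal (F y powr r y) \<partial>lebesgue) < \<infinity> \<Longrightarrow> x \<in> gcube q \<Longrightarrow>
       mavg F (gcube q) powr gexp r rinf (fst q) x \<le> C * mavg (\<lambda>y. F y powr r y + lweight y) (gcube q)"
proof -
  define n where "n = real CARD('n)"
  have n: "1 \<le> n" by (simp add: n_def Suc_leI)
  obtain L where L: "0 < L" "\<And>x y. norm (x - y) \<le> 1/2 \<Longrightarrow> \<bar>r x - r y\<bar> \<le> - L / ln (norm (x - y))"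
    using r(1) unfolding log_Hoelder_def by blast
  obtain Li where Li: "0 < Li" "\<And>x. \<bar>r x - rinf\<bar> \<le> Li / ln (exp 1 + norm x)"
    using r(1) tendsto_unique[OF trivial_limit_at_infinity rinf] unfolding log_Hoelder_def by blast
  have rinf1: "1 \<le> rinf"
    by (rule tendsto_lowerbound[OF rinf _ trivial_limit_at_infinity]) (simp add: r)
  have rinfR: "rinf \<le> R"
    by (rule tendsto_upperbound[OF rinf _ trivial_limit_at_infinity]) (simp add: r)
  have R: "1 \<le> R" using rinf1 rinfR by simp
  define E where "E = exp (n * Li)"
  define C0 where "C0 = (2 * n) ^ CARD('n)"
  define C1 where "C1 = exp (n * L * (1 + ln n / ln 2))"
  \<comment> \<open>Large cubes use \<open>C0 powr R + E\<close>, small cubes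
    \<open>C1 + E * E + 2 powr n\<close>; the factor \<open>2 powr R\<close> splits the power of a
    sum.\<close>
  define C where "C = 2 powr R * (C0 powr R + C1 + E * E + 2 powr n + E)"
  have E: "1 \<le> E" unfolding E_def using n Li by simp
  have C0: "1 \<le> C0" unfolding C0_def using n by (intro one_le_power) auto
  have C1: "1 \<le> C1" unfolding C1_def using n L by (simp)
  have C0R: "1 \<le> C0 powr R" using C0 R by (intro ge_one_powr_ge_zero) auto
  show thesis
  proof (rule that)
    show "0 < C" unfolding C_def using E C1 C0R by (intro mult_pos_pos add_pos_pos) auto
    fix q :: "int \<times> ('n \<Rightarrow> int)" and x :: "real^'n" and F :: "real^'n \<Rightarrow> real"
    assume Fm[measurable]: "F \<in> borel_measurable lebesgue" and F0: "\<And>y. 0 \<le> F y"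
      and F1: "(\<integral>\<^sup>+y\<in>gcube q. ennreal (if 1 < F y then F y else 0) \<partial>lebesgue) \<le> 1"
      and fin: "(\<integral>\<^sup>+y\<in>gcube q. ennreal (F y powr r y) \<partial>lebesgue) < \<infinity>"
      and x: "x \<in> gcube q"
    note [measurable] = r(2)
    define s where "s = gside (fst q)"
    have s: "0 < s" by (simp add: s_def)
    define Fa where "Fa y = (if 1 < F y then F y else 0)" for y
    define Fb where "Fb y = (if 1 < F y then 0 else F y)" for y
    define G where "G y = F y powr r y + lweight y" for y
    have [measurable]: "Fa \<in> borel_measurable lebesgue" "Fb \<in> borel_measurable lebesgue" "G \<in> borel_measurable lebesgue"
      unfolding Fa_def Fb_def G_def by measurable
    have Fb01: "0 \<le> Fb y" "Fb y \<le> 1" "Fb y \<le> F y" for y using F0 by (auto simp: Fb_def)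
    have Fa0: "0 \<le> Fa y" "Fa y \<le> F y" for y using F0 by (auto simp: Fa_def)
    define a where "a = mavg Fa (gcube q)"
    define b where "b = mavg Fb (gcube q)"
    define g where "g = mavg G (gcube q)"
    have fin_h: "(\<integral>\<^sup>+y\<in>gcube q. ennreal (lweight y) \<partial>lebesgue) < \<infinity>"
    proof -
      have "(\<integral>\<^sup>+y\<in>gcube q. ennreal (lweight y) \<partial>lebesgue) \<le> (\<integral>\<^sup>+y. indicator (gcube q) (y :: real^'n) \<partial>lebesgue)"
        using lweight_bounds(2) by (intro nn_integral_mono) (auto simp: indicator_def)
      also have "\<dots> < \<infinity>" by simp
      finally show ?thesis .
    qed
    have Gfin: "(\<integral>\<^sup>+y\<in>gcube q. ennreal (G y) \<partial>lebesgue) < \<infinity>"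
    proof -
      have "(\<integral>\<^sup>+y\<in>gcube q. ennreal (G y) \<partial>lebesgue) = (\<integral>\<^sup>+y\<in>gcube q. ennreal (F y powr r y) \<partial>lebesgue) + (\<integral>\<^sup>+y\<in>gcube q. ennreal (lweight y) \<partial>lebesgue)"
        unfolding G_def by (subst nn_integral_add[symmetric]) (auto simp: distrib_right)
      then show ?thesis using fin fin_h by (simp add: less_top)
    qed
    have fin_le: "(\<integral>\<^sup>+y\<in>gcube q. ennreal (H y) \<partial>lebesgue) < \<infinity>" if "\<And>y. H y \<le> c * G y" "0 \<le> c" for H c
    proof -
      have "(\<integral>\<^sup>+y\<in>gcube q. ennreal (H y) \<partial>lebesgue) \<le> (\<integral>\<^sup>+y. ennreal c * (ennreal (G y) * indicator (gcube q) y) \<partial>lebesgue)"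
      proof (intro nn_integral_mono)
        fix y
        have "ennreal (H y) \<le> ennreal c * ennreal (G y)"
          using that by (simp add: ennreal_mult'[symmetric] ennreal_leI)
        then show "ennreal (H y) * indicator (gcube q) y \<le> ennreal c * (ennreal (G y) * indicator (gcube q) y)"
          by (auto simp: indicator_def)
      qed
      also have "\<dots> < \<infinity>" using Gfin by (simp add: nn_integral_cmult ennreal_mult_less_top)
      finally show ?thesis .
    qed
    have avg_le: "mavg H (gcube q) \<le> c * g" if "\<And>y. H y \<le> c * G y" "0 \<le> c" for H c
    proof -
      have "mavg H (gcube q) \<le> mavg (\<lambda>y. c * G y) (gcube q)"
        by (intro mavg_mono that fin_le[where c=c]) (use that in auto)
      then show ?thesis using that by (simp add: mavg_cmult g_def)
    qed
    have FrG: "F y powr r y \<le> G y" "lweight y \<le> G y" "0 \<le> G y" for y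
      using lweight_bounds(1)[of y] by (auto simp: G_def)
    have Fa_powr: "Fa y powr \<rho> \<le> 1 * G y" if "\<rho> \<le> r y" for y \<rho>
      using that FrG[of y] by (auto simp: Fa_def intro: order_trans[OF powr_mono])
    have Fb_powr: "Fb y powr rinf \<le> E * G y" for y
    proof -
      have "Fb y powr rinf \<le> E * Fb y powr r y + lweight y"
        unfolding E_def n_def using Fb01[of y] rinf1 r(3)[of y] Li(2)[of y]
        by (intro powr_exponent_change) (auto simp: abs_minus_commute)
      also have "\<dots> \<le> E * F y powr r y + E * lweight y"
        using E Fb01[of y] r(3)[of y] lweight_bounds(1)[of y]
        by (intro add_mono mult_left_mono powr_mono2) (auto simp: mult_le_cancel_right1)
      finally show ?thesis by (simp add: G_def algebra_simps)
    qed
    have Fa1: "Fa y \<le> 1 * G y" for y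
      using Fa_powr[of 1 y] r(3)[of y] Fa0[of y] by simp
    have Fbfin: "(\<integral>\<^sup>+y\<in>gcube q. ennreal (Fb y) \<partial>lebesgue) < \<infinity>"
      by (rule nn_integral_gcube_finite[where u=rinf, OF _ _ rinf1 fin_le[where c=E]])
         (use Fb_powr Fb01 E in auto)
    have Fafin: "(\<integral>\<^sup>+y\<in>gcube q. ennreal (Fa y) \<partial>lebesgue) < \<infinity>"
      using Fa1 by (rule fin_le) simp
    have split: "mavg F (gcube q) = a + b"
    proof -
      have "F = (\<lambda>y. Fa y + Fb y)" by (auto simp: Fa_def Fb_def)
      then show ?thesis unfolding a_def b_def
        using mavg_gcube_add_le[of Fa Fb q] Fa0 Fb01 Fafin Fbfin by simp
    qed
    have ab0: "0 \<le> a" "0 \<le> b" "0 \<le> g" by (simp_all add: a_def b_def g_def)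
    have b1: "b \<le> 1" unfolding b_def by (rule mavg_gcube_le_const) (use Fb01 in auto)
    have b_inf: "b powr rinf \<le> E * g"
    proof -
      have "b powr rinf \<le> mavg (\<lambda>y. Fb y powr rinf) (gcube q)"
        unfolding b_def
      proof (rule mavg_gcube_powr_le[OF _ Fb01(1) rinf1])
        show "(\<integral>\<^sup>+y\<in>gcube q. ennreal (Fb y powr rinf) \<partial>lebesgue) < \<infinity>"
          by (rule fin_le[OF Fb_powr]) (use E in linarith)
      qed measurable
      also have "\<dots> \<le> E * g" by (rule avg_le[OF Fb_powr]) (use E in linarith)
      finally show ?thesis .
    qed
    have a_le: "a * s ^ CARD('n) \<le> 1"
    proof -
      have "ennreal (a * s ^ CARD('n)) = (\<integral>\<^sup>+y\<in>gcube q. ennreal (Fa y) \<partial>lebesgue)"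
        unfolding a_def s_def using s by (subst mavg_gcube[OF Fafin, symmetric]) (simp add: ennreal_mult)
      also have "\<dots> \<le> ennreal 1" using F1 by (simp add: Fa_def)
      finally show ?thesis by (subst (asm) ennreal_le_iff) auto
    qed
    have ag: "a \<le> g" using avg_le[of Fa 1] Fa1 by (simp add: a_def)
    show "mavg F (gcube q) powr gexp r rinf (fst q) x \<le> C * mavg (\<lambda>y. F y powr r y + lweight y) (gcube q)"
    proof (cases "n * s \<le> 1/2")
      case False
      \<comment> \<open>A large cube has side at least 1 / (2 n), so |Q| is bounded below and the
        average \<open>a\<close> above. Once a / C0 \<le> 1, raising to \<open>rinf\<close> is no
        worse than raising to 1.\<close>
      have a_C0: "a \<le> C0"
      proof -
        have "1 \<le> (2 * n * s) ^ CARD('n)" using False by (intro one_le_power) auto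
        then have "1 \<le> C0 * s ^ CARD('n)" by (simp add: C0_def power_mult_distrib)
        then have "a * s ^ CARD('n) \<le> C0 * s ^ CARD('n)" using a_le by linarith
        then show ?thesis using s by simp
      qed
      have "a powr rinf = C0 powr rinf * (a / C0) powr rinf"
        using C0 ab0 by (simp add: powr_divide)
      also have "\<dots> \<le> C0 powr R * (a / C0) powr 1"
        using C0 ab0 a_C0 rinf1 rinfR by (intro mult_mono powr_mono powr_mono') auto
      also have "\<dots> \<le> C0 powr R * g"
      proof -
        have "a / C0 \<le> a" using C0 ab0 by (simp add: divide_le_eq mult_le_cancel_left1)
        then show ?thesis using C0 ab0 ag by (intro mult_left_mono) auto
      qed
      finally have a_inf: "a powr rinf \<le> C0 powr R * g" .
      have "(a + b) powr rinf \<le> 2 powr R * (a powr rinf + b powr rinf)"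
        using ab0 rinf1 rinfR by (intro add_powr_le) auto
      also have "\<dots> \<le> 2 powr R * (C0 powr R * g + E * g)"
        using a_inf b_inf by (intro mult_left_mono add_mono) auto
      also have "\<dots> = 2 powr R * (C0 powr R + E) * g" by (simp add: algebra_simps)
      also have "\<dots> \<le> C * g"
        unfolding C_def using C1 E ab0 by (intro mult_right_mono mult_left_mono) auto
      finally show ?thesis
        using False by (simp add: split gexp_def n_def s_def g_def G_def[abs_def])
    next
      case True
      \<comment> \<open>On a small cube \<delta> bounds the oscillation of \<open>r\<close>, the
        diameter being at most n * s. Hence \<rho> is a constant exponent below \<open>r\<close>
        throughout the cube and within \<delta> of \<open>r x\<close>; the maximum with 1 keeps
        Jensen's inequality available.\<close>
      define \<delta> where "\<delta> = L / (- ln (n * s))"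
      define \<rho> where "\<rho> = max 1 (r x - \<delta>)"
      have ns: "0 < n * s" "n * s \<le> 1/2" using n s True by auto
      have lnns: "ln 2 \<le> - ln (n * s)"
        using ns ln_le_cancel_iff[of "n * s" "1/2"] by (simp add: ln_div)
      have lnns0: "0 < - ln (n * s)" using lnns by (rule less_le_trans[rotated]) simp
      have \<delta>: "0 \<le> \<delta>" unfolding \<delta>_def using L lnns0 by (intro divide_nonneg_pos) auto
      have rxy: "\<bar>r x - r y\<bar> \<le> \<delta>" if y: "y \<in> gcube q" for y
      proof (cases "x = y")
        case False
        have d: "0 < norm (x - y)" "norm (x - y) \<le> n * s"
          using False dist_in_gcube[OF x y] by (auto simp: n_def s_def)
        then have "ln (norm (x - y)) \<le> ln (n * s)" using ns by simp
        then have "L / (- ln (norm (x - y))) \<le> \<delta>"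
          unfolding \<delta>_def using L lnns0 by (intro divide_left_mono mult_pos_pos) auto
        moreover have "\<bar>r x - r y\<bar> \<le> - L / ln (norm (x - y))" using d ns by (intro L(2)) auto
        ultimately show ?thesis by simp
      qed (use \<delta> in simp)
      have \<rho>y: "\<rho> \<le> r y" if "y \<in> gcube q" for y
        using rxy[OF that] r(3)[of y] by (auto simp: \<rho>_def)
      have \<rho>x: "\<rho> \<le> r x" "r x - \<rho> \<le> \<delta>" "1 \<le> \<rho>" using \<rho>y[OF x] by (auto simp: \<rho>_def)
      have a_rho: "a powr \<rho> \<le> g"
      proof -
        \<comment> \<open>\<open>\<rho> \<le> r y\<close> is known only inside the cube, while
          \<open>fin_le\<close> and \<open>avg_le\<close> ask for a bound at every point; cutting
          \<open>Fa\<close> off outside the cube reconciles the two.\<close>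
        define Fc where "Fc y = (if y \<in> gcube q then Fa y else 0)" for y
        have "Fc = (\<lambda>y. indicator (gcube q) y * Fa y)"
          by (auto simp: Fc_def indicator_def)
        then have [measurable]: "Fc \<in> borel_measurable lebesgue" by simp
        have Fc: "Fc y powr \<rho> \<le> 1 * G y" for y
          using Fa_powr[of \<rho> y] \<rho>y[of y] FrG(3)[of y] by (auto simp: Fc_def)
        have "a = mavg Fc (gcube q)"
          unfolding a_def mavg_def
          by (intro arg_cong2[where f="(/)"] arg_cong[where f=enn2real] nn_integral_cong)
             (auto simp: Fc_def indicator_def)
        also have "\<dots> powr \<rho> \<le> mavg (\<lambda>y. Fc y powr \<rho>) (gcube q)"
        proof (rule mavg_gcube_powr_le[OF _ _ \<rho>x(3)])
          show "(\<integral>\<^sup>+y\<in>gcube q. ennreal (Fc y powr \<rho>) \<partial>lebesgue) < \<infinity>"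
            by (rule fin_le[OF Fc]) simp
          show "0 \<le> Fc y" for y by (simp add: Fc_def Fa0)
        qed measurable
        also have "\<dots> \<le> 1 * g" by (rule avg_le[OF Fc]) simp
        finally show ?thesis by simp
      qed
      have a_x: "a powr r x \<le> C1 * g"
      proof (cases "a \<le> 1")
        case True
        then have "a powr r x \<le> a powr \<rho>" using ab0 \<rho>x by (intro powr_mono') auto
        also have "\<dots> \<le> 1 * g" using a_rho by simp
        also have "\<dots> \<le> C1 * g" using C1 ab0 by (intro mult_right_mono) auto
        finally show ?thesis .
      next
        case False
        \<comment> \<open>Heart of the local estimate: ln a is at most n times ln (1/s), whereas the
          exponent gap is at most L / ln (1/(n s)), so their product is bounded independently of the
          cube.\<close>
        have "ln a + n * ln s \<le> 0"
        proof -
          have "ln (a * s ^ CARD('n)) \<le> 0" using a_le False s by simp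
          then show ?thesis using False s by (simp add: ln_mult ln_realpow n_def)
        qed
        then have "ln a \<le> n * (- ln s)" by simp
        also have "- ln s = - ln (n * s) + ln n" using n s by (simp add: ln_mult)
        finally have lna: "ln a \<le> n * (- ln (n * s) + ln n)" .
        have lnn: "0 \<le> ln n" using n by simp
        have "(r x - \<rho>) * ln a \<le> \<delta> * (n * (- ln (n * s) + ln n))"
          using \<rho>x \<delta> False lna by (intro mult_mono) auto
        also have "\<dots> = n * L * (1 + ln n / (- ln (n * s)))"
          unfolding \<delta>_def using lnns0 by (simp add: field_simps)
        also have "\<dots> \<le> n * L * (1 + ln n / ln 2)"
        proof -
          have "0 < - ln (n * s) * ln 2" using lnns0 by (intro mult_pos_pos) auto
          then have "ln n / (- ln (n * s)) \<le> ln n / ln 2"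
            using lnns lnn by (intro divide_left_mono) auto
          then show ?thesis using n L by (intro mult_left_mono add_left_mono) auto
        qed
        finally have "a powr (r x - \<rho>) \<le> C1"
          using False by (simp add: powr_def C1_def)
        then have "a powr (r x - \<rho>) * a powr \<rho> \<le> C1 * g"
          using a_rho C1 by (intro mult_mono) auto
        then show ?thesis by (simp flip: powr_add)
      qed
      have hx: "lweight x \<le> 2 powr n * g"
      proof -
        have "lweight x \<le> 2 powr n * lweight y" if y: "y \<in> gcube q" for y
        proof -
          have "norm (x - y) \<le> n * s" using dist_in_gcube[OF x y] by (simp add: n_def s_def)
          then have "norm y \<le> norm x + 1/2" using ns norm_triangle_sub[of y x] by (simp add: norm_minus_commute)
          then have "exp 1 + norm y \<le> 2 * (exp 1 + norm x)"
          proof -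
            have "1 / 2 \<le> exp (1::real)" using one_le_exp_iff[of "1::real"] by linarith
            then have "exp 1 + norm y \<le> exp 1 + (norm x + exp 1)"
              using \<open>norm y \<le> norm x + 1/2\<close> by linarith
            also have "\<dots> \<le> exp 1 + (norm x + exp 1) + norm x" by simp
            also have "\<dots> = 2 * (exp 1 + norm x)" by simp
            finally show ?thesis .
          qed
          then have "(2 * (exp 1 + norm x)) powr (- n) \<le> (exp 1 + norm y) powr (- n)"
            using exp_1_plus_norm_ge[of y] n by (intro powr_mono2') auto
          then have "2 powr (- n) * lweight x \<le> lweight y"
            using exp_1_plus_norm_ge[of x]
            by (subst (asm) powr_mult) (simp_all add: lweight_def n_def[symmetric])
          then have "2 powr n * (2 powr (- n) * lweight x) \<le> 2 powr n * lweight y"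
            by (intro mult_left_mono) auto
          then show ?thesis by (simp add: mult.assoc[symmetric] flip: powr_add)
        qed
        then have "lweight x \<le> 2 powr n * G y" if "y \<in> gcube q" for y
          using that FrG(2)[of y] by (meson mult_left_mono order_trans powr_ge_zero)
        then have "lweight x / 2 powr n \<le> G y" if "y \<in> gcube q" for y
          using that by (simp add: divide_le_eq mult.commute)
        then have "lweight x / 2 powr n \<le> g" unfolding g_def by (intro mavg_gcube_ge_const Gfin) auto
        then show ?thesis by (simp add: divide_le_eq mult.commute)
      qed
      \<comment> \<open>The exponent of the small part has now been changed twice, from
        \<open>r y\<close> to \<open>rinf\<close> inside the average and here from
        \<open>rinf\<close> to \<open>r x\<close> outside it. Each change costs a factor
        \<open>E\<close> and a weight; on a small cube the weight at x is comparable to its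
        average.\<close>
      have b_x: "b powr r x \<le> E * E * g + 2 powr n * g"
      proof -
        have "b powr r x \<le> E * b powr rinf + lweight x"
          unfolding E_def n_def using ab0 b1 rinf1 r(3)[of x] Li(2)[of x]
          by (intro powr_exponent_change) auto
        also have "\<dots> \<le> E * (E * g) + 2 powr n * g"
          using b_inf E hx by (intro add_mono mult_left_mono) auto
        finally show ?thesis by simp
      qed
      have "(a + b) powr r x \<le> 2 powr R * (a powr r x + b powr r x)"
        using ab0 r(3)[of x] r(4)[of x] by (intro add_powr_le) auto
      also have "\<dots> \<le> 2 powr R * (C1 * g + (E * E * g + 2 powr n * g))"
        using a_x b_x by (intro mult_left_mono add_mono) auto
      also have "\<dots> = 2 powr R * (C1 + E * E + 2 powr n) * g" by (simp add: algebra_simps)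
      also have "\<dots> \<le> C * g"
        unfolding C_def using C0R E ab0 by (intro mult_right_mono mult_left_mono) auto
      finally show ?thesis
        using True by (simp add: split gexp_def n_def s_def g_def G_def[abs_def])
    qed
  qed
qed


text \<open>A Lipschitz map multiplies both moduli by its constant. The Lipschitz bound is asked for
  only on a closed interval containing the values, which then contains the limit as well; this
  admits maps such as the passage to a conjugate exponent.\<close>

lemma log_Hoelder_compose:
  fixes r :: "real^'n::finite \<Rightarrow> real" and \<phi> :: "real \<Rightarrow> real"
  assumes r: "r \<in> log_Hoelder" "(r \<longlongrightarrow> rinf) at_infinity" "\<And>x. r x \<in> {a..b}" and "0 < B"
    and \<phi>: "\<And>v w. v \<in> {a..b} \<Longrightarrow> w \<in> {a..b} \<Longrightarrow> \<bar>\<phi> v - \<phi> w\<bar> \<le> B * \<bar>v - w\<bar>"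
  shows "(\<lambda>x. \<phi> (r x)) \<in> log_Hoelder" "((\<lambda>x. \<phi> (r x)) \<longlongrightarrow> \<phi> rinf) at_infinity" "rinf \<in> {a..b}"
proof -
  show rinf: "rinf \<in> {a..b}"
    using tendsto_lowerbound[OF r(2) _ trivial_limit_at_infinity, of a] r(3)
      tendsto_upperbound[OF r(2) _ trivial_limit_at_infinity, of b] by simp
  have bnd: "\<bar>\<phi> (r x) - \<phi> rinf\<bar> \<le> B * \<bar>r x - rinf\<bar>" for x
    using \<phi> rinf r(3) by blast
  show lim: "((\<lambda>x. \<phi> (r x)) \<longlongrightarrow> \<phi> rinf) at_infinity"
  proof (subst Lim_null, rule Lim_null_comparison)
    show "\<forall>\<^sub>F x in at_infinity. norm (\<phi> (r x) - \<phi> rinf) \<le> B * \<bar>r x - rinf\<bar>"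
      using bnd by simp
    have "((\<lambda>x. B * \<bar>r x - rinf\<bar>) \<longlongrightarrow> B * \<bar>rinf - rinf\<bar>) at_infinity"
      by (intro tendsto_intros r)
    then show "((\<lambda>x. B * \<bar>r x - rinf\<bar>) \<longlongrightarrow> 0) at_infinity" by simp
  qed
  obtain L where L: "0 < L" "\<And>x y. norm (x - y) \<le> 1/2 \<Longrightarrow> \<bar>r x - r y\<bar> \<le> - L / ln (norm (x - y))"
    using r(1) unfolding log_Hoelder_def by blast
  obtain Li where Li: "0 < Li" "\<And>x. \<bar>r x - rinf\<bar> \<le> Li / ln (exp 1 + norm x)"
    using r(1) tendsto_unique[OF trivial_limit_at_infinity r(2)] unfolding log_Hoelder_def by blast
  show "(\<lambda>x. \<phi> (r x)) \<in> log_Hoelder"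
    unfolding log_Hoelder_def
  proof (intro CollectI conjI)
    show "\<exists>C>0. \<forall>x y. norm (x - y) \<le> 1/2 \<longrightarrow> \<bar>\<phi> (r x) - \<phi> (r y)\<bar> \<le> - C / ln (norm (x - y))"
    proof (intro exI[of _ "B * L"] conjI allI impI)
    show "0 < B * L" using L(1) \<open>0 < B\<close> by auto
    fix x y :: "real^'n" assume "norm (x - y) \<le> 1/2"
    then have "B * \<bar>r x - r y\<bar> \<le> B * (- L / ln (norm (x - y)))"
      using L(2) \<open>0 < B\<close> by (intro mult_left_mono) auto
    then show "\<bar>\<phi> (r x) - \<phi> (r y)\<bar> \<le> - (B * L) / ln (norm (x - y))"
      using \<phi>[OF r(3) r(3), of x y] by simp
    qed
    show "\<exists>q_inf. ((\<lambda>x. \<phi> (r x)) \<longlongrightarrow> q_inf) at_infinity \<and>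
        (\<exists>C_inf>0. \<forall>x. \<bar>\<phi> (r x) - q_inf\<bar> \<le> C_inf / ln (exp 1 + norm x))"
    proof (rule exI[of _ "\<phi> rinf"], intro conjI lim exI[of _ "B * Li"] allI)
    show "0 < B * Li" using Li(1) \<open>0 < B\<close> by auto
    fix x
    have "B * \<bar>r x - rinf\<bar> \<le> B * (Li / ln (exp 1 + norm x))"
      using Li(2) \<open>0 < B\<close> by (intro mult_left_mono) auto
    then show "\<bar>\<phi> (r x) - \<phi> rinf\<bar> \<le> B * Li / ln (exp 1 + norm x)"
      using bnd[of x] by simp
    qed
  qed
qed

text \<open>Dyadic shells: where exp 1 + |y| is about 2 powr k the weight is about 2 powr (- n k),
  on a set of measure at most a multiple of 2 powr (n k). The sum over k \<ge> 0 is geometric with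
  ratio 2 powr (- n (u - 1)).\<close>

lemma lweight_powr_integrable:
  assumes "1 < u"
  shows "(\<integral>\<^sup>+y. ennreal (lweight (y :: real^'n::finite) powr u) \<partial>lebesgue) < \<infinity>"
proof -
  define n where "n = real CARD('n)"
  have n: "1 \<le> n" by (simp add: n_def Suc_leI)
  have "0 < n * (u - 1)" using n assms by simp
  then obtain C0 where C0: "0 \<le> C0"
    "\<And>c. (\<integral>\<^sup>+k. ennreal (2 powr (- (n * (u - 1)) * \<bar>real_of_int k + c\<bar>)) \<partial>count_space UNIV) \<le> ennreal C0"
    using int_geometric_sum_bound by metis
  define c where "c k = ennreal (indicator {0..} k * 2 powr (- n * u * (real_of_int k - 1)))" for k :: int
  define A where "A k = (cube 0 (2 * 2 powr real_of_int k) :: (real^'n) set)" for k :: int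
  have pt: "ennreal (lweight y powr u) \<le> (\<integral>\<^sup>+k. c k * indicator (A k) y \<partial>count_space UNIV)" for y :: "real^'n"
  proof -
    define w where "w = exp 1 + norm y"
    have w: "2 \<le> w" unfolding w_def by (rule exp_1_plus_norm_ge)
    define k where "k = \<lceil>log 2 w\<rceil>"
    have k: "real_of_int k - 1 < log 2 w" "log 2 w \<le> real_of_int k" unfolding k_def by linarith+
    have k0: "0 \<le> k" using k(2) w by (smt (verit) le_log_iff of_int_less_0_iff zero_le_log_cancel_iff)
    have wk: "w \<le> 2 powr real_of_int k" "2 powr (real_of_int k - 1) \<le> w"
      using k w by (auto simp: log_le_iff less_log_iff less_imp_le)
    have "lweight y powr u = w powr (- (n * u))"
      by (simp add: lweight_def w_def n_def powr_powr)
    also have "\<dots> \<le> (2 powr (real_of_int k - 1)) powr (- (n * u))"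
      using wk n assms by (intro powr_mono2') auto
    also have "\<dots> = 2 powr (- n * u * (real_of_int k - 1))" by (simp add: powr_powr mult_ac)
    finally have 1: "ennreal (lweight y powr u) \<le> c k"
      using k0 by (simp add: c_def ennreal_leI)
    have "norm y \<le> 2 powr real_of_int k"
      using wk(1) exp_gt_zero[of "1::real"] unfolding w_def by linarith
    then have "y \<in> A k"
      using cball_subset_cube[of 0 "2 powr real_of_int k"] by (auto simp: A_def)
    then have "ennreal (lweight y powr u) \<le> c k * indicator (A k) y" using 1 by simp
    also have "\<dots> \<le> (\<integral>\<^sup>+k. c k * indicator (A k) y \<partial>count_space UNIV)"
      by (rule nn_integral_ge_point) simp
    finally show ?thesis .
  qed
  have [measurable]: "A k \<in> sets lebesgue" for k by (simp add: A_def)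
  have "(\<integral>\<^sup>+y. ennreal (lweight (y :: real^'n) powr u) \<partial>lebesgue)
     \<le> (\<integral>\<^sup>+y. \<integral>\<^sup>+k. c k * indicator (A k) y \<partial>count_space UNIV \<partial>lebesgue)"
    by (intro nn_integral_mono pt)
  also have "\<dots> = (\<integral>\<^sup>+k. c k * emeasure lebesgue (A k) \<partial>count_space UNIV)"
    by (subst nn_integral_count_space_nn_integral) (auto simp: nn_integral_cmult)
  also have "\<dots> \<le> (\<integral>\<^sup>+k. ennreal (2 powr (n * u + n)) * ennreal (2 powr (- (n * (u - 1)) * \<bar>real_of_int k + 0\<bar>)) \<partial>count_space UNIV)"
  proof (intro nn_integral_mono)
    fix k :: int
    show "c k * emeasure lebesgue (A k) \<le> ennreal (2 powr (n * u + n)) * ennreal (2 powr (- (n * (u - 1)) * \<bar>real_of_int k + 0\<bar>))"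
    proof (cases "0 \<le> k")
      case True
      have "(2 * 2 powr real_of_int k) ^ CARD('n) = (2 powr (real_of_int k + 1)) powr n"
        by (simp add: n_def powr_realpow powr_add mult.commute)
      also have "\<dots> = 2 powr (n * (real_of_int k + 1))" by (simp add: powr_powr mult.commute)
      finally have e: "emeasure lebesgue (A k) = ennreal (2 powr (n * (real_of_int k + 1)))"
        unfolding A_def by (subst emeasure_cube_lebesgue) auto
      have "c k * emeasure lebesgue (A k) = ennreal (2 powr (- n * u * (real_of_int k - 1)) * 2 powr (n * (real_of_int k + 1)))"
        unfolding e c_def using True by (simp add: ennreal_mult)
      also have "2 powr (- n * u * (real_of_int k - 1)) * 2 powr (n * (real_of_int k + 1)) = 2 powr (n * u + n) * 2 powr (- (n * (u - 1)) * \<bar>real_of_int k + 0\<bar>)"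
        using True by (simp add: powr_add[symmetric] algebra_simps)
      finally show ?thesis by (simp add: ennreal_mult)
    qed (simp add: c_def)
  qed
  also have "\<dots> = ennreal (2 powr (n * u + n)) * (\<integral>\<^sup>+k. ennreal (2 powr (- (n * (u - 1)) * \<bar>real_of_int k + 0\<bar>)) \<partial>count_space UNIV)"
    by (simp add: nn_integral_cmult)
  also have "\<dots> \<le> ennreal (2 powr (n * u + n)) * ennreal C0"
    by (intro mult_left_mono C0) auto
  also have "\<dots> < \<infinity>" by (simp add: ennreal_mult_less_top)
  finally show ?thesis .
qed

section \<open>From averages with variable exponents to maximal functions with constant
  exponents\<close>

text \<open>The number \<open>a q\<close> carries the two bounds that Hedberg's splitting plays
  against each other: the maximal bound by \<open>W\<close> at every point of the cube, and the
  trivial bound by a multiple of 1/|Q|. Only the final exponent 1 / \<open>gexp\<close> still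
  depends on the point.\<close>

lemma averages_transfer:
  fixes r0 :: "real^'n::finite \<Rightarrow> real"
  assumes r0: "r0 \<in> log_Hoelder" "r0 \<in> borel_measurable lebesgue" "\<And>x. r0 x \<in> {rm..rM}"
    and lim: "(r0 \<longlongrightarrow> rinf) at_infinity" and t: "1 < t" "t < rm"
  obtains C where "1 \<le> C"
    "\<And>f. f \<in> borel_measurable lebesgue \<Longrightarrow> (\<And>y. 0 \<le> f y) \<Longrightarrow>
       (\<integral>\<^sup>+y. ennreal (f y powr r0 y) \<partial>lebesgue) \<le> 1 \<Longrightarrow>
       \<exists>W a. W \<in> borel_measurable lebesgue \<and> (\<integral>\<^sup>+x. W x \<partial>lebesgue) \<le> ennreal C \<and>
         (\<forall>q. 0 \<le> a q \<and> a q * gside (fst q) ^ CARD('n) \<le> C) \<and>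
         (\<forall>q. \<forall>x\<in>gcube q. ennreal (a q) \<le> W x \<and>
            mavg (\<lambda>y. f y powr t) (gcube q) powr (1 / t) \<le> a q powr (1 / gexp r0 rinf (fst q) x))"
proof -
  define u where "u = rm / t"
  have u: "1 < u" using t by (simp add: u_def)
  have rm: "1 < rm" using t by simp
  note [measurable] = r0(2)
  \<comment> \<open>With F = f powr t one has (F powr r) powr u = f powr r0. So the exponent
    \<open>r\<close>, at least 1, goes into the comparison of averages, and the remaining power u >
    1 is left for the strong maximal inequality applied to \<Phi>, which lies in L^u.\<close>
  define r where "r x = r0 x / rm" for x
  have rmM: "rm \<le> rM" using r0(3) by force
  have r_bnd: "1 \<le> r x" "r x \<le> rM / rm" for x
    using r0(3)[of x] rm by (auto simp: r_def divide_right_mono)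
  have r_log: "r \<in> log_Hoelder" "(r \<longlongrightarrow> rinf / rm) at_infinity" and rinf: "rinf \<in> {rm..rM}"
    using log_Hoelder_compose[OF r0(1) lim r0(3), of "1 / rm" "\<lambda>v. v / rm"] rm
    by (auto simp: r_def[abs_def] diff_divide_distrib[symmetric])
  have [measurable]: "r \<in> borel_measurable lebesgue" unfolding r_def[abs_def] by measurable
  obtain C1 where C1: "0 < C1"
    "\<And>q x F. F \<in> borel_measurable lebesgue \<Longrightarrow> (\<And>y. 0 \<le> F y) \<Longrightarrow>
       (\<integral>\<^sup>+y\<in>gcube q. ennreal (if 1 < F y then F y else 0) \<partial>lebesgue) \<le> 1 \<Longrightarrow>
       (\<integral>\<^sup>+y\<in>gcube q. ennreal (F y powr r y) \<partial>lebesgue) < \<infinity> \<Longrightarrow> x \<in> gcube q \<Longrightarrow>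
       mavg F (gcube q) powr gexp r (rinf / rm) (fst q) x \<le> C1 * mavg (\<lambda>y. F y powr r y + lweight y) (gcube q)"
    using log_Hoelder_average_bound[OF r_log(1) \<open>r \<in> borel_measurable lebesgue\<close> r_bnd r_log(2)] by blast
  obtain C2 where C2: "0 \<le> C2"
    "\<And>\<Phi> :: real^'n \<Rightarrow> real. \<Phi> \<in> borel_measurable lebesgue \<Longrightarrow> (\<And>y. 0 \<le> \<Phi> y) \<Longrightarrow>
       (\<integral>\<^sup>+y. ennreal (\<Phi> y powr u) \<partial>lebesgue) < \<infinity> \<Longrightarrow>
       \<exists>W \<in> borel_measurable lebesgue.
         (\<forall>q. \<forall>x\<in>gcube q. ennreal (mavg \<Phi> (gcube q) powr u) \<le> W x) \<and>
         (\<integral>\<^sup>+x. W x \<partial>lebesgue) \<le> ennreal C2 * (\<integral>\<^sup>+y. ennreal (\<Phi> y powr u) \<partial>lebesgue)"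
    using strong_maximal[OF u, where 'n='n] by blast
  define H where "H = enn2real (\<integral>\<^sup>+y. ennreal (lweight (y :: real^'n) powr u) \<partial>lebesgue)"
  have H: "0 \<le> H" "(\<integral>\<^sup>+y. ennreal (lweight (y :: real^'n) powr u) \<partial>lebesgue) = ennreal H"
    using lweight_powr_integrable[OF u, where 'n='n] by (auto simp: H_def less_top)
  define I where "I = 2 powr u * (1 + H)"
  have I: "0 \<le> I" using H by (simp add: I_def)
  define C where "C = C1 powr u * (C2 + 1) * I + 1"
  have C: "1 \<le> C" "C1 powr u * C2 * I \<le> C" "C1 powr u * I \<le> C"
    using C2(1) I by (simp_all add: C_def algebra_simps)
  show thesis
  proof (rule that[OF C(1)])
    fix f :: "real^'n \<Rightarrow> real"
    assume [measurable]: "f \<in> borel_measurable lebesgue" and f0: "\<And>y. 0 \<le> f y"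
      and fI: "(\<integral>\<^sup>+y. ennreal (f y powr r0 y) \<partial>lebesgue) \<le> 1"
    define F where "F y = f y powr t" for y
    define \<Phi> where "\<Phi> y = F y powr r y + lweight y" for y
    have F0: "0 \<le> F y" for y by (simp add: F_def)
    have \<Phi>0: "0 \<le> \<Phi> y" for y by (simp add: \<Phi>_def)
    have [measurable]: "F \<in> borel_measurable lebesgue" unfolding F_def[abs_def] by measurable
    have [measurable]: "\<Phi> \<in> borel_measurable lebesgue" unfolding \<Phi>_def[abs_def] by measurable
    have Fru: "(F y powr r y) powr u = f y powr r0 y" for y
      using rm t by (simp add: F_def r_def u_def powr_powr)
    have \<Phi>I: "(\<integral>\<^sup>+y. ennreal (\<Phi> y powr u) \<partial>lebesgue) \<le> ennreal I"
    proof -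
      have "(\<integral>\<^sup>+y. ennreal (\<Phi> y powr u) \<partial>lebesgue) \<le> (\<integral>\<^sup>+y. ennreal (2 powr u) * (ennreal (f y powr r0 y) + ennreal (lweight y powr u)) \<partial>lebesgue)"
      proof (intro nn_integral_mono)
        fix y
        have "\<Phi> y powr u \<le> 2 powr u * (f y powr r0 y + lweight y powr u)"
          unfolding \<Phi>_def using add_powr_le[of "F y powr r y" "lweight y" u u] u by (simp add: Fru)
        then show "ennreal (\<Phi> y powr u) \<le> ennreal (2 powr u) * (ennreal (f y powr r0 y) + ennreal (lweight y powr u))"
          by (metis ennreal_leI ennreal_mult ennreal_plus powr_ge_zero add_nonneg_nonneg)
      qed
      also have "\<dots> = ennreal (2 powr u) * ((\<integral>\<^sup>+y. ennreal (f y powr r0 y) \<partial>lebesgue) + ennreal H)"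
        by (simp add: nn_integral_cmult nn_integral_add H)
      also have "\<dots> \<le> ennreal (2 powr u) * (1 + ennreal H)"
        by (intro mult_left_mono add_right_mono fI) auto
      also have "\<dots> = ennreal I"
        unfolding I_def using H(1) by (simp add: ennreal_mult)
      finally show ?thesis .
    qed
    then have \<Phi>fin: "(\<integral>\<^sup>+y. ennreal (\<Phi> y powr u) \<partial>lebesgue) < \<infinity>"
      by (rule le_less_trans) simp
    then obtain W where W: "W \<in> borel_measurable lebesgue"
      "\<And>q x. x \<in> gcube q \<Longrightarrow> ennreal (mavg \<Phi> (gcube q) powr u) \<le> W x"
      "(\<integral>\<^sup>+x. W x \<partial>lebesgue) \<le> ennreal C2 * (\<integral>\<^sup>+y. ennreal (\<Phi> y powr u) \<partial>lebesgue)"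
      using C2(2)[of \<Phi>] \<Phi>0 by auto
    define a where "a q = (C1 * mavg \<Phi> (gcube q)) powr u" for q
    have a_eq: "a q = C1 powr u * mavg \<Phi> (gcube q) powr u" for q
      using C1(1) by (simp add: a_def powr_mult)
    show "\<exists>W a. W \<in> borel_measurable lebesgue \<and> (\<integral>\<^sup>+x. W x \<partial>lebesgue) \<le> ennreal C \<and>
         (\<forall>q. 0 \<le> a q \<and> a q * gside (fst q) ^ CARD('n) \<le> C) \<and>
         (\<forall>q. \<forall>x\<in>gcube q. ennreal (a q) \<le> W x \<and>
            mavg (\<lambda>y. f y powr t) (gcube q) powr (1 / t) \<le> a q powr (1 / gexp r0 rinf (fst q) x))"
    proof (intro exI[of _ "\<lambda>x. ennreal (C1 powr u) * W x"] exI[of _ a] conjI allI ballI)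
      show "(\<lambda>x. ennreal (C1 powr u) * W x) \<in> borel_measurable lebesgue" using W(1) by measurable
      have "(\<integral>\<^sup>+x. ennreal (C1 powr u) * W x \<partial>lebesgue) = ennreal (C1 powr u) * (\<integral>\<^sup>+x. W x \<partial>lebesgue)"
        using W(1) by (rule nn_integral_cmult)
      also have "\<dots> \<le> ennreal (C1 powr u) * (ennreal C2 * ennreal I)"
        by (intro mult_left_mono order_trans[OF W(3)] \<Phi>I) auto
      also have "\<dots> = ennreal (C1 powr u * C2 * I)"
        using C2(1) I by (simp add: ennreal_mult mult.assoc)
      also have "\<dots> \<le> ennreal C" using C by (intro ennreal_leI)
      finally show "(\<integral>\<^sup>+x. ennreal (C1 powr u) * W x \<partial>lebesgue) \<le> ennreal C" .
    next
      fix q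
      show "0 \<le> a q" by (simp add: a_def)
      have finQ: "(\<integral>\<^sup>+y\<in>gcube q. ennreal (\<Phi> y powr u) \<partial>lebesgue) \<le> (\<integral>\<^sup>+y. ennreal (\<Phi> y powr u) \<partial>lebesgue)"
        by (intro nn_integral_mono) (auto simp: indicator_def)
      then have finQ': "(\<integral>\<^sup>+y\<in>gcube q. ennreal (\<Phi> y powr u) \<partial>lebesgue) < \<infinity>"
        using \<Phi>fin by (rule le_less_trans)
      have "mavg \<Phi> (gcube q) powr u \<le> mavg (\<lambda>y. \<Phi> y powr u) (gcube q)"
        using \<Phi>0 u finQ' by (intro mavg_gcube_powr_le) auto
      moreover have "mavg (\<lambda>y. \<Phi> y powr u) (gcube q) * gside (fst q) ^ CARD('n) \<le> I"
      proof -
        have "ennreal (mavg (\<lambda>y. \<Phi> y powr u) (gcube q) * gside (fst q) ^ CARD('n)) = (\<integral>\<^sup>+y\<in>gcube q. ennreal (\<Phi> y powr u) \<partial>lebesgue)"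
          by (subst mavg_gcube[OF finQ', symmetric]) (simp add: ennreal_mult)
        also have "\<dots> \<le> ennreal I" using finQ \<Phi>I by (rule order_trans)
        finally show ?thesis using I by (simp add: ennreal_le_iff)
      qed
      ultimately have "mavg \<Phi> (gcube q) powr u * gside (fst q) ^ CARD('n) \<le> I"
        by (meson gside_nonneg mult_right_mono order_trans zero_le_power)
      then have "C1 powr u * (mavg \<Phi> (gcube q) powr u * gside (fst q) ^ CARD('n)) \<le> C1 powr u * I"
        by (rule mult_left_mono) simp
      then show "a q * gside (fst q) ^ CARD('n) \<le> C" using C(3) by (simp add: a_eq mult.assoc)
      fix x assume x: "x \<in> gcube q"
      have "ennreal (a q) = ennreal (C1 powr u) * ennreal (mavg \<Phi> (gcube q) powr u)"
        by (simp add: a_eq ennreal_mult)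
      also have "\<dots> \<le> ennreal (C1 powr u) * W x" by (intro mult_left_mono W(2) x) simp
      finally show "ennreal (a q) \<le> ennreal (C1 powr u) * W x" .
      have g: "gexp r (rinf / rm) (fst q) x = gexp r0 rinf (fst q) x / rm" by (simp add: gexp_def r_def)
      define e where "e = gexp r0 rinf (fst q) x"
      have e: "rm \<le> e" using r0(3)[of x] rinf by (auto simp: e_def gexp_def)
      have "mavg F (gcube q) powr (e / rm) \<le> C1 * mavg \<Phi> (gcube q)"
        unfolding \<Phi>_def[abs_def] e_def g[symmetric]
      proof (rule C1(2)[OF _ F0 _ _ x])
        have "(\<integral>\<^sup>+y\<in>gcube q. ennreal (if 1 < F y then F y else 0) \<partial>lebesgue) \<le> (\<integral>\<^sup>+y. ennreal (f y powr r0 y) \<partial>lebesgue)"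
        proof (intro nn_integral_mono)
          fix y
          have "F y \<le> f y powr r0 y" if "1 < F y"
          proof -
            have "1 \<le> f y"
            proof (rule ccontr)
              assume "\<not> 1 \<le> f y"
              then have "f y powr t \<le> 1" using f0[of y] t by (intro powr_le1) auto
              then show False using that by (simp add: F_def)
            qed
            then show ?thesis unfolding F_def using t r0(3)[of y] by (intro powr_mono) auto
          qed
          then show "ennreal (if 1 < F y then F y else 0) * indicator (gcube q) y \<le> ennreal (f y powr r0 y)"
            by (auto simp: indicator_def ennreal_leI)
        qed
        also have "\<dots> \<le> 1" by (rule fI)
        finally show "(\<integral>\<^sup>+y\<in>gcube q. ennreal (if 1 < F y then F y else 0) \<partial>lebesgue) \<le> 1" .
        have "(\<integral>\<^sup>+y\<in>gcube q. ennreal ((F y powr r y) powr u) \<partial>lebesgue) \<le> (\<integral>\<^sup>+y. ennreal (f y powr r0 y) \<partial>lebesgue)"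
          unfolding Fru by (intro nn_integral_mono) (auto simp: indicator_def)
        then have "(\<integral>\<^sup>+y\<in>gcube q. ennreal ((F y powr r y) powr u) \<partial>lebesgue) < \<infinity>"
        proof -
          assume "(\<integral>\<^sup>+y\<in>gcube q. ennreal ((F y powr r y) powr u) \<partial>lebesgue) \<le> (\<integral>\<^sup>+y. ennreal (f y powr r0 y) \<partial>lebesgue)"
          also note fI
          also have "(1 :: ennreal) < \<infinity>" by simp
          finally show ?thesis .
        qed
        then show "(\<integral>\<^sup>+y\<in>gcube q. ennreal (F y powr r y) \<partial>lebesgue) < \<infinity>"
          using u by (intro nn_integral_gcube_finite[where F="\<lambda>y. F y powr r y" and u=u]) auto
      qed measurable
      \<comment> \<open>Raising to rm / (t * e) turns the exponent e / rm on the left into 1 / t,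
        and equals u * (1 / e) on the right, which is \<open>a q\<close> to the power 1 / e.\<close>
      then have "(mavg F (gcube q) powr (e / rm)) powr (rm / (t * e)) \<le> (C1 * mavg \<Phi> (gcube q)) powr (rm / (t * e))"
        using e rm t by (intro powr_mono2) auto
      moreover have "(e / rm) * (rm / (t * e)) = 1 / t" using e rm t by simp
      moreover have "rm / (t * e) = u * (1 / e)" by (simp add: u_def)
      ultimately show "mavg (\<lambda>y. f y powr t) (gcube q) powr (1 / t) \<le> a q powr (1 / gexp r0 rinf (fst q) x)"
        unfolding a_def e_def[symmetric] F_def[abs_def] by (simp only: powr_powr)
    qed
  qed
qed

section \<open>Hedberg summation and the dual bilinear form\<close>

lemma powr_mult_powr_le_add:
  fixes X Y :: real
  assumes "0 \<le> X" "0 \<le> Y" "0 \<le> a" "0 \<le> b" "a + b = 1"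
  shows "X powr a * Y powr b \<le> X + Y"
proof (cases "max X Y = 0")
  case False
  have "X powr a * Y powr b \<le> max X Y powr a * max X Y powr b"
    using assms by (intro mult_mono powr_mono2) auto
  also have "\<dots> = max X Y" using assms False by (simp flip: powr_add)
  also have "\<dots> \<le> X + Y" using assms by auto
  finally show ?thesis .
next
  case True
  then have "X = 0" "Y = 0" using assms by linarith+
  then show ?thesis by simp
qed

text \<open>Hedberg's trick: a quantity bounded both by \<open>X\<close> and by \<open>C s^{-n}\<close> is summable over the
  generations after multiplication by \<open>s^\<alpha>\<close>.\<close>

lemma hedberg_term:
  fixes X a \<alpha> \<delta> e C :: real and k :: int and n :: nat
  assumes n: "0 < n" and e: "0 < \<alpha>" "\<delta> \<le> \<alpha> / n" "\<delta> \<le> 1 / e - \<alpha> / n" "1 \<le> e" and C: "1 \<le> C"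
    and X: "0 < X" "0 \<le> a" "a \<le> X" "a * gside k ^ n \<le> C"
  shows "gside k powr \<alpha> * a powr (1 / e)
    \<le> C * X powr (1 / e - \<alpha> / n) * 2 powr (- (\<delta> * n) * \<bar>real_of_int k + (log 2 3 + log 2 X / n)\<bar>)"
proof -
  define s where "s = gside k"
  have s: "0 < s" by (simp add: s_def)
  \<comment> \<open>The scale-free variable. Here s powr \<alpha> = \<nu> powr (\<alpha>/n) * X powr
    (- \<alpha>/n), and the two bounds on \<open>a\<close> combine to a \<le> C X min 1 (1/\<nu>).
    Decay comes from \<nu> powr (\<alpha>/n) when \<nu> \<le> 1 and from \<nu> powr (\<alpha>/n -
    1/e) when \<nu> > 1.\<close>
  define \<nu> where "\<nu> = s ^ n * X"
  have \<nu>: "0 < \<nu>" using s X by (simp add: \<nu>_def)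
  have log\<nu>: "log 2 \<nu> = n * (real_of_int k + (log 2 3 + log 2 X / n))"
  proof -
    have "log 2 s = real_of_int k + log 2 3" by (simp add: s_def gside_def log_mult)
    then show ?thesis using s X n by (simp add: \<nu>_def log_mult log_nat_power algebra_simps)
  qed
  have le: "a powr (1 / e) \<le> C * (X powr (1 / e) * (min 1 (1 / \<nu>)) powr (1 / e))"
  proof -
    have sn: "0 < s ^ n" using s by simp
    have "a \<le> C * (X * min 1 (1 / \<nu>))"
    proof (cases "\<nu> \<le> 1")
      case True
      then have "min 1 (1 / \<nu>) = 1" using \<nu> by simp
      moreover have "X \<le> C * X" using C X by simp
      ultimately show ?thesis using X(3) by simp
    next
      case False
      have "X / \<nu> = 1 / s ^ n" using X sn by (simp add: \<nu>_def)
      moreover have "a \<le> C / s ^ n" using X(4) sn by (simp add: s_def le_divide_eq)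
      ultimately show ?thesis using False by simp
    qed
    then have "a powr (1 / e) \<le> (C * (X * min 1 (1 / \<nu>))) powr (1 / e)"
      using X e by (intro powr_mono2) auto
    also have "\<dots> = C powr (1 / e) * (X powr (1 / e) * (min 1 (1 / \<nu>)) powr (1 / e))"
      using C X \<nu> by (simp add: powr_mult)
    also have "\<dots> \<le> C powr 1 * (X powr (1 / e) * (min 1 (1 / \<nu>)) powr (1 / e))"
      using C e by (intro mult_right_mono powr_mono) auto
    finally show ?thesis using C by simp
  qed
  have "s powr \<alpha> = (s ^ n) powr (\<alpha> / n)"
    using s n by (simp add: powr_realpow[symmetric] powr_powr)
  also have "s ^ n = \<nu> / X" using X by (simp add: \<nu>_def)
  also have "(\<nu> / X) powr (\<alpha> / n) = \<nu> powr (\<alpha> / n) * X powr (- (\<alpha> / n))"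
    using X \<nu> by (simp add: powr_divide powr_minus_divide)
  finally have s\<alpha>: "s powr \<alpha> = \<nu> powr (\<alpha> / n) * X powr (- (\<alpha> / n))" .
  have "\<nu> powr (\<alpha> / n) * (min 1 (1 / \<nu>)) powr (1 / e) \<le> 2 powr (- \<delta> * \<bar>log 2 \<nu>\<bar>)"
  proof (cases "\<nu> \<le> 1")
    case True
    then have "\<nu> powr (\<alpha> / n) * (min 1 (1 / \<nu>)) powr (1 / e) = \<nu> powr (\<alpha> / n)" using \<nu> by simp
    also have "\<dots> \<le> \<nu> powr \<delta>" using True \<nu> e by (intro powr_mono') auto
    also have "\<dots> = 2 powr (\<delta> * log 2 \<nu>)"
      using \<nu> by (subst mult.commute, subst powr_powr[symmetric]) simp
    also have "\<delta> * log 2 \<nu> = - \<delta> * \<bar>log 2 \<nu>\<bar>" using True \<nu> by (simp add: abs_if)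
    finally show ?thesis .
  next
    case False
    then have "\<nu> powr (\<alpha> / n) * (min 1 (1 / \<nu>)) powr (1 / e) = \<nu> powr (\<alpha> / n) * \<nu> powr (- (1 / e))"
    proof -
      have "1 / \<nu> \<le> 1" using False by simp
      then have "min 1 (1 / \<nu>) = 1 / \<nu>" by (rule min_absorb2)
      then show ?thesis using \<nu> by (simp add: powr_divide powr_minus_divide)
    qed
    also have "\<dots> = \<nu> powr (\<alpha> / n - 1 / e)" by (simp flip: powr_add)
    also have "\<dots> \<le> \<nu> powr (- \<delta>)" using False e by (intro powr_mono) auto
    also have "\<dots> = 2 powr (- \<delta> * log 2 \<nu>)"
      using \<nu> by (subst mult.commute, subst powr_powr[symmetric]) simp
    also have "- \<delta> * log 2 \<nu> = - \<delta> * \<bar>log 2 \<nu>\<bar>" using False by simp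
    finally show ?thesis .
  qed
  also have "- \<delta> * \<bar>log 2 \<nu>\<bar> = - (\<delta> * n) * \<bar>real_of_int k + (log 2 3 + log 2 X / n)\<bar>"
    unfolding log\<nu> by (simp add: abs_mult)
  finally have main: "\<nu> powr (\<alpha> / n) * (min 1 (1 / \<nu>)) powr (1 / e)
    \<le> 2 powr (- (\<delta> * n) * \<bar>real_of_int k + (log 2 3 + log 2 X / n)\<bar>)" .
  have "s powr \<alpha> * a powr (1 / e) \<le> s powr \<alpha> * (C * (X powr (1 / e) * (min 1 (1 / \<nu>)) powr (1 / e)))"
    using le by (intro mult_left_mono) auto
  also have "\<dots> = C * X powr (1 / e - \<alpha> / n) * (\<nu> powr (\<alpha> / n) * (min 1 (1 / \<nu>)) powr (1 / e))"
    unfolding s\<alpha> by (simp add: diff_conv_add_uminus powr_add mult_ac del: add_uminus_conv_diff)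
  also have "\<dots> \<le> C * X powr (1 / e - \<alpha> / n) * 2 powr (- (\<delta> * n) * \<bar>real_of_int k + (log 2 3 + log 2 X / n)\<bar>)"
    using C main by (intro mult_left_mono) auto
  finally show ?thesis unfolding s_def .
qed

text \<open>For 1/q = 1/v - a the quantity \<open>d v\<close> is 1 - 1/q, so 1 / \<open>d v\<close>
  is the exponent conjugate to q. Its derivative in v has modulus 1 / (v * d v)^2, and v \<ge> 1
  together with the monotonicity of \<open>d\<close> gives the Lipschitz constant.\<close>

lemma conjugate_exponent_bounds:
  fixes a :: real
  assumes "1 < pm" "pm \<le> pM" "0 < a" "a < 1 / pM"
  defines "d \<equiv> \<lambda>v. 1 - 1 / v + a"
  shows "\<And>v. v \<in> {pm..pM} \<Longrightarrow> 1 / d v \<in> {1 / d pM..1 / d pm}"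
    "\<And>v w. v \<in> {pm..pM} \<Longrightarrow> w \<in> {pm..pM} \<Longrightarrow> \<bar>1 / d v - 1 / d w\<bar> \<le> 1 / (d pm)\<^sup>2 * \<bar>v - w\<bar>"
    "0 < d pm" "d pM < 1" "1 < 1 / d pM" "1 / d pM \<le> 1 / d pm"
proof -
  have "1 / pm < 1" using assms(1) by simp
  then have dpos: "0 < d pm" using assms(3) unfolding d_def by linarith
  have mono: "d v \<le> d w" if "v \<le> w" "0 < v" for v w
    using that by (simp add: d_def frac_le)
  show dpos': "0 < d pm" by fact
  show "d pM < 1" using assms by (simp add: d_def)
  have dpM: "0 < d pM" using mono[of pm pM] dpos assms by simp
  show "1 < 1 / d pM" using dpM \<open>d pM < 1\<close> by simp
  show "1 / d pM \<le> 1 / d pm" using mono[of pm pM] dpos assms by (simp add: frac_le)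
  fix v assume v: "v \<in> {pm..pM}"
  then have dv: "d pm \<le> d v" "d v \<le> d pM" using mono[of pm v] mono[of v pM] assms(1) by auto
  then show "1 / d v \<in> {1 / d pM..1 / d pm}" using dpos by (auto intro: divide_left_mono)
  fix w assume w: "w \<in> {pm..pM}"
  then have dw: "d pm \<le> d w" using mono[of pm w] assms(1) by auto
  have "1 / d v - 1 / d w = (d w - d v) / (d v * d w)"
    using dv dw dpos by (simp add: diff_frac_eq)
  then have "\<bar>1 / d v - 1 / d w\<bar> = \<bar>d w - d v\<bar> / (d v * d w)"
    using dv dw dpos by (simp add: abs_mult)
  also have "d w - d v = (w - v) / (v * w)"
    using v w assms(1) by (simp add: d_def field_simps)
  also have "\<bar>(w - v) / (v * w)\<bar> = \<bar>v - w\<bar> / (v * w)"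
    using v w assms(1) by (simp add: abs_mult abs_minus_commute)
  also have "\<bar>v - w\<bar> / (v * w) / (d v * d w) \<le> \<bar>v - w\<bar> / 1 / (d pm * d pm)"
  proof (intro frac_le divide_left_mono)
    have "1 * 1 \<le> v * w" using v w assms(1) by (intro mult_mono) auto
    then show "1 \<le> v * w" by simp
    show "d pm * d pm \<le> d v * d w" using dv dw dpos by (intro mult_mono) auto
  qed (use v w assms(1) dpos in auto)
  finally show "\<bar>1 / d v - 1 / d w\<bar> \<le> 1 / (d pm)\<^sup>2 * \<bar>v - w\<bar>"
    by (simp add: power2_eq_square)
qed

text \<open>The exponent of \<open>g\<close> is conjugate to q, where 1/q = 1/p - \<alpha>/n. At a
  point with local exponent e, Hedberg's bound leaves X powr (1/e - \<alpha>/n) from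
  \<open>f\<close>, and \<open>g\<close> contributes Y powr (1/e'). These two powers add up to 1, so
  the product is at most X + Y, the sum of two integrable maximal majorants.\<close>

lemma bilinear_bound:
  fixes p :: "real^'n::finite \<Rightarrow> real"
  assumes p: "p \<in> log_Hoelder" "p \<in> borel_measurable lebesgue" "\<And>x. p x \<in> {pm..pM}" and "1 < pm"
    and \<alpha>: "0 < \<alpha>" "\<alpha> / real CARD('n) < 1 / pM"
  obtains t C where "1 < t" "t \<le> pm" "\<And>y. t \<le> 1 / (1 - 1 / p y + \<alpha> / real CARD('n))" "0 \<le> C"
    "\<And>f g. f \<in> borel_measurable lebesgue \<Longrightarrow> (\<And>y. 0 \<le> f y) \<Longrightarrow>
       (\<integral>\<^sup>+y. ennreal (f y powr p y) \<partial>lebesgue) \<le> 1 \<Longrightarrow>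
       g \<in> borel_measurable lebesgue \<Longrightarrow> (\<And>y. 0 \<le> g y) \<Longrightarrow>
       (\<integral>\<^sup>+y. ennreal (g y powr (1 / (1 - 1 / p y + \<alpha> / real CARD('n)))) \<partial>lebesgue) \<le> 1 \<Longrightarrow>
       (\<integral>\<^sup>+q. ennreal (gside (fst q) powr \<alpha> * mavg (\<lambda>y. f y powr t) (gcube q) powr (1 / t)
           * mavg (\<lambda>y. g y powr t) (gcube q) powr (1 / t)) * emeasure lebesgue (gcube q :: (real^'n) set)
         \<partial>count_space UNIV) \<le> ennreal C"
proof -
  define n where "n = CARD('n)"
  have n: "0 < n" by (simp add: n_def)
  define d where "d v = 1 - 1 / v + \<alpha> / real n" for v
  define p' where "p' x = 1 / d (p x)" for x
  note [measurable] = p(2)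
  have pmM: "pm \<le> pM" using p(3) by force
  have a: "0 < \<alpha> / real n" "\<alpha> / real n < 1 / pM" using \<alpha> n by (auto simp: n_def)
  note cb = conjugate_exponent_bounds[OF \<open>1 < pm\<close> pmM a, folded d_def]
  obtain pinf where pinf: "(p \<longlongrightarrow> pinf) at_infinity"
    using p(1) unfolding log_Hoelder_def by blast
  have "0 < 1 / (d pm)\<^sup>2" using cb(3) by simp
  note p'_log = log_Hoelder_compose[OF p(1) pinf p(3) this cb(2), folded p'_def]
  have p'_bnd: "p' x \<in> {1 / d pM..1 / d pm}" for x unfolding p'_def by (rule cb(1)[OF p(3)])
  have p'm: "p' \<in> borel_measurable lebesgue" unfolding p'_def[abs_def] d_def by measurable
  \<comment> \<open>Halfway between 1 and the smaller of the lower bounds of the two exponents, so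
    that one power t > 1 serves both \<open>f\<close> and \<open>g\<close>.\<close>
  define t where "t = (1 + min pm (1 / d pM)) / 2"
  have t: "1 < t" "t < pm" "t < 1 / d pM"
    using \<open>1 < pm\<close> cb(5) by (auto simp: t_def min_def)
  obtain Cf where Cf: "1 \<le> Cf"
    "\<And>f. f \<in> borel_measurable lebesgue \<Longrightarrow> (\<And>y. 0 \<le> f y) \<Longrightarrow>
       (\<integral>\<^sup>+y. ennreal (f y powr p y) \<partial>lebesgue) \<le> 1 \<Longrightarrow>
       \<exists>W a. W \<in> borel_measurable lebesgue \<and> (\<integral>\<^sup>+x. W x \<partial>lebesgue) \<le> ennreal Cf \<and>
         (\<forall>q. 0 \<le> a q \<and> a q * gside (fst q) ^ CARD('n) \<le> Cf) \<and>
         (\<forall>q. \<forall>x\<in>gcube q. ennreal (a q) \<le> W x \<and>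
            mavg (\<lambda>y. f y powr t) (gcube q) powr (1 / t) \<le> a q powr (1 / gexp p pinf (fst q) x))"
    using averages_transfer[OF p(1,2,3) pinf t(1,2)] by blast
  obtain Cg where Cg: "1 \<le> Cg"
    "\<And>f. f \<in> borel_measurable lebesgue \<Longrightarrow> (\<And>y. 0 \<le> f y) \<Longrightarrow>
       (\<integral>\<^sup>+y. ennreal (f y powr p' y) \<partial>lebesgue) \<le> 1 \<Longrightarrow>
       \<exists>W a. W \<in> borel_measurable lebesgue \<and> (\<integral>\<^sup>+x. W x \<partial>lebesgue) \<le> ennreal Cg \<and>
         (\<forall>q. 0 \<le> a q \<and> a q * gside (fst q) ^ CARD('n) \<le> Cg) \<and>
         (\<forall>q. \<forall>x\<in>gcube q. ennreal (a q) \<le> W x \<and>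
            mavg (\<lambda>y. f y powr t) (gcube q) powr (1 / t) \<le> a q powr (1 / gexp p' (1 / d pinf) (fst q) x))"
    using averages_transfer[OF p'_log(1) p'm p'_bnd p'_log(2) t(1,3)] by blast
  \<comment> \<open>A decay rate valid for every local exponent e at most \<open>pM\<close>: the
    first entry acts on small scales, the second on large ones.\<close>
  define \<delta> where "\<delta> = min (\<alpha> / real n) (1 / pM - \<alpha> / real n)"
  have \<delta>: "0 < \<delta>" using a by (simp add: \<delta>_def)
  then have "0 < \<delta> * real n" using n by simp
  then obtain C0 where C0: "0 \<le> C0"
    "\<And>c. (\<integral>\<^sup>+k. ennreal (2 powr (- (\<delta> * real n) * \<bar>real_of_int k + c\<bar>)) \<partial>count_space UNIV) \<le> ennreal C0"
    using int_geometric_sum_bound by metis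
  define C where "C = 4 ^ n * C0 * Cf * (Cf + Cg)"
  show thesis
  proof (rule that[OF t(1), of C])
    show "t \<le> pm" using t by simp
    show "t \<le> 1 / (1 - 1 / p y + \<alpha> / real CARD('n))" for y
      using t(3) p'_bnd[of y] by (simp add: p'_def d_def n_def)
    show "0 \<le> C" unfolding C_def using C0 Cf Cg by simp
    fix f g :: "real^'n \<Rightarrow> real"
    assume fm: "f \<in> borel_measurable lebesgue" and f0: "\<And>y. 0 \<le> f y"
      and fI: "(\<integral>\<^sup>+y. ennreal (f y powr p y) \<partial>lebesgue) \<le> 1"
      and gm: "g \<in> borel_measurable lebesgue" and g0: "\<And>y. 0 \<le> g y"
      and gI: "(\<integral>\<^sup>+y. ennreal (g y powr (1 / (1 - 1 / p y + \<alpha> / real CARD('n)))) \<partial>lebesgue) \<le> 1"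
    obtain W a where W: "W \<in> borel_measurable lebesgue" "(\<integral>\<^sup>+x. W x \<partial>lebesgue) \<le> ennreal Cf"
         "\<And>q. 0 \<le> a q" "\<And>q. a q * gside (fst q) ^ CARD('n) \<le> Cf"
         "\<And>q x. x \<in> gcube q \<Longrightarrow> ennreal (a q) \<le> W x"
         "\<And>q x. x \<in> gcube q \<Longrightarrow> mavg (\<lambda>y. f y powr t) (gcube q) powr (1 / t) \<le> a q powr (1 / gexp p pinf (fst q) x)"
      using Cf(2)[OF fm f0 fI] by blast
    have "(\<integral>\<^sup>+y. ennreal (g y powr p' y) \<partial>lebesgue) \<le> 1"
      using gI by (simp add: p'_def d_def n_def)
    then obtain V c where V: "V \<in> borel_measurable lebesgue" "(\<integral>\<^sup>+x. V x \<partial>lebesgue) \<le> ennreal Cg"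
         "\<And>q. 0 \<le> c q"
         "\<And>q x. x \<in> gcube q \<Longrightarrow> ennreal (c q) \<le> V x"
         "\<And>q x. x \<in> gcube q \<Longrightarrow> mavg (\<lambda>y. g y powr t) (gcube q) powr (1 / t) \<le> c q powr (1 / gexp p' (1 / d pinf) (fst q) x)"
      using Cg(2)[OF gm g0] by blast
    note [measurable] = W(1) V(1)
    define w where "w q = gside (fst q) powr \<alpha> * mavg (\<lambda>y. f y powr t) (gcube q) powr (1 / t)
           * mavg (\<lambda>y. g y powr t) (gcube q) powr (1 / t)" for q
    have w0: "0 \<le> w q" for q by (simp add: w_def)
    \<comment> \<open>The factor |Q| of the form is the integral of the indicator of Q, so it is
      enough to bound the sum over the cubes through a fixed x; that x also serves as the point at
      which \<open>gexp\<close> is evaluated.\<close>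
    have pt: "(\<integral>\<^sup>+q. ennreal (w q) * indicator (gcube q) x \<partial>count_space UNIV)
        \<le> ennreal (4 ^ n * C0 * Cf) * (W x + V x)"
      if fin: "W x \<noteq> \<infinity>" "V x \<noteq> \<infinity>" for x
    proof -
      define X where "X = enn2real (W x)"
      define Y where "Y = enn2real (V x)"
      have XY: "W x = ennreal X" "V x = ennreal Y" "0 \<le> X" "0 \<le> Y"
        using fin by (auto simp: X_def Y_def less_top)
      define cc where "cc = log 2 3 + log 2 X / real n"
      define G where "G k = ennreal (Cf * (X + Y)) * ennreal (2 powr (- (\<delta> * real n) * \<bar>real_of_int k + cc\<bar>))" for k
      have "ennreal (w q) * indicator (gcube q) x \<le> G (fst q) * indicator (gcube q) x" for q
      proof (cases "x \<in> gcube q")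
        case True
        define e where "e = gexp p pinf (fst q) x"
        define e' where "e' = gexp p' (1 / d pinf) (fst q) x"
        have e: "e \<in> {pm..pM}" using p(3) p'_log(3) by (simp add: e_def gexp_def)
        have e1: "1 \<le> e" using e \<open>1 < pm\<close> by simp
        have e'e: "e' = 1 / d e" by (simp add: e_def e'_def gexp_def p'_def)
        have de: "1 / e' = 1 - (1 / e - \<alpha> / real n)"
          by (simp add: e'e d_def)
        have "1 / e \<le> 1" using e1 by simp
        then have e'0: "0 \<le> 1 / e'" using a unfolding de by linarith
        have aX: "a q \<le> X" and cY: "c q \<le> Y"
          using W(5)[OF True] V(4)[OF True] XY by (auto simp: ennreal_le_iff)
        have "1 / pM \<le> 1 / e" using e \<open>1 < pm\<close> by (auto intro: divide_left_mono)
        then have \<delta>e: "\<delta> \<le> \<alpha> / real n" "\<delta> \<le> 1 / e - \<alpha> / real n" by (auto simp: \<delta>_def)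
        have "w q \<le> gside (fst q) powr \<alpha> * a q powr (1 / e) * c q powr (1 / e')"
          unfolding w_def e_def e'_def using W(6)[OF True] V(5)[OF True] by (intro mult_mono) auto
        also have "\<dots> \<le> (Cf * X powr (1 / e - \<alpha> / real n) * 2 powr (- (\<delta> * real n) * \<bar>real_of_int (fst q) + cc\<bar>)) * Y powr (1 / e')"
        proof (cases "a q = 0")
          case True
          then show ?thesis using Cf by simp
        next
          case False
          then have "0 < X" using aX W(3)[of q] by linarith
          have "gside (fst q) powr \<alpha> * a q powr (1 / e) \<le> Cf * X powr (1 / e - \<alpha> / real n) * 2 powr (- (\<delta> * real n) * \<bar>real_of_int (fst q) + cc\<bar>)"
            unfolding cc_def
            using hedberg_term[OF n \<alpha>(1) \<delta>e e1 Cf(1) \<open>0 < X\<close> W(3) aX] W(4)[of q] by (simp add: n_def)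
          moreover have "c q powr (1 / e') \<le> Y powr (1 / e')"
            using V(3)[of q] cY e'0 by (intro powr_mono2) auto
          ultimately show ?thesis by (rule mult_mono) (use Cf(1) in auto)
        qed
        also have "\<dots> = Cf * 2 powr (- (\<delta> * real n) * \<bar>real_of_int (fst q) + cc\<bar>) * (X powr (1 / e - \<alpha> / real n) * Y powr (1 / e'))"
          by (simp add: mult_ac)
        also have "\<dots> \<le> Cf * 2 powr (- (\<delta> * real n) * \<bar>real_of_int (fst q) + cc\<bar>) * (X + Y)"
          using Cf XY \<delta> \<delta>e e'0 de by (intro mult_left_mono powr_mult_powr_le_add) auto
        also have "\<dots> = Cf * (X + Y) * 2 powr (- (\<delta> * real n) * \<bar>real_of_int (fst q) + cc\<bar>)"
          by (simp add: mult_ac)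
        finally have "ennreal (w q) \<le> G (fst q)"
          unfolding G_def using Cf XY by (subst ennreal_mult[symmetric]) (auto intro: ennreal_leI)
        then show ?thesis by (rule mult_right_mono) simp
      qed simp
      then have "(\<integral>\<^sup>+q. ennreal (w q) * indicator (gcube q) x \<partial>count_space UNIV)
        \<le> (\<integral>\<^sup>+q. G (fst q) * indicator (gcube q) x \<partial>count_space UNIV)"
        by (intro nn_integral_mono)
      also have "\<dots> \<le> 4 ^ n * (\<integral>\<^sup>+k. G k \<partial>count_space UNIV)"
        unfolding n_def by (rule nn_integral_gcube_overlap)
      also have "\<dots> \<le> 4 ^ n * (ennreal (Cf * (X + Y)) * ennreal C0)"
      proof -
        have "(\<integral>\<^sup>+k. G k \<partial>count_space UNIV) = ennreal (Cf * (X + Y)) * (\<integral>\<^sup>+k. ennreal (2 powr (- (\<delta> * real n) * \<bar>real_of_int k + cc\<bar>)) \<partial>count_space UNIV)"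
          unfolding G_def by (rule nn_integral_cmult) simp
        also have "\<dots> \<le> ennreal (Cf * (X + Y)) * ennreal C0"
          by (rule mult_left_mono[OF C0(2)]) simp
        finally show ?thesis by (rule mult_left_mono) simp
      qed
      also have "\<dots> = ennreal (4 ^ n * C0 * Cf) * (W x + V x)"
      proof -
        have "(4::ennreal) ^ n = ennreal (4 ^ n)" using ennreal_power[of 4 n] by simp
        then have "4 ^ n * (ennreal (Cf * (X + Y)) * ennreal C0) = ennreal (4 ^ n * (Cf * (X + Y) * C0))"
          using Cf XY C0 by (simp add: ennreal_mult)
        also have "4 ^ n * (Cf * (X + Y) * C0) = (4 ^ n * C0 * Cf) * (X + Y)" by (simp add: mult_ac)
        also have "ennreal \<dots> = ennreal (4 ^ n * C0 * Cf) * ennreal (X + Y)"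
          using Cf XY C0 by (intro ennreal_mult) auto
        finally show ?thesis using XY by simp
      qed
      finally show ?thesis .
    qed
    have "AE x in lebesgue. W x \<noteq> \<infinity>" "AE x in lebesgue. V x \<noteq> \<infinity>"
    proof -
      have "(\<integral>\<^sup>+x. W x \<partial>lebesgue) \<noteq> \<infinity>" "(\<integral>\<^sup>+x. V x \<partial>lebesgue) \<noteq> \<infinity>"
        using W(2) V(2) by (auto simp: top_unique)
      from nn_integral_PInf_AE[OF W(1) this(1)] nn_integral_PInf_AE[OF V(1) this(2)]
      show "AE x in lebesgue. W x \<noteq> \<infinity>" "AE x in lebesgue. V x \<noteq> \<infinity>" .
    qed
    then have ae: "AE x in lebesgue. (\<integral>\<^sup>+q. ennreal (w q) * indicator (gcube q) x \<partial>count_space UNIV)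
        \<le> ennreal (4 ^ n * C0 * Cf) * (W x + V x)"
      by eventually_elim (rule pt)
    have "(\<integral>\<^sup>+q. ennreal (w q) * emeasure lebesgue (gcube q :: (real^'n) set) \<partial>count_space UNIV)
      = (\<integral>\<^sup>+x. \<integral>\<^sup>+q. ennreal (w q) * indicator (gcube q) (x :: real^'n) \<partial>count_space UNIV \<partial>lebesgue)"
      by (subst nn_integral_count_space_nn_integral) (auto simp: nn_integral_cmult)
    also have "\<dots> \<le> (\<integral>\<^sup>+x. ennreal (4 ^ n * C0 * Cf) * (W x + V x) \<partial>lebesgue)"
      by (rule nn_integral_mono_AE[OF ae])
    also have "\<dots> = ennreal (4 ^ n * C0 * Cf) * ((\<integral>\<^sup>+x. W x \<partial>lebesgue) + (\<integral>\<^sup>+x. V x \<partial>lebesgue))"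
      by (simp add: nn_integral_cmult nn_integral_add)
    also have "\<dots> \<le> ennreal (4 ^ n * C0 * Cf) * (ennreal Cf + ennreal Cg)"
      by (intro mult_left_mono add_mono W(2) V(2)) auto
    also have "\<dots> = ennreal C"
    proof -
      have "ennreal Cf + ennreal Cg = ennreal (Cf + Cg)" using Cf Cg by simp
      then show ?thesis unfolding C_def using Cf(1) Cg(1) C0 by (simp add: ennreal_mult)
    qed
    finally show "(\<integral>\<^sup>+q. ennreal (gside (fst q) powr \<alpha> * mavg (\<lambda>y. f y powr t) (gcube q) powr (1 / t)
           * mavg (\<lambda>y. g y powr t) (gcube q) powr (1 / t)) * emeasure lebesgue (gcube q :: (real^'n) set)
         \<partial>count_space UNIV) \<le> ennreal C"
      unfolding w_def .
  qed
qed

section \<open>The John--Nirenberg inequality\<close>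

definition child :: "real^'n::finite \<Rightarrow> real \<Rightarrow> ('n \<Rightarrow> bool) \<Rightarrow> real^'n" where
  "child x r s = x + (\<chi> i. if s i then r / 4 else - (r / 4))"

lemma AE_off_hyperplanes:
  fixes x :: "real^'n::finite"
  shows "AE y in lebesgue. \<forall>i. y $ i \<noteq> x $ i"
proof -
  have "AE y in lebesgue. y $ i \<noteq> x $ i" for i
  proof -
    have "{y. y $ i = x $ i} \<in> null_sets lebesgue"
      using negligible_standard_hyperplane[of "axis i (1::real)" "x $ i"]
      by (simp add: negligible_iff_null_sets inner_axis axis_in_Basis_iff)
    then have "AE y in lebesgue. y \<notin> {y. y $ i = x $ i}" by (rule AE_not_in)
    then show ?thesis by simp
  qed
  then show ?thesis by (simp add: AE_all_countable)
qed

lemma cube_child_iff: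
  fixes x y :: "real^'n::finite"
  assumes "0 < r" "\<forall>i. y $ i \<noteq> x $ i"
  shows "y \<in> cube (child x r s) (r / 2) \<longleftrightarrow> y \<in> cube x r \<and> s = (\<lambda>i. x $ i < y $ i)"
proof -
  have *: "\<bar>y $ i - child x r s $ i\<bar> \<le> r / 4 \<longleftrightarrow> \<bar>y $ i - x $ i\<bar> \<le> r / 2 \<and> s i = (x $ i < y $ i)" for i
  proof -
    have 1: "\<bar>u - (v + r / 4)\<bar> \<le> r / 4 \<longleftrightarrow> \<bar>u - v\<bar> \<le> r / 2 \<and> v < u"
      and 2: "\<bar>u - (v - r / 4)\<bar> \<le> r / 4 \<longleftrightarrow> \<bar>u - v\<bar> \<le> r / 2 \<and> \<not> v < u"
      if "u \<noteq> v" for u v :: real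
      using assms(1) that by linarith+
    show ?thesis
      using 1[of "y $ i" "x $ i"] 2[of "y $ i" "x $ i"] assms(2) by (cases "s i") (auto simp: child_def)
  qed
  have "y \<in> cube (child x r s) (r / 2) \<longleftrightarrow> (\<forall>i. \<bar>y $ i - child x r s $ i\<bar> \<le> r / 4)"
    by (simp add: cube_def)
  also have "\<dots> \<longleftrightarrow> y \<in> cube x r \<and> s = (\<lambda>i. x $ i < y $ i)"
    unfolding * by (auto simp: cube_def fun_eq_iff)
  finally show ?thesis .
qed

lemma child_subset_cube:
  fixes x :: "real^'n::finite"
  assumes "0 < r"
  shows "cube (child x r s) (r / 2) \<subseteq> cube x r"
proof
  fix y assume y: "y \<in> cube (child x r s) (r / 2)"
  have "\<bar>y $ i - x $ i\<bar> \<le> r / 2" for i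
  proof -
    have "\<bar>y $ i - child x r s $ i\<bar> \<le> r / 4" using y by (simp add: cube_def)
    moreover have "child x r s $ i = x $ i + r / 4 \<or> child x r s $ i = x $ i - r / 4"
      by (simp add: child_def)
    ultimately show ?thesis using assms by linarith
  qed
  then show "y \<in> cube x r" by (simp add: cube_def)
qed

text \<open>Closed children overlap only on the coordinate hyperplanes through the centre. Off this
  null set a point of the cube lies in exactly one child, the one given by the signs of its
  coordinates relative to the centre.\<close>

lemma nn_integral_cube_children:
  fixes F :: "real^'n::finite \<Rightarrow> ennreal"
  assumes [measurable]: "F \<in> borel_measurable lebesgue" and "0 < r"
  shows "(\<integral>\<^sup>+y\<in>cube x r. F y \<partial>lebesgue) = (\<Sum>s\<in>UNIV. \<integral>\<^sup>+y\<in>cube (child x r s) (r / 2). F y \<partial>lebesgue)"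
proof -
  have "(\<integral>\<^sup>+y\<in>cube x r. F y \<partial>lebesgue)
      = (\<integral>\<^sup>+y. (\<Sum>s\<in>UNIV. F y * indicator (cube (child x r s) (r / 2)) y) \<partial>lebesgue)"
  proof (rule nn_integral_cong_AE)
    show "AE y in lebesgue. F y * indicator (cube x r) y = (\<Sum>s\<in>UNIV. F y * indicator (cube (child x r s) (r / 2)) y)"
      using AE_off_hyperplanes[of x]
    proof eventually_elim
      case (elim y)
      have "(\<Sum>s\<in>UNIV. F y * indicator (cube (child x r s) (r / 2)) y)
        = (\<Sum>s\<in>UNIV. if s = (\<lambda>i. x $ i < y $ i) then F y * indicator (cube x r) y else 0)"
        using cube_child_iff[OF \<open>0 < r\<close> elim] by (intro sum.cong) (auto simp: indicator_def)
      then show ?case by simp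
    qed
  qed
  also have "\<dots> = (\<Sum>s\<in>UNIV. \<integral>\<^sup>+y\<in>cube (child x r s) (r / 2). F y \<partial>lebesgue)"
    by (rule nn_integral_sum) simp
  finally show ?thesis .
qed

lemma nn_integral_cube_mono:
  assumes "\<And>y. y \<in> A \<Longrightarrow> F y \<le> G y"
  shows "(\<integral>\<^sup>+y\<in>A. F y \<partial>M) \<le> (\<integral>\<^sup>+y\<in>A. G y \<partial>M)"
  using assms by (intro nn_integral_mono) (auto simp: indicator_def)

section \<open>Mean oscillation over dyadic generations\<close>

context
  fixes b :: "'n::finite cfun"
  assumes loc: "b locally_integrable_on UNIV"
begin

lemma loc_cube: "set_integrable lebesgue (cube x r) b"
  using loc unfolding locally_integrable_on_def by simp

lemma loc_measurable [measurable]: "b \<in> borel_measurable lebesgue"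
proof -
  have "(\<lambda>y. indicator (cube 0 (real k)) y *\<^sub>R b y) \<in> borel_measurable lebesgue" for k :: nat
    using loc_cube[of 0 "real k"] unfolding set_integrable_def by (rule borel_measurable_integrable)
  moreover have "(\<lambda>k. indicator (cube 0 (real k)) y *\<^sub>R b y) \<longlonglongrightarrow> b y" for y :: "real^'n"
  proof (rule tendsto_eventually)
    obtain k0 :: nat where k0: "2 * norm y \<le> real k0" using real_arch_simple by blast
    show "\<forall>\<^sub>F k in sequentially. indicator (cube 0 (real k)) y *\<^sub>R b y = b y"
      unfolding eventually_sequentially
    proof (intro exI[of _ k0] allI impI)
      fix k assume "k0 \<le> k"
      then have "norm y \<le> real k / 2" using k0 by linarith
      then have "y \<in> cube 0 (real k)" using cball_subset_cube[of 0 "real k / 2"] by auto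
      then show "indicator (cube 0 (real k)) y *\<^sub>R b y = b y" by simp
    qed
  qed
  ultimately show ?thesis by (rule borel_measurable_LIMSEQ_metric)
qed

lemma nn_integral_cube_norm_finite:
  "(\<integral>\<^sup>+y\<in>cube x r. ennreal (norm (b y - a)) \<partial>lebesgue) < \<infinity>"
proof -
  have fin: "emeasure lebesgue (cube x r) < \<infinity>"
    using emeasure_compact_finite[OF compact_cube, of x r] by simp
  have "set_integrable lebesgue (cube x r) (\<lambda>y. b y - a)"
    by (intro set_integral_diff loc_cube) (use fin in \<open>auto simp: set_integrable_def\<close>)
  then have "integrable lebesgue (\<lambda>y. indicator (cube x r) y *\<^sub>R (b y - a))"
    by (simp add: set_integrable_def)
  then have "(\<integral>\<^sup>+y. ennreal (norm (indicator (cube x r) y *\<^sub>R (b y - a))) \<partial>lebesgue) < \<infinity>"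
    by (simp add: integrable_iff_bounded)
  also have "(\<integral>\<^sup>+y. ennreal (norm (indicator (cube x r) y *\<^sub>R (b y - a))) \<partial>lebesgue)
      = (\<integral>\<^sup>+y\<in>cube x r. ennreal (norm (b y - a)) \<partial>lebesgue)"
    by (intro nn_integral_cong) (auto simp: indicator_def)
  finally show ?thesis .
qed

lemma average_diff_le:
  assumes r: "0 < r"
  shows "ennreal (norm (average b (cube x r) - a)) * ennreal (r ^ CARD('n))
    \<le> (\<integral>\<^sup>+y\<in>cube x r. ennreal (norm (b y - a)) \<partial>lebesgue)"
proof -
  define Q where "Q = cube x r"
  define m where "m = r ^ CARD('n)"
  have m: "0 < m" using r by (simp add: m_def)
  have mQ: "measure lebesgue Q = m" unfolding m_def Q_def by (rule measure_cube) (use r in simp)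
  have em: "emeasure lebesgue Q < \<infinity>" using r by (simp add: Q_def emeasure_cube)
  have c: "set_integrable lebesgue Q (\<lambda>y. a)" using em by (simp add: set_integrable_def Q_def)
  have i: "set_integrable lebesgue Q (\<lambda>y. b y - a)"
    unfolding Q_def by (intro set_integral_diff loc_cube c[unfolded Q_def])
  have "(LINT y:Q|lebesgue. b y - a) = (LINT y:Q|lebesgue. b y) - (LINT y:Q|lebesgue. a)"
    unfolding Q_def by (intro set_integral_diff loc_cube c[unfolded Q_def])
  also have "(LINT y:Q|lebesgue. a) = of_real m * a"
    using em mQ by (simp add: set_integral_const Q_def scaleR_conv_of_real)
  finally have "(average b Q - a) * of_real m = (LINT y:Q|lebesgue. b y - a)"
    using m unfolding average_def mQ by (simp add: left_diff_distrib right_diff_distrib mult.commute)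
  then have "norm (average b Q - a) * m = norm (LINT y:Q|lebesgue. b y - a)"
    using m by (metis norm_mult norm_of_real abs_of_pos)
  also have "ennreal \<dots> \<le> (\<integral>\<^sup>+y. norm (indicator Q y *\<^sub>R (b y - a)) \<partial>lebesgue)"
    unfolding set_lebesgue_integral_def
    using i by (intro integral_norm_bound_ennreal) (simp add: set_integrable_def)
  also have "\<dots> = (\<integral>\<^sup>+y\<in>Q. ennreal (norm (b y - a)) \<partial>lebesgue)"
    by (intro nn_integral_cong) (auto simp: indicator_def)
  finally show ?thesis using m by (simp add: ennreal_mult Q_def m_def)
qed

text \<open>Unrolled, this adds the integrals of |b - b_P| over all dyadic descendants P of side r /
  2 ^ N. Without division by measures it is additive over the children, as the induction on
  generations requires.\<close>

primrec gen_osc :: "nat \<Rightarrow> real^'n \<Rightarrow> real \<Rightarrow> ennreal" where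
  "gen_osc 0 x r = (\<integral>\<^sup>+y\<in>cube x r. ennreal (norm (b y - average b (cube x r))) \<partial>lebesgue)"
| "gen_osc (Suc N) x r = (\<Sum>s\<in>UNIV. gen_osc N (child x r s) (r / 2))"

text \<open>Up to a factor 2 the average is the best constant in mean, so on each descendant it may
  be traded for the value of \<open>g\<close> at the centre, from which \<open>g\<close> deviates by
  at most \<omega>.\<close>

lemma gen_osc_le:
  assumes "0 < r" "0 \<le> \<omega>" and [measurable]: "g \<in> borel_measurable lebesgue"
    and "\<And>y y'. y \<in> cube x r \<Longrightarrow> y' \<in> cube x r \<Longrightarrow> (\<And>i. \<bar>y $ i - y' $ i\<bar> \<le> r / 2 ^ N) \<Longrightarrow> norm (g y - g y') \<le> \<omega>"
  shows "gen_osc N x r \<le> 2 * (\<integral>\<^sup>+y\<in>cube x r. ennreal (norm (b y - g y)) \<partial>lebesgue) + 2 * (ennreal \<omega> * ennreal (r ^ CARD('n)))"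
  using assms(1,4)
proof (induction N arbitrary: x r)
  case (0 x r)
  define a where "a = g x"
  define Q where "Q = cube x r"
  have Qm: "Q \<in> sets lebesgue" "emeasure lebesgue Q = ennreal (r ^ CARD('n))"
    using 0 by (simp_all add: Q_def emeasure_cube)
  have xQ: "x \<in> Q" using 0 by (simp add: Q_def cube_def)
  have 1: "(\<integral>\<^sup>+y\<in>Q. ennreal (norm (b y - a)) \<partial>lebesgue) \<le> (\<integral>\<^sup>+y\<in>Q. ennreal (norm (b y - g y)) \<partial>lebesgue) + ennreal \<omega> * ennreal (r ^ CARD('n))"
  proof -
    have "(\<integral>\<^sup>+y\<in>Q. ennreal (norm (b y - a)) \<partial>lebesgue) \<le> (\<integral>\<^sup>+y. ennreal (norm (b y - g y)) * indicator Q y + ennreal \<omega> * indicator Q y \<partial>lebesgue)"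
    proof (intro nn_integral_mono)
      fix y
      have "norm (b y - a) \<le> norm (b y - g y) + \<omega>" if "y \<in> Q"
      proof -
        have "\<bar>y $ i - x $ i\<bar> \<le> r" for i
        proof -
          have "\<bar>y $ i - x $ i\<bar> \<le> r / 2" using that by (simp add: Q_def cube_def)
          then show ?thesis using 0(1) by linarith
        qed
        then have "norm (g y - a) \<le> \<omega>"
          unfolding a_def using 0(2)[of y x] that xQ by (simp add: Q_def)
        then show ?thesis using norm_triangle_ineq[of "b y - g y" "g y - a"] by simp
      qed
      then have "y \<in> Q \<Longrightarrow> ennreal (norm (b y - a)) \<le> ennreal (norm (b y - g y)) + ennreal \<omega>"
        using \<open>0 \<le> \<omega>\<close> by (simp add: ennreal_leI flip: ennreal_plus)
      then show "ennreal (norm (b y - a)) * indicator Q y \<le> ennreal (norm (b y - g y)) * indicator Q y + ennreal \<omega> * indicator Q y"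
        by (auto simp: indicator_def)
    qed
    also have "\<dots> = (\<integral>\<^sup>+y\<in>Q. ennreal (norm (b y - g y)) \<partial>lebesgue) + ennreal \<omega> * ennreal (r ^ CARD('n))"
      using Qm by (subst nn_integral_add) (auto simp: nn_integral_cmult)
    finally show ?thesis .
  qed
  have "gen_osc 0 x r \<le> (\<integral>\<^sup>+y. ennreal (norm (b y - a)) * indicator Q y + ennreal (norm (average b Q - a)) * indicator Q y \<partial>lebesgue)"
    unfolding gen_osc.simps Q_def[symmetric]
  proof (intro nn_integral_mono)
    fix y
    have "norm (b y - average b Q) \<le> norm (b y - a) + norm (average b Q - a)"
      using norm_triangle_ineq4[of "b y - a" "average b Q - a"] by simp
    then have "ennreal (norm (b y - average b Q)) \<le> ennreal (norm (b y - a)) + ennreal (norm (average b Q - a))"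
      by (simp add: ennreal_leI flip: ennreal_plus)
    then show "ennreal (norm (b y - average b Q)) * indicator Q y \<le> ennreal (norm (b y - a)) * indicator Q y + ennreal (norm (average b Q - a)) * indicator Q y"
      by (auto simp: indicator_def)
  qed
  also have "\<dots> = (\<integral>\<^sup>+y\<in>Q. ennreal (norm (b y - a)) \<partial>lebesgue) + ennreal (norm (average b Q - a)) * ennreal (r ^ CARD('n))"
    using Qm by (subst nn_integral_add) (auto simp: nn_integral_cmult)
  also have "\<dots> \<le> (\<integral>\<^sup>+y\<in>Q. ennreal (norm (b y - a)) \<partial>lebesgue) + (\<integral>\<^sup>+y\<in>Q. ennreal (norm (b y - a)) \<partial>lebesgue)"
    unfolding Q_def by (intro add_left_mono average_diff_le 0)
  also have "\<dots> = 2 * (\<integral>\<^sup>+y\<in>Q. ennreal (norm (b y - a)) \<partial>lebesgue)" by (simp add: mult_2)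
  also have "\<dots> \<le> 2 * ((\<integral>\<^sup>+y\<in>Q. ennreal (norm (b y - g y)) \<partial>lebesgue) + ennreal \<omega> * ennreal (r ^ CARD('n)))"
    by (intro mult_left_mono 1) simp
  finally show ?case by (simp add: distrib_left Q_def)
next
  case (Suc N x r)
  have IH: "gen_osc N (child x r s) (r / 2) \<le> 2 * (\<integral>\<^sup>+y\<in>cube (child x r s) (r / 2). ennreal (norm (b y - g y)) \<partial>lebesgue) + 2 * (ennreal \<omega> * ennreal ((r / 2) ^ CARD('n)))" for s
  proof (rule Suc.IH)
    show "0 < r / 2" using Suc by simp
    fix y y' assume y: "y \<in> cube (child x r s) (r / 2)" "y' \<in> cube (child x r s) (r / 2)" "\<And>i. \<bar>y $ i - y' $ i\<bar> \<le> r / 2 / 2 ^ N"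
    show "norm (g y - g y') \<le> \<omega>"
      using y child_subset_cube[OF Suc.prems(1), of x s] by (intro Suc.prems(2)) auto
  qed
  have vol: "(\<Sum>s\<in>(UNIV :: ('n \<Rightarrow> bool) set). ennreal ((r / 2) ^ CARD('n))) = ennreal (r ^ CARD('n))"
  proof -
    have "(\<Sum>s\<in>(UNIV :: ('n \<Rightarrow> bool) set). ennreal ((r / 2) ^ CARD('n))) = of_nat (2 ^ CARD('n)) * ennreal ((r / 2) ^ CARD('n))"
      by (simp add: card_fun)
    also have "\<dots> = ennreal (2 ^ CARD('n) * (r / 2) ^ CARD('n))"
      using Suc.prems(1) by (simp add: ennreal_mult ennreal_of_nat_eq_real_of_nat)
    finally show ?thesis by (simp add: power_divide)
  qed
  have "gen_osc (Suc N) x r \<le> (\<Sum>s\<in>UNIV. 2 * (\<integral>\<^sup>+y\<in>cube (child x r s) (r / 2). ennreal (norm (b y - g y)) \<partial>lebesgue) + 2 * (ennreal \<omega> * ennreal ((r / 2) ^ CARD('n))))"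
    unfolding gen_osc.simps by (intro sum_mono IH)
  also have "\<dots> = 2 * (\<Sum>s\<in>UNIV. \<integral>\<^sup>+y\<in>cube (child x r s) (r / 2). ennreal (norm (b y - g y)) \<partial>lebesgue) + 2 * (ennreal \<omega> * (\<Sum>s\<in>(UNIV :: ('n \<Rightarrow> bool) set). ennreal ((r / 2) ^ CARD('n))))"
    by (simp only: sum.distrib sum_distrib_left)
  also have "(\<Sum>s\<in>UNIV. \<integral>\<^sup>+y\<in>cube (child x r s) (r / 2). ennreal (norm (b y - g y)) \<partial>lebesgue) = (\<integral>\<^sup>+y\<in>cube x r. ennreal (norm (b y - g y)) \<partial>lebesgue)"
    using Suc.prems(1) by (intro nn_integral_cube_children[symmetric]) auto
  finally show ?case by (simp only: vol)
qed

text \<open>Two dominated convergence arguments: first b is projected onto a large ball, then the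
  projection is approximated through continuous functions converging to b almost everywhere. Being
  continuous and bounded, the projection preserves continuity of the approximants and provides the
  dominating constant on the cube.\<close>

lemma continuous_approx:
  assumes "0 < \<epsilon>"
  obtains g where "continuous_on UNIV g" "(\<integral>\<^sup>+y\<in>cube x r. ennreal (norm (b y - g y)) \<partial>lebesgue) \<le> ennreal \<epsilon>"
proof -
  define Q where "Q = cube x r"
  have [measurable]: "Q \<in> sets lebesgue" by (simp add: Q_def)
  have finQ: "emeasure lebesgue Q < \<infinity>"
    using emeasure_compact_finite[OF compact_cube, of x r] by (simp add: Q_def)
  define R where "R M = closest_point (cball (0::complex) (real M))" for M
  have Rc: "continuous_on UNIV (R M)" for M
    unfolding R_def by (intro continuous_on_closest_point) auto
  have Rn: "norm (R M z) \<le> real M" for M z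
    using closest_point_in_set[of "cball (0::complex) (real M)" z] by (auto simp: R_def)
  have Rs: "R M z = z" if "norm z \<le> real M" for M z
    unfolding R_def by (rule closest_point_self) (use that in auto)
  have [measurable]: "R M \<in> borel_measurable borel" for M
    by (rule borel_measurable_continuous_onI) (rule Rc)
  have "(\<lambda>M. \<integral>\<^sup>+y\<in>Q. ennreal (norm (b y - R M (b y))) \<partial>lebesgue) \<longlonglongrightarrow> (\<integral>\<^sup>+y\<in>Q. 0 \<partial>lebesgue)"
  proof (rule nn_integral_dominated_convergence[where w="\<lambda>y. 2 * (ennreal (norm (b y - 0)) * indicator Q y)"])
    show "(\<integral>\<^sup>+y. 2 * (ennreal (norm (b y - 0)) * indicator Q y) \<partial>lebesgue) < \<infinity>"
      using nn_integral_cube_norm_finite[where x=x and r=r and a=0] unfolding Q_def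
      by (subst nn_integral_cmult) (auto simp: ennreal_mult_less_top)
    show "AE y in lebesgue. ennreal (norm (b y - R M (b y))) * indicator Q y \<le> 2 * (ennreal (norm (b y - 0)) * indicator Q y)" for M
    proof (rule AE_I2)
      fix y
      have "norm (b y - R M (b y)) \<le> 2 * norm (b y)"
      proof (cases "norm (b y) \<le> real M")
        case False
        then show ?thesis using norm_triangle_ineq4[of "b y" "R M (b y)"] Rn[of M "b y"] by linarith
      qed (simp add: Rs)
      then have "ennreal (norm (b y - R M (b y))) \<le> ennreal (2 * norm (b y))" by (rule ennreal_leI)
      then show "ennreal (norm (b y - R M (b y))) * indicator Q y \<le> 2 * (ennreal (norm (b y - 0)) * indicator Q y)"
        by (auto simp: indicator_def ennreal_mult)
    qed
    show "AE y in lebesgue. (\<lambda>M. ennreal (norm (b y - R M (b y))) * indicator Q y) \<longlonglongrightarrow> 0 * indicator Q y"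
    proof (rule AE_I2)
      fix y
      obtain M0 :: nat where M0: "norm (b y) \<le> real M0" using real_arch_simple by blast
      have "\<forall>\<^sub>F M in sequentially. ennreal (norm (b y - R M (b y))) * indicator Q y = 0 * indicator Q y"
        unfolding eventually_sequentially
      proof (intro exI[of _ M0] allI impI)
        fix M assume "M0 \<le> M"
        then have "R M (b y) = b y" using M0 by (intro Rs) linarith
        then show "ennreal (norm (b y - R M (b y))) * indicator Q y = 0 * indicator Q y" by simp
      qed
      then show "(\<lambda>M. ennreal (norm (b y - R M (b y))) * indicator Q y) \<longlonglongrightarrow> 0 * indicator Q y"
        by (rule tendsto_eventually)
    qed
  qed measurable
  then have "(\<lambda>M. \<integral>\<^sup>+y\<in>Q. ennreal (norm (b y - R M (b y))) \<partial>lebesgue) \<longlonglongrightarrow> 0" by simp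
  moreover have "0 < ennreal (\<epsilon> / 2)" using assms by simp
  ultimately have "\<forall>\<^sub>F M in sequentially. (\<integral>\<^sup>+y\<in>Q. ennreal (norm (b y - R M (b y))) \<partial>lebesgue) < ennreal (\<epsilon> / 2)"
    by (rule order_tendstoD)
  from eventually_happens'[OF sequentially_bot this] obtain M where M: "(\<integral>\<^sup>+y\<in>Q. ennreal (norm (b y - R M (b y))) \<partial>lebesgue) < ennreal (\<epsilon> / 2)"
    by blast
  have "b measurable_on UNIV"
    by (intro lebesgue_measurable_imp_measurable_on) auto
  then have "\<exists>N g. negligible N \<and> (\<forall>n. continuous_on UNIV (g n)) \<and> (\<forall>y. y \<notin> N \<longrightarrow> (\<lambda>n. g n y) \<longlonglongrightarrow> b y)"
    unfolding measurable_on_def by simp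
  then obtain N g where N: "negligible N" "\<And>n. continuous_on UNIV (g n)"
    "\<And>y. y \<notin> N \<Longrightarrow> (\<lambda>n. g n y) \<longlonglongrightarrow> b y"
    by blast
  have gm: "g n \<in> borel_measurable lebesgue" for n
    using borel_measurable_continuous_onI[OF N(2)] by (simp add: measurable_completion)
  note [measurable] = gm
  have "(\<lambda>n. \<integral>\<^sup>+y\<in>Q. ennreal (norm (R M (b y) - R M (g n y))) \<partial>lebesgue) \<longlonglongrightarrow> (\<integral>\<^sup>+y\<in>Q. 0 \<partial>lebesgue)"
  proof (rule nn_integral_dominated_convergence[where w="\<lambda>y. ennreal (2 * real M) * indicator Q y"])
    show "(\<integral>\<^sup>+y. ennreal (2 * real M) * indicator Q y \<partial>lebesgue) < \<infinity>"
      using finQ by (simp add: nn_integral_cmult ennreal_mult_less_top)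
    show "AE y in lebesgue. ennreal (norm (R M (b y) - R M (g n y))) * indicator Q y \<le> ennreal (2 * real M) * indicator Q y" for n
    proof (intro AE_I2 mult_right_mono ennreal_leI)
      fix y
      show "norm (R M (b y) - R M (g n y)) \<le> 2 * real M"
        using norm_triangle_ineq4[of "R M (b y)" "R M (g n y)"] Rn[of M "b y"] Rn[of M "g n y"] by linarith
    qed simp
    have "AE y in lebesgue. y \<notin> N" using N(1) by (intro AE_not_in) (simp add: negligible_iff_null_sets)
    then show "AE y in lebesgue. (\<lambda>n. ennreal (norm (R M (b y) - R M (g n y))) * indicator Q y) \<longlonglongrightarrow> 0 * indicator Q y"
    proof eventually_elim
      case (elim y)
      have "(\<lambda>n. R M (g n y)) \<longlonglongrightarrow> R M (b y)"
        by (rule continuous_on_tendsto_compose[OF Rc N(3)[OF elim]]) auto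
      then have "(\<lambda>n. norm (R M (b y) - R M (g n y))) \<longlonglongrightarrow> norm (R M (b y) - R M (b y))"
        by (intro tendsto_intros)
      then have "(\<lambda>n. ennreal (norm (R M (b y) - R M (g n y)))) \<longlonglongrightarrow> ennreal 0"
        by (intro tendsto_ennrealI) simp
      then show ?case by (cases "y \<in> Q") auto
    qed
  qed measurable
  then have "(\<lambda>n. \<integral>\<^sup>+y\<in>Q. ennreal (norm (R M (b y) - R M (g n y))) \<partial>lebesgue) \<longlonglongrightarrow> 0" by simp
  moreover have "0 < ennreal (\<epsilon> / 2)" using assms by simp
  ultimately have "\<forall>\<^sub>F n in sequentially. (\<integral>\<^sup>+y\<in>Q. ennreal (norm (R M (b y) - R M (g n y))) \<partial>lebesgue) < ennreal (\<epsilon> / 2)"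
    by (rule order_tendstoD)
  from eventually_happens'[OF sequentially_bot this] obtain n where n: "(\<integral>\<^sup>+y\<in>Q. ennreal (norm (R M (b y) - R M (g n y))) \<partial>lebesgue) < ennreal (\<epsilon> / 2)"
    by blast
  show thesis
  proof (rule that)
    show "continuous_on UNIV (\<lambda>y. R M (g n y))"
      by (rule continuous_on_compose2[OF Rc N(2)]) auto
    have "(\<integral>\<^sup>+y\<in>Q. ennreal (norm (b y - R M (g n y))) \<partial>lebesgue)
      \<le> (\<integral>\<^sup>+y. ennreal (norm (b y - R M (b y))) * indicator Q y + ennreal (norm (R M (b y) - R M (g n y))) * indicator Q y \<partial>lebesgue)"
    proof (intro nn_integral_mono)
      fix y
      have "norm (b y - R M (g n y)) \<le> norm (b y - R M (b y)) + norm (R M (b y) - R M (g n y))"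
        using norm_triangle_ineq[of "b y - R M (b y)" "R M (b y) - R M (g n y)"] by simp
      then have "ennreal (norm (b y - R M (g n y))) \<le> ennreal (norm (b y - R M (b y))) + ennreal (norm (R M (b y) - R M (g n y)))"
        by (simp add: ennreal_leI flip: ennreal_plus)
      then show "ennreal (norm (b y - R M (g n y))) * indicator Q y
        \<le> ennreal (norm (b y - R M (b y))) * indicator Q y + ennreal (norm (R M (b y) - R M (g n y))) * indicator Q y"
        by (auto simp: indicator_def)
    qed
    also have "\<dots> = (\<integral>\<^sup>+y\<in>Q. ennreal (norm (b y - R M (b y))) \<partial>lebesgue) + (\<integral>\<^sup>+y\<in>Q. ennreal (norm (R M (b y) - R M (g n y))) \<partial>lebesgue)"
      by (intro nn_integral_add) measurable
    also have "\<dots> \<le> ennreal (\<epsilon> / 2) + ennreal (\<epsilon> / 2)"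
      using M n by (intro add_mono) auto
    also have "\<dots> = ennreal \<epsilon>" using assms by (simp flip: ennreal_plus)
    finally show "(\<integral>\<^sup>+y\<in>cube x r. ennreal (norm (b y - R M (g n y))) \<partial>lebesgue) \<le> ennreal \<epsilon>"
      by (simp add: Q_def)
  qed
qed

text \<open>Takes the part of the Lebesgue differentiation theorem in the John--Nirenberg argument:
  what is left after many generations is negligible in mean. Uniform continuity of an approximant on
  the compact cube is all that is needed.\<close>

lemma gen_osc_small:
  assumes "0 < r" "0 < \<epsilon>"
  obtains N where "gen_osc N x r \<le> ennreal \<epsilon>"
proof -
  define m where "m = r ^ CARD('n)"
  have m: "0 < m" using assms by (simp add: m_def)
  obtain g where g: "continuous_on UNIV g" "(\<integral>\<^sup>+y\<in>cube x r. ennreal (norm (b y - g y)) \<partial>lebesgue) \<le> ennreal (\<epsilon> / 4)"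
    using continuous_approx[of "\<epsilon> / 4" x r] assms by auto
  have "uniformly_continuous_on (cube x r) g"
    by (rule compact_uniformly_continuous) (auto intro: continuous_on_subset[OF g(1)])
  moreover define \<omega> where "\<omega> = \<epsilon> / (4 * m)"
  moreover have \<omega>: "0 < \<omega>" using assms m by (simp add: \<omega>_def)
  ultimately obtain d where d: "0 < d" "\<And>y y'. y \<in> cube x r \<Longrightarrow> y' \<in> cube x r \<Longrightarrow> dist y' y < d \<Longrightarrow> dist (g y') (g y) < \<omega>"
    unfolding uniformly_continuous_on_def by metis
  obtain N where N: "real CARD('n) * r / d < 2 ^ N" using real_arch_pow[of 2] by auto
  have [measurable]: "g \<in> borel_measurable lebesgue"
    using borel_measurable_continuous_onI[OF g(1)] by (simp add: measurable_completion)
  have "gen_osc N x r \<le> 2 * (\<integral>\<^sup>+y\<in>cube x r. ennreal (norm (b y - g y)) \<partial>lebesgue) + 2 * (ennreal \<omega> * ennreal (r ^ CARD('n)))"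
  proof (rule gen_osc_le)
    fix y y' assume y: "y \<in> cube x r" "y' \<in> cube x r" "\<And>i. \<bar>y $ i - y' $ i\<bar> \<le> r / 2 ^ N"
    have "(\<Sum>i\<in>UNIV. \<bar>(y - y') $ i\<bar>) \<le> real CARD('n) * (r / 2 ^ N)"
      using sum_bounded_above[of "UNIV :: 'n set" "\<lambda>i. \<bar>(y - y') $ i\<bar>" "r / 2 ^ N"] y(3) by simp
    then have "norm (y - y') \<le> real CARD('n) * (r / 2 ^ N)"
      using norm_le_l1_cart[of "y - y'"] by linarith
    also have "\<dots> < d" using N d(1) by (simp add: field_simps)
    finally have "dist (g y) (g y') < \<omega>" using y by (intro d(2)) (auto simp: dist_norm)
    then show "norm (g y - g y') \<le> \<omega>" by (simp add: dist_norm)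
  qed (use assms \<omega> in auto)
  also have "\<dots> \<le> 2 * ennreal (\<epsilon> / 4) + 2 * (ennreal \<omega> * ennreal m)"
    unfolding m_def by (intro add_mono mult_left_mono g(2)) auto
  also have "\<dots> = ennreal (2 * (\<epsilon> / 4) + 2 * (\<omega> * m))"
  proof -
    have "ennreal (2 * (\<epsilon> / 4)) = ennreal 2 * ennreal (\<epsilon> / 4)"
      using assms by (intro ennreal_mult) auto
    moreover have "ennreal (2 * (\<omega> * m)) = ennreal 2 * (ennreal \<omega> * ennreal m)"
      using \<omega> m by (simp only: ennreal_mult less_imp_le mult_nonneg_nonneg zero_le_numeral)
    ultimately show ?thesis
      using assms \<omega> m by (subst ennreal_plus) auto
  qed
  also have "2 * (\<epsilon> / 4) + 2 * (\<omega> * m) = \<epsilon>" using m by (simp add: \<omega>_def)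
  finally show thesis by (rule that)
qed

end

section \<open>Exponential integrability of BMO functions\<close>

text \<open>For m the minimum, 1 - 1/m \<le> ln m \<le> u, hence m - 1 \<le> m u \<le> L u. This
  lets the truncated exponential on the last generation be controlled by the plain oscillation, with
  a factor L that the smallness of \<open>gen_osc\<close> absorbs.\<close>

lemma min_exp_le_linear:
  fixes u L :: real
  assumes "1 \<le> L" "0 \<le> u"
  shows "min (exp u) L \<le> 1 + L * u"
proof -
  define m where "m = min (exp u) L"
  have m: "1 \<le> m" "m \<le> L" "m \<le> exp u" using assms by (auto simp: m_def)
  have "ln m \<le> ln (exp u)" using m by (subst ln_le_cancel_iff) auto
  then have "ln m \<le> u" by simp
  moreover have "1 - 1 / m \<le> ln m" using ln_le_minus_one[of "1 / m"] m by (simp add: ln_div)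
  ultimately have "1 - 1 / m \<le> u" by linarith
  then have "m * (1 - 1 / m) \<le> m * u" using m by (intro mult_left_mono) auto
  also have "\<dots> \<le> L * u" using m assms by (intro mult_right_mono) auto
  also have "m * (1 - 1 / m) = m - 1" using m by (simp add: right_diff_distrib)
  finally show ?thesis by (simp add: m_def)
qed

lemma ennreal_double: "0 \<le> a \<Longrightarrow> 2 * ennreal a = ennreal (2 * a)"
  by (simp add: ennreal_mult)

text \<open>Chosen so that exp (\<epsilon> * (4 + 2 ^ n)) = 2: the height 4 is the drift allowed
  before stopping, and 2 ^ n the largest jump of the average from a normalized cube to one of its
  children.\<close>

definition jn_const :: "'n::finite itself \<Rightarrow> real" where
  "jn_const _ = ln 2 / (4 + 2 ^ CARD('n))"

lemma jn_const_pos: "0 < jn_const TYPE('n::finite)"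
  by (auto simp: jn_const_def intro!: divide_pos_pos add_pos_pos)

text \<open>Either \<open>b_Q\<close> is still close to the reference value \<open>a\<close>, and the estimate is passed on to the
  children, or a child has drifted away from \<open>a\<close>; such children are few, because they contribute at
  least \<open>4\<close> times their measure to the mean oscillation, and \<open>hyp\<close> applies to them.  After
  \<open>N\<close> generations the cubes that are left have total oscillation \<open>gen_osc b N x r\<close>.\<close>

lemma jn_generation:
  fixes b :: "'n::finite cfun"
  assumes loc: "b locally_integrable_on UNIV"
    and osc: "\<And>x r. 0 < r \<Longrightarrow> (\<integral>\<^sup>+y\<in>cube x r. ennreal (norm (b y - average b (cube x r))) \<partial>lebesgue) \<le> ennreal (r ^ CARD('n))"
    and L: "1 \<le> L" and \<epsilon>: "\<epsilon> = jn_const TYPE('n)" and X: "0 \<le> X"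
    and hyp: "\<And>x r. 0 < r \<Longrightarrow> (\<integral>\<^sup>+y\<in>cube x r. ennreal (min (exp (\<epsilon> * norm (b y - average b (cube x r)))) L) \<partial>lebesgue) \<le> ennreal X * ennreal (r ^ CARD('n))"
    and r: "0 < r" and a: "norm (average b (cube x r) - a) \<le> 4"
  shows "(\<integral>\<^sup>+y\<in>cube x r. ennreal (min (exp (\<epsilon> * norm (b y - a))) L) \<partial>lebesgue)
    \<le> 2 * (ennreal (r ^ CARD('n)) + ennreal (L * \<epsilon>) * gen_osc b N x r)
      + ennreal (X / 2) * (\<integral>\<^sup>+y\<in>cube x r. ennreal (norm (b y - a)) \<partial>lebesgue)"
proof -
  note [measurable] = loc_measurable[OF loc]
  have \<epsilon>0: "0 < \<epsilon>" using jn_const_pos \<epsilon> by simp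
  have \<epsilon>exp: "exp (\<epsilon> * c) \<le> 2" if "c \<le> 4 + 2 ^ CARD('n)" for c
  proof -
    have pos: "0 < 4 + (2::real) ^ CARD('n)" by (intro add_pos_pos) auto
    have "\<epsilon> * c \<le> \<epsilon> * (4 + 2 ^ CARD('n))" using that \<epsilon>0 by (intro mult_left_mono) auto
    also have "\<dots> = ln 2" using pos by (simp add: \<epsilon> jn_const_def)
    finally have "exp (\<epsilon> * c) \<le> exp (ln 2)" by (simp only: exp_le_cancel_iff)
    also have "exp (ln 2) = (2::real)" by simp
    finally show ?thesis .
  qed
  \<comment> \<open>Moving the reference value by the largest drift that can occur costs only a
    factor 2, by the choice of \<epsilon>.\<close>
  have shift: "min (exp (\<epsilon> * norm (z - a))) L \<le> 2 * min (exp (\<epsilon> * norm (z - a'))) L"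
    if "norm (a' - a) \<le> 4 + 2 ^ CARD('n)" for z a a' :: complex
  proof -
    have "norm (z - a) \<le> norm (a' - a) + norm (z - a')"
      using norm_triangle_ineq[of "a' - a" "z - a'"] by simp
    then have "\<epsilon> * norm (z - a) \<le> \<epsilon> * norm (a' - a) + \<epsilon> * norm (z - a')"
      using \<epsilon>0 by (simp flip: distrib_left)
    then have "exp (\<epsilon> * norm (z - a)) \<le> exp (\<epsilon> * norm (a' - a)) * exp (\<epsilon> * norm (z - a'))"
      by (simp flip: exp_add)
    also have "\<dots> \<le> 2 * exp (\<epsilon> * norm (z - a'))"
      by (intro mult_right_mono \<epsilon>exp that) simp
    finally show ?thesis using L by (auto simp: min_def)
  qed
  show ?thesis using r a
  proof (induction N arbitrary: x r)
    case (0 x r)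
    define Q where "Q = cube x r"
    have [measurable]: "Q \<in> sets lebesgue" by (simp add: Q_def)
    have Qe: "emeasure lebesgue Q = ennreal (r ^ CARD('n))" using 0 by (simp add: Q_def emeasure_cube)
    have "(\<integral>\<^sup>+y\<in>Q. ennreal (min (exp (\<epsilon> * norm (b y - a))) L) \<partial>lebesgue)
      \<le> (\<integral>\<^sup>+y. 2 * indicator Q y + 2 * ennreal (L * \<epsilon>) * (ennreal (norm (b y - average b Q)) * indicator Q y) \<partial>lebesgue)"
    proof (intro nn_integral_mono)
      fix y
      have "norm (average b Q - a) \<le> 4 + 2 ^ CARD('n)"
        using 0(2) zero_less_power[of "2::real" "CARD('n)"] unfolding Q_def by linarith
      then have "min (exp (\<epsilon> * norm (b y - a))) L \<le> 2 * min (exp (\<epsilon> * norm (b y - average b Q))) L"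
        by (rule shift)
      also have "\<dots> \<le> 2 * (1 + L * (\<epsilon> * norm (b y - average b Q)))"
        using \<epsilon>0 by (intro mult_left_mono min_exp_le_linear L) auto
      finally have "ennreal (min (exp (\<epsilon> * norm (b y - a))) L) \<le> ennreal (2 + 2 * ((L * \<epsilon>) * norm (b y - average b Q)))"
        by (intro ennreal_leI) (simp add: mult.assoc)
      also have "\<dots> = 2 + 2 * ennreal (L * \<epsilon>) * ennreal (norm (b y - average b Q))"
        using L \<epsilon>0 by (subst ennreal_plus) (auto simp: ennreal_mult mult.assoc)
      finally show "ennreal (min (exp (\<epsilon> * norm (b y - a))) L) * indicator Q y
        \<le> 2 * indicator Q y + 2 * ennreal (L * \<epsilon>) * (ennreal (norm (b y - average b Q)) * indicator Q y)"
        by (auto simp: indicator_def)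
    qed
    also have "\<dots> = 2 * ennreal (r ^ CARD('n)) + 2 * ennreal (L * \<epsilon>) * (\<integral>\<^sup>+y\<in>Q. ennreal (norm (b y - average b Q)) \<partial>lebesgue)"
      by (subst nn_integral_add) (auto simp: nn_integral_cmult Qe)
    also have "\<dots> = 2 * (ennreal (r ^ CARD('n)) + ennreal (L * \<epsilon>) * gen_osc b 0 x r)"
      by (simp add: gen_osc.simps[OF loc] Q_def distrib_left mult.assoc)
    finally show ?case unfolding Q_def by (rule order_trans) simp
  next
    case (Suc N x r)
    define P where "P s = cube (child x r s) (r / 2)" for s
    have r2: "0 < r / 2" using Suc by simp
    have Pm[measurable]: "P s \<in> sets lebesgue" for s by (simp add: P_def)
    define A where "A s = (\<integral>\<^sup>+y\<in>P s. ennreal (norm (b y - a)) \<partial>lebesgue)" for s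
    have Asum: "(\<Sum>s\<in>UNIV. A s) = (\<integral>\<^sup>+y\<in>cube x r. ennreal (norm (b y - a)) \<partial>lebesgue)"
      unfolding A_def P_def using Suc.prems(1) by (intro nn_integral_cube_children[symmetric]) auto
    have child_bound: "(\<integral>\<^sup>+y\<in>P s. ennreal (min (exp (\<epsilon> * norm (b y - a))) L) \<partial>lebesgue)
       \<le> 2 * (ennreal ((r / 2) ^ CARD('n)) + ennreal (L * \<epsilon>) * gen_osc b N (child x r s) (r / 2)) + ennreal (X / 2) * A s" for s
    proof (cases "norm (average b (P s) - a) \<le> 4")
      case True
      then show ?thesis unfolding A_def P_def by (intro Suc.IH r2)
    next
      case False
      define m where "m = (r / 2) ^ CARD('n)"
      have m: "0 < m" using r2 by (simp add: m_def)
      have "ennreal (norm (average b (P s) - average b (cube x r)) * m) = ennreal (norm (average b (P s) - average b (cube x r))) * ennreal ((r / 2) ^ CARD('n))"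
        unfolding m_def using r2 by (intro ennreal_mult) auto
      also have "\<dots> \<le> (\<integral>\<^sup>+y\<in>P s. ennreal (norm (b y - average b (cube x r))) \<partial>lebesgue)"
        unfolding P_def by (rule average_diff_le[OF loc r2])
      also have "\<dots> \<le> (\<integral>\<^sup>+y\<in>cube x r. ennreal (norm (b y - average b (cube x r))) \<partial>lebesgue)"
        using child_subset_cube[OF Suc.prems(1), of x s] unfolding P_def
        by (intro nn_integral_mono) (auto simp: indicator_def)
      also have "\<dots> \<le> ennreal (r ^ CARD('n))" by (rule osc) fact
      finally have "norm (average b (P s) - average b (cube x r)) * m \<le> r ^ CARD('n)"
        using Suc.prems(1) by (subst (asm) ennreal_le_iff) auto
      also have "r ^ CARD('n) = 2 ^ CARD('n) * m" by (simp add: m_def power_divide)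
      finally have "norm (average b (P s) - average b (cube x r)) \<le> 2 ^ CARD('n)" using m by simp
      \<comment> \<open>The parent average is still within 4 of \<open>a\<close>; the mean
        oscillation of the parent is at most 1 and a child has 2 ^ - n of its measure, so the child
        average is within 2 ^ n of the parent average.\<close>
      then have near: "norm (average b (P s) - a) \<le> 4 + 2 ^ CARD('n)"
        using norm_triangle_ineq[of "average b (P s) - average b (cube x r)" "average b (cube x r) - a"] Suc.prems(2) by simp
      have "(\<integral>\<^sup>+y\<in>P s. ennreal (min (exp (\<epsilon> * norm (b y - a))) L) \<partial>lebesgue)
        \<le> (\<integral>\<^sup>+y. 2 * (ennreal (min (exp (\<epsilon> * norm (b y - average b (P s)))) L) * indicator (P s) y) \<partial>lebesgue)"
      proof (intro nn_integral_mono)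
        fix y
        have "ennreal (min (exp (\<epsilon> * norm (b y - a))) L) \<le> ennreal (2 * min (exp (\<epsilon> * norm (b y - average b (P s)))) L)"
          by (intro ennreal_leI shift near)
        also have "\<dots> = 2 * ennreal (min (exp (\<epsilon> * norm (b y - average b (P s)))) L)"
          using L by (subst ennreal_mult) auto
        finally show "ennreal (min (exp (\<epsilon> * norm (b y - a))) L) * indicator (P s) y \<le> 2 * (ennreal (min (exp (\<epsilon> * norm (b y - average b (P s)))) L) * indicator (P s) y)"
          by (auto simp: indicator_def)
      qed
      also have "\<dots> = 2 * (\<integral>\<^sup>+y\<in>P s. ennreal (min (exp (\<epsilon> * norm (b y - average b (P s)))) L) \<partial>lebesgue)"
        by (rule nn_integral_cmult) measurable
      also have "\<dots> \<le> 2 * (ennreal X * ennreal m)"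
        unfolding P_def m_def by (intro mult_left_mono hyp r2) simp
      \<comment> \<open>A drift of more than 4 means that 4 m is at most the integral
        \<open>A s\<close> of |b - a| over the child. So 2 X m becomes half of X times
        \<open>A s\<close>, and the halving is what makes the later iteration contract.\<close>
      also have "\<dots> = ennreal (X / 2) * ennreal (4 * m)"
      proof -
        have "2 * (ennreal X * ennreal m) = ennreal (2 * (X * m))"
        proof -
          have "ennreal X * ennreal m = ennreal (X * m)" using X m by (intro ennreal_mult[symmetric]) auto
          then show ?thesis using X m by (simp only: ennreal_double mult_nonneg_nonneg less_imp_le)
        qed
        also have "2 * (X * m) = (X / 2) * (4 * m)" by simp
        also have "ennreal ((X / 2) * (4 * m)) = ennreal (X / 2) * ennreal (4 * m)"
          using X m by (intro ennreal_mult) auto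
        finally show ?thesis .
      qed
      also have "\<dots> \<le> ennreal (X / 2) * A s"
      proof (intro mult_left_mono)
        have "ennreal (4 * m) \<le> ennreal (norm (average b (P s) - a) * m)"
          using False m by (intro ennreal_leI mult_right_mono) auto
        also have "\<dots> = ennreal (norm (average b (P s) - a)) * ennreal ((r / 2) ^ CARD('n))"
          unfolding m_def using r2 by (intro ennreal_mult) auto
        also have "\<dots> \<le> A s" unfolding A_def P_def by (rule average_diff_le[OF loc r2])
        finally show "ennreal (4 * m) \<le> A s" .
      qed simp
      finally show ?thesis by (rule order_trans) simp
    qed
    have vol: "(\<Sum>s\<in>(UNIV :: ('n \<Rightarrow> bool) set). ennreal ((r / 2) ^ CARD('n))) = ennreal (r ^ CARD('n))"
    proof -
      have "(\<Sum>s\<in>(UNIV :: ('n \<Rightarrow> bool) set). ennreal ((r / 2) ^ CARD('n))) = of_nat (2 ^ CARD('n)) * ennreal ((r / 2) ^ CARD('n))"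
        by (simp add: card_fun)
      also have "\<dots> = ennreal (2 ^ CARD('n) * (r / 2) ^ CARD('n))"
        using Suc.prems(1) by (simp add: ennreal_mult ennreal_of_nat_eq_real_of_nat)
      finally show ?thesis by (simp add: power_divide)
    qed
    have "(\<integral>\<^sup>+y\<in>cube x r. ennreal (min (exp (\<epsilon> * norm (b y - a))) L) \<partial>lebesgue)
      = (\<Sum>s\<in>UNIV. \<integral>\<^sup>+y\<in>P s. ennreal (min (exp (\<epsilon> * norm (b y - a))) L) \<partial>lebesgue)"
      unfolding P_def using Suc.prems(1) by (intro nn_integral_cube_children) auto
    also have "\<dots> \<le> (\<Sum>s\<in>UNIV. 2 * (ennreal ((r / 2) ^ CARD('n)) + ennreal (L * \<epsilon>) * gen_osc b N (child x r s) (r / 2)) + ennreal (X / 2) * A s)"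
      by (intro sum_mono child_bound)
    also have "\<dots> = 2 * ((\<Sum>s\<in>(UNIV :: ('n \<Rightarrow> bool) set). ennreal ((r / 2) ^ CARD('n))) + ennreal (L * \<epsilon>) * (\<Sum>s\<in>UNIV. gen_osc b N (child x r s) (r / 2))) + ennreal (X / 2) * (\<Sum>s\<in>UNIV. A s)"
      by (simp only: sum.distrib sum_distrib_left[symmetric])
    finally show ?case
      by (simp only: vol Asum gen_osc.simps(2)[OF loc])
  qed
qed

text \<open>Taking the average itself as reference value, the generation estimate improves a uniform
  bound X to 2 + X/2, since the oscillation of a cube is at most its measure. This map has fixed
  point 4, so iteration from any finite bound yields 4, independently of the truncation height L
  that supplied the finite start.\<close>

lemma jn_truncated:
  fixes b :: "'n::finite cfun"
  assumes loc: "b locally_integrable_on UNIV"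
    and osc: "\<And>x r. 0 < r \<Longrightarrow> (\<integral>\<^sup>+y\<in>cube x r. ennreal (norm (b y - average b (cube x r))) \<partial>lebesgue) \<le> ennreal (r ^ CARD('n))"
    and L: "1 \<le> L" and \<epsilon>: "\<epsilon> = jn_const TYPE('n)" and "0 < r"
  shows "(\<integral>\<^sup>+y\<in>cube x r. ennreal (min (exp (\<epsilon> * norm (b y - average b (cube x r)))) L) \<partial>lebesgue) \<le> ennreal (4 * r ^ CARD('n))"
proof -
  have \<epsilon>0: "0 < \<epsilon>" using jn_const_pos \<epsilon> by simp
  define H where "H X \<longleftrightarrow> (\<forall>x r. 0 < r \<longrightarrow> (\<integral>\<^sup>+y\<in>cube x r. ennreal (min (exp (\<epsilon> * norm (b y - average b (cube x r)))) L) \<partial>lebesgue) \<le> ennreal X * ennreal (r ^ CARD('n)))" for X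
  have step: "H (2 + X / 2)" if HX: "H X" and X: "0 \<le> X" for X
    unfolding H_def
  proof (intro allI impI)
    fix x :: "real^'n" and r :: real assume r: "0 < r"
    define m where "m = r ^ CARD('n)"
    have m: "0 < m" using r by (simp add: m_def)
    have "(\<integral>\<^sup>+y\<in>cube x r. ennreal (min (exp (\<epsilon> * norm (b y - average b (cube x r)))) L) \<partial>lebesgue)
      \<le> ennreal ((2 + X / 2) * m) + ennreal \<eta>" if \<eta>: "0 < \<eta>" for \<eta>
    proof -
      have "0 < \<eta> / (2 * (L * \<epsilon>))" using \<eta> L \<epsilon>0 by (intro divide_pos_pos mult_pos_pos) auto
      from gen_osc_small[OF loc r this] obtain N where N: "gen_osc b N x r \<le> ennreal (\<eta> / (2 * (L * \<epsilon>)))" .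
      have "(\<integral>\<^sup>+y\<in>cube x r. ennreal (min (exp (\<epsilon> * norm (b y - average b (cube x r)))) L) \<partial>lebesgue)
        \<le> 2 * (ennreal (r ^ CARD('n)) + ennreal (L * \<epsilon>) * gen_osc b N x r)
          + ennreal (X / 2) * (\<integral>\<^sup>+y\<in>cube x r. ennreal (norm (b y - average b (cube x r))) \<partial>lebesgue)"
        by (rule jn_generation[OF loc osc L \<epsilon> X _ r]) (use HX in \<open>auto simp: H_def\<close>)
      also have "\<dots> \<le> 2 * (ennreal m + ennreal (L * \<epsilon>) * ennreal (\<eta> / (2 * (L * \<epsilon>)))) + ennreal (X / 2) * ennreal m"
        unfolding m_def by (intro add_mono mult_left_mono N osc r) auto
      also have "\<dots> = ennreal ((2 + X / 2) * m) + ennreal \<eta>"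
      proof -
        have "0 < L * \<epsilon>" using L \<epsilon>0 by simp
        then have eq1: "ennreal (L * \<epsilon>) * ennreal (\<eta> / (2 * (L * \<epsilon>))) = ennreal (\<eta> / 2)"
          using \<eta> by (subst ennreal_mult[symmetric]) auto
        have "ennreal m + ennreal (\<eta> / 2) = ennreal (m + \<eta> / 2)"
          using m \<eta> by (intro ennreal_plus[symmetric]) auto
        moreover have "2 * ennreal (m + \<eta> / 2) = ennreal (2 * (m + \<eta> / 2))"
          using m \<eta> by (intro ennreal_double) auto
        ultimately have eq2: "2 * (ennreal m + ennreal (\<eta> / 2)) = ennreal (2 * (m + \<eta> / 2))"
          by (simp only:)
        have eq3: "ennreal (X / 2) * ennreal m = ennreal (X / 2 * m)"
          using X m by (intro ennreal_mult[symmetric]) auto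
          have "ennreal (2 * (m + \<eta> / 2)) + ennreal (X / 2 * m) = ennreal (2 * (m + \<eta> / 2) + X / 2 * m)"
          by (rule ennreal_plus[symmetric]) (use X m \<eta> in auto)
        also have "2 * (m + \<eta> / 2) + X / 2 * m = (2 + X / 2) * m + \<eta>"
            by (simp add: algebra_simps)
          also have "ennreal ((2 + X / 2) * m + \<eta>) = ennreal ((2 + X / 2) * m) + ennreal \<eta>"
            by (rule ennreal_plus) (use X m \<eta> in auto)
        finally show ?thesis by (simp only: eq1 eq2 eq3)
      qed
      finally show ?thesis .
    qed
    then have "(\<integral>\<^sup>+y\<in>cube x r. ennreal (min (exp (\<epsilon> * norm (b y - average b (cube x r)))) L) \<partial>lebesgue) \<le> ennreal ((2 + X / 2) * m)"
      by (rule ennreal_le_epsilon)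
    also have "\<dots> = ennreal (2 + X / 2) * ennreal m" using X m by (intro ennreal_mult) auto
    finally show "(\<integral>\<^sup>+y\<in>cube x r. ennreal (min (exp (\<epsilon> * norm (b y - average b (cube x r)))) L) \<partial>lebesgue) \<le> ennreal (2 + X / 2) * ennreal (r ^ CARD('n))"
      by (simp only: m_def)
  qed
  \<comment> \<open>L alone would bound the truncated integrand; adding 4 makes the iterates exactly
    4 + L / 2 ^ k.\<close>
  have base: "H (4 + L)"
    unfolding H_def
  proof (intro allI impI)
    fix x :: "real^'n" and r :: real assume r: "0 < r"
    have "(\<integral>\<^sup>+y\<in>cube x r. ennreal (min (exp (\<epsilon> * norm (b y - average b (cube x r)))) L) \<partial>lebesgue)
      \<le> (\<integral>\<^sup>+y\<in>cube x r. ennreal (4 + L) \<partial>lebesgue)"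
      by (intro nn_integral_cube_mono ennreal_leI) auto
    also have "\<dots> = ennreal (4 + L) * ennreal (r ^ CARD('n))"
      using r by (subst nn_integral_cmult) (auto simp: emeasure_cube)
    finally show "(\<integral>\<^sup>+y\<in>cube x r. ennreal (min (exp (\<epsilon> * norm (b y - average b (cube x r)))) L) \<partial>lebesgue)
      \<le> ennreal (4 + L) * ennreal (r ^ CARD('n))" .
  qed
  have Hk: "H (4 + L / 2 ^ k)" for k
  proof (induction k)
    case (Suc k)
    have "H (2 + (4 + L / 2 ^ k) / 2)" using Suc L by (intro step) auto
    then show ?case by (simp add: add_divide_distrib mult.commute)
  qed (use base in simp)
  have lim: "(\<lambda>k. ennreal ((4 + L / 2 ^ k) * r ^ CARD('n))) \<longlonglongrightarrow> ennreal ((4 + 0) * r ^ CARD('n))"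
  proof (intro tendsto_ennrealI tendsto_mult tendsto_add tendsto_const)
    have "(\<lambda>k. L * (1 / 2) ^ k) \<longlonglongrightarrow> L * 0"
      by (intro tendsto_mult tendsto_const LIMSEQ_power_zero) auto
    then show "(\<lambda>k. L / 2 ^ k) \<longlonglongrightarrow> 0" by (simp add: power_divide)
  qed
  have mult: "ennreal ((4 + L / 2 ^ k) * r ^ CARD('n)) = ennreal (4 + L / 2 ^ k) * ennreal (r ^ CARD('n))" for k
    using L \<open>0 < r\<close> by (intro ennreal_mult) auto
  have "(\<integral>\<^sup>+y\<in>cube x r. ennreal (min (exp (\<epsilon> * norm (b y - average b (cube x r)))) L) \<partial>lebesgue) \<le> ennreal ((4 + 0) * r ^ CARD('n))"
    by (rule LIMSEQ_le_const[OF lim]) (use Hk \<open>0 < r\<close> in \<open>auto simp: H_def mult\<close>)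
  then show ?thesis by simp
qed

text \<open>The truncated bound does not involve the height, so Fatou's lemma removes the
  truncation.\<close>

lemma john_nirenberg_normalized:
  fixes b :: "'n::finite cfun"
  assumes loc: "b locally_integrable_on UNIV"
    and osc: "\<And>x r. 0 < r \<Longrightarrow> (\<integral>\<^sup>+y\<in>cube x r. ennreal (norm (b y - average b (cube x r))) \<partial>lebesgue) \<le> ennreal (r ^ CARD('n))"
    and \<epsilon>: "\<epsilon> = jn_const TYPE('n)" and "0 < r"
  shows "(\<integral>\<^sup>+y\<in>cube x r. ennreal (exp (\<epsilon> * norm (b y - average b (cube x r)))) \<partial>lebesgue) \<le> ennreal (4 * r ^ CARD('n))"
proof -
  note [measurable] = loc_measurable[OF loc]
  define F where "F k y = ennreal (min (exp (\<epsilon> * norm (b y - average b (cube x r)))) (real (Suc k))) * indicator (cube x r) y" for k y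
  have "(\<integral>\<^sup>+y. ennreal (exp (\<epsilon> * norm (b y - average b (cube x r)))) * indicator (cube x r) y \<partial>lebesgue)
    \<le> (\<integral>\<^sup>+y. liminf (\<lambda>k. F k y) \<partial>lebesgue)"
  proof (intro nn_integral_mono)
    fix y
    define v where "v = exp (\<epsilon> * norm (b y - average b (cube x r)))"
    obtain k0 :: nat where k0: "v \<le> real k0" using real_arch_simple by blast
    have "\<forall>\<^sub>F k in sequentially. ennreal v * indicator (cube x r) y \<le> F k y"
      unfolding eventually_sequentially
    proof (intro exI[of _ k0] allI impI)
      fix k assume "k0 \<le> k"
      then have "v \<le> real (Suc k)" using k0 by simp
      then show "ennreal v * indicator (cube x r) y \<le> F k y" by (simp add: F_def v_def[symmetric])
    qed
    then show "ennreal (exp (\<epsilon> * norm (b y - average b (cube x r)))) * indicator (cube x r) y \<le> liminf (\<lambda>k. F k y)"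
      unfolding v_def by (rule Liminf_bounded)
  qed
  also have "\<dots> \<le> liminf (\<lambda>k. \<integral>\<^sup>+y. F k y \<partial>lebesgue)"
    by (rule nn_integral_liminf) (auto simp: F_def)
  also have "\<dots> \<le> liminf (\<lambda>k::nat. ennreal (4 * r ^ CARD('n)))"
    unfolding F_def by (intro Liminf_mono always_eventually allI jn_truncated[OF loc osc _ \<epsilon> \<open>0 < r\<close>]) auto
  finally show ?thesis by (simp add: Liminf_const)
qed

lemma BMO_oscillation:
  fixes b :: "'n::finite cfun"
  assumes b: "b \<in> BMO" and r: "0 < r"
  shows "(\<integral>\<^sup>+y\<in>cube x r. ennreal (norm (b y - average b (cube x r))) \<partial>lebesgue) \<le> ennreal (BMO_norm b) * ennreal (r ^ CARD('n))"
proof -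
  define Q where "Q = cube x r"
  define m where "m = r ^ CARD('n)"
  have m: "0 < m" using r by (simp add: m_def)
  have mQ: "measure lebesgue Q = m" unfolding m_def Q_def by (rule measure_cube) (use r in simp)
  have loc: "b locally_integrable_on UNIV" using b by (simp add: BMO_def)
  note [measurable] = loc_measurable[OF loc]
  have fin: "(\<integral>\<^sup>+y\<in>Q. ennreal (norm (b y - average b Q)) \<partial>lebesgue) < \<infinity>"
    unfolding Q_def by (rule nn_integral_cube_norm_finite[OF loc])
  define f where "f y = indicator Q y * norm (b y - average b Q)" for y
  have f0: "0 \<le> f y" for y by (simp add: f_def)
  have [measurable]: "Q \<in> sets lebesgue" by (simp add: Q_def)
  have fm: "f \<in> borel_measurable lebesgue" unfolding f_def[abs_def] by measurable
  have e: "(\<integral>\<^sup>+y. ennreal (f y) \<partial>lebesgue) = (\<integral>\<^sup>+y\<in>Q. ennreal (norm (b y - average b Q)) \<partial>lebesgue)"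
    by (intro nn_integral_cong) (auto simp: f_def indicator_def)
  have "integrable lebesgue f"
    using fin e f0 fm by (intro integrableI_nonneg) auto
  then have "(\<integral>\<^sup>+y. ennreal (f y) \<partial>lebesgue) = ennreal (LINT y|lebesgue. f y)"
    using f0 by (intro nn_integral_eq_integral) auto
  also have "(LINT y|lebesgue. f y) = mean_osc b Q * m"
    using m by (simp add: mean_osc_def mQ set_lebesgue_integral_def f_def)
  also have "mean_osc b Q \<le> BMO_norm b"
  proof -
    have "mean_osc b Q \<in> (\<lambda>(x, r). mean_osc b (cube x r)) ` (UNIV \<times> {0<..})"
      using r by (auto simp: Q_def)
    moreover have "bdd_above ((\<lambda>(x, r). mean_osc b (cube x r)) ` (UNIV \<times> {0<..}))"
      using b by (simp add: BMO_def)
    ultimately show ?thesis unfolding BMO_norm_def by (rule cSup_upper)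
  qed
  then have "ennreal (mean_osc b Q * m) \<le> ennreal (BMO_norm b * m)"
    using m by (intro ennreal_leI mult_right_mono) auto
  also have "\<dots> = ennreal (BMO_norm b) * ennreal m" using m by (intro ennreal_mult'') auto
  finally show ?thesis using e by (simp add: Q_def m_def)
qed

text \<open>Division of b by \<beta> normalizes the oscillation. An arbitrary positive bound \<beta>
  instead of the norm itself avoids dividing by 0 when b is constant almost everywhere.\<close>

lemma john_nirenberg:
  fixes b :: "'n::finite cfun"
  assumes b: "b \<in> BMO" and \<beta>: "0 < \<beta>" "BMO_norm b \<le> \<beta>" and r: "0 < r"
  shows "(\<integral>\<^sup>+y\<in>cube x r. ennreal (exp (jn_const TYPE('n) * (norm (b y - average b (cube x r)) / \<beta>))) \<partial>lebesgue)
    \<le> ennreal (4 * r ^ CARD('n))"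
proof -
  have loc: "b locally_integrable_on UNIV" using b by (simp add: BMO_def)
  note [measurable] = loc_measurable[OF loc]
  define d where "d y = b y / of_real \<beta>" for y
  have locd: "d locally_integrable_on UNIV"
    unfolding locally_integrable_on_def
  proof (intro allI impI)
    fix S :: "(real^'n) set" assume "compact S \<and> S \<subseteq> UNIV"
    then have "set_integrable lebesgue S b" using loc by (simp add: locally_integrable_on_def)
    then have "set_integrable lebesgue S (\<lambda>y. b y * (1 / of_real \<beta>))" by (intro set_integrable_mult_left) simp
    then show "set_integrable lebesgue S d" by (simp add: d_def[abs_def])
  qed
  have avg: "average d A = average b A / of_real \<beta>" for A
  proof -
    have "(LINT x:A|lebesgue. b x * (1 / of_real \<beta>)) = (LINT x:A|lebesgue. b x) * (1 / of_real \<beta>)"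
      by (rule set_integral_mult_left)
    then show ?thesis by (simp add: average_def d_def[abs_def])
  qed
  have nrm: "norm (d y - average d A) = norm (b y - average b A) / \<beta>" for y A
    using \<beta>(1) by (simp add: avg d_def diff_divide_distrib[symmetric] norm_divide)
  have "(\<integral>\<^sup>+y\<in>cube x r. ennreal (norm (d y - average d (cube x r))) \<partial>lebesgue) \<le> ennreal (r ^ CARD('n))"
    if r: "0 < r" for x r
  proof -
    have "(\<integral>\<^sup>+y\<in>cube x r. ennreal (norm (d y - average d (cube x r))) \<partial>lebesgue)
      = (\<integral>\<^sup>+y. ennreal (1 / \<beta>) * (ennreal (norm (b y - average b (cube x r))) * indicator (cube x r) y) \<partial>lebesgue)"
      unfolding nrm using \<beta> by (intro nn_integral_cong) (auto simp: ennreal_mult[symmetric] indicator_def)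
    also have "\<dots> = ennreal (1 / \<beta>) * (\<integral>\<^sup>+y\<in>cube x r. ennreal (norm (b y - average b (cube x r))) \<partial>lebesgue)"
      by (rule nn_integral_cmult) measurable
    also have "\<dots> \<le> ennreal (1 / \<beta>) * (ennreal (BMO_norm b) * ennreal (r ^ CARD('n)))"
      by (intro mult_left_mono BMO_oscillation b r) simp
    also have "\<dots> \<le> ennreal (1 / \<beta>) * (ennreal \<beta> * ennreal (r ^ CARD('n)))"
      by (intro mult_left_mono mult_right_mono ennreal_leI \<beta>) auto
    also have "\<dots> = ennreal (r ^ CARD('n))"
      using \<beta>(1) r by (simp add: mult.assoc[symmetric] ennreal_mult[symmetric])
    finally show ?thesis .
  qed
  from john_nirenberg_normalized[OF locd this refl r, of x] show ?thesis
    by (simp only: nrm)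
qed

lemma powr_le_exp:
  fixes u s \<epsilon> :: real
  assumes "0 \<le> u" "0 < s" "0 < \<epsilon>"
  shows "u powr s \<le> (s / \<epsilon>) powr s * exp (\<epsilon> * u)"
proof -
  have "\<epsilon> * u / s \<le> exp (\<epsilon> * u / s)" using exp_ge_add_one_self[of "\<epsilon> * u / s"] by linarith
  then have "u \<le> (s / \<epsilon>) * exp (\<epsilon> * u / s)" using assms by (simp add: field_simps)
  then have "u powr s \<le> ((s / \<epsilon>) * exp (\<epsilon> * u / s)) powr s" using assms by (intro powr_mono2) auto
  also have "\<dots> = (s / \<epsilon>) powr s * exp (\<epsilon> * u / s) powr s" using assms by (intro powr_mult)
  also have "exp (\<epsilon> * u / s) powr s = exp (\<epsilon> * u)" using assms by (simp add: exp_powr_real)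
  finally show ?thesis .
qed

text \<open>Hoelder's inequality with exponents t and s = t / (t - 1), through Young's inequality
  normalized by the t-average \<open>A\<close> of f. The s-th power of the oscillation is dominated
  by the exponential and hence by 4 times the measure, which gives \<open>4 * D\<close>; the
  normalized power of f contributes the summand 1.\<close>

lemma BMO_hoelder:
  fixes t :: real
  assumes t: "1 < t"
  obtains C where "0 \<le> C"
    "\<And>(b :: 'n::finite cfun) \<beta> f q. b \<in> BMO \<Longrightarrow> 0 < \<beta> \<Longrightarrow> BMO_norm b \<le> \<beta> \<Longrightarrow>
       f \<in> borel_measurable lebesgue \<Longrightarrow> (\<And>y. 0 \<le> f y) \<Longrightarrow>
       (\<integral>\<^sup>+y\<in>gcube q. ennreal (f y powr t) \<partial>lebesgue) < \<infinity> \<Longrightarrow>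
       (\<integral>\<^sup>+y\<in>gcube q. ennreal (norm (b y - average b (gcube q)) * f y) \<partial>lebesgue)
         \<le> ennreal (C * \<beta> * mavg (\<lambda>y. f y powr t) (gcube q) powr (1 / t)) * emeasure lebesgue (gcube q :: (real^'n) set)"
proof -
  define s where "s = t / (t - 1)"
  have s: "0 < s" "1 < s" using t by (auto simp: s_def less_divide_eq)
  define \<epsilon> where "\<epsilon> = jn_const TYPE('n)"
  have \<epsilon>: "0 < \<epsilon>" unfolding \<epsilon>_def by (rule jn_const_pos)
  define D where "D = (s / \<epsilon>) powr s"
  show thesis
  proof (rule that[of "4 * D + 1"])
    show "0 \<le> 4 * D + 1" by (simp add: D_def)
    fix b :: "'n cfun" and \<beta> :: real and f :: "real^'n \<Rightarrow> real" and q :: "int \<times> ('n \<Rightarrow> int)"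
    assume b: "b \<in> BMO" and \<beta>: "0 < \<beta>" "BMO_norm b \<le> \<beta>" and [measurable]: "f \<in> borel_measurable lebesgue"
      and f0: "\<And>y. 0 \<le> f y" and fin: "(\<integral>\<^sup>+y\<in>gcube q. ennreal (f y powr t) \<partial>lebesgue) < \<infinity>"
    have loc: "b locally_integrable_on UNIV" using b by (simp add: BMO_def)
    note [measurable] = loc_measurable[OF loc]
    define m where "m = gside (fst q) ^ CARD('n)"
    have m: "0 < m" by (simp add: m_def)
    define M where "M = mavg (\<lambda>y. f y powr t) (gcube q)"
    define A where "A = M powr (1 / t)"
    have M: "ennreal (M * m) = (\<integral>\<^sup>+y\<in>gcube q. ennreal (f y powr t) \<partial>lebesgue)"
      using m unfolding M_def m_def by (subst mavg_gcube[OF fin, symmetric]) (simp add: ennreal_mult)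
    have M0: "0 \<le> M" by (simp add: M_def)
    define v where "v y = norm (b y - average b (gcube q)) / \<beta>" for y
    have [measurable]: "v \<in> borel_measurable lebesgue" unfolding v_def[abs_def] by measurable
    have v0: "0 \<le> v y" for y using \<beta> by (simp add: v_def)
    have jn: "(\<integral>\<^sup>+y\<in>gcube q. ennreal (exp (\<epsilon> * v y)) \<partial>lebesgue) \<le> ennreal (4 * m)"
      unfolding v_def \<epsilon>_def gcube_def m_def by (rule john_nirenberg[OF b \<beta>]) simp
    show "(\<integral>\<^sup>+y\<in>gcube q. ennreal (norm (b y - average b (gcube q)) * f y) \<partial>lebesgue)
         \<le> ennreal ((4 * D + 1) * \<beta> * mavg (\<lambda>y. f y powr t) (gcube q) powr (1 / t)) * emeasure lebesgue (gcube q :: (real^'n) set)"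
    \<comment> \<open>The normalization divides by \<open>A\<close>, a positive power of
      \<open>M\<close>; if \<open>M = 0\<close> then f vanishes almost everywhere on the cube and
      both sides are 0.\<close>
    proof (cases "M = 0")
      case True
      then have "(\<integral>\<^sup>+y\<in>gcube q. ennreal (f y powr t) \<partial>lebesgue) = 0" using M by simp
      then have "AE y in lebesgue. ennreal (f y powr t) * indicator (gcube q) y = 0"
        by (subst (asm) nn_integral_0_iff_AE) auto
      then have "AE y in lebesgue. ennreal (norm (b y - average b (gcube q)) * f y) * indicator (gcube q) y = 0"
      proof eventually_elim
        case (elim y)
        then have "y \<in> gcube q \<Longrightarrow> f y powr t \<le> 0" by (auto simp: indicator_def ennreal_eq_0_iff split: if_splits)
        then have "y \<in> gcube q \<Longrightarrow> f y = 0" by (metis order_antisym powr_ge_zero powr_eq_0_iff)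
        then show ?case by (auto simp: indicator_def)
      qed
      then have "(\<integral>\<^sup>+y\<in>gcube q. ennreal (norm (b y - average b (gcube q)) * f y) \<partial>lebesgue) = 0"
        by (subst nn_integral_0_iff_AE) auto
      then show ?thesis by simp
    next
      case False
      then have A: "0 < A" using M0 by (simp add: A_def)
      have At: "A powr t = M" using M0 t by (simp add: A_def powr_powr)
      have pt: "norm (b y - average b (gcube q)) * f y \<le> (\<beta> * A * D) * exp (\<epsilon> * v y) + (\<beta> * A / M) * f y powr t" for y
      proof -
        have "v y * (f y / A) \<le> v y powr s / s + (f y / A) powr t / t"
        proof (rule Youngs_inequality[OF s(2) t])
          show "1 / s + 1 / t = 1" using t by (simp add: s_def diff_divide_distrib)
        qed (use v0 f0 A in auto)
        also have "\<dots> \<le> v y powr s + (f y / A) powr t"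
          using s t by (intro add_mono) (simp_all add: divide_le_eq mult_le_cancel_left1)
        also have "\<dots> \<le> D * exp (\<epsilon> * v y) + f y powr t / M"
          unfolding D_def using powr_le_exp[OF v0 s(1) \<epsilon>, of y] f0 A At by (simp add: powr_divide)
        finally have "\<beta> * A * (v y * (f y / A)) \<le> \<beta> * A * (D * exp (\<epsilon> * v y) + f y powr t / M)"
          using \<beta> A by (intro mult_left_mono) auto
        moreover have "\<beta> * A * (v y * (f y / A)) = norm (b y - average b (gcube q)) * f y"
          using \<beta> A by (simp add: v_def)
        ultimately show ?thesis by (simp add: algebra_simps)
      qed
      have c1: "0 \<le> \<beta> * A * D" using \<beta> A by (simp add: D_def)
      have c2: "0 \<le> \<beta> * A / M" using \<beta> A M0 by simp
      have "(\<integral>\<^sup>+y\<in>gcube q. ennreal (norm (b y - average b (gcube q)) * f y) \<partial>lebesgue)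
        \<le> (\<integral>\<^sup>+y. ennreal (\<beta> * A * D) * (ennreal (exp (\<epsilon> * v y)) * indicator (gcube q) y)
              + ennreal (\<beta> * A / M) * (ennreal (f y powr t) * indicator (gcube q) y) \<partial>lebesgue)"
      proof (intro nn_integral_mono)
        fix y
        have "ennreal (norm (b y - average b (gcube q)) * f y) \<le> ennreal ((\<beta> * A * D) * exp (\<epsilon> * v y) + (\<beta> * A / M) * f y powr t)"
          by (intro ennreal_leI pt)
        also have "\<dots> = ennreal ((\<beta> * A * D) * exp (\<epsilon> * v y)) + ennreal ((\<beta> * A / M) * f y powr t)"
          by (rule ennreal_plus) (use c1 mult_nonneg_nonneg[OF c2, of "f y powr t"] in auto)
        also have "ennreal ((\<beta> * A * D) * exp (\<epsilon> * v y)) = ennreal (\<beta> * A * D) * ennreal (exp (\<epsilon> * v y))"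
          by (rule ennreal_mult) (use c1 in auto)
        also have "ennreal ((\<beta> * A / M) * f y powr t) = ennreal (\<beta> * A / M) * ennreal (f y powr t)"
          by (rule ennreal_mult) (use c2 in auto)
        finally show "ennreal (norm (b y - average b (gcube q)) * f y) * indicator (gcube q) y
          \<le> ennreal (\<beta> * A * D) * (ennreal (exp (\<epsilon> * v y)) * indicator (gcube q) y)
              + ennreal (\<beta> * A / M) * (ennreal (f y powr t) * indicator (gcube q) y)"
          by (auto simp: indicator_def)
      qed
      also have "\<dots> = ennreal (\<beta> * A * D) * (\<integral>\<^sup>+y\<in>gcube q. ennreal (exp (\<epsilon> * v y)) \<partial>lebesgue) + ennreal (\<beta> * A / M) * ennreal (M * m)"
        unfolding M by (subst nn_integral_add) (auto simp: nn_integral_cmult)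
      also have "\<dots> \<le> ennreal (\<beta> * A * D) * ennreal (4 * m) + ennreal (\<beta> * A / M) * ennreal (M * m)"
        by (intro add_right_mono mult_left_mono jn) simp
      also have "\<dots> = ennreal ((\<beta> * A * D) * (4 * m)) + ennreal ((\<beta> * A / M) * (M * m))"
      proof -
        have "ennreal (\<beta> * A * D) * ennreal (4 * m) = ennreal ((\<beta> * A * D) * (4 * m))"
          using c1 m by (intro ennreal_mult[symmetric]) auto
        moreover have "ennreal (\<beta> * A / M) * ennreal (M * m) = ennreal ((\<beta> * A / M) * (M * m))"
          using c2 m M0 by (intro ennreal_mult[symmetric]) auto
        ultimately show ?thesis by (simp only:)
      qed
      also have "\<dots> = ennreal ((\<beta> * A * D) * (4 * m) + (\<beta> * A / M) * (M * m))"
        by (rule ennreal_plus[symmetric]) (use c1 c2 m M0 A \<beta> in \<open>auto intro!: mult_nonneg_nonneg\<close>)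
      also have "(\<beta> * A * D) * (4 * m) + (\<beta> * A / M) * (M * m) = ((4 * D + 1) * \<beta> * A) * m"
        using False by (simp add: algebra_simps)
      also have "ennreal \<dots> = ennreal ((4 * D + 1) * \<beta> * A) * ennreal m"
        using m by (intro ennreal_mult'') auto
      finally show ?thesis by (simp add: A_def M_def m_def)
    qed
  qed
qed

text \<open>Polynomial growth is dominated by the John--Nirenberg exponential. The use is that a BMO
  function times a bounded function with compact support lies in every Lebesgue space
  involved.\<close>

lemma BMO_powr_locally_integrable:
  fixes b :: "'n::finite cfun"
  assumes b: "b \<in> BMO" and s: "1 \<le> s" and r: "0 < r"
  shows "(\<integral>\<^sup>+y\<in>cube x r. ennreal (norm (b y) powr s) \<partial>lebesgue) < \<infinity>"
proof -
  have loc: "b locally_integrable_on UNIV" using b by (simp add: BMO_def)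
  note [measurable] = loc_measurable[OF loc]
  define \<beta> where "\<beta> = max 1 (BMO_norm b)"
  have \<beta>: "0 < \<beta>" "BMO_norm b \<le> \<beta>" by (auto simp: \<beta>_def)
  define \<epsilon> where "\<epsilon> = jn_const TYPE('n)"
  have \<epsilon>: "0 < \<epsilon>" unfolding \<epsilon>_def by (rule jn_const_pos)
  define a where "a = average b (cube x r)"
  define c where "c = 2 powr s * \<beta> powr s * (s / \<epsilon>) powr s"
  define c' where "c' = 2 powr s * norm a powr s"
  have [measurable]: "cube x r \<in> sets lebesgue" by simp
  have "(\<integral>\<^sup>+y\<in>cube x r. ennreal (norm (b y) powr s) \<partial>lebesgue)
    \<le> (\<integral>\<^sup>+y. ennreal c * (ennreal (exp (\<epsilon> * (norm (b y - a) / \<beta>))) * indicator (cube x r) y) + ennreal c' * indicator (cube x r) y \<partial>lebesgue)"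
  proof (intro nn_integral_mono)
    fix y
    define v where "v = norm (b y - a) / \<beta>"
    have v: "0 \<le> v" "norm (b y - a) = \<beta> * v" using \<beta> by (auto simp: v_def)
    have "norm (b y) powr s \<le> (norm (b y - a) + norm a) powr s"
      using norm_triangle_ineq[of "b y - a" a] s by (intro powr_mono2) auto
    also have "\<dots> \<le> 2 powr s * (norm (b y - a) powr s + norm a powr s)"
      using s by (intro add_powr_le) auto
    also have "norm (b y - a) powr s = \<beta> powr s * v powr s" using \<beta> v by (simp add: powr_mult)
    also have "2 powr s * (\<beta> powr s * v powr s + norm a powr s) \<le> 2 powr s * (\<beta> powr s * ((s / \<epsilon>) powr s * exp (\<epsilon> * v)) + norm a powr s)"
      using s \<epsilon> v by (intro mult_left_mono add_right_mono powr_le_exp) auto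
    also have "\<dots> = c * exp (\<epsilon> * v) + c'" by (simp add: c_def c'_def algebra_simps)
    finally have "ennreal (norm (b y) powr s) \<le> ennreal (c * exp (\<epsilon> * v) + c')" by (rule ennreal_leI)
    also have "\<dots> = ennreal c * ennreal (exp (\<epsilon> * v)) + ennreal c'"
      by (subst ennreal_plus) (auto simp: c_def c'_def ennreal_mult)
    finally show "ennreal (norm (b y) powr s) * indicator (cube x r) y
      \<le> ennreal c * (ennreal (exp (\<epsilon> * (norm (b y - a) / \<beta>))) * indicator (cube x r) y) + ennreal c' * indicator (cube x r) y"
      by (auto simp: indicator_def v_def)
  qed
  also have "\<dots> = ennreal c * (\<integral>\<^sup>+y\<in>cube x r. ennreal (exp (\<epsilon> * (norm (b y - a) / \<beta>))) \<partial>lebesgue) + ennreal c' * emeasure lebesgue (cube x r)"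
    by (subst nn_integral_add) (auto simp: nn_integral_cmult)
  also have "\<dots> \<le> ennreal c * ennreal (4 * r ^ CARD('n)) + ennreal c' * ennreal (r ^ CARD('n))"
    unfolding \<epsilon>_def a_def using r
    by (intro add_mono mult_left_mono john_nirenberg[OF b \<beta> r]) (auto simp: emeasure_cube)
  also have "\<dots> < \<infinity>" by (simp add: ennreal_mult_less_top)
  finally show ?thesis .
qed

section \<open>Fractional integrals and their commutators on variable exponent spaces\<close>

text \<open>The norming function of Lebesgue duality, adapted to a variable exponent. If the modular
  \<rho> exceeded 1, the function \<open>g\<close> below would have dual modular exactly 1, while
  pairing \<open>G\<close> with it gives at least C * \<rho> powr (1 / qM) > C. Finiteness of \<rho>
  is what allows the normalization.\<close>

lemma duality_modular_bound_truncated: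
  fixes H q :: "real^'n::finite \<Rightarrow> real" and G :: "real^'n \<Rightarrow> ennreal"
  assumes q[measurable]: "q \<in> borel_measurable lebesgue" and qb: "\<And>x. q x \<in> {qm..qM}" and qm: "1 < qm" and C: "0 < C"
    and dual: "\<And>g. g \<in> borel_measurable lebesgue \<Longrightarrow> (\<And>y. 0 \<le> g y) \<Longrightarrow>
        (\<integral>\<^sup>+y. ennreal (g y powr (1 / (1 - 1 / q y))) \<partial>lebesgue) \<le> 1 \<Longrightarrow> (\<integral>\<^sup>+y. G y * ennreal (g y) \<partial>lebesgue) \<le> ennreal C"
    and H[measurable]: "H \<in> borel_measurable lebesgue" and H0: "\<And>x. 0 \<le> H x" "\<And>x. ennreal (C * H x) \<le> G x"
    and fin: "(\<integral>\<^sup>+x. ennreal (H x powr q x) \<partial>lebesgue) < \<infinity>"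
  shows "(\<integral>\<^sup>+x. ennreal (H x powr q x) \<partial>lebesgue) \<le> 1"
proof (rule ccontr)
  assume neg: "\<not> ?thesis"
  define \<rho> where "\<rho> = enn2real (\<integral>\<^sup>+x. ennreal (H x powr q x) \<partial>lebesgue)"
  have \<rho>e: "(\<integral>\<^sup>+x. ennreal (H x powr q x) \<partial>lebesgue) = ennreal \<rho>"
    using fin by (simp add: \<rho>_def less_top)
  have \<rho>: "1 < \<rho>"
  proof (rule ccontr)
    assume "\<not> 1 < \<rho>"
    then have "ennreal \<rho> \<le> ennreal 1" by (intro ennreal_leI) simp
    then show False using neg \<rho>e by simp
  qed
  have qx: "1 < q x" "qm \<le> q x" "q x \<le> qM" for x using qb[of x] qm by auto
  \<comment> \<open>The exponent of \<rho> is minus the reciprocal of the conjugate exponent at x,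
    so that raising \<open>g\<close> to the conjugate exponent gives exactly H powr q /
    \<rho>.\<close>
  define g where "g x = H x powr (q x - 1) * \<rho> powr (- (1 - 1 / q x))" for x
  have [measurable]: "g \<in> borel_measurable lebesgue" unfolding g_def[abs_def] by measurable
  have g0: "0 \<le> g x" for x by (simp add: g_def)
  have gq: "g x powr (1 / (1 - 1 / q x)) = (1 / \<rho>) * H x powr q x" for x
  proof -
    have e: "(q x - 1) * (1 / (1 - 1 / q x)) = q x" "- (1 - 1 / q x) * (1 / (1 - 1 / q x)) = - 1"
      using qx[of x] by (auto simp: field_simps)
    have "g x powr (1 / (1 - 1 / q x)) = H x powr ((q x - 1) * (1 / (1 - 1 / q x))) * \<rho> powr (- (1 - 1 / q x) * (1 / (1 - 1 / q x)))"
      unfolding g_def by (simp only: powr_mult powr_ge_zero powr_powr)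
    then show ?thesis unfolding e using \<rho> by (simp add: powr_minus_divide)
  qed
  have "(\<integral>\<^sup>+y. ennreal (g y powr (1 / (1 - 1 / q y))) \<partial>lebesgue) = (\<integral>\<^sup>+y. ennreal (1 / \<rho>) * ennreal (H y powr q y) \<partial>lebesgue)"
    unfolding gq using \<rho> by (intro nn_integral_cong ennreal_mult) auto
  also have "\<dots> = ennreal (1 / \<rho>) * ennreal \<rho>" by (subst nn_integral_cmult) (auto simp: \<rho>e)
  also have "\<dots> = ennreal (1 / \<rho> * \<rho>)" using \<rho> by (intro ennreal_mult[symmetric]) auto
  also have "\<dots> = 1" using \<rho> by simp
  finally have "(\<integral>\<^sup>+y. G y * ennreal (g y) \<partial>lebesgue) \<le> ennreal C"
    by (intro dual) (auto simp: g0)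
  moreover have "ennreal (C * \<rho> powr (1 / qM)) \<le> (\<integral>\<^sup>+y. G y * ennreal (g y) \<partial>lebesgue)"
  proof -
    have "ennreal (C * \<rho> powr (1 / qM)) = ennreal (C * \<rho> powr (- (1 - 1 / qM))) * ennreal \<rho>"
    proof -
      have "\<rho> powr (- (1 - 1 / qM)) * \<rho> powr 1 = \<rho> powr (1 / qM)" by (subst powr_add[symmetric]) simp
      then have "C * \<rho> powr (1 / qM) = C * \<rho> powr (- (1 - 1 / qM)) * \<rho>" using \<rho> by simp
      then show ?thesis using C \<rho> by (simp only:) (rule ennreal_mult; simp)
    qed
    also have "\<dots> = (\<integral>\<^sup>+y. ennreal (C * \<rho> powr (- (1 - 1 / qM))) * ennreal (H y powr q y) \<partial>lebesgue)"
      by (subst nn_integral_cmult) (auto simp: \<rho>e)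
    also have "\<dots> \<le> (\<integral>\<^sup>+y. G y * ennreal (g y) \<partial>lebesgue)"
    proof (intro nn_integral_mono)
      fix y
      have "1 / qM \<le> 1 / q y" using qx[of y] by (intro divide_left_mono) auto
      then have "\<rho> powr (- (1 - 1 / qM)) \<le> \<rho> powr (- (1 - 1 / q y))" using \<rho> by (intro powr_mono) auto
      then have "C * H y powr q y * \<rho> powr (- (1 - 1 / qM)) \<le> C * H y powr q y * \<rho> powr (- (1 - 1 / q y))"
        using C by (intro mult_left_mono) auto
      also have "C * H y powr q y * \<rho> powr (- (1 - 1 / q y)) = (C * H y) * g y"
      proof -
        have "H y powr q y = H y * H y powr (q y - 1)"
          using H0(1)[of y] qx[of y] by (cases "H y = 0") (auto simp: powr_diff)
        then show ?thesis by (simp only: g_def mult_ac)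
      qed
      finally have "ennreal (C * H y powr q y * \<rho> powr (- (1 - 1 / qM))) \<le> ennreal ((C * H y) * g y)" by (rule ennreal_leI)
      also have "\<dots> = ennreal (C * H y) * ennreal (g y)" using C H0(1)[of y] g0[of y] by (intro ennreal_mult) auto
      also have "\<dots> \<le> G y * ennreal (g y)" by (intro mult_right_mono H0) simp
      finally show "ennreal (C * \<rho> powr (- (1 - 1 / qM))) * ennreal (H y powr q y) \<le> G y * ennreal (g y)"
        using C by (subst ennreal_mult[symmetric]) (auto simp: mult_ac)
    qed
    finally show ?thesis .
  qed
  ultimately have "ennreal (C * \<rho> powr (1 / qM)) \<le> ennreal C" by (rule order_trans[rotated])
  then have "C * \<rho> powr (1 / qM) \<le> C" using C by (subst (asm) ennreal_le_iff) auto
  then have "\<rho> powr (1 / qM) \<le> 1" using C by simp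
  moreover have "0 < 1 / qM" using qx[of undefined] by simp
  then have "1 < \<rho> powr (1 / qM)" using \<rho> by simp
  ultimately show False by simp
qed

text \<open>\<open>G\<close> is truncated in height and in space, which makes the modular finite a
  priori; Fatou's lemma then recovers the full modular.\<close>

lemma duality_modular_bound:
  fixes q :: "real^'n::finite \<Rightarrow> real" and G :: "real^'n \<Rightarrow> ennreal"
  assumes q[measurable]: "q \<in> borel_measurable lebesgue" and qb: "\<And>x. q x \<in> {qm..qM}" and qm: "1 < qm" and C: "0 < C"
    and G[measurable]: "G \<in> borel_measurable lebesgue"
    and dual: "\<And>g. g \<in> borel_measurable lebesgue \<Longrightarrow> (\<And>y. 0 \<le> g y) \<Longrightarrow>
        (\<integral>\<^sup>+y. ennreal (g y powr (1 / (1 - 1 / q y))) \<partial>lebesgue) \<le> 1 \<Longrightarrow> (\<integral>\<^sup>+y. G y * ennreal (g y) \<partial>lebesgue) \<le> ennreal C"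
  shows "AE x in lebesgue. G x \<noteq> \<infinity>"
    and "(\<integral>\<^sup>+x. ennreal ((enn2real (G x) / C) powr q x) \<partial>lebesgue) \<le> 1"
proof -
  have qx: "1 < q x" "qm \<le> q x" "q x \<le> qM" for x using qb[of x] qm by auto
  define H where "H N x = enn2real (min (G x) (of_nat N)) / C * indicator (cube 0 (real N)) x" for N :: nat and x
  have [measurable]: "cube (0 :: real^'n) (real N) \<in> sets lebesgue" for N by simp
  have Hm[measurable]: "H N \<in> borel_measurable lebesgue" for N unfolding H_def[abs_def] by measurable
  have H0: "0 \<le> H N x" for N x using C by (simp add: H_def)
  have HN: "H N x \<le> real N / C * indicator (cube 0 (real N)) x" for N x
  proof -
    have "of_nat N < (top :: ennreal)" by (metis ennreal_less_top ennreal_of_nat_eq_real_of_nat)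
    then have "enn2real (min (G x) (of_nat N)) \<le> enn2real (of_nat N)" by (intro enn2real_mono) auto
    then show ?thesis using C unfolding H_def by (intro mult_right_mono divide_right_mono) auto
  qed
  have HG: "ennreal (C * H N x) \<le> G x" for N x
  proof -
    have "C * H N x \<le> enn2real (min (G x) (of_nat N))" using C by (auto simp: H_def indicator_def)
    then have "ennreal (C * H N x) \<le> ennreal (enn2real (min (G x) (of_nat N)))" by (rule ennreal_leI)
    also have "\<dots> = min (G x) (of_nat N)"
    proof (rule ennreal_enn2real)
      have "of_nat N < (top :: ennreal)" by (metis ennreal_less_top ennreal_of_nat_eq_real_of_nat)
      then show "min (G x) (of_nat N) < top" by (rule min.strict_coboundedI2)
    qed
    also have "\<dots> \<le> G x" by simp
    finally show ?thesis .
  qed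
  have bound: "(\<integral>\<^sup>+x. ennreal (H N x powr q x) \<partial>lebesgue) \<le> 1" for N
  proof (rule duality_modular_bound_truncated[OF q qb qm C dual Hm H0 HG])
    define c where "c = max 1 (real N / C) powr qM"
    have "(\<integral>\<^sup>+x. ennreal (H N x powr q x) \<partial>lebesgue) \<le> (\<integral>\<^sup>+x. ennreal c * indicator (cube 0 (real N)) (x :: real^'n) \<partial>lebesgue)"
    proof (intro nn_integral_mono)
      fix x
      show "ennreal (H N x powr q x) \<le> ennreal c * indicator (cube 0 (real N)) x"
      proof (cases "x \<in> cube 0 (real N)")
        case True
        have "H N x powr q x \<le> max 1 (real N / C) powr q x"
          using HN[of N x] True H0[of N x] qx[of x] by (intro powr_mono2) auto
        also have "\<dots> \<le> c" unfolding c_def using qx[of x] by (intro powr_mono) auto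
        finally show ?thesis using True by (simp add: ennreal_leI)
      qed (simp add: H_def)
    qed
    also have "\<dots> < \<infinity>"
      using emeasure_compact_finite[OF compact_cube, of "0 :: real^'n" "real N"]
      by (simp add: nn_integral_cmult ennreal_mult_less_top)
    finally show "(\<integral>\<^sup>+x. ennreal (H N x powr q x) \<partial>lebesgue) < \<infinity>" .
  qed auto
  \<comment> \<open>The value \<infinity> where \<open>G\<close> is infinite is deliberate:
    \<open>enn2real\<close> would send such points to 0, whereas the bound for the integral of
    \<open>F\<close> shows that they form a null set.\<close>
  define F where "F x = (if G x = \<infinity> then \<infinity> else ennreal ((enn2real (G x) / C) powr q x))" for x
  have Fm[measurable]: "F \<in> borel_measurable lebesgue" unfolding F_def[abs_def] by measurable
  have "(\<integral>\<^sup>+x. F x \<partial>lebesgue) \<le> (\<integral>\<^sup>+x. liminf (\<lambda>N. ennreal (H N x powr q x)) \<partial>lebesgue)"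
  proof (intro nn_integral_mono)
    fix x :: "real^'n"
    obtain N0 :: nat where N0: "2 * norm x \<le> real N0" using real_arch_simple by blast
    have inQ: "x \<in> cube 0 (real N)" if "N0 \<le> N" for N
    proof -
      have "norm x \<le> real N / 2" using N0 that by linarith
      then show ?thesis using cball_subset_cube[of 0 "real N / 2"] by auto
    qed
    show "F x \<le> liminf (\<lambda>N. ennreal (H N x powr q x))"
    proof (cases "G x = \<infinity>")
      case False
      then obtain g where g: "G x = ennreal g" "0 \<le> g" by (metis ennreal_cases infinity_ennreal_def)
      obtain N1 :: nat where N1: "g \<le> real N1" using real_arch_simple by blast
      have "\<forall>\<^sub>F N in sequentially. F x \<le> ennreal (H N x powr q x)"
        unfolding eventually_sequentially
      proof (intro exI[of _ "max N0 N1"] allI impI)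
        fix N assume N: "max N0 N1 \<le> N"
        then have "g \<le> real N" using N1 by (simp add: order_trans)
        then have "ennreal g \<le> of_nat N" by (metis ennreal_leI ennreal_of_nat_eq_real_of_nat)
        then have "min (G x) (of_nat N) = G x" by (simp add: g)
        then have "H N x = enn2real (G x) / C" using inQ[of N] N by (simp add: H_def)
        then show "F x \<le> ennreal (H N x powr q x)" using False by (simp add: F_def)
      qed
      then show ?thesis by (rule Liminf_bounded)
    next
      case True
      have "ennreal (real M) \<le> liminf (\<lambda>N. ennreal (H N x powr q x))" for M :: nat
      proof (rule Liminf_bounded)
        obtain N1 :: nat where N1: "C * max 1 (real M) \<le> real N1" using real_arch_simple by blast
        show "\<forall>\<^sub>F N in sequentially. ennreal (real M) \<le> ennreal (H N x powr q x)"
          unfolding eventually_sequentially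
        proof (intro exI[of _ "max N0 N1"] allI impI ennreal_leI)
          fix N assume N: "max N0 N1 \<le> N"
          have "H N x = real N / C" using inQ[of N] N True by (simp add: H_def)
          moreover have "max 1 (real M) \<le> real N / C"
          proof -
            have "C * max 1 (real M) \<le> real N" using N N1 by linarith
            then show ?thesis using C by (subst pos_le_divide_eq) (auto simp: mult.commute)
          qed
          moreover have "(real N / C) powr 1 \<le> (real N / C) powr q x"
            using calculation(2) qx[of x] by (intro powr_mono) auto
          ultimately show "real M \<le> H N x powr q x" using C by simp
        qed
      qed
      then have "\<forall>M::nat. ennreal (real M) \<le> liminf (\<lambda>N. ennreal (H N x powr q x))" by blast
      then have "liminf (\<lambda>N. ennreal (H N x powr q x)) = \<infinity>"
      proof (rule contrapos_pp)
        assume "liminf (\<lambda>N. ennreal (H N x powr q x)) \<noteq> \<infinity>"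
        then obtain l where l: "liminf (\<lambda>N. ennreal (H N x powr q x)) = ennreal l" "0 \<le> l"
          by (metis ennreal_cases infinity_ennreal_def)
        obtain M :: nat where "l < real M" using reals_Archimedean2 by blast
        then have "ennreal l < ennreal (real M)" using l(2) by (intro ennreal_lessI) auto
        then show "\<not> (\<forall>M::nat. ennreal (real M) \<le> liminf (\<lambda>N. ennreal (H N x powr q x)))"
          unfolding l(1) by (auto simp: not_le)
      qed
      then show ?thesis by simp
    qed
  qed
  also have "\<dots> \<le> liminf (\<lambda>N. \<integral>\<^sup>+x. ennreal (H N x powr q x) \<partial>lebesgue)"
    by (rule nn_integral_liminf) auto
  also have "\<dots> \<le> liminf (\<lambda>N::nat. 1)"
    by (intro Liminf_mono always_eventually allI bound)
  finally have FI: "(\<integral>\<^sup>+x. F x \<partial>lebesgue) \<le> 1" by (simp add: Liminf_const)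
  then have "(\<integral>\<^sup>+x. F x \<partial>lebesgue) \<noteq> \<infinity>" by (auto simp: top_unique)
  from nn_integral_PInf_AE[OF Fm this] show ae: "AE x in lebesgue. G x \<noteq> \<infinity>"
    by eventually_elim (auto simp: F_def)
  have "(\<integral>\<^sup>+x. ennreal ((enn2real (G x) / C) powr q x) \<partial>lebesgue) \<le> (\<integral>\<^sup>+x. F x \<partial>lebesgue)"
    by (intro nn_integral_mono) (auto simp: F_def)
  then show "(\<integral>\<^sup>+x. ennreal ((enn2real (G x) / C) powr q x) \<partial>lebesgue) \<le> 1"
    using FI by (rule order_trans)
qed

text \<open>Grid versions of the fractional integral of \<open>f\<close> and of its commutator with \<open>b\<close>.\<close>

definition frac_int :: "real \<Rightarrow> (real^'n::finite \<Rightarrow> real) \<Rightarrow> real^'n \<Rightarrow> ennreal" where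
  "frac_int \<alpha> f x = (\<integral>\<^sup>+q. ennreal (gside (fst q) powr (\<alpha> - real CARD('n))) * indicator (gcube q) x
      * (\<integral>\<^sup>+y\<in>gcube q. ennreal (f y) \<partial>lebesgue) \<partial>count_space UNIV)"

definition frac_comm :: "real \<Rightarrow> 'n::finite cfun \<Rightarrow> (real^'n \<Rightarrow> real) \<Rightarrow> real^'n \<Rightarrow> ennreal" where
  "frac_comm \<alpha> b f x = (\<integral>\<^sup>+q. ennreal (gside (fst q) powr (\<alpha> - real CARD('n))) * indicator (gcube q) x
      * (ennreal (norm (b x - average b (gcube q))) * (\<integral>\<^sup>+y\<in>gcube q. ennreal (f y) \<partial>lebesgue)
         + (\<integral>\<^sup>+y\<in>gcube q. ennreal (norm (b y - average b (gcube q)) * f y) \<partial>lebesgue)) \<partial>count_space UNIV)"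

text \<open>The index set is countably infinite, so an enumeration is a bijection with the naturals
  and turns the integral into a series of measurable functions.\<close>

lemma measurable_nn_integral_gcubes [measurable (raw)]:
  fixes F :: "int \<times> ('n::finite \<Rightarrow> int) \<Rightarrow> 'a \<Rightarrow> ennreal"
  assumes [measurable]: "\<And>q. F q \<in> borel_measurable M"
  shows "(\<lambda>x. \<integral>\<^sup>+q. F q x \<partial>count_space UNIV) \<in> borel_measurable M"
proof -
  have "(\<integral>\<^sup>+q. F q x \<partial>count_space UNIV) = (\<Sum>k. F (from_nat_into UNIV k) x)" for x
  proof -
    have "bij_betw (from_nat_into (UNIV :: (int \<times> ('n \<Rightarrow> int)) set)) UNIV UNIV"
      by (rule bij_betw_from_nat_into) (auto intro: infinite_UNIV_char_0 simp: finite_prod)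
    then have "(\<integral>\<^sup>+q. F q x \<partial>count_space UNIV) = (\<integral>\<^sup>+k. F (from_nat_into UNIV k) x \<partial>count_space UNIV)"
      by (rule nn_integral_bij_count_space[symmetric])
    then show ?thesis by (simp add: nn_integral_count_space_nat)
  qed
  then show ?thesis by simp
qed

lemma frac_int_measurable [measurable]: "frac_int \<alpha> f \<in> borel_measurable lebesgue"
  unfolding frac_int_def[abs_def] by measurable

lemma frac_comm_measurable:
  assumes [measurable]: "b \<in> borel_measurable lebesgue"
  shows "frac_comm \<alpha> b f \<in> borel_measurable lebesgue"
  unfolding frac_comm_def[abs_def] by measurable

text \<open>By duality it suffices to pair with \<open>g\<close> in the conjugate space, where both
  operators become sums over cubes of products of averages. For the commutator |b(x) - b_Q| joins
  \<open>g\<close> and |b(y) - b_Q| stays with \<open>f\<close>; \<open>BMO_hoelder\<close> replaces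
  either one by \<beta> and the t-average, the very average that \<open>bilinear_bound\<close>
  controls.\<close>

lemma frac_bounds:
  fixes p :: "real^'n::finite \<Rightarrow> real"
  assumes p: "p \<in> log_Hoelder" "p \<in> borel_measurable lebesgue" "\<And>x. p x \<in> {pm..pM}" and pm: "1 < pm"
    and \<alpha>: "0 < \<alpha>" "\<alpha> / real CARD('n) < 1 / pM"
  obtains C where "0 < C"
    "\<And>f. f \<in> borel_measurable lebesgue \<Longrightarrow> (\<And>y. 0 \<le> f y) \<Longrightarrow>
       (\<integral>\<^sup>+y. ennreal (f y powr p y) \<partial>lebesgue) \<le> 1 \<Longrightarrow>
       (AE x in lebesgue. frac_int \<alpha> f x \<noteq> \<infinity>) \<and>
       (\<integral>\<^sup>+x. ennreal ((enn2real (frac_int \<alpha> f x) / C) powr (1 / (1 / p x - \<alpha> / real CARD('n)))) \<partial>lebesgue) \<le> 1"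
    "\<And>f b \<beta>. f \<in> borel_measurable lebesgue \<Longrightarrow> (\<And>y. 0 \<le> f y) \<Longrightarrow>
       (\<integral>\<^sup>+y. ennreal (f y powr p y) \<partial>lebesgue) \<le> 1 \<Longrightarrow> b \<in> BMO \<Longrightarrow> 0 < \<beta> \<Longrightarrow> BMO_norm b \<le> \<beta> \<Longrightarrow>
       (AE x in lebesgue. frac_comm \<alpha> b f x \<noteq> \<infinity>) \<and>
       (\<integral>\<^sup>+x. ennreal ((enn2real (frac_comm \<alpha> b f x) / (C * \<beta>)) powr (1 / (1 / p x - \<alpha> / real CARD('n)))) \<partial>lebesgue) \<le> 1"
proof -
  define n where "n = CARD('n)"
  have n: "0 < n" by (simp add: n_def)
  note [measurable] = p(2)
  have pmM: "pm \<le> pM" using p(3) by force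
  obtain t C1 where t: "1 < t" "t \<le> pm" "\<And>y. t \<le> 1 / (1 - 1 / p y + \<alpha> / real CARD('n))" and C1: "0 \<le> C1"
    "\<And>f g. f \<in> borel_measurable lebesgue \<Longrightarrow> (\<And>y. 0 \<le> f y) \<Longrightarrow>
       (\<integral>\<^sup>+y. ennreal (f y powr p y) \<partial>lebesgue) \<le> 1 \<Longrightarrow>
       g \<in> borel_measurable lebesgue \<Longrightarrow> (\<And>y. 0 \<le> g y) \<Longrightarrow>
       (\<integral>\<^sup>+y. ennreal (g y powr (1 / (1 - 1 / p y + \<alpha> / real CARD('n)))) \<partial>lebesgue) \<le> 1 \<Longrightarrow>
       (\<integral>\<^sup>+q. ennreal (gside (fst q) powr \<alpha> * mavg (\<lambda>y. f y powr t) (gcube q) powr (1 / t)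
           * mavg (\<lambda>y. g y powr t) (gcube q) powr (1 / t)) * emeasure lebesgue (gcube q :: (real^'n) set)
         \<partial>count_space UNIV) \<le> ennreal C1"
    using bilinear_bound[OF p pm \<alpha>] by blast
  obtain C2 where C2: "0 \<le> C2"
    "\<And>(b :: 'n cfun) \<beta> f q. b \<in> BMO \<Longrightarrow> 0 < \<beta> \<Longrightarrow> BMO_norm b \<le> \<beta> \<Longrightarrow>
       f \<in> borel_measurable lebesgue \<Longrightarrow> (\<And>y. 0 \<le> f y) \<Longrightarrow>
       (\<integral>\<^sup>+y\<in>gcube q. ennreal (f y powr t) \<partial>lebesgue) < \<infinity> \<Longrightarrow>
       (\<integral>\<^sup>+y\<in>gcube q. ennreal (norm (b y - average b (gcube q)) * f y) \<partial>lebesgue)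
         \<le> ennreal (C2 * \<beta> * mavg (\<lambda>y. f y powr t) (gcube q) powr (1 / t)) * emeasure lebesgue (gcube q :: (real^'n) set)"
    using BMO_hoelder[OF t(1), where 'n='n] by blast
  define q where "q x = 1 / (1 / p x - \<alpha> / real n)" for x
  define qm where "qm = 1 / (1 / pm - \<alpha> / real n)"
  define qM where "qM = 1 / (1 / pM - \<alpha> / real n)"
  have an: "0 < \<alpha> / real n" "\<alpha> / real n < 1 / pM" using \<alpha> n by (auto simp: n_def)
  have [measurable]: "q \<in> borel_measurable lebesgue" unfolding q_def[abs_def] by measurable
  have qb: "q x \<in> {qm..qM}" for x
  proof -
    have "1 / pM \<le> 1 / p x" "1 / p x \<le> 1 / pm" using p(3)[of x] pm by (auto intro: divide_left_mono)
    then show ?thesis unfolding q_def qm_def qM_def using an by (auto intro!: divide_left_mono mult_pos_pos)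
  qed
  have qm: "1 < qm"
  proof -
    have "1 / pM \<le> 1 / pm" using pm pmM by (auto intro: divide_left_mono)
    moreover have "1 / pm < 1" using pm by simp
    ultimately have "0 < 1 / pm - \<alpha> / real n" "1 / pm - \<alpha> / real n < 1" using an by linarith+
    then show ?thesis unfolding qm_def by simp
  qed
  have q'e: "1 / (1 - 1 / q y) = 1 / (1 - 1 / p y + \<alpha> / real CARD('n))" for y
  proof -
    have "1 / q y = 1 / p y - \<alpha> / real n" by (simp add: q_def)
    then show ?thesis by (simp add: n_def)
  qed
  define A where "A f k = mavg (\<lambda>y. f y powr t) (gcube k) powr (1 / t)" for f :: "real^'n \<Rightarrow> real" and k
  have A0: "0 \<le> A f k" for f k by (simp add: A_def)
  have finite_t: "(\<integral>\<^sup>+y\<in>gcube k. ennreal (f y powr t) \<partial>lebesgue) < \<infinity>"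
    if "f \<in> borel_measurable lebesgue" "e \<in> borel_measurable lebesgue" "\<And>y. 0 \<le> f y" "\<And>y. t \<le> e y" "(\<integral>\<^sup>+y. ennreal (f y powr e y) \<partial>lebesgue) \<le> 1"
    for f e :: "real^'n \<Rightarrow> real" and k
  proof -
    note [measurable] = that(1,2)
    have "(\<integral>\<^sup>+y\<in>gcube k. ennreal (f y powr t) \<partial>lebesgue) \<le> (\<integral>\<^sup>+y. indicator (gcube k) y + ennreal (f y powr e y) \<partial>lebesgue)"
    proof (intro nn_integral_mono)
      fix y
      have "f y powr t \<le> 1 + f y powr e y"
      proof (cases "f y \<le> 1")
        case True
        then have "f y powr t \<le> 1" using that(3)[of y] t(1) by (intro powr_le1) auto
        then show ?thesis by (simp add: add_increasing2)
      next
        case False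
        then have "f y powr t \<le> f y powr e y" using that(4)[of y] by (intro powr_mono) auto
        then show ?thesis by simp
      qed
      then have "ennreal (f y powr t) \<le> 1 + ennreal (f y powr e y)"
        by (metis ennreal_1 ennreal_leI ennreal_plus powr_ge_zero zero_le_one)
      then show "ennreal (f y powr t) * indicator (gcube k) y \<le> indicator (gcube k) y + ennreal (f y powr e y)"
        by (auto simp: indicator_def)
    qed
    also have "\<dots> = emeasure lebesgue (gcube k :: (real^'n) set) + (\<integral>\<^sup>+y. ennreal (f y powr e y) \<partial>lebesgue)"
      by (subst nn_integral_add) auto
    also have "\<dots> < \<infinity>" using that(5) by (auto simp: less_top[symmetric] top_unique)
    finally show ?thesis .
  qed
  have avg_le: "(\<integral>\<^sup>+y\<in>gcube k. ennreal (f y) \<partial>lebesgue) \<le> ennreal (A f k) * emeasure lebesgue (gcube k :: (real^'n) set)"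
    if [measurable]: "f \<in> borel_measurable lebesgue" and f0: "\<And>y. 0 \<le> f y" and fin: "(\<integral>\<^sup>+y\<in>gcube k. ennreal (f y powr t) \<partial>lebesgue) < \<infinity>"
    for f :: "real^'n \<Rightarrow> real" and k
  proof -
    have fin1: "(\<integral>\<^sup>+y\<in>gcube k. ennreal (f y) \<partial>lebesgue) < \<infinity>"
      by (rule nn_integral_gcube_finite[OF _ f0 _ fin]) (use t in auto)
    have "mavg f (gcube k) powr t \<le> mavg (\<lambda>y. f y powr t) (gcube k)"
      by (rule mavg_gcube_powr_le[OF _ f0 _ fin]) (use t in auto)
    then have "(mavg f (gcube k) powr t) powr (1 / t) \<le> A f k"
      unfolding A_def using t by (intro powr_mono2) auto
    then have "mavg f (gcube k) \<le> A f k" using t by (simp add: powr_powr)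
    then show ?thesis
      by (subst mavg_gcube[OF fin1, symmetric]) (auto intro!: mult_right_mono ennreal_leI)
  qed
  define w where "w k = ennreal (gside (fst k) powr (\<alpha> - real n))" for k :: "int \<times> ('n \<Rightarrow> int)"
  define V where "V k = emeasure lebesgue (gcube k :: (real^'n) set)" for k
  \<comment> \<open>The kernel weight side^(\<alpha> - n) times |Q| twice, once from each average,
    is side^\<alpha> * |Q|, the weight of the bilinear form.\<close>
  have wV: "w k * (V k * V k) * ennreal a = ennreal (gside (fst k) powr \<alpha> * a) * V k" if "0 \<le> a" for k a
  proof -
    define s where "s = gside (fst k)"
    have s: "0 < s" by (simp add: s_def)
    have "s powr (\<alpha> - real n) * s ^ n = s powr \<alpha>"
      using s by (simp add: powr_diff powr_realpow)
    moreover have "w k * V k = ennreal (s powr (\<alpha> - real n) * s ^ n)"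
      unfolding w_def V_def s_def n_def by (simp add: ennreal_mult)
    ultimately have "w k * V k = ennreal (s powr \<alpha>)" by simp
    then have "w k * V k * ennreal a = ennreal (s powr \<alpha> * a)" using that by (simp add: ennreal_mult)
    then show ?thesis by (metis (no_types) mult.assoc mult.commute s_def)
  qed
  show thesis
  \<comment> \<open>\<open>C1\<close> serves the fractional integral, \<open>2 * C2 * C1\<close> the
    two terms of its commutator, and the summand 1 keeps the constant positive.\<close>
  proof (rule that[of "2 * C2 * C1 + C1 + 1"])
    show "0 < 2 * C2 * C1 + C1 + 1" using C1 C2 by (simp add: add_nonneg_pos)
    fix f :: "real^'n \<Rightarrow> real"
    assume fm[measurable]: "f \<in> borel_measurable lebesgue" and f0: "\<And>y. 0 \<le> f y"
      and fI: "(\<integral>\<^sup>+y. ennreal (f y powr p y) \<partial>lebesgue) \<le> 1"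
    have tp: "t \<le> p y" for y using t(2) p(3)[of y] by auto
    have ft: "(\<integral>\<^sup>+y\<in>gcube k. ennreal (f y powr t) \<partial>lebesgue) < \<infinity>" for k
      by (rule finite_t[OF fm p(2) f0 tp fI])
    show "(AE x in lebesgue. frac_int \<alpha> f x \<noteq> \<infinity>) \<and>
       (\<integral>\<^sup>+x. ennreal ((enn2real (frac_int \<alpha> f x) / (2 * C2 * C1 + C1 + 1)) powr (1 / (1 / p x - \<alpha> / real CARD('n)))) \<partial>lebesgue) \<le> 1"
    proof -
      have D: "0 < 2 * C2 * C1 + C1 + 1" using C1 C2 by (simp add: add_nonneg_pos)
      have dual: "(\<integral>\<^sup>+y. frac_int \<alpha> f y * ennreal (g y) \<partial>lebesgue) \<le> ennreal (2 * C2 * C1 + C1 + 1)"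
        if gm[measurable]: "g \<in> borel_measurable lebesgue" and g0: "\<And>y. 0 \<le> g y"
          and gI: "(\<integral>\<^sup>+y. ennreal (g y powr (1 / (1 - 1 / q y))) \<partial>lebesgue) \<le> 1" for g
      proof -
        have gt: "(\<integral>\<^sup>+y\<in>gcube k. ennreal (g y powr t) \<partial>lebesgue) < \<infinity>" for k
          by (rule finite_t[OF gm _ g0 _ gI]) (use t(3) in \<open>simp_all add: q'e\<close>)
        have "(\<integral>\<^sup>+y. frac_int \<alpha> f y * ennreal (g y) \<partial>lebesgue)
          = (\<integral>\<^sup>+y. \<integral>\<^sup>+k. w k * (\<integral>\<^sup>+z\<in>gcube k. ennreal (f z) \<partial>lebesgue) * (ennreal (g y) * indicator (gcube k) y) \<partial>count_space UNIV \<partial>lebesgue)"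
        proof (intro nn_integral_cong)
          fix y
          have "frac_int \<alpha> f y * ennreal (g y) = (\<integral>\<^sup>+k. w k * indicator (gcube k) y * (\<integral>\<^sup>+z\<in>gcube k. ennreal (f z) \<partial>lebesgue) * ennreal (g y) \<partial>count_space UNIV)"
            unfolding frac_int_def w_def n_def by (rule nn_integral_multc[symmetric]) simp
          also have "\<dots> = (\<integral>\<^sup>+k. w k * (\<integral>\<^sup>+z\<in>gcube k. ennreal (f z) \<partial>lebesgue) * (ennreal (g y) * indicator (gcube k) y) \<partial>count_space UNIV)"
            by (intro nn_integral_cong) (simp only: mult_ac)
          finally show "frac_int \<alpha> f y * ennreal (g y) = \<dots>" .
        qed
        also have "\<dots> = (\<integral>\<^sup>+k. w k * (\<integral>\<^sup>+z\<in>gcube k. ennreal (f z) \<partial>lebesgue) * (\<integral>\<^sup>+z\<in>gcube k. ennreal (g z) \<partial>lebesgue) \<partial>count_space UNIV)"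
          by (subst nn_integral_count_space_nn_integral) (auto simp: nn_integral_cmult)
        also have "\<dots> \<le> (\<integral>\<^sup>+k. w k * (ennreal (A f k) * V k) * (ennreal (A g k) * V k) \<partial>count_space UNIV)"
          unfolding V_def by (intro nn_integral_mono mult_mono mult_left_mono avg_le ft gt fm gm f0 g0) auto
        also have "\<dots> = (\<integral>\<^sup>+k. ennreal (gside (fst k) powr \<alpha> * A f k * A g k) * V k \<partial>count_space UNIV)"
        proof (intro nn_integral_cong)
          fix k
          have "w k * (ennreal (A f k) * V k) * (ennreal (A g k) * V k) = w k * (V k * V k) * (ennreal (A f k) * ennreal (A g k))"
            by (simp add: mult_ac)
          also have "\<dots> = ennreal (gside (fst k) powr \<alpha> * (A f k * A g k)) * V k"
            using wV[of "A f k * A g k" k] A0 by (simp add: ennreal_mult)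
          finally show "w k * (ennreal (A f k) * V k) * (ennreal (A g k) * V k) = ennreal (gside (fst k) powr \<alpha> * A f k * A g k) * V k"
            by (simp add: mult.assoc)
        qed
        also have "\<dots> \<le> ennreal C1"
          unfolding A_def V_def by (rule C1(2)[OF fm f0 fI gm g0]) (use gI in \<open>simp add: q'e\<close>)
        also have "\<dots> \<le> ennreal (2 * C2 * C1 + C1 + 1)" using C1(1) C2(1) by (intro ennreal_leI) simp
        finally show ?thesis .
      qed
      show ?thesis
        using duality_modular_bound[OF \<open>q \<in> borel_measurable lebesgue\<close> qb qm D frac_int_measurable dual]
        by (simp add: q_def n_def)
    qed
    fix b :: "'n cfun" and \<beta> :: real
    assume b: "b \<in> BMO" and \<beta>: "0 < \<beta>" "BMO_norm b \<le> \<beta>"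
    have loc: "b locally_integrable_on UNIV" using b by (simp add: BMO_def)
    note [measurable] = loc_measurable[OF loc]
    show "(AE x in lebesgue. frac_comm \<alpha> b f x \<noteq> \<infinity>) \<and>
       (\<integral>\<^sup>+x. ennreal ((enn2real (frac_comm \<alpha> b f x) / ((2 * C2 * C1 + C1 + 1) * \<beta>)) powr (1 / (1 / p x - \<alpha> / real CARD('n)))) \<partial>lebesgue) \<le> 1"
    proof -
      have D: "0 < (2 * C2 * C1 + C1 + 1) * \<beta>" using C1 C2 \<beta> by (simp add: add_nonneg_pos)
      define B where "B h k = (\<integral>\<^sup>+y\<in>gcube k. ennreal (norm (b y - average b (gcube k)) * h y) \<partial>lebesgue)" for h :: "real^'n \<Rightarrow> real" and k
      have dual: "(\<integral>\<^sup>+y. frac_comm \<alpha> b f y * ennreal (g y) \<partial>lebesgue) \<le> ennreal ((2 * C2 * C1 + C1 + 1) * \<beta>)"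
        if gm[measurable]: "g \<in> borel_measurable lebesgue" and g0: "\<And>y. 0 \<le> g y"
          and gI: "(\<integral>\<^sup>+y. ennreal (g y powr (1 / (1 - 1 / q y))) \<partial>lebesgue) \<le> 1" for g
      proof -
        have gt: "(\<integral>\<^sup>+y\<in>gcube k. ennreal (g y powr t) \<partial>lebesgue) < \<infinity>" for k
          by (rule finite_t[OF gm _ g0 _ gI]) (use t(3) in \<open>simp_all add: q'e\<close>)
        have Bf: "B f k \<le> ennreal (C2 * \<beta> * A f k) * V k" and Bg: "B g k \<le> ennreal (C2 * \<beta> * A g k) * V k" for k
          unfolding B_def A_def V_def by (rule C2(2)[OF b \<beta> fm f0 ft], rule C2(2)[OF b \<beta> gm g0 gt])
        have "(\<integral>\<^sup>+y. frac_comm \<alpha> b f y * ennreal (g y) \<partial>lebesgue)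
          = (\<integral>\<^sup>+y. \<integral>\<^sup>+k. w k * ((\<integral>\<^sup>+z\<in>gcube k. ennreal (f z) \<partial>lebesgue) * (ennreal (norm (b y - average b (gcube k)) * g y) * indicator (gcube k) y)
                + B f k * (ennreal (g y) * indicator (gcube k) y)) \<partial>count_space UNIV \<partial>lebesgue)"
        proof (intro nn_integral_cong)
          fix y
          have "frac_comm \<alpha> b f y * ennreal (g y) = (\<integral>\<^sup>+k. w k * indicator (gcube k) y
              * (ennreal (norm (b y - average b (gcube k))) * (\<integral>\<^sup>+z\<in>gcube k. ennreal (f z) \<partial>lebesgue) + B f k) * ennreal (g y) \<partial>count_space UNIV)"
            unfolding frac_comm_def w_def n_def B_def by (rule nn_integral_multc[symmetric]) simp
          also have "\<dots> = (\<integral>\<^sup>+k. w k * ((\<integral>\<^sup>+z\<in>gcube k. ennreal (f z) \<partial>lebesgue) * (ennreal (norm (b y - average b (gcube k)) * g y) * indicator (gcube k) y)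
                + B f k * (ennreal (g y) * indicator (gcube k) y)) \<partial>count_space UNIV)"
          proof (intro nn_integral_cong)
            fix k
            have e: "ennreal (norm (b y - average b (gcube k)) * g y) = ennreal (norm (b y - average b (gcube k))) * ennreal (g y)"
              using g0 by (intro ennreal_mult) auto
            show "w k * indicator (gcube k) y
              * (ennreal (norm (b y - average b (gcube k))) * (\<integral>\<^sup>+z\<in>gcube k. ennreal (f z) \<partial>lebesgue) + B f k) * ennreal (g y)
              = w k * ((\<integral>\<^sup>+z\<in>gcube k. ennreal (f z) \<partial>lebesgue) * (ennreal (norm (b y - average b (gcube k)) * g y) * indicator (gcube k) y)
                + B f k * (ennreal (g y) * indicator (gcube k) y))"
              unfolding e by (simp only: distrib_left distrib_right mult_ac)
          qed
          finally show "frac_comm \<alpha> b f y * ennreal (g y) = \<dots>" .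
        qed
        also have "\<dots> = (\<integral>\<^sup>+k. w k * ((\<integral>\<^sup>+z\<in>gcube k. ennreal (f z) \<partial>lebesgue) * B g k
                + B f k * (\<integral>\<^sup>+z\<in>gcube k. ennreal (g z) \<partial>lebesgue)) \<partial>count_space UNIV)"
          unfolding B_def
          by (subst nn_integral_count_space_nn_integral) (auto simp: nn_integral_cmult nn_integral_add)
        also have "\<dots> \<le> (\<integral>\<^sup>+k. w k * ((ennreal (A f k) * V k) * (ennreal (C2 * \<beta> * A g k) * V k)
                + (ennreal (C2 * \<beta> * A f k) * V k) * (ennreal (A g k) * V k)) \<partial>count_space UNIV)"
          using avg_le[OF fm f0 ft] avg_le[OF gm g0 gt] unfolding V_def[symmetric]
          by (intro nn_integral_mono mult_left_mono add_mono mult_mono Bf Bg) auto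
        also have "\<dots> = (\<integral>\<^sup>+k. ennreal (2 * C2 * \<beta>) * (ennreal (gside (fst k) powr \<alpha> * A f k * A g k) * V k) \<partial>count_space UNIV)"
        proof (intro nn_integral_cong)
          fix k
          have CB: "0 \<le> C2 * \<beta>" using C2 \<beta> by simp
          have e: "ennreal (C2 * \<beta> * A h k) = ennreal (C2 * \<beta>) * ennreal (A h k)" for h
            using CB A0 by (intro ennreal_mult) auto
          have "w k * ((ennreal (A f k) * V k) * (ennreal (C2 * \<beta> * A g k) * V k)
                + (ennreal (C2 * \<beta> * A f k) * V k) * (ennreal (A g k) * V k))
             = ennreal (C2 * \<beta>) * (w k * (V k * V k) * (ennreal (A f k) * ennreal (A g k)))
              + ennreal (C2 * \<beta>) * (w k * (V k * V k) * (ennreal (A f k) * ennreal (A g k)))"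
            unfolding e distrib_left by (intro arg_cong2[where f="(+)"]) (simp_all only: mult_ac)
          also have "\<dots> = 2 * ennreal (C2 * \<beta>) * (w k * (V k * V k) * (ennreal (A f k) * ennreal (A g k)))"
            by (simp only: mult_2[symmetric] mult.assoc)
          also have "ennreal (A f k) * ennreal (A g k) = ennreal (A f k * A g k)"
            using A0 by (intro ennreal_mult[symmetric]) auto
          also have "w k * (V k * V k) * ennreal (A f k * A g k) = ennreal (gside (fst k) powr \<alpha> * (A f k * A g k)) * V k"
            by (rule wV) (use A0 in auto)
          also have "2 * ennreal (C2 * \<beta>) = ennreal (2 * C2 * \<beta>)"
            using ennreal_double[OF CB] by (simp add: mult.assoc)
          finally show "w k * ((ennreal (A f k) * V k) * (ennreal (C2 * \<beta> * A g k) * V k)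
                + (ennreal (C2 * \<beta> * A f k) * V k) * (ennreal (A g k) * V k))
             = ennreal (2 * C2 * \<beta>) * (ennreal (gside (fst k) powr \<alpha> * A f k * A g k) * V k)"
            by (simp only: mult.assoc)
        qed
        also have "\<dots> = ennreal (2 * C2 * \<beta>) * (\<integral>\<^sup>+k. ennreal (gside (fst k) powr \<alpha> * A f k * A g k) * V k \<partial>count_space UNIV)"
          by (rule nn_integral_cmult) simp
        also have "\<dots> \<le> ennreal (2 * C2 * \<beta>) * ennreal C1"
        proof (rule mult_left_mono)
          show "(\<integral>\<^sup>+k. ennreal (gside (fst k) powr \<alpha> * A f k * A g k) * V k \<partial>count_space UNIV) \<le> ennreal C1"
            unfolding A_def V_def by (rule C1(2)[OF fm f0 fI gm g0]) (use gI in \<open>simp add: q'e\<close>)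
        qed simp
        also have "\<dots> = ennreal (2 * C2 * \<beta> * C1)" using C2 C1 \<beta> by (intro ennreal_mult[symmetric]) auto
        also have "\<dots> \<le> ennreal ((2 * C2 * C1 + C1 + 1) * \<beta>)"
          using C1(1) C2(1) \<beta> by (intro ennreal_leI) (simp add: algebra_simps)
        finally show ?thesis .
      qed
      show ?thesis
        using duality_modular_bound[OF \<open>q \<in> borel_measurable lebesgue\<close> qb qm D frac_comm_measurable[OF loc_measurable[OF loc]] dual]
        by (simp add: q_def n_def)
    qed
  qed
qed

section \<open>Lebesgue measure on the product space\<close>

lemma prod_mono_ennreal:
  fixes f g :: "'i \<Rightarrow> ennreal"
  assumes "\<And>i. i \<in> I \<Longrightarrow> f i \<le> g i"
  shows "prod f I \<le> prod g I"
  using assms by (induction I rule: infinite_finite_induct) (auto intro: mult_mono)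

lemma Basis_vec_axis: "(Basis :: ('a::euclidean_space ^ 'm::finite) set) = (\<lambda>(j, u). axis j u) ` (UNIV \<times> Basis)"
  unfolding Basis_vec_def by auto

lemma inj_axis_Basis: "inj_on (\<lambda>(j, u). axis j u :: 'a::euclidean_space ^ 'm::finite) (UNIV \<times> Basis)"
  by (auto simp: inj_on_def axis_eq_axis)

lemma box_vec_iff:
  fixes l u :: "'a::euclidean_space ^ 'm::finite"
  shows "y \<in> box l u \<longleftrightarrow> (\<forall>j. y $ j \<in> box (l $ j) (u $ j))"
  by (auto simp: mem_box Basis_vec_axis inner_axis)

lemma vec_lambda_measurable_PiM:
  "(\<lambda>f. \<chi> j. f j) \<in> (\<Pi>\<^sub>M j\<in>(UNIV :: 'm::finite set). (lborel :: 'a::euclidean_space measure)) \<rightarrow>\<^sub>M borel"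
proof -
  have "(\<lambda>f. (\<chi> j. f j) \<bullet> b) \<in> borel_measurable (\<Pi>\<^sub>M j\<in>(UNIV :: 'm set). (lborel :: 'a measure))"
    if b: "b \<in> Basis" for b :: "'a ^ 'm"
  proof -
    obtain j u where "b = axis j u" using b by (auto simp: Basis_vec_axis)
    then have "(\<lambda>f. (\<chi> j. f j) \<bullet> b) = (\<lambda>f :: 'm \<Rightarrow> 'a. f j \<bullet> u)" by (simp add: inner_axis)
    then show ?thesis by simp
  qed
  then show ?thesis by (subst borel_measurable_euclidean_space) blast
qed

text \<open>Two measures on the nested vector type have to be matched: Lebesgue measure of that
  Euclidean space and the product over the index type. Agreement on boxes is enough, and it makes
  Tonelli's theorem available for products of functions of single components.\<close>

lemma lborel_vec_eq_distr_PiM: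
  "(lborel :: ('a::euclidean_space ^ 'm::finite) measure)
    = distr (\<Pi>\<^sub>M j\<in>(UNIV :: 'm set). (lborel :: 'a measure)) borel (\<lambda>f. \<chi> j. f j)"
proof (rule lborel_eqI)
  fix l u :: "'a ^ 'm" assume le: "\<And>b. b \<in> Basis \<Longrightarrow> l \<bullet> b \<le> u \<bullet> b"
  have le': "l $ j \<bullet> b \<le> u $ j \<bullet> b" if "b \<in> Basis" for j b
    using le[of "axis j b"] that by (simp add: inner_axis)
  interpret product_sigma_finite "\<lambda>j :: 'm. lborel :: 'a measure" ..
  have "emeasure (distr (\<Pi>\<^sub>M j\<in>(UNIV :: 'm set). (lborel :: 'a measure)) borel (\<lambda>f. \<chi> j. f j)) (box l u)
     = emeasure (\<Pi>\<^sub>M j\<in>(UNIV :: 'm set). (lborel :: 'a measure)) (PiE UNIV (\<lambda>j. box (l $ j) (u $ j)))"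
    by (subst emeasure_distr[OF vec_lambda_measurable_PiM])
       (auto intro!: arg_cong2[where f=emeasure] simp: box_vec_iff space_PiM PiE_iff)
  also have "\<dots> = (\<Prod>j\<in>UNIV. emeasure lborel (box (l $ j) (u $ j)))"
    by (rule emeasure_PiM) auto
  also have "\<dots> = (\<Prod>j\<in>UNIV. ennreal (\<Prod>b\<in>Basis. (u $ j - l $ j) \<bullet> b))"
    by (intro prod.cong refl emeasure_lborel_box le')
  also have "\<dots> = ennreal (\<Prod>j\<in>UNIV. \<Prod>b\<in>Basis. (u $ j - l $ j) \<bullet> b)"
    using le' by (intro prod_ennreal prod_nonneg) (simp add: inner_diff_left)
  also have "(\<Prod>j\<in>UNIV. \<Prod>b\<in>Basis. (u $ j - l $ j) \<bullet> b) = (\<Prod>(j, b)\<in>UNIV \<times> Basis. (u $ j - l $ j) \<bullet> b)"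
    by (rule prod.cartesian_product)
  also have "\<dots> = (\<Prod>b\<in>Basis. (u - l) \<bullet> b)"
    unfolding Basis_vec_axis by (subst prod.reindex[OF inj_axis_Basis]) (auto simp: inner_axis intro!: prod.cong)
  finally show "emeasure (distr (\<Pi>\<^sub>M j\<in>(UNIV :: 'm set). (lborel :: 'a measure)) borel (\<lambda>f. \<chi> j. f j)) (box l u)
     = ennreal (\<Prod>b\<in>Basis. (u - l) \<bullet> b)" .
qed simp

lemma nn_integral_vec_prod:
  fixes \<phi> :: "'m::finite \<Rightarrow> 'a::euclidean_space \<Rightarrow> ennreal"
  assumes [measurable]: "\<And>j. \<phi> j \<in> borel_measurable borel"
  shows "(\<integral>\<^sup>+y. (\<Prod>j\<in>UNIV. \<phi> j (y $ j)) \<partial>lborel) = (\<Prod>j\<in>UNIV. \<integral>\<^sup>+z. \<phi> j z \<partial>lborel)"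
proof -
  interpret product_sigma_finite "\<lambda>j :: 'm. lborel :: 'a measure" ..
  have [measurable]: "(\<lambda>y :: 'a ^ 'm. y $ j) \<in> borel_measurable borel" for j
    by (intro borel_measurable_continuous_onI continuous_intros)
  have "(\<integral>\<^sup>+y. (\<Prod>j\<in>UNIV. \<phi> j (y $ j)) \<partial>lborel)
      = (\<integral>\<^sup>+f. (\<Prod>j\<in>UNIV. \<phi> j ((\<chi> j. f j) $ j)) \<partial>(\<Pi>\<^sub>M j\<in>UNIV. lborel))"
    unfolding lborel_vec_eq_distr_PiM by (rule nn_integral_distr[OF vec_lambda_measurable_PiM]) measurable
  also have "\<dots> = (\<Prod>j\<in>UNIV. \<integral>\<^sup>+z. \<phi> j z \<partial>lborel)"
    by (simp add: product_nn_integral_prod)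
  finally show ?thesis .
qed

text \<open>The preimage of a null set under a projection is a cylinder; in the product formula for
  its measure one factor is 0, and 0 prevails even though the other factors are infinite.\<close>

lemma AE_vec_nth:
  fixes P :: "'a::euclidean_space \<Rightarrow> bool" and j :: "'m::finite"
  assumes "AE z in lebesgue. P z"
  shows "AE y in lebesgue. P (y $ j)"
proof -
  from assms have "AE z in lborel. P z" by (simp add: AE_completion_iff)
  then obtain N where N: "{z. \<not> P z} \<subseteq> N" "emeasure lborel N = 0" "N \<in> sets lborel"
    by (auto elim!: AE_E)
  define \<phi> where "\<phi> i = (if i = j then indicator N else (\<lambda>_. 1 :: ennreal))" for i
  have [measurable]: "\<phi> i \<in> borel_measurable borel" for i using N(3) by (simp add: \<phi>_def)
  have "(\<integral>\<^sup>+y. indicator N (y $ j) \<partial>lborel) = (\<integral>\<^sup>+y. (\<Prod>i\<in>UNIV. \<phi> i (y $ i)) \<partial>lborel)"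
    by (intro nn_integral_cong) (simp add: \<phi>_def if_distrib[of "\<lambda>h. h _"] cong: if_cong)
  also have "\<dots> = (\<Prod>i\<in>UNIV. \<integral>\<^sup>+z. \<phi> i z \<partial>lborel)" by (rule nn_integral_vec_prod) simp
  also have "\<dots> = 0"
    using N by (intro prod_zero bexI[of _ j]) (auto simp: \<phi>_def)
  finally have z: "(\<integral>\<^sup>+y. indicator N ((y :: 'a ^ 'm) $ j) \<partial>lborel) = 0" .
  have [measurable]: "(\<lambda>y :: 'a ^ 'm. y $ j) \<in> borel_measurable borel"
    by (intro borel_measurable_continuous_onI continuous_intros)
  have "AE y in lborel. indicator N ((y :: 'a ^ 'm) $ j) = (0 :: ennreal)"
    using z N(3) by (subst (asm) nn_integral_0_iff_AE) auto
  then have "AE y in lborel. P ((y :: 'a ^ 'm) $ j)"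
    by eventually_elim (use N(1) in \<open>auto simp: indicator_def split: if_splits\<close>)
  then show ?thesis by (rule AE_completion)
qed

text \<open>For complete measures this is more than continuity: the preimage of a non-Borel null set
  has to be measurable, and it is because that preimage is again null.\<close>

lemma vec_nth_measurable_lebesgue [measurable]:
  "(\<lambda>y :: 'a::euclidean_space ^ 'm::finite. y $ j) \<in> lebesgue \<rightarrow>\<^sub>M lebesgue"
proof (rule measurableI)
  fix A :: "'a set" assume "A \<in> sets lebesgue"
  then obtain S N N' where A: "A = S \<union> N" "N \<subseteq> N'" "N' \<in> null_sets lborel" "S \<in> sets lborel"
    by (rule sets_completionE)
  have [measurable]: "(\<lambda>y :: 'a ^ 'm. y $ j) \<in> borel_measurable borel"
    by (intro borel_measurable_continuous_onI continuous_intros)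
  have "(\<lambda>y :: 'a ^ 'm. y $ j) -` S \<inter> space borel \<in> sets borel"
    using A(4) by (intro measurable_sets) auto
  then have S: "(\<lambda>y :: 'a ^ 'm. y $ j) -` S \<in> sets lebesgue" by (simp add: sets_completionI_sets)
  have "AE z in lebesgue. z \<notin> N'"
    using A(3) by (intro AE_completion AE_not_in)
  from AE_vec_nth[OF this, of j] have "AE y in lebesgue. (y :: 'a ^ 'm) \<notin> (\<lambda>y. y $ j) -` N"
    by eventually_elim (use A(2) in auto)
  then have "(\<lambda>y :: 'a ^ 'm. y $ j) -` N \<in> null_sets lebesgue"
    unfolding eventually_ae_filter_negligible negligible_iff_null_sets[symmetric]
    by (auto intro: negligible_subset)
  then show "(\<lambda>y :: 'a ^ 'm. y $ j) -` A \<inter> space lebesgue \<in> sets lebesgue"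
    using S A(1) by (auto simp: vimage_Un)
qed simp

text \<open>A Borel version is made infinite on a Borel null set that contains all disagreements.
  Domination then holds at every point and passes to products of components without any treatment of
  null sets.\<close>

lemma lebesgue_measurable_borel_majorant:
  fixes \<phi> :: "'a::euclidean_space \<Rightarrow> ennreal"
  assumes "\<phi> \<in> borel_measurable lebesgue"
  obtains \<psi> where "\<psi> \<in> borel_measurable borel" "\<And>z. \<phi> z \<le> \<psi> z" "(\<integral>\<^sup>+z. \<psi> z \<partial>lborel) = (\<integral>\<^sup>+z. \<phi> z \<partial>lebesgue)"
proof -
  obtain g where g[measurable]: "g \<in> borel_measurable lborel" and ae: "AE z in lborel. \<phi> z = g z"
    using completion_ex_borel_measurable[OF assms] by auto
  obtain N where N: "{z. \<phi> z \<noteq> g z} \<subseteq> N" "emeasure lborel N = 0" "N \<in> sets lborel"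
    using ae by (auto elim!: AE_E)
  define \<psi> where "\<psi> z = (if z \<in> N then \<infinity> else g z)" for z
  have [measurable]: "N \<in> sets borel" using N(3) by simp
  have [measurable]: "g \<in> borel_measurable borel" using g by simp
  show thesis
  proof (rule that[of \<psi>])
    show "\<psi> \<in> borel_measurable borel" unfolding \<psi>_def[abs_def] by measurable
    show "\<phi> z \<le> \<psi> z" for z
    proof -
      have "\<phi> z = g z" if "z \<notin> N" using N(1) that by blast
      then show ?thesis by (simp add: \<psi>_def)
    qed
    have "AE z in lborel. z \<notin> N" using N by (intro AE_not_in) auto
    then have "AE z in lborel. \<psi> z = \<phi> z"
      using ae by eventually_elim (simp add: \<psi>_def)
    then show "(\<integral>\<^sup>+z. \<psi> z \<partial>lborel) = (\<integral>\<^sup>+z. \<phi> z \<partial>lebesgue)"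
      unfolding nn_integral_completion by (rule nn_integral_cong_AE)
  qed
qed

lemma nn_integral_vec_prod_le:
  fixes \<phi> :: "'m::finite \<Rightarrow> 'a::euclidean_space \<Rightarrow> ennreal"
  assumes "\<And>j. \<phi> j \<in> borel_measurable lebesgue"
  shows "(\<integral>\<^sup>+y. (\<Prod>j\<in>UNIV. \<phi> j (y $ j)) \<partial>lebesgue) \<le> (\<Prod>j\<in>UNIV. \<integral>\<^sup>+z. \<phi> j z \<partial>lebesgue)"
proof -
  have "\<exists>\<psi>. \<psi> \<in> borel_measurable borel \<and> (\<forall>z. \<phi> j z \<le> \<psi> z) \<and> (\<integral>\<^sup>+z. \<psi> z \<partial>lborel) = (\<integral>\<^sup>+z. \<phi> j z \<partial>lebesgue)" for j
    using lebesgue_measurable_borel_majorant[OF assms[of j]] by metis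
  then obtain \<psi> where \<psi>: "\<And>j. \<psi> j \<in> borel_measurable borel" "\<And>j z. \<phi> j z \<le> \<psi> j z"
    "\<And>j. (\<integral>\<^sup>+z. \<psi> j z \<partial>lborel) = (\<integral>\<^sup>+z. \<phi> j z \<partial>lebesgue)"
    by metis
  have "(\<integral>\<^sup>+y. (\<Prod>j\<in>UNIV. \<phi> j (y $ j)) \<partial>lebesgue) \<le> (\<integral>\<^sup>+y. (\<Prod>j\<in>UNIV. \<psi> j (y $ j)) \<partial>lborel)"
    unfolding nn_integral_completion by (intro nn_integral_mono prod_mono_ennreal \<psi>)
  also have "\<dots> = (\<Prod>j\<in>UNIV. \<integral>\<^sup>+z. \<phi> j z \<partial>lebesgue)"
    by (simp add: nn_integral_vec_prod \<psi>)
  finally show ?thesis .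
qed

section \<open>The kernel estimate\<close>

text \<open>All of \<open>x, y_1, ..., y_m\<close> lie in one grid cube of side comparable to
  \<open>\<Sum>j. |x - y_j|\<close>, which turns the size condition into a product bound.\<close>

lemma size_condition_gcube:
  fixes K :: "real^'n::finite \<Rightarrow> real^'n^'m::finite \<Rightarrow> complex" and \<alpha>i :: "'m \<Rightarrow> real"
  assumes A: "0 \<le> A" "\<And>x y. (x, y) \<in> off_diagonal \<Longrightarrow>
     norm (K x y) \<le> A * (\<Sum>j\<in>UNIV. norm (x - y $ j)) powr (- (real CARD('m) * real CARD('n) - \<alpha>))"
    and \<alpha>: "\<alpha> = (\<Sum>j\<in>UNIV. \<alpha>i j)" "\<And>j. \<alpha>i j \<le> real CARD('n)"
    and xy: "(x, y) \<in> off_diagonal"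
  obtains q where "x \<in> gcube q" "\<And>j. y $ j \<in> gcube q"
    "norm (K x y) \<le> A * (\<Prod>j\<in>UNIV. 6 powr (real CARD('n) - \<alpha>i j)) * (\<Prod>j\<in>UNIV. gside (fst q) powr (\<alpha>i j - real CARD('n)))"
proof -
  define S where "S = (\<Sum>j\<in>UNIV. norm (x - y $ j))"
  have Sj: "norm (x - y $ j) \<le> S" for j
    unfolding S_def by (intro member_le_sum) auto
  obtain j0 where "y $ j0 \<noteq> x" using xy by (auto simp: off_diagonal_def)
  then have S: "0 < S" using Sj[of j0] by (smt (verit) norm_le_zero_iff right_minus_eq)
  \<comment> \<open>The first dyadic scale not below \<open>S\<close>. Then S > 2 powr (k - 1) =
    \<open>gside k\<close> / 6, and since the exponents \<alpha>i j - n are not positive, this is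
    where the constant 6 comes from.\<close>
  define k where "k = \<lceil>log 2 S\<rceil>"
  have "real_of_int k - 1 < log 2 S" "log 2 S \<le> real_of_int k" unfolding k_def by linarith+
  then have k: "2 powr (real_of_int k - 1) < S" "S \<le> 2 powr real_of_int k"
    using S by (auto simp: less_log_iff log_le_iff)
  obtain z where z: "x \<in> gcube (k, z)" "\<And>w. (\<And>i. \<bar>w $ i - x $ i\<bar> \<le> 2 powr real_of_int k) \<Longrightarrow> w \<in> gcube (k, z)"
    using gcube_exists[of x k] by blast
  show thesis
  proof (rule that[of "(k, z)"])
    show "x \<in> gcube (k, z)" by (rule z)
    show "y $ j \<in> gcube (k, z)" for j
    proof (rule z(2))
      fix i
      have "\<bar>(x - y $ j) $ i\<bar> \<le> norm (x - y $ j)" by (rule component_le_norm_cart)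
      then show "\<bar>y $ j $ i - x $ i\<bar> \<le> 2 powr real_of_int k"
        using Sj[of j] k by (simp add: abs_minus_commute)
    qed
    have g: "gside k = 6 * 2 powr (real_of_int k - 1)" by (simp add: gside_def powr_diff)
    have "S powr (- (real CARD('m) * real CARD('n) - \<alpha>)) = S powr (\<Sum>j\<in>(UNIV :: 'm set). \<alpha>i j - real CARD('n))"
      by (simp add: sum_subtractf \<alpha>)
    also have "\<dots> = (\<Prod>j\<in>(UNIV :: 'm set). S powr (\<alpha>i j - real CARD('n)))"
      using S by (simp add: powr_sum)
    also have "\<dots> \<le> (\<Prod>j\<in>(UNIV :: 'm set). 6 powr (real CARD('n) - \<alpha>i j) * gside k powr (\<alpha>i j - real CARD('n)))"
    proof (intro prod_mono conjI)
      fix j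
      have "S powr (\<alpha>i j - real CARD('n)) \<le> (2 powr (real_of_int k - 1)) powr (\<alpha>i j - real CARD('n))"
        using k(1) \<alpha>(2)[of j] by (intro powr_mono2') auto
      also have "\<dots> = 6 powr (real CARD('n) - \<alpha>i j) * gside k powr (\<alpha>i j - real CARD('n))"
        unfolding g by (simp add: powr_mult mult.assoc[symmetric] powr_add[symmetric])
      finally show "S powr (\<alpha>i j - real CARD('n)) \<le> 6 powr (real CARD('n) - \<alpha>i j) * gside k powr (\<alpha>i j - real CARD('n))" .
    qed simp
    finally have "A * S powr (- (real CARD('m) * real CARD('n) - \<alpha>)) \<le> A * (\<Prod>j\<in>(UNIV :: 'm set). 6 powr (real CARD('n) - \<alpha>i j) * gside k powr (\<alpha>i j - real CARD('n)))"
      using A(1) by (intro mult_left_mono) auto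
    moreover have "norm (K x y) \<le> A * S powr (- (real CARD('m) * real CARD('n) - \<alpha>))"
      unfolding S_def by (rule A(2)[OF xy])
    ultimately show "norm (K x y) \<le> A * (\<Prod>j\<in>UNIV. 6 powr (real CARD('n) - \<alpha>i j)) * (\<Prod>j\<in>UNIV. gside (fst (k, z)) powr (\<alpha>i j - real CARD('n)))"
      by (simp add: prod.distrib mult.assoc)
  qed
qed

text \<open>The cube provided by the size condition depends on y, but it is the same for all
  components. Each factor at that cube is at most its own sum over all cubes; this decouples the
  components and Tonelli applies. \<open>D\<close> and \<open>u\<close> are left abstract,
  \<open>u\<close> depending on the cube, so that the plain and the commutator integrand are both
  covered.\<close>

lemma kernel_product_bound:
  fixes K :: "real^'n::finite \<Rightarrow> real^'n^'m::finite \<Rightarrow> complex" and \<alpha>i :: "'m \<Rightarrow> real"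
    and u :: "'m \<Rightarrow> int \<times> ('n \<Rightarrow> int) \<Rightarrow> real^'n \<Rightarrow> ennreal"
  assumes A: "0 \<le> A" "\<And>x y. (x, y) \<in> off_diagonal \<Longrightarrow>
     norm (K x y) \<le> A * (\<Sum>j\<in>UNIV. norm (x - y $ j)) powr (- (real CARD('m) * real CARD('n) - \<alpha>))"
    and \<alpha>: "\<alpha> = (\<Sum>j\<in>UNIV. \<alpha>i j)" "\<And>j. \<alpha>i j \<le> real CARD('n)"
    and u[measurable]: "\<And>j q. u j q \<in> borel_measurable lebesgue"
    and D: "\<And>q y. x \<in> gcube q \<Longrightarrow> (\<And>j. y $ j \<in> gcube q) \<Longrightarrow> D y \<le> (\<Prod>j\<in>UNIV. u j q (y $ j))"
  shows "(\<integral>\<^sup>+y. ennreal (norm (K x y)) * D y \<partial>lebesgue)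
    \<le> ennreal (A * (\<Prod>j\<in>UNIV. 6 powr (real CARD('n) - \<alpha>i j))) *
      (\<Prod>j\<in>UNIV. \<integral>\<^sup>+q. ennreal (gside (fst q) powr (\<alpha>i j - real CARD('n))) * indicator (gcube q) x
         * (\<integral>\<^sup>+z\<in>gcube q. u j q z \<partial>lebesgue) \<partial>count_space UNIV)"
proof -
  define c where "c = A * (\<Prod>j\<in>UNIV. 6 powr (real CARD('n) - \<alpha>i j))"
  have c: "0 \<le> c" using A(1) unfolding c_def by (intro mult_nonneg_nonneg prod_nonneg) auto
  define \<kappa> where "\<kappa> j q z = ennreal (gside (fst q) powr (\<alpha>i j - real CARD('n))) * indicator (gcube q) x * (u j q z * indicator (gcube q) z)" for j q z
  have \<kappa>m[measurable]: "\<kappa> j q \<in> borel_measurable lebesgue" for j q unfolding \<kappa>_def[abs_def] by measurable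
  have \<kappa>Sm: "(\<lambda>z. \<integral>\<^sup>+q. \<kappa> j q z \<partial>count_space UNIV) \<in> borel_measurable lebesgue" for j
    by measurable
  have "AE y in lebesgue. (x, y :: real^'n^'m) \<in> off_diagonal"
  proof -
    have "AE y in lebesgue. y \<notin> {\<chi> j. x :: real^'n^'m}"
      by (rule AE_not_in) (simp add: negligible_iff_null_sets[symmetric])
    then show ?thesis by eventually_elim (auto simp: off_diagonal_def vec_eq_iff)
  qed
  then have "AE y in lebesgue. ennreal (norm (K x y)) * D y \<le> ennreal c * (\<Prod>j\<in>UNIV. \<integral>\<^sup>+q. \<kappa> j q (y $ j) \<partial>count_space UNIV)"
  proof eventually_elim
    case (elim y)
    obtain q where q: "x \<in> gcube q" "\<And>j. y $ j \<in> gcube q"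
      "norm (K x y) \<le> c * (\<Prod>j\<in>UNIV. gside (fst q) powr (\<alpha>i j - real CARD('n)))"
      unfolding c_def using size_condition_gcube[OF A \<alpha> elim] by blast
    have "ennreal (norm (K x y)) * D y \<le> ennreal (c * (\<Prod>j\<in>UNIV. gside (fst q) powr (\<alpha>i j - real CARD('n)))) * (\<Prod>j\<in>UNIV. u j q (y $ j))"
      using q by (intro mult_mono ennreal_leI D) auto
    also have "\<dots> = ennreal c * (\<Prod>j\<in>UNIV. \<kappa> j q (y $ j))"
    proof -
      have "ennreal (c * (\<Prod>j\<in>UNIV. gside (fst q) powr (\<alpha>i j - real CARD('n))))
        = ennreal c * (\<Prod>j\<in>UNIV. ennreal (gside (fst q) powr (\<alpha>i j - real CARD('n))))"
        using c by (simp add: ennreal_mult prod_nonneg prod_ennreal)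
      then show ?thesis using q by (simp add: \<kappa>_def prod.distrib mult.assoc)
    qed
    \<comment> \<open>One term is replaced by the whole sum separately in each factor, so the cubes
      in different factors are no longer tied together.\<close>
    also have "\<dots> \<le> ennreal c * (\<Prod>j\<in>UNIV. \<integral>\<^sup>+q. \<kappa> j q (y $ j) \<partial>count_space UNIV)"
      by (intro mult_left_mono prod_mono_ennreal nn_integral_ge_point) auto
    finally show ?case .
  qed
  then have "(\<integral>\<^sup>+y. ennreal (norm (K x y)) * D y \<partial>lebesgue)
    \<le> (\<integral>\<^sup>+y. ennreal c * (\<Prod>j\<in>UNIV. \<integral>\<^sup>+q. \<kappa> j q (y $ j) \<partial>count_space UNIV) \<partial>lebesgue)"
    by (rule nn_integral_mono_AE)
  also have "\<dots> = ennreal c * (\<integral>\<^sup>+y. (\<Prod>j\<in>UNIV. \<integral>\<^sup>+q. \<kappa> j q (y $ j) \<partial>count_space UNIV) \<partial>lebesgue)"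
  proof (rule nn_integral_cmult)
    have "(\<lambda>y. \<integral>\<^sup>+q. \<kappa> j q (y $ j) \<partial>count_space UNIV) \<in> borel_measurable lebesgue" for j
      using measurable_compose[OF vec_nth_measurable_lebesgue \<kappa>Sm] .
    then show "(\<lambda>y. \<Prod>j\<in>UNIV. \<integral>\<^sup>+q. \<kappa> j q (y $ j) \<partial>count_space UNIV) \<in> borel_measurable lebesgue"
      by (rule borel_measurable_prod_ennreal)
  qed
  also have "\<dots> \<le> ennreal c * (\<Prod>j\<in>UNIV. \<integral>\<^sup>+z. \<integral>\<^sup>+q. \<kappa> j q z \<partial>count_space UNIV \<partial>lebesgue)"
    by (intro mult_left_mono nn_integral_vec_prod_le \<kappa>Sm) simp
  also have "(\<lambda>j. \<integral>\<^sup>+z. \<integral>\<^sup>+q. \<kappa> j q z \<partial>count_space UNIV \<partial>lebesgue)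
    = (\<lambda>j. \<integral>\<^sup>+q. ennreal (gside (fst q) powr (\<alpha>i j - real CARD('n))) * indicator (gcube q) x
         * (\<integral>\<^sup>+z\<in>gcube q. u j q z \<partial>lebesgue) \<partial>count_space UNIV)"
    unfolding \<kappa>_def
    by (rule ext, subst nn_integral_count_space_nn_integral) (auto simp: nn_integral_cmult)
  finally show ?thesis by (simp add: c_def)
qed

lemma kernel_frac_int_bound:
  fixes K :: "real^'n::finite \<Rightarrow> real^'n^'m::finite \<Rightarrow> complex" and \<alpha>i :: "'m \<Rightarrow> real"
  assumes A: "0 \<le> A" "\<And>x y. (x, y) \<in> off_diagonal \<Longrightarrow>
     norm (K x y) \<le> A * (\<Sum>j\<in>UNIV. norm (x - y $ j)) powr (- (real CARD('m) * real CARD('n) - \<alpha>))"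
    and \<alpha>: "\<alpha> = (\<Sum>j\<in>UNIV. \<alpha>i j)" "\<And>j. \<alpha>i j \<le> real CARD('n)"
    and f: "\<And>j. f j \<in> borel_measurable lebesgue" "\<And>j y. 0 \<le> f j y"
  shows "(\<integral>\<^sup>+y. ennreal (norm (K x y)) * ennreal (\<Prod>j\<in>UNIV. f j (y $ j)) \<partial>lebesgue)
    \<le> ennreal (A * (\<Prod>j\<in>UNIV. 6 powr (real CARD('n) - \<alpha>i j))) * (\<Prod>j\<in>UNIV. frac_int (\<alpha>i j) (f j) x)"
  unfolding frac_int_def using f
  by (intro kernel_product_bound[OF A \<alpha>, where u="\<lambda>j q z. ennreal (f j z)"]) (auto simp: prod_ennreal)

text \<open>The average of b over the cube is inserted between b(x) and b(y_i). It must be the cube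
  common to x and all y_j, so the i-th factor has to depend on the cube.\<close>

lemma kernel_frac_comm_bound:
  fixes K :: "real^'n::finite \<Rightarrow> real^'n^'m::finite \<Rightarrow> complex" and \<alpha>i :: "'m \<Rightarrow> real"
  assumes A: "0 \<le> A" "\<And>x y. (x, y) \<in> off_diagonal \<Longrightarrow>
     norm (K x y) \<le> A * (\<Sum>j\<in>UNIV. norm (x - y $ j)) powr (- (real CARD('m) * real CARD('n) - \<alpha>))"
    and \<alpha>: "\<alpha> = (\<Sum>j\<in>UNIV. \<alpha>i j)" "\<And>j. \<alpha>i j \<le> real CARD('n)"
    and f: "\<And>j. f j \<in> borel_measurable lebesgue" "\<And>j y. 0 \<le> f j y"
    and b: "b \<in> borel_measurable lebesgue"
  shows "(\<integral>\<^sup>+y. ennreal (norm (K x y)) * ennreal (norm (b x - b (y $ i)) * (\<Prod>j\<in>UNIV. f j (y $ j))) \<partial>lebesgue)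
    \<le> ennreal (A * (\<Prod>j\<in>UNIV. 6 powr (real CARD('n) - \<alpha>i j)))
      * (frac_comm (\<alpha>i i) b (f i) x * (\<Prod>j\<in>UNIV - {i}. frac_int (\<alpha>i j) (f j) x))"
proof -
  note [measurable] = f(1) b
  define u where "u j q z = (if j = i then ennreal (norm (b x - average b (gcube q))) * ennreal (f j z)
    + ennreal (norm (b z - average b (gcube q)) * f j z) else ennreal (f j z))" for j q z
  have [measurable]: "u j q \<in> borel_measurable lebesgue" for j q unfolding u_def[abs_def] by measurable
  have "(\<integral>\<^sup>+y. ennreal (norm (K x y)) * ennreal (norm (b x - b (y $ i)) * (\<Prod>j\<in>UNIV. f j (y $ j))) \<partial>lebesgue)
    \<le> ennreal (A * (\<Prod>j\<in>UNIV. 6 powr (real CARD('n) - \<alpha>i j))) *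
      (\<Prod>j\<in>UNIV. \<integral>\<^sup>+q. ennreal (gside (fst q) powr (\<alpha>i j - real CARD('n))) * indicator (gcube q) x
         * (\<integral>\<^sup>+z\<in>gcube q. u j q z \<partial>lebesgue) \<partial>count_space UNIV)"
  proof (rule kernel_product_bound[OF A \<alpha>])
    fix q :: "int \<times> ('n \<Rightarrow> int)" and y :: "real^'n^'m"
    define a where "a = average b (gcube q)"
    have prod: "(\<Prod>j\<in>UNIV. g j) = g i * (\<Prod>j\<in>UNIV - {i}. g j)" for g :: "'m \<Rightarrow> 'c::comm_monoid_mult"
      by (rule prod.remove) auto
    have "norm (b x - b (y $ i)) \<le> norm (b x - a) + norm (b (y $ i) - a)"
      using norm_triangle_ineq4[of "b x - a" "b (y $ i) - a"] by simp
    then have "norm (b x - b (y $ i)) * f i (y $ i) \<le> norm (b x - a) * f i (y $ i) + norm (b (y $ i) - a) * f i (y $ i)"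
      using f(2)[of i "y $ i"] by (simp add: mult_right_mono flip: distrib_right)
    then have "ennreal (norm (b x - b (y $ i)) * f i (y $ i)) \<le> ennreal (norm (b x - a) * f i (y $ i) + norm (b (y $ i) - a) * f i (y $ i))"
      by (rule ennreal_leI)
    also have "\<dots> = u i q (y $ i)"
      using f(2)[of i "y $ i"] by (simp add: u_def a_def ennreal_mult)
    finally have 1: "ennreal (norm (b x - b (y $ i)) * f i (y $ i)) \<le> u i q (y $ i)" .
    have "ennreal (norm (b x - b (y $ i)) * (\<Prod>j\<in>UNIV. f j (y $ j)))
      = ennreal ((norm (b x - b (y $ i)) * f i (y $ i)) * (\<Prod>j\<in>UNIV - {i}. f j (y $ j)))"
      by (simp add: prod mult.assoc)
    also have "\<dots> = ennreal (norm (b x - b (y $ i)) * f i (y $ i)) * ennreal (\<Prod>j\<in>UNIV - {i}. f j (y $ j))"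
      using f(2) by (intro ennreal_mult mult_nonneg_nonneg prod_nonneg) auto
    also have "ennreal (\<Prod>j\<in>UNIV - {i}. f j (y $ j)) = (\<Prod>j\<in>UNIV - {i}. ennreal (f j (y $ j)))"
      using f(2) by (intro prod_ennreal[symmetric]) auto
    also have "\<dots> = (\<Prod>j\<in>UNIV - {i}. u j q (y $ j))" by (intro prod.cong) (auto simp: u_def)
    also have "ennreal (norm (b x - b (y $ i)) * f i (y $ i)) * \<dots> \<le> u i q (y $ i) * (\<Prod>j\<in>UNIV - {i}. u j q (y $ j))"
      using 1 by (rule mult_right_mono) simp
    also have "\<dots> = (\<Prod>j\<in>UNIV. u j q (y $ j))" by (simp add: prod)
    finally show "ennreal (norm (b x - b (y $ i)) * (\<Prod>j\<in>UNIV. f j (y $ j))) \<le> (\<Prod>j\<in>UNIV. u j q (y $ j))" .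
  qed measurable
  also have "(\<Prod>j\<in>UNIV. \<integral>\<^sup>+q. ennreal (gside (fst q) powr (\<alpha>i j - real CARD('n))) * indicator (gcube q) x
         * (\<integral>\<^sup>+z\<in>gcube q. u j q z \<partial>lebesgue) \<partial>count_space UNIV)
     = (\<integral>\<^sup>+q. ennreal (gside (fst q) powr (\<alpha>i i - real CARD('n))) * indicator (gcube q) x
         * (\<integral>\<^sup>+z\<in>gcube q. u i q z \<partial>lebesgue) \<partial>count_space UNIV)
       * (\<Prod>j\<in>UNIV - {i}. \<integral>\<^sup>+q. ennreal (gside (fst q) powr (\<alpha>i j - real CARD('n))) * indicator (gcube q) x
         * (\<integral>\<^sup>+z\<in>gcube q. u j q z \<partial>lebesgue) \<partial>count_space UNIV)"
    by (rule prod.remove) auto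
  also have "(\<integral>\<^sup>+q. ennreal (gside (fst q) powr (\<alpha>i i - real CARD('n))) * indicator (gcube q) x
         * (\<integral>\<^sup>+z\<in>gcube q. u i q z \<partial>lebesgue) \<partial>count_space UNIV) = frac_comm (\<alpha>i i) b (f i) x"
    unfolding frac_comm_def
  proof (intro nn_integral_cong arg_cong2[where f="(*)"] refl)
    fix q :: "int \<times> ('n \<Rightarrow> int)"
    show "(\<integral>\<^sup>+z\<in>gcube q. u i q z \<partial>lebesgue) = ennreal (norm (b x - average b (gcube q))) * (\<integral>\<^sup>+y\<in>gcube q. ennreal (f i y) \<partial>lebesgue)
         + (\<integral>\<^sup>+y\<in>gcube q. ennreal (norm (b y - average b (gcube q)) * f i y) \<partial>lebesgue)"
      by (simp add: u_def distrib_right mult.assoc nn_integral_add nn_integral_cmult)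
  qed
  also have "(\<Prod>j\<in>UNIV - {i}. \<integral>\<^sup>+q. ennreal (gside (fst q) powr (\<alpha>i j - real CARD('n))) * indicator (gcube q) x
         * (\<integral>\<^sup>+z\<in>gcube q. u j q z \<partial>lebesgue) \<partial>count_space UNIV) = (\<Prod>j\<in>UNIV - {i}. frac_int (\<alpha>i j) (f j) x)"
    by (intro prod.cong) (auto simp: u_def frac_int_def)
  finally show ?thesis .
qed

section \<open>Measurability of kernel integrals\<close>

lemma borel_measurable_lebesgue_cong_AE:
  fixes f g :: "'a::euclidean_space \<Rightarrow> 'b::topological_space"
  assumes g: "g \<in> borel_measurable lebesgue" and ae: "AE x in lebesgue. f x = g x"
  shows "f \<in> borel_measurable lebesgue"
proof (rule measurableI)
  fix A :: "'b set" assume A: "A \<in> sets borel"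
  obtain N where N: "negligible N" "{x. f x \<noteq> g x} \<subseteq> N"
    using ae unfolding eventually_ae_filter_negligible by blast
  have eq: "f -` A \<inter> space lebesgue = (g -` A \<inter> space lebesgue - N) \<union> (f -` A \<inter> N)"
    using N(2) by auto
  show "f -` A \<inter> space lebesgue \<in> sets lebesgue"
  proof (subst eq, rule sets.Un)
    show "f -` A \<inter> N \<in> sets lebesgue"
      by (intro negligible_imp_sets negligible_subset[OF N(1)]) auto
    show "g -` A \<inter> space lebesgue - N \<in> sets lebesgue"
      using measurable_sets[OF g A] negligible_imp_sets[OF N(1)] by blast
  qed
qed simp

lemma lebesgue_measurable_borel_version:
  fixes f :: "'a::euclidean_space \<Rightarrow> complex"
  assumes "f \<in> borel_measurable lebesgue"
  obtains g where "g \<in> borel_measurable borel" "AE x in lborel. f x = g x"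
proof -
  obtain u where u: "u \<in> borel_measurable lborel" "AE x in lborel. Re (f x) = u x"
    using completion_ex_borel_measurable_real[of "\<lambda>x. Re (f x)" lborel] assms by auto
  obtain v where v: "v \<in> borel_measurable lborel" "AE x in lborel. Im (f x) = v x"
    using completion_ex_borel_measurable_real[of "\<lambda>x. Im (f x)" lborel] assms by auto
  have [measurable]: "u \<in> borel_measurable borel" "v \<in> borel_measurable borel" using u v by simp_all
  show thesis
  proof (rule that[of "\<lambda>x. Complex (u x) (v x)"])
    show "(\<lambda>x. Complex (u x) (v x)) \<in> borel_measurable borel"
      unfolding Complex_eq by measurable
    show "AE x in lborel. f x = Complex (u x) (v x)"
      using u(2) v(2) by eventually_elim (simp add: complex_eq_iff)
  qed
qed

lemma off_diagonal_open: "open (off_diagonal :: ((real^'n::finite) \<times> (real^'n^'m::finite)) set)"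
proof -
  have "off_diagonal = (\<Union>j. {p :: (real^'n) \<times> (real^'n^'m). snd p $ j \<noteq> fst p})"
    by (auto simp: off_diagonal_def)
  moreover have "open (\<Union>j. {p :: (real^'n) \<times> (real^'n^'m). snd p $ j \<noteq> fst p})"
    by (intro open_UN ballI open_Collect_neq continuous_intros)
  ultimately show ?thesis by simp
qed

text \<open>Local integrability gives measurability only on compact subsets of the off-diagonal set,
  so that open set is exhausted by compacts. For every x the section of the diagonal is a single
  point and hence null, so almost every section of the kernel agrees almost everywhere with the
  Borel version.\<close>

lemma kernel_borel_version:
  fixes K :: "real^'n::finite \<Rightarrow> real^'n^'m::finite \<Rightarrow> complex"
  assumes K: "(\<lambda>(x, y). K x y) locally_integrable_on off_diagonal"
  obtains K' where "K' \<in> borel_measurable (borel \<Otimes>\<^sub>M borel)"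
    "AE x in lborel. AE y in lborel. K x y = K' (x, y)"
proof -
  define k where "k = (\<lambda>(x, y). K x y)"
  obtain C :: "nat \<Rightarrow> ((real^'n) \<times> (real^'n^'m)) set" where C: "\<And>n. compact (C n)" "\<And>n. C n \<subseteq> off_diagonal"
    "\<And>n. C n \<subseteq> interior (C (Suc n))" "\<Union> (range C) = off_diagonal"
    using open_Union_compact_subsets[OF off_diagonal_open] by metis
  have Cmono: "C m \<subseteq> C n" if "m \<le> n" for m n
    using that
  proof (induction n rule: dec_induct)
    case (step n)
    then show ?case using C(3)[of n] interior_subset[of "C (Suc n)"] by blast
  qed simp
  have "(\<lambda>p. indicator off_diagonal p *\<^sub>R k p) \<in> borel_measurable lebesgue"
  proof (rule borel_measurable_LIMSEQ_metric)
    show "(\<lambda>p. indicator (C n) p *\<^sub>R k p) \<in> borel_measurable lebesgue" for n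
      using K C(1,2)[of n] unfolding locally_integrable_on_def set_integrable_def k_def
      by (blast intro: borel_measurable_integrable)
    fix p :: "(real^'n) \<times> (real^'n^'m)"
    show "(\<lambda>n. indicator (C n) p *\<^sub>R k p) \<longlonglongrightarrow> indicator off_diagonal p *\<^sub>R k p"
    proof (rule tendsto_eventually)
      show "\<forall>\<^sub>F n in sequentially. indicator (C n) p *\<^sub>R k p = indicator off_diagonal p *\<^sub>R k p"
      proof (cases "p \<in> off_diagonal")
        case True
        then obtain n0 where "p \<in> C n0" using C(4) by blast
        then have "\<And>n. n0 \<le> n \<Longrightarrow> p \<in> C n" using Cmono by blast
        then show ?thesis using True unfolding eventually_sequentially by (intro exI[of _ n0]) auto
      next
        case False
        then have "p \<notin> C n" for n using C(2)[of n] by blast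
        then show ?thesis using False by simp
      qed
    qed
  qed
  from lebesgue_measurable_borel_version[OF this] obtain g where
    g: "g \<in> borel_measurable borel" "AE p in lborel. indicator off_diagonal p *\<^sub>R k p = g p" .
  have aeg: "AE x in lborel. AE y in lborel. indicator off_diagonal (x, y) *\<^sub>R k (x, y) = g (x, y)"
    using g(2) unfolding lborel_prod[symmetric] by (rule lborel_pair.AE_pair)
  have off: "AE y in lborel. (x, y :: real^'n^'m) \<in> off_diagonal" for x
  proof -
    have "AE y in lborel. y \<notin> {\<chi> j. x :: real^'n^'m}"
      by (rule AE_not_in) (simp add: null_sets_def)
    then show ?thesis by eventually_elim (auto simp: off_diagonal_def vec_eq_iff)
  qed
  from aeg have "AE x in lborel. AE y in lborel. K x y = g (x, y)"
  proof eventually_elim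
    case (elim x)
    from elim off[of x] show ?case by eventually_elim (simp add: k_def)
  qed
  moreover have "g \<in> borel_measurable (borel \<Otimes>\<^sub>M borel)" using g(1) by (simp add: borel_prod)
  ultimately show thesis by (rule that[rotated])
qed

text \<open>The witness for the extended commutator. The differences b_i(x) - b_i(y_i) are kept
  under the integral because for general tuples only they are controlled; b_i f_i need not lie in
  the space of f_i. Where the integral fails to converge its value is 0.\<close>

definition comm_kernel_integral ::
  "(real^'n::finite \<Rightarrow> real^'n^'m::finite \<Rightarrow> complex) \<Rightarrow> ('m \<Rightarrow> 'n cfun) \<Rightarrow> ('m \<Rightarrow> 'n cfun) \<Rightarrow> 'n cfun" where
  "comm_kernel_integral K b f x =
     (LINT y|lebesgue. K x y * ((\<Sum>i\<in>UNIV. b i x - b i (y $ i)) * (\<Prod>j\<in>UNIV. f j (y $ j))))"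

lemma kernel_section_measurable:
  fixes K :: "real^'n::finite \<Rightarrow> real^'n^'m::finite \<Rightarrow> complex"
  assumes K: "(\<lambda>(x, y). K x y) locally_integrable_on off_diagonal"
  shows "AE x in lebesgue. K x \<in> borel_measurable lebesgue"
proof -
  obtain K' where [measurable]: "K' \<in> borel_measurable (borel \<Otimes>\<^sub>M borel)"
    and ae: "AE x in lborel. AE y in lborel. K x y = K' (x, y)"
    using kernel_borel_version[OF K] by blast
  have "(\<lambda>y. K' (x, y)) \<in> borel_measurable lebesgue" for x
    by (rule measurable_completion) measurable
  from AE_completion[OF ae] show ?thesis
  proof eventually_elim
    case (elim x)
    show ?case
      by (rule borel_measurable_lebesgue_cong_AE[OF \<open>(\<lambda>y. K' (x, y)) \<in> borel_measurable lebesgue\<close>])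
         (use AE_completion[OF elim] in simp)
  qed
qed

lemma comm_integrand_measurable:
  fixes b f :: "'m::finite \<Rightarrow> 'n::finite cfun"
  assumes "\<And>j. f j \<in> borel_measurable lebesgue" "\<And>j. b j \<in> borel_measurable lebesgue" "k \<in> borel_measurable lebesgue"
  shows "(\<lambda>y. k y * ((\<Sum>i\<in>UNIV. b i x - b i (y $ i)) * (\<Prod>j\<in>UNIV. f j (y $ j)))) \<in> borel_measurable lebesgue"
    "(\<lambda>y. k y * (\<Prod>j\<in>UNIV. f j (y $ j))) \<in> borel_measurable lebesgue"
proof -
  have [measurable]: "(\<lambda>y. f j (y $ j)) \<in> borel_measurable lebesgue" "(\<lambda>y. b j (y $ j)) \<in> borel_measurable lebesgue" for j :: 'm
    using measurable_compose[OF vec_nth_measurable_lebesgue assms(1)] measurable_compose[OF vec_nth_measurable_lebesgue assms(2)] by auto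
  note [measurable] = assms(3)
  show "(\<lambda>y. k y * ((\<Sum>i\<in>UNIV. b i x - b i (y $ i)) * (\<Prod>j\<in>UNIV. f j (y $ j)))) \<in> borel_measurable lebesgue"
    by measurable
  show "(\<lambda>y. k y * (\<Prod>j\<in>UNIV. f j (y $ j))) \<in> borel_measurable lebesgue"
    by measurable
qed

text \<open>Measurability in a parameter is available for integrands measurable with respect to a
  product sigma-algebra, so kernel, entries and symbols are all replaced by Borel versions; for
  almost every x this changes the integrand only on a null set.\<close>

lemma comm_kernel_integral_measurable:
  fixes K :: "real^'n::finite \<Rightarrow> real^'n^'m::finite \<Rightarrow> complex"
  assumes K: "(\<lambda>(x, y). K x y) locally_integrable_on off_diagonal"
    and f: "\<And>j. f j \<in> borel_measurable lebesgue" and b: "\<And>j. b j \<in> borel_measurable lebesgue"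
  shows "comm_kernel_integral K b f \<in> borel_measurable lebesgue"
proof -
  obtain K' where [measurable]: "K' \<in> borel_measurable (borel \<Otimes>\<^sub>M borel)"
    and aeK: "AE x in lborel. AE y in lborel. K x y = K' (x, y)"
    using kernel_borel_version[OF K] by blast
  have "\<exists>g. g \<in> borel_measurable borel \<and> (AE x in lborel. f j x = g x)" for j
    using lebesgue_measurable_borel_version[OF f[of j]] by metis
  then obtain f' where f': "\<And>j. f' j \<in> borel_measurable borel" "\<And>j. AE x in lborel. f j x = f' j x"
    by metis
  have "\<exists>g. g \<in> borel_measurable borel \<and> (AE x in lborel. b j x = g x)" for j
    using lebesgue_measurable_borel_version[OF b[of j]] by metis
  then obtain b' where b': "\<And>j. b' j \<in> borel_measurable borel" "\<And>j. AE x in lborel. b j x = b' j x"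
    by metis
  note [measurable] = f'(1) b'(1)
  have [measurable]: "(\<lambda>y :: real^'n^'m. y $ j) \<in> borel_measurable borel" for j
    by (intro borel_measurable_continuous_onI continuous_intros)
  define G where "G x y = K' (x, y) * ((\<Sum>i\<in>UNIV. b' i x - b' i (y $ i)) * (\<Prod>j\<in>UNIV. f' j (y $ j)))" for x y
  have Gm: "case_prod G \<in> borel_measurable (borel \<Otimes>\<^sub>M lborel)"
    unfolding G_def case_prod_beta' by measurable
  have "(\<lambda>x. LINT y|lborel. G x y) \<in> borel_measurable borel"
    using lborel.borel_measurable_lebesgue_integral[OF Gm] by simp
  then have "(\<lambda>x. LINT y|lborel. G x y) \<in> borel_measurable lborel" by simp
  then have Sm: "(\<lambda>x. LINT y|lborel. G x y) \<in> borel_measurable lebesgue" by (rule measurable_completion)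
  have ae_f: "AE y in lebesgue. \<forall>j. f j (y $ j) = f' j (y $ j)"
    unfolding AE_all_countable by (intro allI AE_vec_nth AE_completion f')
  have ae_b: "AE y in lebesgue. \<forall>j. b j (y $ j) = b' j (y $ j)"
    unfolding AE_all_countable by (intro allI AE_vec_nth AE_completion b')
  have ae_bx: "AE x in lebesgue. \<forall>j. b j x = b' j x"
    unfolding AE_all_countable by (intro allI AE_completion b')
  show ?thesis
  proof (rule borel_measurable_lebesgue_cong_AE[OF Sm])
    show "AE x in lebesgue. comm_kernel_integral K b f x = (LINT y|lborel. G x y)"
      using AE_completion[OF aeK] ae_bx
    proof eventually_elim
      case (elim x)
      have Gx: "G x \<in> borel_measurable lborel" unfolding G_def[abs_def] by measurable
      have ae: "AE y in lebesgue. K x y * ((\<Sum>i\<in>UNIV. b i x - b i (y $ i)) * (\<Prod>j\<in>UNIV. f j (y $ j))) = G x y"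
        using AE_completion[OF elim(1)] ae_f ae_b
        by eventually_elim (simp add: G_def elim(2))
      have "comm_kernel_integral K b f x = (LINT y|lebesgue. G x y)"
        unfolding comm_kernel_integral_def
      proof (rule integral_cong_AE[OF _ _ ae])
        show "G x \<in> borel_measurable lebesgue" using Gx by (rule measurable_completion)
        then show "(\<lambda>y. K x y * ((\<Sum>i\<in>UNIV. b i x - b i (y $ i)) * (\<Prod>j\<in>UNIV. f j (y $ j)))) \<in> borel_measurable lebesgue"
          by (rule borel_measurable_lebesgue_cong_AE[OF _ ae])
      qed
      also have "\<dots> = (LINT y|lborel. G x y)" using Gx by (rule integral_completion)
      finally show ?case .
    qed
  qed
qed

section \<open>Modulars\<close>

text \<open>Hoelder's inequality at the level of modulars, without constants. With M the largest of
  the powers, each g j is at most M powr (1 / e j), and the exponents add up to 1/Q.\<close>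

lemma prod_powr_le_sum:
  fixes g e :: "'m::finite \<Rightarrow> real"
  assumes g: "\<And>j. 0 \<le> g j" and e: "\<And>j. 0 < e j" and Q: "1 / Q = (\<Sum>j\<in>UNIV. 1 / e j)" "0 < Q"
  shows "(\<Prod>j\<in>UNIV. g j) powr Q \<le> (\<Sum>j\<in>UNIV. g j powr e j)"
proof -
  define M where "M = Max (range (\<lambda>j. g j powr e j))"
  have M: "g j powr e j \<le> M" for j unfolding M_def by (intro Max_ge) auto
  have M0: "0 \<le> M" using order_trans[OF powr_ge_zero M[of undefined]] .
  have "g j \<le> M powr (1 / e j)" for j
  proof -
    have "(g j powr e j) powr (1 / e j) \<le> M powr (1 / e j)"
      using M[of j] e[of j] by (intro powr_mono2) auto
    then show ?thesis using g[of j] e[of j] by (simp add: powr_powr)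
  qed
  then have "(\<Prod>j\<in>UNIV. g j) \<le> (\<Prod>j\<in>UNIV. M powr (1 / e j))"
    using g by (intro prod_mono) auto
  then have "(\<Prod>j\<in>UNIV. g j) powr Q \<le> (\<Prod>j\<in>UNIV. M powr (1 / e j)) powr Q"
    using g Q by (intro powr_mono2 prod_nonneg) auto
  also have "\<dots> = M"
  proof (cases "M = 0")
    case True
    then show ?thesis using Q by (simp add: prod_zero_iff card_gt_0_iff)
  next
    case False
    then have "(\<Prod>j\<in>UNIV. M powr (1 / e j)) = M powr (\<Sum>j\<in>UNIV. 1 / e j)"
      using M0 by (simp add: powr_sum)
    then have "(\<Prod>j\<in>(UNIV :: 'm set). M powr (1 / e j)) powr Q = M powr (1 / Q * Q)"
      by (simp only: Q(1)[symmetric] powr_powr)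
    then show ?thesis using False M0 Q(2) by simp
  qed
  also have "M \<le> (\<Sum>j\<in>UNIV. g j powr e j)"
  proof -
    have "M \<in> range (\<lambda>j. g j powr e j)" unfolding M_def by (intro Max_in) auto
    then obtain j where "M = g j powr e j" by blast
    then show ?thesis using member_le_sum[of j UNIV "\<lambda>j. g j powr e j"] by simp
  qed
  finally show ?thesis .
qed

text \<open>Of the square of the cardinality one factor bounds the sum by the largest term; the
  other, raised to an exponent at least 1, yields the 1/N that compensates adding N
  modulars.\<close>

lemma modular_sum_le_one:
  fixes W :: "'k \<Rightarrow> real^'n::finite \<Rightarrow> real"
  assumes fin: "finite I" "I \<noteq> {}" and [measurable]: "\<And>k. k \<in> I \<Longrightarrow> W k \<in> borel_measurable lebesgue" "q \<in> borel_measurable lebesgue"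
    and W0: "\<And>k x. k \<in> I \<Longrightarrow> 0 \<le> W k x" and q: "\<And>x. 1 \<le> q x" and \<eta>: "0 < \<eta>"
    and le: "\<And>k. k \<in> I \<Longrightarrow> (\<integral>\<^sup>+x. ennreal ((W k x / \<eta>) powr q x) \<partial>lebesgue) \<le> 1"
  shows "(\<integral>\<^sup>+x. ennreal (((\<Sum>k\<in>I. W k x) / ((real (card I))\<^sup>2 * \<eta>)) powr q x) \<partial>lebesgue) \<le> 1"
proof -
  define N where "N = real (card I)"
  have N: "1 \<le> N" using fin by (simp add: N_def Suc_leI card_gt_0_iff)
  have *: "((\<Sum>k\<in>I. W k x) / (N\<^sup>2 * \<eta>)) powr q x \<le> (1 / N) * (\<Sum>k\<in>I. (W k x / \<eta>) powr q x)" for x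
  proof -
    define M where "M = Max ((\<lambda>k. W k x) ` I)"
    have M: "W k x \<le> M" if "k \<in> I" for k unfolding M_def using that fin by (intro Max_ge) auto
    have "M \<in> (\<lambda>k. W k x) ` I" unfolding M_def using fin by (intro Max_in) auto
    then obtain k where k: "k \<in> I" "M = W k x" by blast
    have M0: "0 \<le> M" using W0 k by simp
    have "(\<Sum>k\<in>I. W k x) \<le> N * M" using sum_bounded_above[of I "\<lambda>k. W k x" M] M by (simp add: N_def)
    then have "(\<Sum>k\<in>I. W k x) / (N\<^sup>2 * \<eta>) \<le> N * M / (N\<^sup>2 * \<eta>)" using \<eta> N by (intro divide_right_mono) auto
    also have "\<dots> = (1 / N) * (M / \<eta>)" using N by (simp add: power2_eq_square)
    finally have "((\<Sum>k\<in>I. W k x) / (N\<^sup>2 * \<eta>)) powr q x \<le> ((1 / N) * (M / \<eta>)) powr q x"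
      using q[of x] W0 \<eta> by (intro powr_mono2 divide_nonneg_nonneg sum_nonneg) auto
    also have "\<dots> = (1 / N) powr q x * (M / \<eta>) powr q x" using N M0 \<eta> by (intro powr_mult)
    also have "\<dots> \<le> (1 / N) powr 1 * (M / \<eta>) powr q x"
      using N q[of x] by (intro mult_right_mono powr_mono') auto
    also have "\<dots> \<le> (1 / N) * (\<Sum>k\<in>I. (W k x / \<eta>) powr q x)"
      using N k fin member_le_sum[of k I "\<lambda>k. (W k x / \<eta>) powr q x"] by (simp add: divide_right_mono)
    finally show ?thesis .
  qed
  have "(\<integral>\<^sup>+x. ennreal (((\<Sum>k\<in>I. W k x) / (N\<^sup>2 * \<eta>)) powr q x) \<partial>lebesgue)
     \<le> (\<integral>\<^sup>+x. ennreal (1 / N) * (\<Sum>k\<in>I. ennreal ((W k x / \<eta>) powr q x)) \<partial>lebesgue)"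
  proof (intro nn_integral_mono)
    fix x
    have "ennreal (((\<Sum>k\<in>I. W k x) / (N\<^sup>2 * \<eta>)) powr q x) \<le> ennreal ((1 / N) * (\<Sum>k\<in>I. (W k x / \<eta>) powr q x))"
      by (intro ennreal_leI *)
    also have "\<dots> = ennreal (1 / N) * ennreal (\<Sum>k\<in>I. (W k x / \<eta>) powr q x)"
      using N by (intro ennreal_mult sum_nonneg) auto
    also have "ennreal (\<Sum>k\<in>I. (W k x / \<eta>) powr q x) = (\<Sum>k\<in>I. ennreal ((W k x / \<eta>) powr q x))"
      by (rule sum_ennreal[symmetric]) simp
    finally show "ennreal (((\<Sum>k\<in>I. W k x) / (N\<^sup>2 * \<eta>)) powr q x) \<le> ennreal (1 / N) * (\<Sum>k\<in>I. ennreal ((W k x / \<eta>) powr q x))" .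
  qed
  also have "\<dots> = ennreal (1 / N) * (\<Sum>k\<in>I. \<integral>\<^sup>+x. ennreal ((W k x / \<eta>) powr q x) \<partial>lebesgue)"
  proof -
    have "(\<lambda>x. ennreal ((W k x / \<eta>) powr q x)) \<in> borel_measurable lebesgue" if "k \<in> I" for k
      using that by measurable
    then have "(\<integral>\<^sup>+x. (\<Sum>k\<in>I. ennreal ((W k x / \<eta>) powr q x)) \<partial>lebesgue) = (\<Sum>k\<in>I. \<integral>\<^sup>+x. ennreal ((W k x / \<eta>) powr q x) \<partial>lebesgue)"
      by (rule nn_integral_sum)
    moreover have "(\<integral>\<^sup>+x. ennreal (1 / N) * (\<Sum>k\<in>I. ennreal ((W k x / \<eta>) powr q x)) \<partial>lebesgue)
      = ennreal (1 / N) * (\<integral>\<^sup>+x. (\<Sum>k\<in>I. ennreal ((W k x / \<eta>) powr q x)) \<partial>lebesgue)"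
      by (rule nn_integral_cmult) measurable
    ultimately show ?thesis by (simp only:)
  qed
  also have "\<dots> \<le> ennreal (1 / N) * (\<Sum>k\<in>I. 1)"
    by (intro mult_left_mono sum_mono le) auto
  also have "\<dots> = ennreal (1 / N * N)"
  proof -
    have "(\<Sum>k\<in>I. 1 :: ennreal) = ennreal N" by (simp add: N_def ennreal_of_nat_eq_real_of_nat)
    moreover have "ennreal (1 / N) * ennreal N = ennreal (1 / N * N)" using N by (intro ennreal_mult[symmetric]) auto
    ultimately show ?thesis by (simp only:)
  qed
  also have "\<dots> = 1" using N by simp
  finally show ?thesis by (simp add: N_def)
qed

lemma var_modular_mono_scale:
  assumes q: "\<And>x. 0 \<le> q x" and "0 < \<eta>" "\<eta> \<le> \<eta>'"
  shows "var_modular q f \<eta>' \<le> var_modular q f \<eta>"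
  unfolding var_modular_def using assms
  by (intro nn_integral_mono ennreal_leI powr_mono2 divide_left_mono) auto

lemma var_modular_scaled_le:
  assumes f: "f \<in> borel_measurable lebesgue" "q \<in> borel_measurable lebesgue" and q: "\<And>x. 1 \<le> q x" and "0 < \<eta>" "1 \<le> c"
  shows "var_modular q f (c * \<eta>) \<le> ennreal (1 / c) * var_modular q f \<eta>"
proof -
  note [measurable] = f
  have "var_modular q f (c * \<eta>) \<le> (\<integral>\<^sup>+x. ennreal (1 / c) * ennreal ((norm (f x) / \<eta>) powr q x) \<partial>lebesgue)"
    unfolding var_modular_def
  proof (intro nn_integral_mono)
    fix x
    have "(norm (f x) / (c * \<eta>)) powr q x = ((1 / c) * (norm (f x) / \<eta>)) powr q x" by simp
    also have "\<dots> = (1 / c) powr q x * (norm (f x) / \<eta>) powr q x"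
      using assms by (intro powr_mult)
    also have "\<dots> \<le> (1 / c) powr 1 * (norm (f x) / \<eta>) powr q x"
      using assms q[of x] by (intro mult_right_mono powr_mono') auto
    finally have "ennreal ((norm (f x) / (c * \<eta>)) powr q x) \<le> ennreal ((1 / c) * (norm (f x) / \<eta>) powr q x)"
      using assms by (intro ennreal_leI) simp
    also have "\<dots> = ennreal (1 / c) * ennreal ((norm (f x) / \<eta>) powr q x)"
      using assms by (intro ennreal_mult) auto
    finally show "ennreal ((norm (f x) / (c * \<eta>)) powr q x) \<le> ennreal (1 / c) * ennreal ((norm (f x) / \<eta>) powr q x)" .
  qed
  then show ?thesis using assms by (simp add: nn_integral_cmult var_modular_def)
qed

lemma var_Lp_norm_nonneg: "0 \<le> var_Lp_norm q f" if "\<exists>\<eta>>0. var_modular q f \<eta> \<le> 1"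
  unfolding var_Lp_norm_def using that by (intro cInf_greatest) auto

lemma var_Lp_space_modular_le_one:
  assumes "f \<in> var_Lp_space q" "q \<in> borel_measurable lebesgue" and q: "\<And>x. 1 \<le> q x"
  obtains \<eta> where "0 < \<eta>" "var_modular q f \<eta> \<le> 1"
proof -
  obtain \<eta> where \<eta>: "0 < \<eta>" "var_modular q f \<eta> < \<infinity>" and f: "f \<in> borel_measurable lebesgue"
    using assms(1) by (auto simp: var_Lp_space_def)
  define c where "c = max 1 (enn2real (var_modular q f \<eta>))"
  have v: "var_modular q f \<eta> = ennreal (enn2real (var_modular q f \<eta>))" using \<eta>(2) by simp
  have "var_modular q f (c * \<eta>) \<le> ennreal (1 / c) * var_modular q f \<eta>"
    using assms f \<eta> by (intro var_modular_scaled_le) (auto simp: c_def)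
  also have "\<dots> \<le> ennreal (1 / c) * ennreal c"
    by (subst v, intro mult_left_mono ennreal_leI) (auto simp: c_def)
  also have "\<dots> = ennreal (1 / c * c)" by (rule ennreal_mult[symmetric]) (auto simp: c_def)
  also have "1 / c * c = 1" by (simp add: c_def)
  finally have "var_modular q f (c * \<eta>) \<le> 1" by simp
  moreover have "0 < c * \<eta>" using \<eta> by (simp add: c_def)
  ultimately show thesis by (rule that[rotated])
qed

lemma var_Lp_norm_le:
  assumes "0 < \<eta>" "var_modular q f \<eta> \<le> 1"
  shows "var_Lp_norm q f \<le> \<eta>"
  unfolding var_Lp_norm_def using assms by (intro cInf_lower bdd_belowI[of _ 0]) auto

lemma var_Lp_norm_less_modular:
  assumes f: "f \<in> var_Lp_space q" "q \<in> borel_measurable lebesgue" and q: "\<And>x. 1 \<le> q x" and "var_Lp_norm q f < \<eta>"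
  shows "var_modular q f \<eta> \<le> 1"
proof -
  obtain \<eta>0 where "0 < \<eta>0" "var_modular q f \<eta>0 \<le> 1" using var_Lp_space_modular_le_one[OF f q] by blast
  then have "{\<eta>. \<eta> > 0 \<and> var_modular q f \<eta> \<le> 1} \<noteq> {}" by blast
  from cInf_lessD[OF this assms(4)[unfolded var_Lp_norm_def]]
  obtain \<zeta> where \<zeta>: "0 < \<zeta>" "var_modular q f \<zeta> \<le> 1" "\<zeta> < \<eta>" by blast
  have "var_modular q f \<eta> \<le> var_modular q f \<zeta>"
    using \<zeta> q by (intro var_modular_mono_scale) (auto intro: order_trans[OF zero_le_one])
  then show ?thesis using \<zeta>(2) by (rule order_trans)
qed

section \<open>The commutator kernel on products of variable exponent spaces\<close>

text \<open>Telescoping. The remaining factors are bounded by |a| + |b| whichever of the two occurs,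
  so the estimate does not depend on the order and every summand is again a product over all
  indices.\<close>

lemma norm_prod_diff_le:
  fixes a b :: "'i \<Rightarrow> complex"
  assumes "finite I"
  shows "norm (prod a I - prod b I) \<le> (\<Sum>j\<in>I. norm (a j - b j) * (\<Prod>l\<in>I - {j}. norm (a l) + norm (b l)))"
  using assms
proof (induction I rule: finite_induct)
  case (insert k I)
  have e: "prod a (insert k I) - prod b (insert k I) = (a k - b k) * prod a I + b k * (prod a I - prod b I)"
    using insert by (simp add: algebra_simps)
  have "norm (prod a I) \<le> (\<Prod>l\<in>I. norm (a l) + norm (b l))"
    unfolding prod_norm[symmetric] by (intro prod_mono) auto
  then have 1: "norm ((a k - b k) * prod a I) \<le> norm (a k - b k) * (\<Prod>l\<in>insert k I - {k}. norm (a l) + norm (b l))"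
    using insert by (simp add: norm_mult mult_left_mono)
  have "norm (b k * (prod a I - prod b I)) \<le> (norm (a k) + norm (b k)) * (\<Sum>j\<in>I. norm (a j - b j) * (\<Prod>l\<in>I - {j}. norm (a l) + norm (b l)))"
    unfolding norm_mult by (intro mult_mono insert.IH) auto
  also have "\<dots> = (\<Sum>j\<in>I. norm (a j - b j) * (\<Prod>l\<in>insert k I - {j}. norm (a l) + norm (b l)))"
    unfolding sum_distrib_left
  proof (intro sum.cong refl)
    fix j assume "j \<in> I"
    then have "insert k I - {j} = insert k (I - {j})" "k \<notin> I - {j}" using insert by auto
    then show "(norm (a k) + norm (b k)) * (norm (a j - b j) * (\<Prod>l\<in>I - {j}. norm (a l) + norm (b l)))
      = norm (a j - b j) * (\<Prod>l\<in>insert k I - {j}. norm (a l) + norm (b l))"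
      using insert by simp
  qed
  finally show ?case
    unfolding e using 1 insert norm_triangle_ineq[of "(a k - b k) * prod a I" "b k * (prod a I - prod b I)"] by simp
qed simp

lemma ennreal_norm_integral_le:
  fixes f :: "'a \<Rightarrow> complex"
  shows "ennreal (norm (LINT x|M. f x)) \<le> (\<integral>\<^sup>+x. ennreal (norm (f x)) \<partial>M)"
proof (cases "integrable M f")
  case True
  then show ?thesis by (rule integral_norm_bound_ennreal)
qed (simp add: not_integrable_integral_eq)

lemma frac_int_cmult:
  assumes [measurable]: "g \<in> borel_measurable lebesgue" and "0 \<le> H" "\<And>y. 0 \<le> g y"
  shows "frac_int a (\<lambda>y. H * g y) x = ennreal H * frac_int a g x"
proof -
  have i: "(\<integral>\<^sup>+y\<in>gcube k. ennreal (H * g y) \<partial>lebesgue) = ennreal H * (\<integral>\<^sup>+y\<in>gcube k. ennreal (g y) \<partial>lebesgue)" for k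
    using assms by (subst nn_integral_cmult[symmetric]) (auto simp: ennreal_mult mult.assoc)
  have "frac_int a (\<lambda>y. H * g y) x = (\<integral>\<^sup>+k. ennreal H * (ennreal (gside (fst k) powr (a - real CARD('a))) * indicator (gcube k) x
      * (\<integral>\<^sup>+y\<in>gcube k. ennreal (g y) \<partial>lebesgue)) \<partial>count_space UNIV)"
    unfolding frac_int_def i by (intro nn_integral_cong) (simp only: mult_ac)
  also have "\<dots> = ennreal H * frac_int a g x"
    unfolding frac_int_def by (rule nn_integral_cmult) simp
  finally show ?thesis .
qed

lemma frac_comm_cmult:
  assumes [measurable]: "g \<in> borel_measurable lebesgue" "b \<in> borel_measurable lebesgue" and "0 \<le> H" "\<And>y. 0 \<le> g y"
  shows "frac_comm a b (\<lambda>y. H * g y) x = ennreal H * frac_comm a b g x"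
proof -
  have i: "(\<integral>\<^sup>+y\<in>gcube k. ennreal (H * g y) \<partial>lebesgue) = ennreal H * (\<integral>\<^sup>+y\<in>gcube k. ennreal (g y) \<partial>lebesgue)" for k
    using assms by (subst nn_integral_cmult[symmetric]) (auto simp: ennreal_mult mult.assoc)
  have c: "(\<integral>\<^sup>+y\<in>gcube k. ennreal (norm (b y - average b (gcube k)) * (H * g y)) \<partial>lebesgue)
    = ennreal H * (\<integral>\<^sup>+y\<in>gcube k. ennreal (norm (b y - average b (gcube k)) * g y) \<partial>lebesgue)" for k
  proof -
    have e: "ennreal (norm (b y - average b (gcube k)) * (H * g y)) = ennreal H * ennreal (norm (b y - average b (gcube k)) * g y)" for y
      using assms by (subst ennreal_mult[symmetric]) (auto simp: mult.left_commute)
    show ?thesis unfolding e mult.assoc by (rule nn_integral_cmult) measurable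
  qed
  have "frac_comm a b (\<lambda>y. H * g y) x = (\<integral>\<^sup>+k. ennreal H * (ennreal (gside (fst k) powr (a - real CARD('a))) * indicator (gcube k) x
      * (ennreal (norm (b x - average b (gcube k))) * (\<integral>\<^sup>+y\<in>gcube k. ennreal (g y) \<partial>lebesgue)
         + (\<integral>\<^sup>+y\<in>gcube k. ennreal (norm (b y - average b (gcube k)) * g y) \<partial>lebesgue))) \<partial>count_space UNIV)"
    unfolding frac_comm_def i c by (intro nn_integral_cong) (simp only: distrib_left mult_ac)
  also have "\<dots> = ennreal H * frac_comm a b g x"
    unfolding frac_comm_def by (rule nn_integral_cmult) simp
  finally show ?thesis .
qed

text \<open>The bounds on \<open>ps\<close> are required at every point; for log-Hoelder exponents
  this follows from the essential bounds by continuity.\<close>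

locale fractional_kernel =
  fixes K :: "real^'n::finite \<Rightarrow> real^'n^'m::finite \<Rightarrow> complex" and A \<alpha> :: real and \<alpha>i :: "'m \<Rightarrow> real"
    and ps :: "'m \<Rightarrow> real^'n \<Rightarrow> real" and pm pM :: "'m \<Rightarrow> real" and q :: "real^'n \<Rightarrow> real"
  assumes K_loc: "(\<lambda>(x, y). K x y) locally_integrable_on off_diagonal"
    and A_nonneg: "0 \<le> A"
    and size: "\<And>x y. (x, y) \<in> off_diagonal \<Longrightarrow>
       norm (K x y) \<le> A * (\<Sum>j\<in>UNIV. norm (x - y $ j)) powr (- (real CARD('m) * real CARD('n) - \<alpha>))"
    and \<alpha>_sum: "\<alpha> = (\<Sum>j\<in>UNIV. \<alpha>i j)" and \<alpha>i_pos: "\<And>j. 0 < \<alpha>i j"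
    and \<alpha>i_less: "\<And>j. \<alpha>i j / real CARD('n) < 1 / pM j"
    and ps_log: "\<And>j. ps j \<in> log_Hoelder" and ps_measurable: "\<And>j. ps j \<in> borel_measurable lebesgue"
    and ps_bounds: "\<And>j x. ps j x \<in> {pm j..pM j}" and pm_gt_1: "\<And>j. 1 < pm j"
    and q_eq: "\<And>x. 1 / q x = (\<Sum>j\<in>UNIV. 1 / ps j x) - \<alpha> / real CARD('n)"
    and q_gt_1: "\<And>x. 1 < q x" and q_measurable: "q \<in> borel_measurable lebesgue"
begin

lemma \<alpha>i_le: "\<alpha>i j \<le> real CARD('n)"
proof -
  have "1 < pM j" using pm_gt_1[of j] ps_bounds[of j undefined] by simp
  then have "1 / pM j < 1" by simp
  then have "\<alpha>i j / real CARD('n) < 1" using \<alpha>i_less[of j] by linarith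
  then show ?thesis by (simp add: divide_less_eq split: if_splits)
qed

definition qj :: "'m \<Rightarrow> real^'n \<Rightarrow> real" where
  "qj j x = 1 / (1 / ps j x - \<alpha>i j / real CARD('n))"

lemma qj_pos: "0 < qj j x"
proof -
  have "1 / pM j \<le> 1 / ps j x" using ps_bounds[of j x] pm_gt_1[of j] by (intro divide_left_mono) auto
  then show ?thesis using \<alpha>i_less[of j] by (simp add: qj_def)
qed

lemma qj_sum: "1 / q x = (\<Sum>j\<in>UNIV. 1 / qj j x)"
  unfolding q_eq qj_def by (simp add: sum_subtractf \<alpha>_sum sum_divide_distrib)

lemma qj_measurable [measurable]: "qj j \<in> borel_measurable lebesgue"
  unfolding qj_def[abs_def] using ps_measurable[of j] by measurable

text \<open>One constant per factor, valid for all f, b and \<beta> together. Fixing it here, before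
  any f or b is chosen, is what makes the constant of the theorem independent of them.\<close>

definition majorizing_const :: "('m \<Rightarrow> real) \<Rightarrow> bool" where
  "majorizing_const C \<longleftrightarrow> (\<forall>j. 0 < C j \<and>
    (\<forall>f. f \<in> borel_measurable lebesgue \<longrightarrow> (\<forall>y. 0 \<le> f y) \<longrightarrow> (\<integral>\<^sup>+y. ennreal (f y powr ps j y) \<partial>lebesgue) \<le> 1 \<longrightarrow>
       (AE x in lebesgue. frac_int (\<alpha>i j) f x \<noteq> \<infinity>) \<and>
       (\<integral>\<^sup>+x. ennreal ((enn2real (frac_int (\<alpha>i j) f x) / C j) powr qj j x) \<partial>lebesgue) \<le> 1) \<and>
    (\<forall>f b \<beta>. f \<in> borel_measurable lebesgue \<longrightarrow> (\<forall>y. 0 \<le> f y) \<longrightarrow> (\<integral>\<^sup>+y. ennreal (f y powr ps j y) \<partial>lebesgue) \<le> 1 \<longrightarrow>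
       b \<in> BMO \<longrightarrow> 0 < \<beta> \<longrightarrow> BMO_norm b \<le> \<beta> \<longrightarrow>
       (AE x in lebesgue. frac_comm (\<alpha>i j) b f x \<noteq> \<infinity>) \<and>
       (\<integral>\<^sup>+x. ennreal ((enn2real (frac_comm (\<alpha>i j) b f x) / (C j * \<beta>)) powr qj j x) \<partial>lebesgue) \<le> 1))"

lemma majorizing_const_exists: "\<exists>C. majorizing_const C"
proof -
  have "\<exists>C. 0 < C \<and>
    (\<forall>f. f \<in> borel_measurable lebesgue \<longrightarrow> (\<forall>y. 0 \<le> f y) \<longrightarrow> (\<integral>\<^sup>+y. ennreal (f y powr ps j y) \<partial>lebesgue) \<le> 1 \<longrightarrow>
       (AE x in lebesgue. frac_int (\<alpha>i j) f x \<noteq> \<infinity>) \<and>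
       (\<integral>\<^sup>+x. ennreal ((enn2real (frac_int (\<alpha>i j) f x) / C) powr qj j x) \<partial>lebesgue) \<le> 1) \<and>
    (\<forall>f b \<beta>. f \<in> borel_measurable lebesgue \<longrightarrow> (\<forall>y. 0 \<le> f y) \<longrightarrow> (\<integral>\<^sup>+y. ennreal (f y powr ps j y) \<partial>lebesgue) \<le> 1 \<longrightarrow>
       b \<in> BMO \<longrightarrow> 0 < \<beta> \<longrightarrow> BMO_norm b \<le> \<beta> \<longrightarrow>
       (AE x in lebesgue. frac_comm (\<alpha>i j) b f x \<noteq> \<infinity>) \<and>
       (\<integral>\<^sup>+x. ennreal ((enn2real (frac_comm (\<alpha>i j) b f x) / (C * \<beta>)) powr qj j x) \<partial>lebesgue) \<le> 1)" for j
  proof (rule frac_bounds[OF ps_log ps_measurable ps_bounds pm_gt_1 \<alpha>i_pos \<alpha>i_less, of j], goal_cases)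
    case (1 C)
    show ?case unfolding qj_def using 1 by (intro exI[of _ C]) blast
  qed
  then show ?thesis unfolding majorizing_const_def by (rule choice[OF allI])
qed

definition Cf :: "'m \<Rightarrow> real" where "Cf = (SOME C. majorizing_const C)"

lemma Cf: "majorizing_const Cf"
  unfolding Cf_def by (rule someI_ex[OF majorizing_const_exists])

lemma Cf_pos: "0 < Cf j"
  using Cf unfolding majorizing_const_def by blast

lemma Cf_int:
  assumes "f \<in> borel_measurable lebesgue" "\<And>y. 0 \<le> f y" "(\<integral>\<^sup>+y. ennreal (f y powr ps j y) \<partial>lebesgue) \<le> 1"
  shows "AE x in lebesgue. frac_int (\<alpha>i j) f x \<noteq> \<infinity>"
    "(\<integral>\<^sup>+x. ennreal ((enn2real (frac_int (\<alpha>i j) f x) / Cf j) powr qj j x) \<partial>lebesgue) \<le> 1"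
  using Cf assms unfolding majorizing_const_def by blast+

lemma Cf_comm:
  assumes "f \<in> borel_measurable lebesgue" "\<And>y. 0 \<le> f y" "(\<integral>\<^sup>+y. ennreal (f y powr ps j y) \<partial>lebesgue) \<le> 1"
    "b \<in> BMO" "0 < \<beta>" "BMO_norm b \<le> \<beta>"
  shows "AE x in lebesgue. frac_comm (\<alpha>i j) b f x \<noteq> \<infinity>"
    "(\<integral>\<^sup>+x. ennreal ((enn2real (frac_comm (\<alpha>i j) b f x) / (Cf j * \<beta>)) powr qj j x) \<partial>lebesgue) \<le> 1"
  using Cf assms unfolding majorizing_const_def by blast+

definition c0 :: real where "c0 = A * (\<Prod>j\<in>(UNIV :: 'm set). 6 powr (real CARD('n) - \<alpha>i j)) + 1"

lemma c0: "0 < c0" "A * (\<Prod>j\<in>(UNIV :: 'm set). 6 powr (real CARD('n) - \<alpha>i j)) \<le> c0"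
proof -
  have "0 \<le> A * (\<Prod>j\<in>(UNIV :: 'm set). 6 powr (real CARD('n) - \<alpha>i j))"
    by (intro mult_nonneg_nonneg A_nonneg prod_nonneg) simp
  then show "0 < c0" "A * (\<Prod>j\<in>(UNIV :: 'm set). 6 powr (real CARD('n) - \<alpha>i j)) \<le> c0" by (auto simp: c0_def)
qed

definition C1 :: real where "C1 = real CARD('m) * c0 * (\<Prod>j\<in>UNIV. Cf j)"

lemma C1_pos: "0 < C1"
  unfolding C1_def using c0 Cf_pos by (intro mult_pos_pos prod_pos) (auto simp: card_gt_0_iff)

text \<open>Hoelder for the exponents \<open>qj\<close>, whose reciprocals add up to 1/q. Dividing
  by m, with q > 1, offsets the sum of m modulars.\<close>

lemma product_majorant:
  fixes G :: "'m \<Rightarrow> real^'n \<Rightarrow> real"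
  assumes [measurable]: "\<And>j. G j \<in> borel_measurable lebesgue" and G0: "\<And>j x. 0 \<le> G j x"
    and GI: "\<And>j. (\<integral>\<^sup>+x. ennreal (G j x powr qj j x) \<partial>lebesgue) \<le> 1"
  shows "(\<integral>\<^sup>+x. ennreal (((\<Prod>j\<in>UNIV. G j x) / real CARD('m)) powr q x) \<partial>lebesgue) \<le> 1"
proof -
  define N where "N = real CARD('m)"
  have N: "1 \<le> N" by (simp add: N_def Suc_leI card_gt_0_iff)
  have "(\<integral>\<^sup>+x. ennreal (((\<Prod>j\<in>UNIV. G j x) / N) powr q x) \<partial>lebesgue)
     \<le> (\<integral>\<^sup>+x. ennreal (1 / N) * (\<Sum>j\<in>UNIV. ennreal (G j x powr qj j x)) \<partial>lebesgue)"
  proof (intro nn_integral_mono)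
    fix x
    define P where "P = (\<Prod>j\<in>UNIV. G j x)"
    have P0: "0 \<le> P" unfolding P_def using G0 by (intro prod_nonneg) auto
    have q: "1 < q x" by (rule q_gt_1)
    have "(P / N) powr q x = (1 / N) powr q x * P powr q x"
      using powr_mult[of "1 / N" P "q x"] N P0 by simp
    also have "\<dots> \<le> (1 / N) powr 1 * P powr q x"
      using N q by (intro mult_right_mono powr_mono') auto
    also have "\<dots> \<le> (1 / N) powr 1 * (\<Sum>j\<in>UNIV. G j x powr qj j x)"
      unfolding P_def using G0 qj_pos qj_sum[of x] q by (intro mult_left_mono prod_powr_le_sum) auto
    also have "(1 / N) powr 1 = 1 / N" using N by simp
    finally have "ennreal ((P / N) powr q x) \<le> ennreal ((1 / N) * (\<Sum>j\<in>UNIV. G j x powr qj j x))"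
      by (rule ennreal_leI)
    also have "\<dots> = ennreal (1 / N) * ennreal (\<Sum>j\<in>UNIV. G j x powr qj j x)"
      using N by (intro ennreal_mult sum_nonneg) auto
    also have "ennreal (\<Sum>j\<in>UNIV. G j x powr qj j x) = (\<Sum>j\<in>UNIV. ennreal (G j x powr qj j x))"
      by (rule sum_ennreal[symmetric]) simp
    finally show "ennreal (((\<Prod>j\<in>UNIV. G j x) / N) powr q x) \<le> ennreal (1 / N) * (\<Sum>j\<in>UNIV. ennreal (G j x powr qj j x))"
      by (simp only: P_def)
  qed
  also have "\<dots> = ennreal (1 / N) * (\<integral>\<^sup>+x. (\<Sum>j\<in>UNIV. ennreal (G j x powr qj j x)) \<partial>lebesgue)"
    by (rule nn_integral_cmult) measurable
  also have "(\<integral>\<^sup>+x. (\<Sum>j\<in>UNIV. ennreal (G j x powr qj j x)) \<partial>lebesgue) = (\<Sum>j\<in>UNIV. \<integral>\<^sup>+x. ennreal (G j x powr qj j x) \<partial>lebesgue)"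
    by (rule nn_integral_sum) measurable
  also have "ennreal (1 / N) * \<dots> \<le> ennreal (1 / N) * (\<Sum>j\<in>(UNIV :: 'm set). 1)"
    by (intro mult_left_mono sum_mono GI) auto
  also have "\<dots> = ennreal (1 / N * N)"
  proof -
    have "(\<Sum>j\<in>(UNIV :: 'm set). 1 :: ennreal) = ennreal N" by (simp add: N_def ennreal_of_nat_eq_real_of_nat)
    moreover have "ennreal (1 / N) * ennreal N = ennreal (1 / N * N)" using N by (intro ennreal_mult[symmetric]) auto
    ultimately show ?thesis by (simp only:)
  qed
  also have "\<dots> = 1" using N by simp
  finally show ?thesis by (simp add: N_def)
qed

text \<open>Each entry is normalized to modular 1, and the product of all scales is attached to the
  single index i, so that homogeneity has to be used in one factor only.\<close>

lemma scaled_prod: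
  fixes f :: "'m \<Rightarrow> real^'n \<Rightarrow> real"
  assumes "\<And>j. 0 < \<eta> j"
  shows "(\<Prod>j\<in>UNIV. f j (y $ j)) = (\<Prod>j\<in>UNIV. (if j = i then \<Prod>k\<in>UNIV. \<eta> k else 1) * (f j (y $ j) / \<eta> j))"
proof -
  have "f j (y $ j) = \<eta> j * (f j (y $ j) / \<eta> j)" for j using assms[of j] by simp
  then have "(\<Prod>j\<in>UNIV. f j (y $ j)) = (\<Prod>k\<in>UNIV. \<eta> k) * (\<Prod>j\<in>UNIV. f j (y $ j) / \<eta> j)"
    by (simp only: prod.distrib[symmetric])
  also have "(\<Prod>k\<in>UNIV. \<eta> k) = (\<Prod>j\<in>UNIV. if j = i then \<Prod>k\<in>UNIV. \<eta> k else 1)"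
    by simp
  finally show ?thesis by (simp only: prod.distrib)
qed

text \<open>The grid operators take extended values, so a real measurable majorant is built from
  their finite parts; it dominates almost everywhere because they are finite almost
  everywhere.\<close>

lemma comm_majorant:
  assumes f[measurable]: "\<And>j. f j \<in> borel_measurable lebesgue" and f0: "\<And>j y. 0 \<le> f j y" and \<eta>: "\<And>j. 0 < \<eta> j"
    and fI: "\<And>j. (\<integral>\<^sup>+y. ennreal ((f j y / \<eta> j) powr ps j y) \<partial>lebesgue) \<le> 1"
    and b: "b \<in> BMO" and \<beta>: "0 < \<beta>" "BMO_norm b \<le> \<beta>"
  shows "\<exists>W \<in> borel_measurable lebesgue. (\<forall>x. 0 \<le> W x) \<and>
     (AE x in lebesgue. (\<integral>\<^sup>+y. ennreal (norm (K x y)) * ennreal (norm (b x - b (y $ i)) * (\<Prod>j\<in>UNIV. f j (y $ j))) \<partial>lebesgue) \<le> ennreal (W x)) \<and>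
     (\<integral>\<^sup>+x. ennreal ((W x / (C1 * \<beta> * (\<Prod>j\<in>UNIV. \<eta> j))) powr q x) \<partial>lebesgue) \<le> 1"
proof -
  have loc: "b locally_integrable_on UNIV" using b by (simp add: BMO_def)
  note bm[measurable] = loc_measurable[OF loc]
  define g where "g j y = f j y / \<eta> j" for j y
  have gm[measurable]: "g j \<in> borel_measurable lebesgue" for j unfolding g_def[abs_def] by measurable
  have g0: "0 \<le> g j y" for j y using f0[of j y] \<eta>[of j] by (simp add: g_def)
  have gI: "(\<integral>\<^sup>+y. ennreal (g j y powr ps j y) \<partial>lebesgue) \<le> 1" for j using fI[of j] by (simp add: g_def)
  define H where "H = (\<Prod>j\<in>UNIV. \<eta> j)"
  have H: "0 < H" unfolding H_def using \<eta> by (intro prod_pos) auto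
  define G where "G j x = (if j = i then enn2real (frac_comm (\<alpha>i i) b (g i) x) / (Cf i * \<beta>) else enn2real (frac_int (\<alpha>i j) (g j) x) / Cf j)" for j x
  have Gm[measurable]: "G j \<in> borel_measurable lebesgue" for j
    unfolding G_def[abs_def] using frac_comm_measurable[OF bm, of "\<alpha>i i" "g i"] by measurable
  have G0: "0 \<le> G j x" for j x using \<beta> Cf_pos[of j] Cf_pos[of i] by (simp add: G_def)
  have GI: "(\<integral>\<^sup>+x. ennreal (G j x powr qj j x) \<partial>lebesgue) \<le> 1" for j
    using Cf_int(2)[OF gm g0 gI, of j] Cf_comm(2)[OF gm g0 gI b \<beta>, of i] by (cases "j = i") (simp_all add: G_def)
  \<comment> \<open>Every \<open>G j\<close> has modular at most 1 in its own exponent;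
    \<open>D\<close> undoes the divisions by \<open>Cf\<close> and \<beta> and restores the scales
    \<eta>.\<close>
  define D where "D = c0 * (\<Prod>j\<in>UNIV. Cf j) * \<beta> * H"
  have D: "0 < D" unfolding D_def using c0 Cf_pos \<beta> H by (intro mult_pos_pos prod_pos) auto
  define W where "W x = D * (\<Prod>j\<in>UNIV. G j x)" for x
  define h where "h j y = (if j = i then H else 1) * g j y" for j y
  have hm: "h j \<in> borel_measurable lebesgue" for j unfolding h_def[abs_def] by measurable
  have h0: "0 \<le> h j y" for j y using g0 H by (simp add: h_def)
  have fh: "(\<Prod>j\<in>UNIV. f j (y $ j)) = (\<Prod>j\<in>UNIV. h j (y $ j))" for y
    unfolding h_def H_def g_def by (rule scaled_prod[OF \<eta>])
  have remove: "(\<Prod>j\<in>UNIV. h j) = h i * (\<Prod>j\<in>UNIV - {i}. h j)" for h :: "'m \<Rightarrow> real"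
    by (rule prod.remove) auto
  have W_eq: "W x = c0 * H * (enn2real (frac_comm (\<alpha>i i) b (g i) x) * (\<Prod>j\<in>UNIV - {i}. enn2real (frac_int (\<alpha>i j) (g j) x)))" for x
  proof -
    have "(\<Prod>j\<in>UNIV - {i}. Cf j) * (\<Prod>j\<in>UNIV - {i}. G j x) = (\<Prod>j\<in>UNIV - {i}. enn2real (frac_int (\<alpha>i j) (g j) x))"
      unfolding prod.distrib[symmetric] using Cf_pos by (intro prod.cong) (auto simp: G_def less_imp_neq[symmetric])
    moreover have "Cf i * \<beta> * G i x = enn2real (frac_comm (\<alpha>i i) b (g i) x)"
      using Cf_pos[of i] \<beta> by (simp add: G_def)
    moreover have "W x = c0 * H * ((Cf i * \<beta> * G i x) * ((\<Prod>j\<in>UNIV - {i}. Cf j) * (\<Prod>j\<in>UNIV - {i}. G j x)))"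
      unfolding W_def D_def remove[of Cf] remove[of "\<lambda>j. G j x"] by (simp only: mult_ac)
    ultimately show ?thesis by simp
  qed
  have ae: "AE x in lebesgue. frac_comm (\<alpha>i i) b (g i) x \<noteq> \<infinity> \<and> (\<forall>j. frac_int (\<alpha>i j) (g j) x \<noteq> \<infinity>)"
    using Cf_comm(1)[OF gm g0 gI b \<beta>, of i] Cf_int(1)[OF gm g0 gI] by (simp add: AE_all_countable)
  show ?thesis
  proof (intro bexI[of _ W] conjI allI)
    show "W \<in> borel_measurable lebesgue" unfolding W_def[abs_def] by measurable
    show "0 \<le> W x" for x unfolding W_def using D G0 by (intro mult_nonneg_nonneg prod_nonneg) auto
    show "AE x in lebesgue. (\<integral>\<^sup>+y. ennreal (norm (K x y)) * ennreal (norm (b x - b (y $ i)) * (\<Prod>j\<in>UNIV. f j (y $ j))) \<partial>lebesgue) \<le> ennreal (W x)"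
      using ae
    proof eventually_elim
      case (elim x)
      have fin: "ennreal (enn2real (frac_comm (\<alpha>i i) b (g i) x)) = frac_comm (\<alpha>i i) b (g i) x"
         "ennreal (enn2real (frac_int (\<alpha>i j) (g j) x)) = frac_int (\<alpha>i j) (g j) x" for j
        using elim by (auto simp: less_top)
      have "(\<integral>\<^sup>+y. ennreal (norm (K x y)) * ennreal (norm (b x - b (y $ i)) * (\<Prod>j\<in>UNIV. f j (y $ j))) \<partial>lebesgue)
        \<le> ennreal (A * (\<Prod>j\<in>UNIV. 6 powr (real CARD('n) - \<alpha>i j)))
         * (frac_comm (\<alpha>i i) b (h i) x * (\<Prod>j\<in>UNIV - {i}. frac_int (\<alpha>i j) (h j) x))"
        unfolding fh by (rule kernel_frac_comm_bound[OF A_nonneg size \<alpha>_sum \<alpha>i_le hm h0 bm])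
      also have "(\<Prod>j\<in>UNIV - {i}. frac_int (\<alpha>i j) (h j) x) = (\<Prod>j\<in>UNIV - {i}. frac_int (\<alpha>i j) (g j) x)"
        by (intro prod.cong) (auto simp: h_def[abs_def])
      also have "frac_comm (\<alpha>i i) b (h i) x = ennreal H * frac_comm (\<alpha>i i) b (g i) x"
      proof -
        have "h i = (\<lambda>y. H * g i y)" by (auto simp: h_def[abs_def])
        then show ?thesis using frac_comm_cmult[OF gm bm _ g0, of H "\<alpha>i i" i x] H by simp
      qed
      also have "ennreal (A * (\<Prod>j\<in>UNIV. 6 powr (real CARD('n) - \<alpha>i j)))
         * (ennreal H * frac_comm (\<alpha>i i) b (g i) x * (\<Prod>j\<in>UNIV - {i}. frac_int (\<alpha>i j) (g j) x))
         \<le> ennreal c0 * (ennreal H * frac_comm (\<alpha>i i) b (g i) x * (\<Prod>j\<in>UNIV - {i}. frac_int (\<alpha>i j) (g j) x))"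
        by (intro mult_right_mono ennreal_leI c0) simp
      also have "\<dots> = ennreal (W x)"
      proof -
        have "(\<Prod>j\<in>UNIV - {i}. frac_int (\<alpha>i j) (g j) x) = ennreal (\<Prod>j\<in>UNIV - {i}. enn2real (frac_int (\<alpha>i j) (g j) x))"
          by (simp add: prod_ennreal[symmetric] fin)
        moreover have "ennreal (W x) = ennreal c0 * (ennreal H * ennreal (enn2real (frac_comm (\<alpha>i i) b (g i) x)) * ennreal (\<Prod>j\<in>UNIV - {i}. enn2real (frac_int (\<alpha>i j) (g j) x)))"
          unfolding W_eq using c0(1) H by (simp add: ennreal_mult prod_nonneg mult.assoc)
        ultimately show ?thesis by (simp only: fin)
      qed
      finally show ?case .
    qed
    have "W x / (C1 * \<beta> * (\<Prod>j\<in>UNIV. \<eta> j)) = (\<Prod>j\<in>UNIV. G j x) / real CARD('m)" for x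
    proof -
      have "C1 * \<beta> * (\<Prod>j\<in>UNIV. \<eta> j) = D * real CARD('m)" by (simp add: C1_def D_def H_def mult_ac)
      then show ?thesis using D by (simp add: W_def)
    qed
    then show "(\<integral>\<^sup>+x. ennreal ((W x / (C1 * \<beta> * (\<Prod>j\<in>UNIV. \<eta> j))) powr q x) \<partial>lebesgue) \<le> 1"
      using product_majorant[OF Gm G0 GI] by simp
  qed
qed

lemma kernel_absolutely_convergent:
  assumes f[measurable]: "\<And>j. f j \<in> borel_measurable lebesgue" and f0: "\<And>j y. 0 \<le> f j y" and \<eta>: "\<And>j. 0 < \<eta> j"
    and fI: "\<And>j. (\<integral>\<^sup>+y. ennreal ((f j y / \<eta> j) powr ps j y) \<partial>lebesgue) \<le> 1"
  shows "AE x in lebesgue. (\<integral>\<^sup>+y. ennreal (norm (K x y)) * ennreal (\<Prod>j\<in>UNIV. f j (y $ j)) \<partial>lebesgue) < \<infinity>"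
proof -
  define g where "g j y = f j y / \<eta> j" for j y
  have gm[measurable]: "g j \<in> borel_measurable lebesgue" for j unfolding g_def[abs_def] by measurable
  have g0: "0 \<le> g j y" for j y using f0[of j y] \<eta>[of j] by (simp add: g_def)
  have gI: "(\<integral>\<^sup>+y. ennreal (g j y powr ps j y) \<partial>lebesgue) \<le> 1" for j using fI[of j] by (simp add: g_def)
  define H where "H = (\<Prod>j\<in>UNIV. \<eta> j)"
  have H: "0 < H" unfolding H_def using \<eta> by (intro prod_pos) auto
  \<comment> \<open>\<open>undefined\<close> is just some index, chosen to carry the product of all
    scales.\<close>
  define h where "h j y = (if j = undefined then H else 1) * g j y" for j y
  have hm: "h j \<in> borel_measurable lebesgue" for j unfolding h_def[abs_def] by measurable
  have h0: "0 \<le> h j y" for j y using g0 H by (simp add: h_def)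
  have fh: "(\<Prod>j\<in>UNIV. f j (y $ j)) = (\<Prod>j\<in>UNIV. h j (y $ j))" for y
    unfolding h_def H_def g_def by (rule scaled_prod[OF \<eta>])
  have frac_h: "frac_int a (h j) x = ennreal (if j = undefined then H else 1) * frac_int a (g j) x" for a j x
    unfolding h_def[abs_def] by (rule frac_int_cmult) (use H g0 gm in auto)
  have "AE x in lebesgue. \<forall>j. frac_int (\<alpha>i j) (g j) x \<noteq> \<infinity>"
    using Cf_int(1)[OF gm g0 gI] by (simp add: AE_all_countable)
  then show ?thesis
  proof eventually_elim
    case (elim x)
    have fin: "frac_int (\<alpha>i j) (h j) x < \<infinity>" for j
      using elim by (simp add: frac_h ennreal_mult_less_top less_top)
    have "(\<Prod>j\<in>UNIV. frac_int (\<alpha>i j) (h j) x) < \<infinity>"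
    proof -
      have "(\<Prod>j\<in>UNIV. frac_int (\<alpha>i j) (h j) x) = ennreal (\<Prod>j\<in>UNIV. enn2real (frac_int (\<alpha>i j) (h j) x))"
        using fin by (simp add: prod_ennreal[symmetric])
      then show ?thesis by simp
    qed
    then have "ennreal (A * (\<Prod>j\<in>UNIV. 6 powr (real CARD('n) - \<alpha>i j))) * (\<Prod>j\<in>UNIV. frac_int (\<alpha>i j) (h j) x) < \<infinity>"
      by (simp add: ennreal_mult_less_top)
    then show ?case
      unfolding fh using kernel_frac_int_bound[OF A_nonneg size \<alpha>_sum \<alpha>i_le hm h0, of x] by (rule le_less_trans[rotated])
  qed
qed

lemma kernel_integral_integrable:
  assumes f: "\<And>j. f j \<in> borel_measurable lebesgue" and \<eta>: "\<And>j. 0 < \<eta> j" and fI: "\<And>j. var_modular (ps j) (f j) (\<eta> j) \<le> 1"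
  shows "AE x in lebesgue. integrable lebesgue (\<lambda>y. K x y * (\<Prod>j\<in>UNIV. f j (y $ j)))"
proof -
  have "AE x in lebesgue. (\<integral>\<^sup>+y. ennreal (norm (K x y)) * ennreal (\<Prod>j\<in>UNIV. norm (f j (y $ j))) \<partial>lebesgue) < \<infinity>"
    by (rule kernel_absolutely_convergent[where f="\<lambda>j y. norm (f j y)" and \<eta>=\<eta>])
       (use f \<eta> fI in \<open>auto simp: var_modular_def\<close>)
  with kernel_section_measurable[OF K_loc] show ?thesis
  proof eventually_elim
    case (elim x)
    show ?case
    proof (rule integrableI_bounded)
      show "(\<lambda>y. K x y * (\<Prod>j\<in>UNIV. f j (y $ j))) \<in> borel_measurable lebesgue"
        by (rule comm_integrand_measurable(2)[OF f f elim(1)])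
      show "(\<integral>\<^sup>+y. ennreal (norm (K x y * (\<Prod>j\<in>UNIV. f j (y $ j)))) \<partial>lebesgue) < \<infinity>"
        using elim(2) by (simp add: norm_mult prod_norm ennreal_mult prod_nonneg)
    qed
  qed
qed

text \<open>The squared cardinalities are those of \<open>modular_sum_le_one\<close>: m summands,
  one per symbol, for the integral itself, and in \<open>C3\<close> m * m summands for the
  difference of two tuples, one per symbol and telescoping term.\<close>

definition C2 :: real where "C2 = (real CARD('m))\<^sup>2 * C1"

definition C3 :: real where "C3 = (real (CARD('m) * CARD('m)))\<^sup>2 * C1"

lemma C2_pos: "0 < C2" and C3_pos: "0 < C3"
  using C1_pos by (auto simp: C2_def C3_def intro!: mult_pos_pos)

lemma comm_integrand_bound:
  fixes b f :: "'m \<Rightarrow> 'n cfun" and h :: "'m \<Rightarrow> 'm \<Rightarrow> real^'n \<Rightarrow> real"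
  assumes I: "finite I" and P: "norm P \<le> (\<Sum>k\<in>I. \<Prod>j\<in>UNIV. h k j (y $ j))" and h0: "\<And>k j z. 0 \<le> h k j z"
  shows "ennreal (norm (k * ((\<Sum>i\<in>UNIV. b i x - b i (y $ i)) * P)))
    \<le> (\<Sum>(i, l)\<in>UNIV \<times> I. ennreal (norm k) * ennreal (norm (b i x - b i (y $ i)) * (\<Prod>j\<in>UNIV. h l j (y $ j))))"
proof -
  have "norm (k * ((\<Sum>i\<in>UNIV. b i x - b i (y $ i)) * P)) = norm k * (norm (\<Sum>i\<in>UNIV. b i x - b i (y $ i)) * norm P)"
    by (simp add: norm_mult)
  also have "\<dots> \<le> norm k * ((\<Sum>i\<in>UNIV. norm (b i x - b i (y $ i))) * (\<Sum>l\<in>I. \<Prod>j\<in>UNIV. h l j (y $ j)))"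
    using P by (intro mult_left_mono mult_mono norm_sum sum_nonneg) auto
  also have "\<dots> = (\<Sum>(i, l)\<in>UNIV \<times> I. norm k * (norm (b i x - b i (y $ i)) * (\<Prod>j\<in>UNIV. h l j (y $ j))))"
  proof -
    have "(\<Sum>i\<in>UNIV. norm (b i x - b i (y $ i))) * (\<Sum>l\<in>I. \<Prod>j\<in>UNIV. h l j (y $ j))
      = (\<Sum>(i, l)\<in>UNIV \<times> I. norm (b i x - b i (y $ i)) * (\<Prod>j\<in>UNIV. h l j (y $ j)))"
      by (simp only: sum_product sum.cartesian_product)
    then show ?thesis by (simp only: sum_distrib_left case_prod_beta')
  qed
  finally have "ennreal (norm (k * ((\<Sum>i\<in>UNIV. b i x - b i (y $ i)) * P))) \<le> ennreal (\<Sum>(i, l)\<in>UNIV \<times> I. norm k * (norm (b i x - b i (y $ i)) * (\<Prod>j\<in>UNIV. h l j (y $ j))))"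
    by (rule ennreal_leI)
  also have "\<dots> = (\<Sum>(i, l)\<in>UNIV \<times> I. ennreal (norm k) * ennreal (norm (b i x - b i (y $ i)) * (\<Prod>j\<in>UNIV. h l j (y $ j))))"
    using h0 by (subst sum_ennreal[symmetric]) (auto simp: case_prod_beta' ennreal_mult prod_nonneg intro!: mult_nonneg_nonneg)
  finally show ?thesis .
qed

text \<open>One statement for the size of the integral, where \<open>I\<close> is a singleton, and
  for its modulus of continuity, where \<open>I\<close> runs through the terms of a telescoped
  product. The products of the scales must agree over \<open>I\<close>, so that all majorants are
  normalized by the same number.\<close>

lemma comm_kernel_modular_bound:
  fixes b :: "'m \<Rightarrow> 'n cfun" and D :: "real^'n^'m \<Rightarrow> complex" and h :: "'m \<Rightarrow> 'm \<Rightarrow> real^'n \<Rightarrow> real"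
  assumes b: "\<And>i. b i \<in> BMO" and \<beta>: "0 < \<beta>" "\<And>i. BMO_norm (b i) \<le> \<beta>"
    and I: "I \<noteq> {}" and D: "\<And>y. norm (D y) \<le> (\<Sum>l\<in>I. \<Prod>j\<in>UNIV. h l j (y $ j))"
    and h: "\<And>l j. h l j \<in> borel_measurable lebesgue" "\<And>l j z. 0 \<le> h l j z"
    and \<theta>: "\<And>l j. 0 < \<theta> l j" "\<And>l. l \<in> I \<Longrightarrow> (\<Prod>j\<in>UNIV. \<theta> l j) = \<Theta>"
    and hI: "\<And>l j. (\<integral>\<^sup>+y. ennreal ((h l j y / \<theta> l j) powr ps j y) \<partial>lebesgue) \<le> 1"
  shows "AE x in lebesgue. (\<integral>\<^sup>+y. ennreal (norm (K x y * ((\<Sum>i\<in>UNIV. b i x - b i (y $ i)) * D y))) \<partial>lebesgue) < \<infinity>"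
    and "(\<And>x. ennreal (norm (F x)) \<le> (\<integral>\<^sup>+y. ennreal (norm (K x y * ((\<Sum>i\<in>UNIV. b i x - b i (y $ i)) * D y))) \<partial>lebesgue)) \<Longrightarrow>
      var_modular q F ((real (CARD('m) * card I))\<^sup>2 * (C1 * \<beta> * \<Theta>)) \<le> 1"
proof -
  have finI: "finite I" by (rule finite_subset[OF subset_UNIV]) simp
  have bm: "b i \<in> borel_measurable lebesgue" for i using b[of i] by (simp add: BMO_def loc_measurable)
  have \<Theta>: "0 < \<Theta>" using I \<theta> by (metis ex_in_conv prod_pos)
  define Pr where "Pr i l W \<longleftrightarrow> W \<in> borel_measurable lebesgue \<and> (\<forall>x. 0 \<le> W x) \<and>
     (AE x in lebesgue. (\<integral>\<^sup>+y. ennreal (norm (K x y)) * ennreal (norm (b i x - b i (y $ i)) * (\<Prod>j\<in>UNIV. h l j (y $ j))) \<partial>lebesgue) \<le> ennreal (W x)) \<and>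
     (\<integral>\<^sup>+x. ennreal ((W x / (C1 * \<beta> * (\<Prod>j\<in>UNIV. \<theta> l j))) powr q x) \<partial>lebesgue) \<le> 1" for i l and W :: "real^'n \<Rightarrow> real"
  define W where "W i l = (SOME W. Pr i l W)" for i l
  have Pr: "Pr i l (W i l)" for i l
  proof -
    have "\<exists>W. Pr i l W"
      using comm_majorant[where f="h l" and \<eta>="\<theta> l" and b="b i" and i=i and \<beta>=\<beta>, OF h(1) h(2) \<theta>(1) hI b \<beta>]
      unfolding Pr_def by blast
    then show ?thesis unfolding W_def by (rule someI_ex)
  qed
  have W: "W i l \<in> borel_measurable lebesgue" "0 \<le> W i l x"
     "AE x in lebesgue. (\<integral>\<^sup>+y. ennreal (norm (K x y)) * ennreal (norm (b i x - b i (y $ i)) * (\<Prod>j\<in>UNIV. h l j (y $ j))) \<partial>lebesgue) \<le> ennreal (W i l x)"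
     "(\<integral>\<^sup>+x. ennreal ((W i l x / (C1 * \<beta> * (\<Prod>j\<in>UNIV. \<theta> l j))) powr q x) \<partial>lebesgue) \<le> 1" for i l x
    using Pr[of i l] unfolding Pr_def by blast+
  have hv: "(\<lambda>y. norm (b i x - b i (y $ i)) * (\<Prod>j\<in>UNIV. h l j (y $ j))) \<in> borel_measurable lebesgue" for i l x
  proof -
    have [measurable]: "(\<lambda>y. h l j (y $ j)) \<in> borel_measurable lebesgue" "(\<lambda>y. b i (y $ i)) \<in> borel_measurable lebesgue" for j
      using measurable_compose[OF vec_nth_measurable_lebesgue h(1)] measurable_compose[OF vec_nth_measurable_lebesgue bm] by auto
    show ?thesis by measurable
  qed
  have "AE x in lebesgue. \<forall>i l. (\<integral>\<^sup>+y. ennreal (norm (K x y)) * ennreal (norm (b i x - b i (y $ i)) * (\<Prod>j\<in>UNIV. h l j (y $ j))) \<partial>lebesgue) \<le> ennreal (W i l x)"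
    using W(3) by (simp add: AE_all_countable)
  with kernel_section_measurable[OF K_loc]
  have ae: "AE x in lebesgue. (\<integral>\<^sup>+y. ennreal (norm (K x y * ((\<Sum>i\<in>UNIV. b i x - b i (y $ i)) * D y))) \<partial>lebesgue)
     \<le> ennreal (\<Sum>(i, l)\<in>UNIV \<times> I. W i l x)"
  proof eventually_elim
    case (elim x)
    note [measurable] = elim(1) hv
    have "(\<integral>\<^sup>+y. ennreal (norm (K x y * ((\<Sum>i\<in>UNIV. b i x - b i (y $ i)) * D y))) \<partial>lebesgue)
      \<le> (\<integral>\<^sup>+y. (\<Sum>(i, l)\<in>UNIV \<times> I. ennreal (norm (K x y)) * ennreal (norm (b i x - b i (y $ i)) * (\<Prod>j\<in>UNIV. h l j (y $ j)))) \<partial>lebesgue)"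
      by (intro nn_integral_mono comm_integrand_bound finI D h)
    also have "\<dots> = (\<Sum>(i, l)\<in>UNIV \<times> I. \<integral>\<^sup>+y. ennreal (norm (K x y)) * ennreal (norm (b i x - b i (y $ i)) * (\<Prod>j\<in>UNIV. h l j (y $ j))) \<partial>lebesgue)"
      unfolding case_prod_beta' by (rule nn_integral_sum) measurable
    also have "\<dots> \<le> (\<Sum>(i, l)\<in>UNIV \<times> I. ennreal (W i l x))"
      using elim(2) by (intro sum_mono) auto
    also have "\<dots> = ennreal (\<Sum>(i, l)\<in>UNIV \<times> I. W i l x)"
      using W(2) by (simp add: case_prod_beta' sum_ennreal)
    finally show ?case .
  qed
  then show "AE x in lebesgue. (\<integral>\<^sup>+y. ennreal (norm (K x y * ((\<Sum>i\<in>UNIV. b i x - b i (y $ i)) * D y))) \<partial>lebesgue) < \<infinity>"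
    by eventually_elim (auto intro: le_less_trans)
  assume F: "\<And>x. ennreal (norm (F x)) \<le> (\<integral>\<^sup>+y. ennreal (norm (K x y * ((\<Sum>i\<in>UNIV. b i x - b i (y $ i)) * D y))) \<partial>lebesgue)"
  define \<eta> where "\<eta> = C1 * \<beta> * \<Theta>"
  have \<eta>: "0 < \<eta>" unfolding \<eta>_def using C1_pos \<beta> \<Theta> by simp
  have c: "0 < (real (CARD('m) * card I))\<^sup>2 * \<eta>" using \<eta> I finI by (simp add: card_gt_0_iff)
  have "var_modular q F ((real (CARD('m) * card I))\<^sup>2 * \<eta>)
     \<le> (\<integral>\<^sup>+x. ennreal (((\<Sum>p\<in>UNIV \<times> I. W (fst p) (snd p) x) / ((real (card ((UNIV :: 'm set) \<times> I)))\<^sup>2 * \<eta>)) powr q x) \<partial>lebesgue)"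
    unfolding var_modular_def
  proof (rule nn_integral_mono_AE)
    show "AE x in lebesgue. ennreal ((norm (F x) / ((real (CARD('m) * card I))\<^sup>2 * \<eta>)) powr q x)
      \<le> ennreal (((\<Sum>p\<in>UNIV \<times> I. W (fst p) (snd p) x) / ((real (card ((UNIV :: 'm set) \<times> I)))\<^sup>2 * \<eta>)) powr q x)"
      using ae
    proof eventually_elim
      case (elim x)
      have "ennreal (norm (F x)) \<le> ennreal (\<Sum>(i, l)\<in>UNIV \<times> I. W i l x)" using F elim by (rule order_trans)
      then have "norm (F x) \<le> (\<Sum>p\<in>UNIV \<times> I. W (fst p) (snd p) x)"
        using W(2) by (subst (asm) ennreal_le_iff) (auto simp: case_prod_beta' intro: sum_nonneg)
      then show ?case
        using c q_gt_1[of x] by (intro ennreal_leI powr_mono2) (auto simp: card_cartesian_product divide_right_mono)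
    qed
  qed
  also have "\<dots> \<le> 1"
  proof (rule modular_sum_le_one[where W="\<lambda>p. W (fst p) (snd p)"])
    show "(\<integral>\<^sup>+x. ennreal ((W (fst p) (snd p) x / \<eta>) powr q x) \<partial>lebesgue) \<le> 1" if "p \<in> UNIV \<times> I" for p
      using W(4)[of "fst p" "snd p"] \<theta>(2)[of "snd p"] that by (auto simp: \<eta>_def)
  qed (use finI I W q_measurable q_gt_1 \<eta> in \<open>auto simp: less_imp_le\<close>)
  finally show "var_modular q F ((real (CARD('m) * card I))\<^sup>2 * (C1 * \<beta> * \<Theta>)) \<le> 1"
    by (simp add: \<eta>_def)
qed

lemma comm_kernel_integral_bound:
  fixes b f :: "'m \<Rightarrow> 'n cfun"
  assumes b: "\<And>i. b i \<in> BMO" and \<beta>: "0 < \<beta>" "\<And>i. BMO_norm (b i) \<le> \<beta>"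
    and f: "\<And>j. f j \<in> borel_measurable lebesgue" and \<eta>: "\<And>j. 0 < \<eta> j" and fI: "\<And>j. var_modular (ps j) (f j) (\<eta> j) \<le> 1"
  shows "var_modular q (comm_kernel_integral K b f) (C2 * \<beta> * (\<Prod>j\<in>UNIV. \<eta> j)) \<le> 1"
    and "AE x in lebesgue. integrable lebesgue (\<lambda>y. K x y * ((\<Sum>i\<in>UNIV. b i x - b i (y $ i)) * (\<Prod>j\<in>UNIV. f j (y $ j))))"
proof -
  have bm: "b i \<in> borel_measurable lebesgue" for i using b[of i] by (simp add: BMO_def loc_measurable)
  define i0 where "i0 = (undefined :: 'm)"
  have 1: "norm (\<Prod>j\<in>UNIV. f j (y $ j)) \<le> (\<Sum>l\<in>{i0}. \<Prod>j\<in>UNIV. norm (f j (y $ j)))" for y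
    by (simp add: prod_norm)
  note bnd = comm_kernel_modular_bound[OF b \<beta>, of "{i0}" "\<lambda>y. \<Prod>j\<in>UNIV. f j (y $ j)" "\<lambda>l j z. norm (f j z)" "\<lambda>l j. \<eta> j" "\<Prod>j\<in>UNIV. \<eta> j", OF _ 1]
  have "var_modular q (comm_kernel_integral K b f) ((real (CARD('m) * card {i0}))\<^sup>2 * (C1 * \<beta> * (\<Prod>j\<in>UNIV. \<eta> j))) \<le> 1"
    by (rule bnd(2)) (use f \<eta> fI in \<open>auto simp: var_modular_def comm_kernel_integral_def intro: ennreal_norm_integral_le\<close>)
  then show "var_modular q (comm_kernel_integral K b f) (C2 * \<beta> * (\<Prod>j\<in>UNIV. \<eta> j)) \<le> 1"
    by (simp add: C2_def mult.assoc)
  have "AE x in lebesgue. (\<integral>\<^sup>+y. ennreal (norm (K x y * ((\<Sum>i\<in>UNIV. b i x - b i (y $ i)) * (\<Prod>j\<in>UNIV. f j (y $ j))))) \<partial>lebesgue) < \<infinity>"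
    by (rule bnd(1)) (use f \<eta> fI in \<open>auto simp: var_modular_def\<close>)
  with kernel_section_measurable[OF K_loc]
  show "AE x in lebesgue. integrable lebesgue (\<lambda>y. K x y * ((\<Sum>i\<in>UNIV. b i x - b i (y $ i)) * (\<Prod>j\<in>UNIV. f j (y $ j))))"
    by eventually_elim (intro integrableI_bounded comm_integrand_measurable f bm)
qed

end

section \<open>Norm bound and continuity of the commutator kernel integral\<close>

text \<open>The case of two summands, indexed by \<open>bool\<close>; 4 is the square of their
  number.\<close>

lemma modular_add_le_one:
  fixes u v :: "real^'n::finite \<Rightarrow> real"
  assumes "u \<in> borel_measurable lebesgue" "v \<in> borel_measurable lebesgue" "p \<in> borel_measurable lebesgue"
    and "\<And>x. 0 \<le> u x" "\<And>x. 0 \<le> v x" "\<And>x. 1 \<le> p x" "0 < \<eta>"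
    and "(\<integral>\<^sup>+x. ennreal ((u x / \<eta>) powr p x) \<partial>lebesgue) \<le> 1" "(\<integral>\<^sup>+x. ennreal ((v x / \<eta>) powr p x) \<partial>lebesgue) \<le> 1"
  shows "(\<integral>\<^sup>+x. ennreal (((u x + v x) / (4 * \<eta>)) powr p x) \<partial>lebesgue) \<le> 1"
  using modular_sum_le_one[of "UNIV :: bool set" "\<lambda>k. if k then u else v" p \<eta>] assms
  by (auto simp: UNIV_bool add.commute)

lemma var_Lp_space_diff:
  assumes f: "f \<in> var_Lp_space p" "g \<in> var_Lp_space p" and p: "p \<in> borel_measurable lebesgue" "\<And>x. 1 \<le> p x"
  shows "(\<lambda>x. f x - g x) \<in> var_Lp_space p"
proof -
  have fm[measurable]: "f \<in> borel_measurable lebesgue" and gm[measurable]: "g \<in> borel_measurable lebesgue"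
    using f by (auto simp: var_Lp_space_def)
  have p0: "0 \<le> p x" for x using p(2)[of x] by linarith
  obtain a where a: "0 < a" "var_modular p f a \<le> 1" by (rule var_Lp_space_modular_le_one[OF f(1) p])
  obtain c where c: "0 < c" "var_modular p g c \<le> 1" by (rule var_Lp_space_modular_le_one[OF f(2) p])
  have "var_modular p f (max a c) \<le> 1" "var_modular p g (max a c) \<le> 1"
    using var_modular_mono_scale[where q=p and f=f and \<eta>'="max a c", OF p0 a(1)] a(2)
      var_modular_mono_scale[where q=p and f=g and \<eta>'="max a c", OF p0 c(1)] c(2) by auto
  then have *: "(\<integral>\<^sup>+x. ennreal (((norm (f x) + norm (g x)) / (4 * max a c)) powr p x) \<partial>lebesgue) \<le> 1"
    using p a c unfolding var_modular_def by (intro modular_add_le_one) auto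
  have "var_modular p (\<lambda>x. f x - g x) (4 * max a c) \<le> 1"
    unfolding var_modular_def
  proof (rule order_trans[OF nn_integral_mono *], rule ennreal_leI, rule powr_mono2)
    fix x
    show "0 \<le> p x" by (rule p0)
    show "norm (f x - g x) / (4 * max a c) \<le> (norm (f x) + norm (g x)) / (4 * max a c)"
      using a by (intro divide_right_mono norm_triangle_ineq4) auto
    show "0 \<le> norm (f x - g x) / (4 * max a c)" using a by simp
  qed
  then have "var_modular p (\<lambda>x. f x - g x) (4 * max a c) < \<infinity>"
    by (rule le_less_trans) simp
  moreover have "0 < 4 * max a c" using a by simp
  ultimately show ?thesis unfolding var_Lp_space_def by (intro CollectI conjI exI) auto
qed

lemma BMO_norm_nonneg:
  assumes "b \<in> BMO"
  shows "0 \<le> BMO_norm b"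
proof -
  have "mean_osc b (cube 0 1) \<in> (\<lambda>(x, r). mean_osc b (cube x r)) ` (UNIV \<times> {0<..})"
    by (intro image_eqI[of _ _ "(0, 1)"]) auto
  moreover have "bdd_above ((\<lambda>(x, r). mean_osc b (cube x r)) ` (UNIV \<times> {0<..}))"
    using assms by (simp add: BMO_def)
  ultimately have "mean_osc b (cube 0 1) \<le> BMO_norm b" unfolding BMO_norm_def by (rule cSup_upper)
  moreover have "0 \<le> mean_osc b (cube 0 1)"
    unfolding mean_osc_def set_lebesgue_integral_def by (intro divide_nonneg_nonneg integral_nonneg_AE) auto
  ultimately show ?thesis by linarith
qed

context fractional_kernel
begin

lemma ps_ge_1: "1 \<le> ps j x"
  using ps_bounds[of j x] pm_gt_1[of j] by simp

text \<open>Telescoping the product leaves in each term one difference, of size \<delta>, and m - 1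
  entries of size \<Theta>. Both integrals converge absolutely almost everywhere, so their
  difference is the integral of the telescoped product.\<close>

lemma comm_kernel_integral_diff:
  fixes b f F :: "'m \<Rightarrow> 'n cfun"
  assumes b: "\<And>i. b i \<in> BMO" and \<beta>: "0 < \<beta>" "\<And>i. BMO_norm (b i) \<le> \<beta>"
    and f: "\<And>j. f j \<in> var_Lp_space (ps j)" and F: "\<And>j. F j \<in> var_Lp_space (ps j)"
    and \<delta>: "0 < \<delta>" "\<And>j. var_modular (ps j) (\<lambda>x. F j x - f j x) \<delta> \<le> 1"
    and \<Theta>: "0 < \<Theta>" "\<And>j. (\<integral>\<^sup>+x. ennreal (((norm (F j x) + norm (f j x)) / \<Theta>) powr ps j x) \<partial>lebesgue) \<le> 1"
  shows "var_modular q (\<lambda>x. comm_kernel_integral K b F x - comm_kernel_integral K b f x)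
    (C3 * (\<beta> * (\<delta> * \<Theta> ^ (CARD('m) - 1)))) \<le> 1"
proof -
  have fm[measurable]: "f j \<in> borel_measurable lebesgue" and Fm[measurable]: "F j \<in> borel_measurable lebesgue" for j
    using f[of j] F[of j] by (auto simp: var_Lp_space_def)
  define D where "D y = (\<Prod>j\<in>UNIV. F j (y $ j)) - (\<Prod>j\<in>UNIV. f j (y $ j))" for y :: "real^'n^'m"
  define h where "h l j z = (if j = l then norm (F j z - f j z) else norm (F j z) + norm (f j z))" for l j z
  define \<theta> where "\<theta> l j = (if j = l then \<delta> else \<Theta>)" for l j :: 'm
  define G where "G x = (LINT y|lebesgue. K x y * ((\<Sum>i\<in>UNIV. b i x - b i (y $ i)) * D y))" for x
  have "var_modular q G ((real (CARD('m) * card (UNIV :: 'm set)))\<^sup>2 * (C1 * \<beta> * (\<delta> * \<Theta> ^ (CARD('m) - 1)))) \<le> 1"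
  proof (rule comm_kernel_modular_bound(2)[where D=D and h=h and \<theta>=\<theta> and I="UNIV :: 'm set", OF b \<beta>])
    fix y
    have "norm (D y) \<le> (\<Sum>l\<in>UNIV. norm (F l (y $ l) - f l (y $ l)) * (\<Prod>j\<in>UNIV - {l}. norm (F j (y $ j)) + norm (f j (y $ j))))"
      unfolding D_def by (rule norm_prod_diff_le) simp
    also have "\<dots> = (\<Sum>l\<in>UNIV. \<Prod>j\<in>UNIV. h l j (y $ j))"
    proof (intro sum.cong refl)
      fix l
      have "(\<Prod>j\<in>UNIV. h l j (y $ j)) = h l l (y $ l) * (\<Prod>j\<in>UNIV - {l}. h l j (y $ j))"
        by (rule prod.remove) auto
      also have "(\<Prod>j\<in>UNIV - {l}. h l j (y $ j)) = (\<Prod>j\<in>UNIV - {l}. norm (F j (y $ j)) + norm (f j (y $ j)))"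
        by (intro prod.cong) (auto simp: h_def)
      finally show "norm (F l (y $ l) - f l (y $ l)) * (\<Prod>j\<in>UNIV - {l}. norm (F j (y $ j)) + norm (f j (y $ j))) = (\<Prod>j\<in>UNIV. h l j (y $ j))"
        by (simp add: h_def)
    qed
    finally show "norm (D y) \<le> (\<Sum>l\<in>UNIV. \<Prod>j\<in>UNIV. h l j (y $ j))" .
  next
    show "h l j \<in> borel_measurable lebesgue" for l j unfolding h_def[abs_def] by measurable
    show "0 \<le> h l j z" for l j z by (simp add: h_def)
    show "0 < \<theta> l j" for l j using \<delta> \<Theta> by (simp add: \<theta>_def)
    show "(\<integral>\<^sup>+y. ennreal ((h l j y / \<theta> l j) powr ps j y) \<partial>lebesgue) \<le> 1" for l j
      using \<delta>(2)[of j] \<Theta>(2)[of j] by (cases "j = l") (simp_all add: h_def \<theta>_def var_modular_def)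
    show "(\<Prod>j\<in>UNIV. \<theta> l j) = \<delta> * \<Theta> ^ (CARD('m) - 1)" for l
    proof -
      have "(\<Prod>j\<in>UNIV. \<theta> l j) = \<theta> l l * (\<Prod>j\<in>UNIV - {l}. \<theta> l j)" by (rule prod.remove) auto
      also have "(\<Prod>j\<in>UNIV - {l}. \<theta> l j) = (\<Prod>j\<in>UNIV - {l}. \<Theta>)" by (intro prod.cong) (auto simp: \<theta>_def)
      finally show ?thesis by (simp add: \<theta>_def card_Diff_singleton)
    qed
    show "ennreal (norm (G x)) \<le> (\<integral>\<^sup>+y. ennreal (norm (K x y * ((\<Sum>i\<in>UNIV. b i x - b i (y $ i)) * D y))) \<partial>lebesgue)" for x
      unfolding G_def by (rule ennreal_norm_integral_le)
  qed simp
  moreover have "var_modular q (\<lambda>x. comm_kernel_integral K b F x - comm_kernel_integral K b f x) \<eta> = var_modular q G \<eta>" for \<eta>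
    unfolding var_modular_def
  proof (rule nn_integral_cong_AE)
    have "\<exists>\<eta>. 0 < \<eta> \<and> var_modular (ps j) (f j) \<eta> \<le> 1" for j
      by (rule var_Lp_space_modular_le_one[OF f ps_measurable ps_ge_1, of j]) blast
    then obtain \<eta>1 where \<eta>1: "\<And>j. 0 < \<eta>1 j" "\<And>j. var_modular (ps j) (f j) (\<eta>1 j) \<le> 1" by metis
    have "\<exists>\<eta>. 0 < \<eta> \<and> var_modular (ps j) (F j) \<eta> \<le> 1" for j
      by (rule var_Lp_space_modular_le_one[OF F ps_measurable ps_ge_1, of j]) blast
    then obtain \<eta>2 where \<eta>2: "\<And>j. 0 < \<eta>2 j" "\<And>j. var_modular (ps j) (F j) (\<eta>2 j) \<le> 1" by metis
    have If: "AE x in lebesgue. integrable lebesgue (\<lambda>y. K x y * ((\<Sum>i\<in>UNIV. b i x - b i (y $ i)) * (\<Prod>j\<in>UNIV. f j (y $ j))))"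
      by (rule comm_kernel_integral_bound(2)[OF b \<beta> fm \<eta>1])
    have IF: "AE x in lebesgue. integrable lebesgue (\<lambda>y. K x y * ((\<Sum>i\<in>UNIV. b i x - b i (y $ i)) * (\<Prod>j\<in>UNIV. F j (y $ j))))"
      by (rule comm_kernel_integral_bound(2)[OF b \<beta> Fm \<eta>2])
    show "AE x in lebesgue. ennreal ((norm (comm_kernel_integral K b F x - comm_kernel_integral K b f x) / \<eta>) powr q x)
      = ennreal ((norm (G x) / \<eta>) powr q x)"
      using If IF
    proof eventually_elim
      case (elim x)
      have "comm_kernel_integral K b F x - comm_kernel_integral K b f x = G x"
        unfolding comm_kernel_integral_def G_def D_def
        by (subst Bochner_Integration.integral_diff[OF elim(2,1), symmetric]) (simp add: right_diff_distrib)
      then show ?case by simp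
    qed
  qed
  ultimately show ?thesis by (simp add: C3_def mult.assoc)
qed

text \<open>Norms are infima over positive scales and may vanish, so every norm is first enlarged by
  e > 0, which makes the modulars at most 1; then e tends to 0.\<close>

lemma comm_kernel_integral_in_space:
  assumes b: "\<And>i. b i \<in> BMO" and f: "\<And>j. f j \<in> var_Lp_space (ps j)"
  shows "comm_kernel_integral K b f \<in> var_Lp_space q"
    and "var_Lp_norm q (comm_kernel_integral K b f) \<le> C2 * BMO_tuple_norm b * (\<Prod>j\<in>UNIV. var_Lp_norm (ps j) (f j))"
proof -
  have fm: "f j \<in> borel_measurable lebesgue" for j using f[of j] by (auto simp: var_Lp_space_def)
  have bm: "b i \<in> borel_measurable lebesgue" for i using b[of i] by (simp add: BMO_def loc_measurable)
  have bt: "BMO_norm (b i) \<le> BMO_tuple_norm b" for i unfolding BMO_tuple_norm_def by (rule Max_ge) auto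
  have bt0: "0 \<le> BMO_tuple_norm b" using BMO_norm_nonneg[OF b] bt[of undefined] by (rule order_trans)
  define N where "N j = var_Lp_norm (ps j) (f j)" for j
  have N0: "0 \<le> N j" for j
    unfolding N_def by (rule var_Lp_norm_nonneg) (rule var_Lp_space_modular_le_one[OF f ps_measurable ps_ge_1, of j], blast)
  have mod: "var_modular q (comm_kernel_integral K b f) (C2 * (BMO_tuple_norm b + e) * (\<Prod>j\<in>UNIV. N j + e)) \<le> 1" if e: "0 < e" for e
  proof (rule comm_kernel_integral_bound(1)[OF b _ _ fm])
    show "0 < BMO_tuple_norm b + e" using bt0 e by simp
    show "BMO_norm (b i) \<le> BMO_tuple_norm b + e" for i using bt[of i] e by simp
    show "0 < N j + e" for j using N0[of j] e by simp
    show "var_modular (ps j) (f j) (N j + e) \<le> 1" for j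
      by (rule var_Lp_norm_less_modular[OF f ps_measurable ps_ge_1]) (use e in \<open>simp add: N_def\<close>)
  qed
  have pos: "0 < C2 * (BMO_tuple_norm b + e) * (\<Prod>j\<in>UNIV. N j + e)" if "0 < e" for e
    using that C2_pos bt0 N0 by (intro mult_pos_pos prod_pos) (auto intro: add_nonneg_pos)
  have "var_modular q (comm_kernel_integral K b f) (C2 * (BMO_tuple_norm b + 1) * (\<Prod>j\<in>UNIV. N j + 1)) < \<infinity>"
    using mod[of 1] by (rule le_less_trans) auto
  then show "comm_kernel_integral K b f \<in> var_Lp_space q"
    unfolding var_Lp_space_def using pos[of 1] comm_kernel_integral_measurable[OF K_loc fm bm] by auto
  have lim: "((\<lambda>e. C2 * (BMO_tuple_norm b + e) * (\<Prod>j\<in>UNIV. N j + e)) \<longlongrightarrow> C2 * (BMO_tuple_norm b + 0) * (\<Prod>j\<in>UNIV. N j + 0)) (at_right 0)"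
    by (intro tendsto_intros)
  have "var_Lp_norm q (comm_kernel_integral K b f) \<le> C2 * (BMO_tuple_norm b + 0) * (\<Prod>j\<in>UNIV. N j + 0)"
  proof (rule tendsto_lowerbound[OF lim])
    show "\<forall>\<^sub>F e in at_right 0. var_Lp_norm q (comm_kernel_integral K b f) \<le> C2 * (BMO_tuple_norm b + e) * (\<Prod>j\<in>UNIV. N j + e)"
      unfolding eventually_at_right_field
      by (intro exI[of _ 1] conjI allI impI var_Lp_norm_le pos mod) auto
  qed simp
  then show "var_Lp_norm q (comm_kernel_integral K b f) \<le> C2 * BMO_tuple_norm b * (\<Prod>j\<in>UNIV. var_Lp_norm (ps j) (f j))"
    by (simp add: N_def)
qed

lemma comm_kernel_integral_continuous:
  fixes F :: "nat \<Rightarrow> 'm \<Rightarrow> 'n cfun"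
  assumes b: "\<And>i. b i \<in> BMO" and F: "\<And>k j. F k j \<in> var_Lp_space (ps j)" and f: "\<And>j. f j \<in> var_Lp_space (ps j)"
    and lim: "\<And>j. (\<lambda>k. var_Lp_norm (ps j) (\<lambda>x. F k j x - f j x)) \<longlonglongrightarrow> 0"
  shows "(\<lambda>k. var_Lp_norm q (\<lambda>x. comm_kernel_integral K b (F k) x - comm_kernel_integral K b f x)) \<longlonglongrightarrow> 0"
proof -
  have fm[measurable]: "f j \<in> borel_measurable lebesgue" and Fm[measurable]: "F k j \<in> borel_measurable lebesgue" for k j
    using f[of j] F[of k j] by (auto simp: var_Lp_space_def)
  define \<beta> where "\<beta> = BMO_tuple_norm b + 1"
  have bt: "BMO_norm (b i) \<le> BMO_tuple_norm b" for i unfolding BMO_tuple_norm_def by (rule Max_ge) auto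
  have \<beta>: "0 < \<beta>" "\<And>i. BMO_norm (b i) \<le> \<beta>"
  proof -
    have "0 \<le> BMO_tuple_norm b" using BMO_norm_nonneg[OF b] bt[of undefined] by (rule order_trans)
    then show "0 < \<beta>" by (simp add: \<beta>_def)
    show "BMO_norm (b i) \<le> \<beta>" for i using bt[of i] by (simp add: \<beta>_def)
  qed
  \<comment> \<open>Strictly above every norm of the limit tuple, so that each modular at scale
    \<open>M\<close> is at most 1.\<close>
  define M where "M = 1 + (\<Sum>j\<in>UNIV. \<bar>var_Lp_norm (ps j) (f j)\<bar>)"
  have M: "0 < M" "var_Lp_norm (ps j) (f j) < M" for j
  proof -
    have "\<bar>var_Lp_norm (ps j) (f j)\<bar> \<le> (\<Sum>j\<in>UNIV. \<bar>var_Lp_norm (ps j) (f j)\<bar>)" by (rule member_le_sum) auto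
    then show "0 < M" "var_Lp_norm (ps j) (f j) < M" unfolding M_def by linarith+
  qed
  \<comment> \<open>From |F| + |f| \<le> |F - f| + 2 |f|, where both terms have modular at most 1 at
    scale 2 M; adding two such terms costs a factor 4, whence 8 M.\<close>
  define c where "c = C3 * \<beta> * (8 * M) ^ (CARD('m) - 1)"
  have c: "0 < c" unfolding c_def using C3_pos \<beta> M by simp
  show ?thesis
  proof (rule LIMSEQ_I)
    fix r :: real assume r: "0 < r"
    define \<delta> where "\<delta> = min M (r / (2 * c))"
    have \<delta>: "0 < \<delta>" "\<delta> \<le> M" "c * \<delta> < r"
    proof -
      show "0 < \<delta>" "\<delta> \<le> M" using M r c by (auto simp: \<delta>_def)
      have "c * \<delta> \<le> c * (r / (2 * c))" using c by (intro mult_left_mono) (auto simp: \<delta>_def)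
      also have "\<dots> = r / 2" using c by simp
      finally show "c * \<delta> < r" using r by linarith
    qed
    have "\<forall>\<^sub>F k in sequentially. \<forall>j. var_Lp_norm (ps j) (\<lambda>x. F k j x - f j x) < \<delta>"
      using order_tendstoD(2)[OF lim \<delta>(1)] by (simp add: eventually_all_finite)
    then obtain k0 where k0: "\<And>k j. k0 \<le> k \<Longrightarrow> var_Lp_norm (ps j) (\<lambda>x. F k j x - f j x) < \<delta>"
      unfolding eventually_sequentially by blast
    show "\<exists>no. \<forall>k\<ge>no. norm (var_Lp_norm q (\<lambda>x. comm_kernel_integral K b (F k) x - comm_kernel_integral K b f x) - 0) < r"
    proof (intro exI[of _ k0] allI impI)
      fix k assume k: "k0 \<le> k"
      have mod\<delta>: "var_modular (ps j) (\<lambda>x. F k j x - f j x) \<delta> \<le> 1" for j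
        by (rule var_Lp_norm_less_modular[OF var_Lp_space_diff[OF F f ps_measurable ps_ge_1] ps_measurable ps_ge_1 k0[OF k]])
      have modM: "(\<integral>\<^sup>+x. ennreal (((norm (F k j x) + norm (f j x)) / (8 * M)) powr ps j x) \<partial>lebesgue) \<le> 1" for j
      proof -
        have p0: "0 \<le> ps j x" for x using ps_ge_1[of j x] by linarith
        note [measurable] = ps_measurable[of j]
        have 1: "(\<integral>\<^sup>+x. ennreal ((norm (F k j x - f j x) / (2 * M)) powr ps j x) \<partial>lebesgue) \<le> 1"
          using var_modular_mono_scale[where q="ps j" and \<eta>'="2 * M" and f="\<lambda>x. F k j x - f j x", OF p0 \<delta>(1)] mod\<delta>[of j] \<delta> M
          unfolding var_modular_def by auto
        have 2: "(\<integral>\<^sup>+x. ennreal ((2 * norm (f j x) / (2 * M)) powr ps j x) \<partial>lebesgue) \<le> 1"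
          using var_Lp_norm_less_modular[OF f ps_measurable ps_ge_1 M(2), of j] unfolding var_modular_def by simp
        have "(\<integral>\<^sup>+x. ennreal (((norm (F k j x - f j x) + 2 * norm (f j x)) / (4 * (2 * M))) powr ps j x) \<partial>lebesgue) \<le> 1"
          by (rule modular_add_le_one[OF _ _ ps_measurable _ _ ps_ge_1 _ 1 2]) (use M in auto)
        moreover have "(\<integral>\<^sup>+x. ennreal (((norm (F k j x) + norm (f j x)) / (8 * M)) powr ps j x) \<partial>lebesgue)
          \<le> (\<integral>\<^sup>+x. ennreal (((norm (F k j x - f j x) + 2 * norm (f j x)) / (4 * (2 * M))) powr ps j x) \<partial>lebesgue)"
        proof (intro nn_integral_mono ennreal_leI powr_mono2 p0)
          fix x
          have "norm (F k j x) \<le> norm (F k j x - f j x) + norm (f j x)"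
            using norm_triangle_ineq[of "F k j x - f j x" "f j x"] by simp
          then show "(norm (F k j x) + norm (f j x)) / (8 * M) \<le> (norm (F k j x - f j x) + 2 * norm (f j x)) / (4 * (2 * M))"
            using M by (simp add: divide_right_mono)
          show "0 \<le> (norm (F k j x) + norm (f j x)) / (8 * M)" using M by simp
        qed
        ultimately show ?thesis by (rule order_trans[rotated])
      qed
      have "0 < 8 * M" using M by simp
      from comm_kernel_integral_diff[OF b \<beta> f F \<delta>(1) mod\<delta> this modM]
      have mod: "var_modular q (\<lambda>x. comm_kernel_integral K b (F k) x - comm_kernel_integral K b f x) (c * \<delta>) \<le> 1"
        by (simp add: c_def mult_ac)
      have "0 < c * \<delta>" using c \<delta> by simp
      from var_Lp_norm_le[OF this mod] var_Lp_norm_nonneg[of q] mod this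
      show "norm (var_Lp_norm q (\<lambda>x. comm_kernel_integral K b (F k) x - comm_kernel_integral K b f x) - 0) < r"
        using \<delta>(3) by fastforce
    qed
  qed
qed

end

section \<open>The operator is given by its kernel almost everywhere\<close>

text \<open>If D x > 0, then for all large N the term \<open>a N x\<close> exceeds some fixed 1/k,
  because \<open>c N x\<close> becomes smaller than D x / 2. So x lies in an intersection of sets
  whose measures tend to 0, and countably many such intersections suffice.\<close>

lemma AE_zero_if_small_in_measure:
  fixes D :: "'a::euclidean_space \<Rightarrow> real"
  assumes D: "AE x in lebesgue. 0 \<le> D x \<and> (\<forall>N. D x \<le> a N x + c N x)"
    and c: "AE x in lebesgue. (\<lambda>N. c N x) \<longlonglongrightarrow> 0"
    and a: "\<And>t N. 0 < t \<Longrightarrow> {x. t < a N x} \<in> sets lebesgue"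
    and lim: "\<And>t. 0 < t \<Longrightarrow> (\<lambda>N. emeasure lebesgue {x. t < a N x}) \<longlonglongrightarrow> 0"
  shows "AE x in lebesgue. D x = 0"
proof -
  have small: "AE x in lebesgue. \<not> (\<forall>N\<ge>N0. t < a N x)" if t: "0 < t" for t and N0 :: nat
  proof -
    define B where "B = (\<Inter>N\<in>{N0..}. {x. t < a N x})"
    have B: "B \<in> sets lebesgue" unfolding B_def using a[OF t] by (intro sets.countable_INT'') auto
    have "emeasure lebesgue B \<le> 0"
    proof (rule LIMSEQ_le_const[OF lim[OF t]])
      show "\<exists>N. \<forall>n\<ge>N. emeasure lebesgue B \<le> emeasure lebesgue {x. t < a n x}"
        by (intro exI[of _ N0] allI impI emeasure_mono a t) (auto simp: B_def)
    qed
    then have "B \<in> null_sets lebesgue" using B by (auto intro: null_setsI)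
    from AE_not_in[OF this] show ?thesis by eventually_elim (auto simp: B_def)
  qed
  have "AE x in lebesgue. \<forall>k N0. \<not> (\<forall>N\<ge>N0. 1 / real (Suc k) < a N x)"
    unfolding AE_all_countable by (intro allI small) simp
  with D c show ?thesis
  proof eventually_elim
    case (elim x)
    show ?case
    proof (rule ccontr)
      assume "D x \<noteq> 0"
      then have "0 < D x / 2" using elim(1) by simp
      then obtain k where k: "inverse (real (Suc k)) < D x / 2" by (rule reals_Archimedean[THEN exE])
      from LIMSEQ_D[OF elim(2) \<open>0 < D x / 2\<close>]
      obtain N0 where N0: "\<And>N. N0 \<le> N \<Longrightarrow> norm (c N x - 0) < D x / 2" by blast
      have "1 / real (Suc k) < a N x" if "N0 \<le> N" for N
      proof -
        have "D x \<le> a N x + c N x" using elim(1) by blast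
        moreover have "c N x < D x / 2" using N0[OF that] by simp
        ultimately show ?thesis using k by (simp add: inverse_eq_divide)
      qed
      then show False using elim(3) by blast
    qed
  qed
qed

lemma supp_mono:
  assumes "\<And>x. f x = 0 \<Longrightarrow> g x = 0"
  shows "supp g \<subseteq> supp f"
  unfolding supp_def using assms by (intro closure_mono) auto

lemma Linf_c_multiply:
  assumes f: "f \<in> Linf_c" and g: "g \<in> borel_measurable lebesgue" "\<And>x. norm (g x) \<le> M"
  shows "(\<lambda>x. g x * f x) \<in> Linf_c"
proof -
  obtain M' where M': "\<And>x. norm (f x) \<le> M'" using f by (auto simp: Linf_c_def)
  have fm[measurable]: "f \<in> borel_measurable lebesgue" using f by (simp add: Linf_c_def)
  note g(1)[measurable]
  have "compact (supp (\<lambda>x. g x * f x))"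
  proof -
    have "compact (supp f \<inter> supp (\<lambda>x. g x * f x))"
      by (rule compact_Int_closed) (use f in \<open>simp_all add: Linf_c_def supp_def\<close>)
    moreover have "supp (\<lambda>x. g x * f x) \<subseteq> supp f" by (rule supp_mono) simp
    ultimately show ?thesis by (simp add: Int_absorb1)
  qed
  moreover have "norm (g x * f x) \<le> M * M'" for x
    unfolding norm_mult by (intro mult_mono g M' order_trans[OF norm_ge_zero g(2)]) auto
  ultimately show ?thesis by (auto simp: Linf_c_def)
qed

lemma Linf_c_bounded_support:
  assumes f: "f \<in> Linf_c"
  obtains M R where "0 < M" "0 < R" "\<And>x. norm (f x) \<le> M" "\<And>x. f x \<noteq> 0 \<Longrightarrow> x \<in> cube (0 :: real^'n::finite) R"
proof -
  obtain M where M: "\<And>x. norm (f x) \<le> M" using f by (auto simp: Linf_c_def)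
  have "bounded (supp f)" using f by (simp add: Linf_c_def compact_imp_bounded)
  then obtain R where R: "\<And>x. x \<in> supp f \<Longrightarrow> norm x \<le> R" by (auto simp: bounded_iff)
  show thesis
  proof (rule that[of "max M 1" "2 * max R 1"])
    show "norm (f x) \<le> max M 1" for x using M[of x] by simp
    fix x assume "f x \<noteq> 0"
    then have "x \<in> supp f" unfolding supp_def by (intro subsetD[OF closure_subset]) simp
    then have "norm x \<le> max R 1" using R by fastforce
    then show "x \<in> cube 0 (2 * max R 1)" using cball_subset_cube[of 0 "max R 1"] by auto
  qed auto
qed

text \<open>On the support |b| powr e x \<le> 1 + |b| powr E, which leaves a constant exponent.
  Allowing e to vary serves the constant exponents of the weak type bound and the variable ones
  alike.\<close>

lemma nn_integral_BMO_Linf_c_finite: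
  fixes f b :: "'n::finite cfun"
  assumes f: "f \<in> Linf_c" and b: "b \<in> BMO" and e: "\<And>x. 1 \<le> e x" "\<And>x. e x \<le> E"
  shows "(\<integral>\<^sup>+x. ennreal (norm (b x * f x) powr e x) \<partial>lebesgue) < \<infinity>"
proof -
  obtain M R where M: "0 < M" "0 < R" "\<And>x. norm (f x) \<le> M" "\<And>x. f x \<noteq> 0 \<Longrightarrow> x \<in> cube (0 :: real^'n) R"
    using Linf_c_bounded_support[OF f] by blast
  have E: "1 \<le> E" using e[of undefined] by linarith
  have [measurable]: "b \<in> borel_measurable lebesgue" using b by (simp add: BMO_def loc_measurable)
  define M' where "M' = max 1 M powr E"
  have "(\<integral>\<^sup>+x. ennreal (norm (b x * f x) powr e x) \<partial>lebesgue)
    \<le> (\<integral>\<^sup>+x. ennreal M' * (indicator (cube 0 R) x + ennreal (norm (b x) powr E) * indicator (cube 0 R) x) \<partial>lebesgue)"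
  proof (intro nn_integral_mono)
    fix x :: "real^'n"
    show "ennreal (norm (b x * f x) powr e x) \<le> ennreal M' * (indicator (cube 0 R) x + ennreal (norm (b x) powr E) * indicator (cube 0 R) x)"
    proof (cases "f x = 0")
      case False
      then have x: "x \<in> cube 0 R" by (rule M(4))
      have "norm (f x) powr e x \<le> max 1 M powr e x" using M(3)[of x] e(1)[of x] by (intro powr_mono2) auto
      also have "\<dots> \<le> M'" unfolding M'_def using e(2)[of x] by (intro powr_mono) auto
      finally have 1: "norm (f x) powr e x \<le> M'" .
      have 2: "norm (b x) powr e x \<le> 1 + norm (b x) powr E"
      proof (cases "norm (b x) \<le> 1")
        case True
        then have "norm (b x) powr e x \<le> 1" using e(1)[of x] by (intro powr_le1) auto
        then show ?thesis by (simp add: add_increasing2)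
      next
        case False
        then have "norm (b x) powr e x \<le> norm (b x) powr E" using e(2)[of x] by (intro powr_mono) auto
        then show ?thesis by simp
      qed
      have "norm (b x * f x) powr e x = norm (b x) powr e x * norm (f x) powr e x"
        by (simp add: norm_mult powr_mult)
      also have "\<dots> \<le> (1 + norm (b x) powr E) * M'" using 1 2 by (intro mult_mono) auto
      finally have "ennreal (norm (b x * f x) powr e x) \<le> ennreal (M' * (1 + norm (b x) powr E))"
        by (intro ennreal_leI) (simp add: mult.commute)
      also have "\<dots> = ennreal M' * (1 + ennreal (norm (b x) powr E))"
        by (subst ennreal_mult) (auto simp: M'_def)
      finally show ?thesis using x by simp
    qed (use e(1)[of x] in simp)
  qed
  also have "\<dots> = ennreal M' * (emeasure lebesgue (cube (0 :: real^'n) R) + (\<integral>\<^sup>+x\<in>cube 0 R. ennreal (norm (b x) powr E) \<partial>lebesgue))"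
    by (subst nn_integral_cmult) (auto simp: nn_integral_add)
  also have "\<dots> < \<infinity>"
  proof -
    have "emeasure lebesgue (cube (0 :: real^'n) R) < \<infinity>"
      using emeasure_cube_lebesgue[of R "0 :: real^'n"] M(2) by simp
    then have "emeasure lebesgue (cube (0 :: real^'n) R) + (\<integral>\<^sup>+x\<in>cube 0 R. ennreal (norm (b x) powr E) \<partial>lebesgue) < \<infinity>"
      using BMO_powr_locally_integrable[OF b E M(2), of 0] unfolding infinity_ennreal_def ennreal_add_less_top by blast
    then show ?thesis by (simp add: ennreal_mult_less_top)
  qed
  finally show ?thesis .
qed

text \<open>Lets the facts about b times f be specialized to f alone.\<close>

lemma one_in_BMO: "(\<lambda>_. 1) \<in> (BMO :: 'n::finite cfun set)"
proof -
  have "mean_osc (\<lambda>_. 1) (cube x r) = 0" if "0 < r" for x :: "real^'n" and r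
  proof -
    have "(LINT y:cube x r|lebesgue. (1::complex)) = of_real (measure lebesgue (cube x r))"
      using emeasure_compact_finite[OF compact_cube, of x r] by (subst set_integral_const) (auto simp: scaleR_conv_of_real)
    moreover have "measure lebesgue (cube x r) = r ^ CARD('n)" by (rule measure_cube) (use that in simp)
    ultimately have "average (\<lambda>_. 1) (cube x r) = 1" using that unfolding average_def by simp
    then show ?thesis by (simp add: mean_osc_def)
  qed
  then have "bdd_above ((\<lambda>(x :: real^'n, r). mean_osc (\<lambda>_. 1) (cube x r)) ` (UNIV \<times> {0<..}))"
    by (intro bdd_aboveI[of _ 0]) auto
  moreover have "(\<lambda>_. 1 :: complex) locally_integrable_on (UNIV :: (real^'n) set)"
    unfolding locally_integrable_on_def set_integrable_def
  proof (intro allI impI)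
    fix S :: "(real^'n) set" assume "compact S \<and> S \<subseteq> UNIV"
    then have "compact S" by simp
    then have "S \<in> sets lebesgue" "emeasure lebesgue S < \<infinity>"
      using emeasure_compact_finite by (auto simp: compact_imp_closed borel_closed)
    then show "integrable lebesgue (\<lambda>x. indicat_real S x *\<^sub>R (1 :: complex))"
      by (intro integrable_scaleR_left) (auto simp: integrable_indicator_iff)
  qed
  ultimately show ?thesis by (simp add: BMO_def)
qed

lemma Linf_c_in_Lp_space:
  assumes "f \<in> Linf_c" "b \<in> BMO" "1 \<le> s"
  shows "(\<lambda>x. b x * f x) \<in> Lp_space s"
proof -
  have [measurable]: "f \<in> borel_measurable lebesgue" "b \<in> borel_measurable lebesgue"
    using assms by (simp_all add: Linf_c_def BMO_def loc_measurable)
  have "integrable lebesgue (\<lambda>x. norm (b x * f x) powr s)"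
    using nn_integral_BMO_Linf_c_finite[OF assms(1,2), of "\<lambda>_. s" s] assms(3)
    by (intro integrableI_nonneg) auto
  then show ?thesis by (simp add: Lp_space_def)
qed

lemma BMO_times_Linf_c_in_var_Lp_space:
  assumes "f \<in> Linf_c" "b \<in> BMO" "\<And>x. 1 \<le> p x" "\<And>x. p x \<le> P"
  shows "(\<lambda>x. b x * f x) \<in> var_Lp_space p"
proof -
  have [measurable]: "f \<in> borel_measurable lebesgue" "b \<in> borel_measurable lebesgue"
    using assms by (simp_all add: Linf_c_def BMO_def loc_measurable)
  have "var_modular p (\<lambda>x. b x * f x) 1 < \<infinity>"
    unfolding var_modular_def using nn_integral_BMO_Linf_c_finite[OF assms(1,2), of p P] assms(3,4) by simp
  then show ?thesis unfolding var_Lp_space_def by (intro CollectI conjI exI[of _ 1]) auto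
qed

section \<open>Localization of the operator to dyadic cells\<close>

text \<open>With 1/s the sum of the 1/sj, \<open>r_gt\<close> says r > s: the target of the weak
  type bound is strictly better than the one Hoelder scaling gives. This strict gain makes the
  contributions of small cells vanish.\<close>

locale fractional_operator = fractional_kernel K A \<alpha> \<alpha>i ps pm pM q
  for K :: "real^'n::finite \<Rightarrow> real^'n^'m::finite \<Rightarrow> complex" and A \<alpha> \<alpha>i ps pm pM q +
  fixes Te :: "('m \<Rightarrow> 'n cfun) \<Rightarrow> 'n cfun" and sj :: "'m \<Rightarrow> real" and r B :: real
  assumes sj: "\<And>j. 1 \<le> sj j" and r_pos: "0 < r" and r_gt: "1 < r * (\<Sum>j\<in>UNIV. 1 / sj j)"
    and Te_multilinear: "multilinear_on eq_ae (\<lambda>j. Lp_space (sj j)) Te"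
    and Te_weak: "\<And>f. (\<And>j. f j \<in> Lp_space (sj j)) \<Longrightarrow>
        Te f \<in> weak_Lp_space r \<and> weak_Lp_norm r (Te f) \<le> B * (\<Prod>j\<in>UNIV. Lp_norm (sj j) (f j))"
    and Te_kernel: "kernel_formula Te K"
begin

lemma Te_add:
  assumes "\<And>j. f j \<in> Lp_space (sj j)" "u \<in> Lp_space (sj k)" "v \<in> Lp_space (sj k)"
  shows "AE x in lebesgue. Te (f(k := \<lambda>x. u x + v x)) x = Te (f(k := u)) x + Te (f(k := v)) x"
proof -
  have "(Te (f(k := \<lambda>x. 1 * u x + 1 * v x)), \<lambda>z. 1 * Te (f(k := u)) z + 1 * Te (f(k := v)) z) \<in> eq_ae"
    using Te_multilinear assms unfolding multilinear_on_def by blast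
  then show ?thesis by (simp add: eq_ae_def)
qed

lemma Te_measurable:
  assumes "\<And>j. f j \<in> Lp_space (sj j)"
  shows "Te f \<in> borel_measurable lebesgue"
  using Te_weak[OF assms] by (auto simp: weak_Lp_space_def)

lemma Te_weak_estimate:
  assumes f: "\<And>j. f j \<in> Lp_space (sj j)" and t: "0 < t"
  shows "emeasure lebesgue {x. t < norm (Te f x)} \<le> ennreal ((\<bar>B\<bar> * (\<Prod>j\<in>UNIV. Lp_norm (sj j) (f j)) / t) powr r)"
proof -
  define \<mu> where "\<mu> = measure lebesgue {x. t < norm (Te f x)}"
  define P where "P = \<bar>B\<bar> * (\<Prod>j\<in>UNIV. Lp_norm (sj j) (f j))"
  have w: "Te f \<in> weak_Lp_space r" "weak_Lp_norm r (Te f) \<le> B * (\<Prod>j\<in>UNIV. Lp_norm (sj j) (f j))"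
    using Te_weak[OF f] by auto
  have P0: "0 \<le> (\<Prod>j\<in>UNIV. Lp_norm (sj j) (f j))" by (intro prod_nonneg) (simp add: Lp_norm_def)
  have "t * \<mu> powr (1 / r) \<le> weak_Lp_norm r (Te f)"
    unfolding weak_Lp_norm_def \<mu>_def using w(1) t by (intro cSUP_upper) (auto simp: weak_Lp_space_def)
  also have "\<dots> \<le> P" unfolding P_def using w(2) P0 by (intro order_trans[OF w(2)] mult_right_mono) auto
  finally have "\<mu> powr (1 / r) \<le> P / t" using t by (simp add: le_divide_eq mult.commute)
  then have "(\<mu> powr (1 / r)) powr r \<le> (P / t) powr r" using r_pos by (intro powr_mono2) auto
  then have "\<mu> \<le> (P / t) powr r" using r_pos by (simp add: powr_powr \<mu>_def)
  moreover have "emeasure lebesgue {x. t < norm (Te f x)} = ennreal \<mu>"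
    using w(1) t unfolding \<mu>_def weak_Lp_space_def by (intro emeasure_eq_ennreal_measure) (auto simp: fmeasurable_def)
  ultimately show ?thesis by (simp add: P_def ennreal_leI)
qed

lemma ps_le: "ps j x \<le> pM j"
  using ps_bounds[of j x] by simp

lemma kernel_integral_integrable_space:
  assumes "\<And>j. f j \<in> var_Lp_space (ps j)"
  shows "AE x in lebesgue. integrable lebesgue (\<lambda>y. K x y * (\<Prod>j\<in>UNIV. f j (y $ j)))"
proof -
  have "\<exists>\<eta>. 0 < \<eta> \<and> var_modular (ps j) (f j) \<eta> \<le> 1" for j
    by (rule var_Lp_space_modular_le_one[OF assms ps_measurable ps_ge_1, of j]) blast
  then obtain \<eta> where \<eta>: "\<And>j. 0 < \<eta> j" "\<And>j. var_modular (ps j) (f j) (\<eta> j) \<le> 1" by metis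
  have "f j \<in> borel_measurable lebesgue" for j using assms[of j] by (simp add: var_Lp_space_def)
  then show ?thesis by (rule kernel_integral_integrable[OF _ \<eta>])
qed

lemma kernel_integral_add:
  assumes "\<And>j. f j \<in> var_Lp_space (ps j)" "u \<in> var_Lp_space (ps k)" "v \<in> var_Lp_space (ps k)"
  shows "AE x in lebesgue. kernel_integral K (f(k := \<lambda>x. u x + v x)) x
    = kernel_integral K (f(k := u)) x + kernel_integral K (f(k := v)) x"
proof -
  have "AE x in lebesgue. integrable lebesgue (\<lambda>y. K x y * (\<Prod>j\<in>UNIV. (f(k := u)) j (y $ j)))"
    by (rule kernel_integral_integrable_space) (use assms in auto)
  moreover have "AE x in lebesgue. integrable lebesgue (\<lambda>y. K x y * (\<Prod>j\<in>UNIV. (f(k := v)) j (y $ j)))"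
    by (rule kernel_integral_integrable_space) (use assms in auto)
  ultimately show ?thesis
  proof eventually_elim
    case (elim x)
    have rem: "(\<Prod>j\<in>UNIV. (f(k := w)) j (y $ j)) = w (y $ k) * (\<Prod>j\<in>UNIV - {k}. f j (y $ j))" for w y
    proof -
      have "(\<Prod>j\<in>UNIV. (f(k := w)) j (y $ j)) = (f(k := w)) k (y $ k) * (\<Prod>j\<in>UNIV - {k}. (f(k := w)) j (y $ j))"
        by (rule prod.remove) auto
      also have "(\<Prod>j\<in>UNIV - {k}. (f(k := w)) j (y $ j)) = (\<Prod>j\<in>UNIV - {k}. f j (y $ j))"
        by (intro prod.cong) auto
      finally show ?thesis by simp
    qed
    show ?case
      unfolding kernel_integral_def Bochner_Integration.integral_add[OF elim, symmetric]
      by (simp only: rem distrib_left distrib_right)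
  qed
qed

lemma Linf_c_var_Lp_space: "f \<in> Linf_c \<Longrightarrow> f \<in> var_Lp_space (ps j)"
  using BMO_times_Linf_c_in_var_Lp_space[OF _ one_in_BMO, of f "ps j" "pM j"] ps_ge_1 ps_le by simp

lemma Linf_c_Lp_space: "f \<in> Linf_c \<Longrightarrow> f \<in> Lp_space (sj j)"
  using Linf_c_in_Lp_space[OF _ one_in_BMO, of f "sj j"] sj by simp

text \<open>Half-open by the floor function, so that the cells of one generation partition the
  space, in contrast to the closed cubes used elsewhere.\<close>

definition cell :: "nat \<Rightarrow> ('n \<Rightarrow> int) \<Rightarrow> (real^'n) set" where
  "cell N z = {x. \<forall>i. \<lfloor>2 ^ N * x $ i\<rfloor> = z i}"

definition index :: "nat \<Rightarrow> real^'n \<Rightarrow> 'n \<Rightarrow> int" where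
  "index N x i = \<lfloor>2 ^ N * x $ i\<rfloor>"

lemma cell_iff: "x \<in> cell N z \<longleftrightarrow> z = index N x"
  by (auto simp: cell_def index_def fun_eq_iff)

lemma cell_sets [measurable]: "cell N z \<in> sets borel" "cell N z \<in> sets lebesgue"
proof -
  have "cell N z = (\<Inter>i. {x. \<lfloor>2 ^ N * x $ i\<rfloor> = z i})" by (auto simp: cell_def)
  also have "\<dots> \<in> sets borel" by measurable
  finally show "cell N z \<in> sets borel" .
  then show "cell N z \<in> sets lebesgue" by simp
qed

lemma cell_subset_cube: "cell N z \<subseteq> cube (\<chi> i. (real_of_int (z i) + 1/2) / 2 ^ N) (1 / 2 ^ N)"
proof
  fix x assume x: "x \<in> cell N z"
  have "\<bar>x $ i - (real_of_int (z i) + 1/2) / 2 ^ N\<bar> \<le> 1 / 2 ^ N / 2" for i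
  proof -
    have "\<lfloor>2 ^ N * x $ i\<rfloor> = z i" using x by (simp add: cell_def)
    then have "\<bar>2 ^ N * x $ i - (real_of_int (z i) + 1/2)\<bar> \<le> 1 / 2" by linarith
    then have "\<bar>2 ^ N * x $ i - (real_of_int (z i) + 1/2)\<bar> / 2 ^ N \<le> 1 / 2 / 2 ^ N"
      by (intro divide_right_mono) auto
    also have "\<bar>2 ^ N * x $ i - (real_of_int (z i) + 1/2)\<bar> / 2 ^ N = \<bar>(2 ^ N * x $ i - (real_of_int (z i) + 1/2)) / 2 ^ N\<bar>"
      by simp
    also have "(2 ^ N * x $ i - (real_of_int (z i) + 1/2)) / 2 ^ N = x $ i - (real_of_int (z i) + 1/2) / 2 ^ N"
      by (simp add: diff_divide_distrib)
    finally show ?thesis by simp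
  qed
  then show "x \<in> cube (\<chi> i. (real_of_int (z i) + 1/2) / 2 ^ N) (1 / 2 ^ N)" by (simp add: cube_def)
qed

definition restr :: "(real^'n) set \<Rightarrow> 'n cfun \<Rightarrow> 'n cfun" where
  "restr Q f x = (if x \<in> Q then f x else 0)"

lemma restr_Linf_c:
  assumes "f \<in> Linf_c" "Q \<in> sets lebesgue"
  shows "restr Q f \<in> Linf_c"
proof -
  have "restr Q f = (\<lambda>x. indicator Q x * f x)" by (auto simp: restr_def)
  then show ?thesis
    using Linf_c_multiply[OF assms(1), of "indicator Q" 1] assms(2) by (auto simp: indicator_def)
qed

text \<open>Almost every point avoids the countably many dyadic hyperplanes. A whole neighbourhood
  inside the cell is needed because supports are closures: vanishing on the cell alone does not keep
  a boundary point out of the support.\<close>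

lemma AE_cell_interior:
  "AE x in lebesgue. \<forall>N. \<exists>U. open U \<and> x \<in> U \<and> U \<subseteq> cell N (index N x)"
proof -
  have "AE x in lebesgue. \<forall>i. x $ i \<noteq> (\<chi> i. real_of_int k / 2 ^ N) $ i" for k N
    by (rule AE_off_hyperplanes)
  then have "AE x :: real^'n in lebesgue. \<forall>k :: int. \<forall>i. x $ i \<noteq> (\<chi> i. real_of_int k / 2 ^ N) $ i" for N
    by (subst AE_all_countable, intro allI)
  then have "AE x :: real^'n in lebesgue. \<forall>N k. \<forall>i. x $ i \<noteq> (\<chi> i. real_of_int k / 2 ^ N) $ i"
    by (subst AE_all_countable, intro allI)
  then show ?thesis
  proof eventually_elim
    case (elim x)
    show ?case
    proof
      fix N
      define U where "U = (\<Inter>i. {w :: real^'n. real_of_int (index N x i) < 2 ^ N * w $ i \<and> 2 ^ N * w $ i < real_of_int (index N x i) + 1})"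
      have "open U"
        unfolding U_def by (intro open_INT ballI open_Collect_conj open_Collect_less continuous_intros) auto
      moreover have "x \<in> U"
      proof -
        have "real_of_int (index N x i) < 2 ^ N * x $ i" for i
        proof -
          have "2 ^ N * x $ i \<noteq> real_of_int (index N x i)"
          proof
            assume "2 ^ N * x $ i = real_of_int (index N x i)"
            then have "x $ i = real_of_int (index N x i) / 2 ^ N" by (simp add: eq_divide_eq mult.commute)
            then show False using elim by (metis vec_lambda_beta)
          qed
          then show ?thesis unfolding index_def by linarith
        qed
        moreover have "2 ^ N * x $ i < real_of_int (index N x i) + 1" for i unfolding index_def by linarith
        ultimately show ?thesis by (auto simp: U_def)
      qed
      moreover have "U \<subseteq> cell N (index N x)"
      proof
        fix w assume w: "w \<in> U"
        have "\<lfloor>2 ^ N * w $ i\<rfloor> = index N x i" for i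
        proof (rule floor_unique)
          show "real_of_int (index N x i) \<le> 2 ^ N * w $ i" "2 ^ N * w $ i < real_of_int (index N x i) + 1"
            using w by (simp_all add: U_def less_imp_le)
        qed
        then show "w \<in> cell N (index N x)" by (simp add: cell_def)
      qed
      ultimately show "\<exists>U. open U \<and> x \<in> U \<and> U \<subseteq> cell N (index N x)" by blast
    qed
  qed
qed

lemma Te_kernel_bounded:
  assumes "\<And>j. f j \<in> Linf_c"
  shows "AE x in lebesgue. x \<notin> (\<Inter>j. supp (f j)) \<longrightarrow> Te f x = kernel_integral K f x"
  using Te_kernel assms unfolding kernel_formula_def kernel_formula_at_def by blast

text \<open>The entries are cut one at a time. Splitting the k-th entry into its parts on Q and off
  Q, the tuple with the part off Q has a k-th support missing every interior point of Q, so there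
  the kernel formula applies and its error is 0; additivity passes the whole error to the part on
  Q.\<close>

lemma Te_localize:
  assumes f: "\<And>j. f j \<in> Linf_c" and Q: "Q \<in> sets lebesgue"
  shows "AE x in lebesgue. (\<exists>U. open U \<and> x \<in> U \<and> U \<subseteq> Q) \<longrightarrow>
    Te f x - kernel_integral K f x = Te (\<lambda>j. restr Q (f j)) x - kernel_integral K (\<lambda>j. restr Q (f j)) x"
proof -
  define F where "F S j = (if j \<in> S then restr Q (f j) else f j)" for S j
  have F: "F S j \<in> Linf_c" for S j using f restr_Linf_c[OF f Q] by (simp add: F_def)
  have "AE x in lebesgue. (\<exists>U. open U \<and> x \<in> U \<and> U \<subseteq> Q) \<longrightarrow>
    Te f x - kernel_integral K f x = Te (F S) x - kernel_integral K (F S) x" if "finite S" for S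
    using that
  proof (induction S rule: finite_induct)
    case empty
    then show ?case by (simp add: F_def[abs_def])
  next
    case (insert k S)
    define v where "v = restr (- Q) (f k)"
    have v: "v \<in> Linf_c" unfolding v_def using sets.compl_sets[OF Q] by (intro restr_Linf_c f) (simp add: Compl_eq_Diff_UNIV)
    define u where "u = restr Q (f k)"
    have u: "u \<in> Linf_c" unfolding u_def by (intro restr_Linf_c f Q)
    have "(\<lambda>x. u x + v x) = f k" by (rule ext) (simp add: u_def v_def restr_def)
    moreover have "F S k = f k" using insert.hyps by (simp add: F_def)
    ultimately have fk: "(F S)(k := \<lambda>x. u x + v x) = F S" by (simp add: fun_upd_idem)
    have Fi: "F (insert k S) = (F S)(k := u)"
      by (rule ext) (simp add: F_def u_def)
    have 1: "AE x in lebesgue. Te (F S) x = Te ((F S)(k := u)) x + Te ((F S)(k := v)) x"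
      using Te_add[of "F S" u k v, OF Linf_c_Lp_space[OF F] Linf_c_Lp_space[OF u] Linf_c_Lp_space[OF v]]
      unfolding fk .
    have 2: "AE x in lebesgue. kernel_integral K (F S) x = kernel_integral K ((F S)(k := u)) x + kernel_integral K ((F S)(k := v)) x"
      using kernel_integral_add[of "F S" u k v, OF Linf_c_var_Lp_space[OF F] Linf_c_var_Lp_space[OF u] Linf_c_var_Lp_space[OF v]]
      unfolding fk .
    have 3: "AE x in lebesgue. x \<notin> (\<Inter>j. supp (((F S)(k := v)) j)) \<longrightarrow> Te ((F S)(k := v)) x = kernel_integral K ((F S)(k := v)) x"
      by (rule Te_kernel_bounded) (use F v in simp)
    from insert.IH 1 2 3 show ?case
    proof eventually_elim
      case (elim x)
      show ?case
      proof
        assume ex: "\<exists>U. open U \<and> x \<in> U \<and> U \<subseteq> Q"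
        then obtain U where U: "open U" "x \<in> U" "U \<subseteq> Q" by blast
        have "U \<inter> {x. v x \<noteq> 0} = {}" using U(3) by (auto simp: v_def restr_def)
        then have "U \<inter> supp v = {}" unfolding supp_def open_Int_closure_eq_empty[OF U(1)] .
        then have "x \<notin> supp (((F S)(k := v)) k)" using U(2) by auto
        then have "x \<notin> (\<Inter>j. supp (((F S)(k := v)) j))" by (metis INT_D UNIV_I)
        then have "Te ((F S)(k := v)) x = kernel_integral K ((F S)(k := v)) x" by (rule elim(4)[rule_format])
        then show "Te f x - kernel_integral K f x = Te (F (insert k S)) x - kernel_integral K (F (insert k S)) x"
          using elim(1) ex elim(2,3) unfolding Fi by simp
      qed
    qed
  qed
  from this[of UNIV] show ?thesis by (simp add: F_def[abs_def])
qed

end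

context fractional_operator
begin

lemma eventually_not_in_cell:
  assumes "y \<noteq> x"
  shows "\<forall>\<^sub>F N in sequentially. y \<notin> cell N (index N x)"
proof -
  obtain i where i: "y $ i \<noteq> x $ i" using assms by (auto simp: vec_eq_iff)
  then have "0 < \<bar>y $ i - x $ i\<bar>" by simp
  have "(\<lambda>N. (1 / 2 :: real) ^ N) \<longlonglongrightarrow> 0" by (rule LIMSEQ_power_zero) simp
  from order_tendstoD(2)[OF this \<open>0 < \<bar>y $ i - x $ i\<bar>\<close>] show ?thesis
  proof eventually_elim
    case (elim N)
    show ?case
    proof
      assume "y \<in> cell N (index N x)"
      then have "\<lfloor>2 ^ N * y $ i\<rfloor> = \<lfloor>2 ^ N * x $ i\<rfloor>" by (simp add: cell_def index_def)
      then have "\<bar>2 ^ N * y $ i - 2 ^ N * x $ i\<bar> < 1" by linarith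
      moreover have "\<bar>2 ^ N * y $ i - 2 ^ N * x $ i\<bar> = 2 ^ N * \<bar>y $ i - x $ i\<bar>"
        by (simp only: right_diff_distrib[symmetric] abs_mult) simp
      ultimately have "\<bar>y $ i - x $ i\<bar> < (1 / 2) ^ N" by (simp add: power_divide less_divide_eq mult.commute)
      then show False using elim by simp
    qed
  qed
qed

text \<open>Off the single diagonal point some y_j differs from x and eventually leaves the
  shrinking cell of x, so the integrand vanishes from some N on; the uncut integrand
  dominates.\<close>

lemma kernel_integral_cell_tendsto:
  assumes f: "\<And>j. f j \<in> Linf_c"
  shows "AE x in lebesgue. (\<lambda>N. norm (kernel_integral K (\<lambda>j. restr (cell N (index N x)) (f j)) x)) \<longlonglongrightarrow> 0"
proof -
  have "AE x in lebesgue. integrable lebesgue (\<lambda>y. K x y * (\<Prod>j\<in>UNIV. f j (y $ j)))"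
    by (intro kernel_integral_integrable_space Linf_c_var_Lp_space f)
  with kernel_section_measurable[OF K_loc] show ?thesis
  proof eventually_elim
    case (elim x)
    let ?g = "\<lambda>N y. K x y * (\<Prod>j\<in>UNIV. restr (cell N (index N x)) (f j) (y $ j))"
    have rm: "restr (cell N (index N x)) (f j) \<in> borel_measurable lebesgue" for N j
      using restr_Linf_c[OF f cell_sets(2)] by (simp add: Linf_c_def)
    have "(\<lambda>N. LINT y|lebesgue. ?g N y) \<longlonglongrightarrow> (LINT y :: real^'n^'m|lebesgue. (0 :: complex))"
    proof (rule integral_dominated_convergence)
      show "integrable lebesgue (\<lambda>y. norm (K x y * (\<Prod>j\<in>UNIV. f j (y $ j))))"
        using elim(2) by (rule integrable_norm)
      show "?g N \<in> borel_measurable lebesgue" for N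
        by (rule comm_integrand_measurable(2)[OF rm borel_measurable_const elim(1)])
      show "AE y in lebesgue. norm (?g N y) \<le> norm (K x y * (\<Prod>j\<in>UNIV. f j (y $ j)))" for N
        unfolding norm_mult prod_norm[symmetric]
        by (intro AE_I2 mult_left_mono prod_mono) (auto simp: restr_def)
      have "AE y in lebesgue. y \<notin> {\<chi> j. x}" by (intro AE_not_in) simp
      then show "AE y in lebesgue. (\<lambda>N. ?g N y) \<longlonglongrightarrow> 0"
      proof eventually_elim
        case (elim y)
        then obtain j where "y $ j \<noteq> x" by (auto simp: vec_eq_iff)
        from eventually_not_in_cell[OF this]
        have "\<forall>\<^sub>F N in sequentially. ?g N y = 0"
        proof eventually_elim
          case (elim N)
          then have "restr (cell N (index N x)) (f j) (y $ j) = 0" by (simp add: restr_def)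
          then have "(\<Prod>j\<in>UNIV. restr (cell N (index N x)) (f j) (y $ j)) = 0" by (intro prod_zero) auto
          then show ?case by simp
        qed
        then show ?case by (rule tendsto_eventually)
      qed
    qed simp
    then show ?case unfolding kernel_integral_def by (intro tendsto_norm_zero) simp
  qed
qed

lemma Lp_norm_restr_le:
  assumes f: "f \<in> borel_measurable lebesgue" "\<And>x. norm (f x) \<le> M"
    and Q: "Q \<subseteq> cube w d" "0 \<le> d" and s: "1 \<le> s"
  shows "Lp_norm s (restr Q f) \<le> M * (d ^ CARD('n)) powr (1 / s)"
proof -
  have M: "0 \<le> M" using f(2)[of undefined] norm_ge_zero order_trans by blast
  have int: "integrable lebesgue (\<lambda>x. M powr s * indicat_real (cube w d) x)"
    using emeasure_cube_lebesgue[OF Q(2), of w] by (intro integrable_mult_right integrable_real_indicator) auto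
  have "(LINT x|lebesgue. norm (restr Q f x) powr s) \<le> (LINT x|lebesgue. M powr s * indicat_real (cube w d) x)"
  proof (rule integral_mono'[OF int])
    show "norm (restr Q f x) powr s \<le> M powr s * indicat_real (cube w d) x" for x
      using powr_mono2[OF _ norm_ge_zero f(2)[of x], of s] Q(1) s by (auto simp: restr_def indicator_def)
  qed auto
  also have "\<dots> = M powr s * d ^ CARD('n)" using measure_cube[OF Q(2), of w] by simp
  finally have "Lp_norm s (restr Q f) \<le> (M powr s * d ^ CARD('n)) powr (1 / s)"
    unfolding Lp_norm_def using s by (intro powr_mono2) auto
  also have "\<dots> = M * (d ^ CARD('n)) powr (1 / s)"
    using s M Q(2) by (simp add: powr_mult powr_powr)
  finally show ?thesis .
qed

lemma Lp_norm_nonneg: "0 \<le> Lp_norm s f"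
  by (simp add: Lp_norm_def)

text \<open>A bounded function on a cell of side 2^-N has L^(s_j) norm at most M 2^(-N n / s_j). The
  exponents add up in the product, and the weak type bound raises it to the power r.\<close>

lemma Te_cell_estimate:
  assumes f: "\<And>j. f j \<in> Linf_c" and M: "0 \<le> M" "\<And>j x. norm (f j x) \<le> M" and t: "0 < t"
  shows "emeasure lebesgue {x. t < norm (Te (\<lambda>j. restr (cell N z) (f j)) x)}
    \<le> ennreal ((\<bar>B\<bar> * M ^ CARD('m) / t) powr r * (2 powr (- (real CARD('n) * (r * (\<Sum>j\<in>UNIV. 1 / sj j))))) ^ N)"
proof -
  let ?n = "real CARD('n)" and ?\<sigma> = "\<Sum>j\<in>UNIV. 1 / sj j"
  have rf: "restr (cell N z) (f j) \<in> Lp_space (sj j)" for j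
    by (intro Linf_c_Lp_space restr_Linf_c f cell_sets)
  have e: "((1 / 2 ^ N) ^ CARD('n)) powr (1 / sj j) = 2 powr (- (real N * ?n) * (1 / sj j))" for j
  proof -
    have "(1 / 2 ^ N :: real) ^ CARD('n) = 2 powr (- (real N * ?n))"
      by (simp add: powr_minus powr_realpow[symmetric] powr_powr[symmetric] power_one_over divide_inverse power_inverse)
    then show ?thesis by (simp only: powr_powr)
  qed
  have "Lp_norm (sj j) (restr (cell N z) (f j)) \<le> M * 2 powr (- (real N * ?n) * (1 / sj j))" for j
  proof -
    have "f j \<in> borel_measurable lebesgue" using f[of j] by (simp add: Linf_c_def)
    from Lp_norm_restr_le[OF this M(2) cell_subset_cube[of N z] _ sj[of j]]
    show ?thesis unfolding e[symmetric] by simp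
  qed
  then have "(\<Prod>j\<in>UNIV. Lp_norm (sj j) (restr (cell N z) (f j))) \<le> (\<Prod>j\<in>UNIV. M * 2 powr (- (real N * ?n) * (1 / sj j)))"
    by (intro prod_mono conjI Lp_norm_nonneg)
  also have "\<dots> = M ^ CARD('m) * 2 powr (- (real N * ?n) * ?\<sigma>)"
    by (simp only: prod.distrib prod_constant sum_distrib_left powr_sum)
  finally have "\<bar>B\<bar> * (\<Prod>j\<in>UNIV. Lp_norm (sj j) (restr (cell N z) (f j))) / t
      \<le> \<bar>B\<bar> * (M ^ CARD('m) * 2 powr (- (real N * ?n) * ?\<sigma>)) / t"
    using t by (intro divide_right_mono mult_left_mono) auto
  also have "\<dots> = (\<bar>B\<bar> * M ^ CARD('m) / t) * 2 powr (- (real N * ?n) * ?\<sigma>)" by simp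
  finally have "(\<bar>B\<bar> * (\<Prod>j\<in>UNIV. Lp_norm (sj j) (restr (cell N z) (f j))) / t) powr r
      \<le> ((\<bar>B\<bar> * M ^ CARD('m) / t) * 2 powr (- (real N * ?n) * ?\<sigma>)) powr r"
    using t r_pos by (intro powr_mono2) (auto intro!: prod_nonneg Lp_norm_nonneg divide_nonneg_pos mult_nonneg_nonneg)
  also have "\<dots> = (\<bar>B\<bar> * M ^ CARD('m) / t) powr r * (2 powr (- (real N * ?n) * ?\<sigma>)) powr r"
    by (rule powr_mult)
  also have "(2 powr (- (real N * ?n) * ?\<sigma>)) powr r = (2 powr (- (?n * (r * ?\<sigma>)))) ^ N"
    by (simp add: powr_powr powr_realpow[symmetric] mult_ac)
  finally show ?thesis using Te_weak_estimate[OF rf t] by (meson ennreal_leI order_trans)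
qed

text \<open>At most \<open>O(2^{N n})\<close> cells meet the supports, and each contributes
  \<open>O(2^{-N n r / s})\<close> with \<open>1/s = \<Sum>j. 1 / sj j\<close>.\<close>

lemma Te_cells_small:
  assumes f: "\<And>j. f j \<in> Linf_c" and t: "0 < t"
  shows "{x. t < norm (Te (\<lambda>j. restr (cell N (index N x)) (f j)) x)} \<in> sets lebesgue"
    and "(\<lambda>N. emeasure lebesgue {x. t < norm (Te (\<lambda>j. restr (cell N (index N x)) (f j)) x)}) \<longlonglongrightarrow> 0"
proof -
  let ?n = "real CARD('n)" and ?\<sigma> = "\<Sum>j\<in>UNIV. 1 / sj j"
  define E where "E N z = {x. t < norm (Te (\<lambda>j. restr (cell N z) (f j)) x)}" for N z
  define X where "X N = {x. t < norm (Te (\<lambda>j. restr (cell N (index N x)) (f j)) x)}" for N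
  have rf: "restr (cell N z) (f j) \<in> Lp_space (sj j)" for N z j
    by (intro Linf_c_Lp_space restr_Linf_c f cell_sets)
  have E[measurable]: "E N z \<in> sets lebesgue" for N z
  proof -
    have [measurable]: "Te (\<lambda>j. restr (cell N z) (f j)) \<in> borel_measurable lebesgue" by (rule Te_measurable[OF rf])
    have "{x \<in> space lebesgue. t < norm (Te (\<lambda>j. restr (cell N z) (f j)) x)} \<in> sets lebesgue" by measurable
    then show ?thesis by (simp add: E_def)
  qed
  have XE: "X N = (\<Union>z. cell N z \<inter> E N z)" for N
    unfolding X_def E_def by (rule set_eqI) (simp add: cell_iff)
  have X: "X N \<in> sets lebesgue" for N
    unfolding XE
  proof (rule sets.countable_UN)
    show "range (\<lambda>z. cell N z \<inter> E N z) \<subseteq> sets lebesgue"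
      using sets.Int[OF cell_sets(2) E] by (simp only: image_subset_iff) blast
  qed
  then show "{x. t < norm (Te (\<lambda>j. restr (cell N (index N x)) (f j)) x)} \<in> sets lebesgue"
    by (simp add: X_def)
  have "\<exists>MR. 0 < fst MR \<and> 0 < snd MR \<and> (\<forall>x. norm (f j x) \<le> fst MR) \<and> (\<forall>x. f j x \<noteq> 0 \<longrightarrow> x \<in> cube 0 (snd MR))" for j
  proof -
    obtain M R where "0 < M" "0 < R" "\<And>x. norm (f j x) \<le> M" "\<And>x. f j x \<noteq> 0 \<Longrightarrow> x \<in> cube 0 R"
      using Linf_c_bounded_support[OF f[of j]] by blast
    then show ?thesis by (intro exI[of _ "(M, R)"]) simp
  qed
  then have "\<exists>MR. \<forall>j. 0 < fst (MR j) \<and> 0 < snd (MR j) \<and> (\<forall>x. norm (f j x) \<le> fst (MR j)) \<and> (\<forall>x. f j x \<noteq> 0 \<longrightarrow> x \<in> cube 0 (snd (MR j)))"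
    by (intro choice allI)
  then obtain MR where MR': "\<forall>j. 0 < fst (MR j) \<and> 0 < snd (MR j) \<and> (\<forall>x. norm (f j x) \<le> fst (MR j)) \<and> (\<forall>x. f j x \<noteq> 0 \<longrightarrow> x \<in> cube 0 (snd (MR j)))" ..
  define Ms where "Ms j = fst (MR j)" for j
  define Rs where "Rs j = snd (MR j)" for j
  have MR: "0 < Ms j" "0 < Rs j" "norm (f j x) \<le> Ms j" "f j x \<noteq> 0 \<Longrightarrow> x \<in> cube 0 (Rs j)" for j x
    using MR' by (simp_all add: Ms_def Rs_def)
  define M where "M = (\<Sum>j\<in>UNIV. Ms j)"
  define R where "R = (\<Sum>j\<in>UNIV. Rs j)"
  have "Ms j \<le> M" "Rs j \<le> R" for j
    unfolding M_def R_def using MR(1,2) by (simp_all add: member_le_sum less_imp_le)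
  then have M: "norm (f j x) \<le> M" and R: "Rs j \<le> R" for j x
    using order_trans[OF MR(3)[of j x]] by simp_all
  have M0: "0 \<le> M" unfolding M_def using MR(1) by (intro sum_nonneg less_imp_le)
  \<comment> \<open>The extra 1 is room for the floor: at points of the supports |2^N x_i| is at
    most 2^N k - 1, so the cell index stays within 2^N k.\<close>
  obtain k :: nat where k: "R / 2 + 1 \<le> real k" using real_arch_simple by blast
  define I :: "nat \<Rightarrow> ('n \<Rightarrow> int) set" where "I N = PiE UNIV (\<lambda>_. {- (2 ^ N * int k)..2 ^ N * int k})" for N
  have fin: "finite (I N)" for N unfolding I_def by (intro finite_PiE) auto
  have "0 \<le> R" unfolding R_def using MR(2) by (intro sum_nonneg less_imp_le)
  then have k1: "1 \<le> k" using k by linarith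
  have cardI: "real (card (I N)) \<le> real (3 * k) ^ CARD('n) * (2 powr ?n) ^ N" for N
  proof -
    have "card {- (2 ^ N * int k)..2 ^ N * int k} = 2 * (2 ^ N * k) + 1" by (simp add: nat_add_distrib nat_mult_distrib nat_power_eq)
    then have "card (I N) = (2 * (2 ^ N * k) + 1) ^ CARD('n)" unfolding I_def by (simp add: card_PiE)
    also have "\<dots> \<le> (3 * k * 2 ^ N) ^ CARD('n)"
    proof (rule power_mono)
      have "1 \<le> 2 ^ N * k" using k1 by simp
      then show "2 * (2 ^ N * k) + 1 \<le> 3 * k * 2 ^ N" by (simp add: mult_ac)
    qed simp
    finally have "real (card (I N)) \<le> real ((3 * k * 2 ^ N) ^ CARD('n))" by (rule of_nat_mono)
    also have "\<dots> = real (3 * k) ^ CARD('n) * (2 powr ?n) ^ N"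
      by (simp add: power_mult_distrib powr_realpow power_mult[symmetric] mult.commute)
    finally show ?thesis .
  qed
  \<comment> \<open>Outside \<open>I N\<close> all restricted entries vanish identically, and the
    weak type bound makes the image of the zero tuple vanish almost everywhere. There are only
    countably many such cells.\<close>
  have out: "E N z \<in> null_sets lebesgue" if z: "z \<in> - I N" for N z
  proof -
    have zero: "restr (cell N z) (f j) = (\<lambda>_. 0)" for j
    proof (rule ext, rule ccontr)
      fix x assume "restr (cell N z) (f j) x \<noteq> 0"
      then have x: "x \<in> cell N z" "f j x \<noteq> 0" by (auto simp: restr_def split: if_splits)
      have "z i \<in> {- (2 ^ N * int k)..2 ^ N * int k}" for i
      proof -
        have "\<bar>x $ i\<bar> \<le> R / 2" using MR(4)[OF x(2)] R[of j] unfolding cube_def by (auto intro: order_trans)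
        then have "\<bar>2 ^ N * x $ i\<bar> \<le> 2 ^ N * (R / 2)" by (simp add: abs_mult)
        also have "\<dots> \<le> 2 ^ N * (real k - 1)" using k by (intro mult_left_mono) auto
        also have "\<dots> \<le> 2 ^ N * real k - 1" by (simp add: right_diff_distrib)
        finally have *: "\<bar>2 ^ N * x $ i\<bar> \<le> 2 ^ N * real k - 1" .
        have zi: "\<lfloor>2 ^ N * x $ i\<rfloor> = z i" using x(1) by (simp add: cell_def)
        have "real_of_int (- (2 ^ N * int k)) \<le> real_of_int (z i)" "real_of_int (z i) \<le> real_of_int (2 ^ N * int k)"
          using * zi by (simp_all, linarith+)
        then show ?thesis unfolding of_int_le_iff by simp
      qed
      then show False using z by (simp add: I_def PiE_UNIV_domain)
    qed
    have "emeasure lebesgue (E N z) \<le> 0"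
      using Te_weak_estimate[OF rf t, of "\<lambda>_. N" "\<lambda>_. z"] sj
      by (simp add: E_def zero Lp_norm_def prod_constant power_0_left)
    then show ?thesis using E by (intro null_setsI) auto
  qed
  define D where "D = (\<bar>B\<bar> * M ^ CARD('m) / t) powr r"
  have D: "0 \<le> D" by (simp add: D_def)
  \<comment> \<open>The factor 2^n by which the number of cells grows per generation, times the gain
    2^(- n r / s) per cell; it is below 1 because r > s.\<close>
  define \<rho> where "\<rho> = 2 powr (?n * (1 - r * ?\<sigma>))"
  have \<rho>: "0 \<le> \<rho>" "\<rho> < 1"
    using r_gt by (auto simp: \<rho>_def powr_less_one mult_less_0_iff)
  have bound: "emeasure lebesgue (X N) \<le> ennreal (real (3 * k) ^ CARD('n) * D * \<rho> ^ N)" for N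
  proof -
    have "X N \<subseteq> (\<Union>z\<in>I N. E N z) \<union> (\<Union>z\<in>- I N. E N z)" unfolding XE by blast
    then have "emeasure lebesgue (X N) \<le> emeasure lebesgue ((\<Union>z\<in>I N. E N z) \<union> (\<Union>z\<in>- I N. E N z))"
      by (intro emeasure_mono sets.Un sets.countable_UN') auto
    also have "\<dots> = emeasure lebesgue (\<Union>z\<in>I N. E N z)"
      by (intro emeasure_Un_null_set null_sets_UN' out sets.finite_UN fin) auto
    also have "\<dots> \<le> (\<Sum>z\<in>I N. emeasure lebesgue (E N z))"
      by (intro emeasure_subadditive_finite fin) auto
    also have "\<dots> \<le> (\<Sum>z\<in>I N. ennreal (D * (2 powr (- (?n * (r * ?\<sigma>)))) ^ N))"
      unfolding E_def D_def by (intro sum_mono Te_cell_estimate f M M0 t)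
    also have "\<dots> = ennreal (real (card (I N)) * (D * (2 powr (- (?n * (r * ?\<sigma>)))) ^ N))"
      using D by (simp add: ennreal_mult ennreal_of_nat_eq_real_of_nat)
    also have "\<dots> \<le> ennreal ((real (3 * k) ^ CARD('n) * (2 powr ?n) ^ N) * (D * (2 powr (- (?n * (r * ?\<sigma>)))) ^ N))"
      using D by (intro ennreal_leI mult_right_mono cardI) auto
    also have "(real (3 * k) ^ CARD('n) * (2 powr ?n) ^ N) * (D * (2 powr (- (?n * (r * ?\<sigma>)))) ^ N)
      = real (3 * k) ^ CARD('n) * D * (2 powr ?n * 2 powr (- (?n * (r * ?\<sigma>)))) ^ N"
      by (simp only: power_mult_distrib mult_ac)
    also have "2 powr ?n * 2 powr (- (?n * (r * ?\<sigma>))) = \<rho>"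
      unfolding \<rho>_def powr_add[symmetric] by (simp add: right_diff_distrib)
    finally show ?thesis .
  qed
  have "(\<lambda>N. real (3 * k) ^ CARD('n) * D * \<rho> ^ N) \<longlonglongrightarrow> 0"
    using LIMSEQ_power_zero[of \<rho>] \<rho> by (intro tendsto_mult_right_zero) auto
  then have "(\<lambda>N. ennreal (real (3 * k) ^ CARD('n) * D * \<rho> ^ N)) \<longlonglongrightarrow> 0"
    using tendsto_ennrealI by fastforce
  from tendsto_sandwich[OF _ _ tendsto_const this, of "\<lambda>N. emeasure lebesgue (X N)"] bound
  have "(\<lambda>N. emeasure lebesgue (X N)) \<longlonglongrightarrow> 0" by (simp add: always_eventually)
  then show "(\<lambda>N. emeasure lebesgue {x. t < norm (Te (\<lambda>j. restr (cell N (index N x)) (f j)) x)}) \<longlonglongrightarrow> 0"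
    unfolding X_def .
qed

lemma Te_eq_kernel_integral:
  assumes f: "\<And>j. f j \<in> Linf_c"
  shows "AE x in lebesgue. Te f x = kernel_integral K f x"
proof -
  define g where "g N x = (\<lambda>j. restr (cell N (index N x)) (f j))" for N x
  \<comment> \<open>Localization holds almost everywhere for each fixed cell. Only countably many
    cells exist, so it holds for all of them at once, and afterwards the cell may be the one
    containing x.\<close>
  have "AE x in lebesgue. \<forall>N z. (\<exists>U. open U \<and> x \<in> U \<and> U \<subseteq> cell N z) \<longrightarrow>
    Te f x - kernel_integral K f x = Te (\<lambda>j. restr (cell N z) (f j)) x - kernel_integral K (\<lambda>j. restr (cell N z) (f j)) x"
    using Te_localize[OF f cell_sets(2)] by (subst AE_all_countable, intro allI, subst AE_all_countable, intro allI)
  with AE_cell_interior have "AE x in lebesgue. 0 \<le> norm (Te f x - kernel_integral K f x) \<and>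
    (\<forall>N. norm (Te f x - kernel_integral K f x) \<le> norm (Te (g N x) x) + norm (kernel_integral K (g N x) x))"
  proof eventually_elim
    case (elim x)
    have "norm (Te f x - kernel_integral K f x) \<le> norm (Te (g N x) x) + norm (kernel_integral K (g N x) x)" for N
    proof -
      have "Te f x - kernel_integral K f x = Te (g N x) x - kernel_integral K (g N x) x"
        unfolding g_def using elim by blast
      then show ?thesis using norm_triangle_ineq4 by simp
    qed
    then show ?case by simp
  qed
  then have "AE x in lebesgue. norm (Te f x - kernel_integral K f x) = 0"
  proof (rule AE_zero_if_small_in_measure)
    show "AE x in lebesgue. (\<lambda>N. norm (kernel_integral K (g N x) x)) \<longlonglongrightarrow> 0"
      unfolding g_def by (rule kernel_integral_cell_tendsto[OF f])
    show "{x. t < norm (Te (g N x) x)} \<in> sets lebesgue" if "0 < t" for t N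
      unfolding g_def by (rule Te_cells_small(1)[OF f that])
    show "(\<lambda>N. emeasure lebesgue {x. t < norm (Te (g N x) x)}) \<longlonglongrightarrow> 0" if "0 < t" for t
      unfolding g_def by (rule Te_cells_small(2)[OF f that])
  qed
  then show ?thesis by simp
qed

end

section \<open>Entries multiplied by BMO functions, and the commutator\<close>

context fractional_operator
begin

text \<open>The entry b f_i is split where |b| exceeds N. Its bounded part \<open>u N\<close> falls
  under the previous case, so the error is that of the tail \<open>v N\<close> for every N. The tail
  is dominated by b f_i and vanishes eventually at each point; hence its kernel integral tends to 0
  and its image under \<open>Te\<close> tends to 0 in measure.\<close>

lemma Te_eq_kernel_integral_BMO:
  assumes f: "\<And>j. f j \<in> Linf_c" and b: "b \<in> BMO"
  shows "AE x in lebesgue. Te (f(i := \<lambda>y. b y * f i y)) x = kernel_integral K (f(i := \<lambda>y. b y * f i y)) x"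
proof -
  define bf where "bf = (\<lambda>y. b y * f i y)"
  define u where "u N = (\<lambda>y. (if norm (b y) \<le> real N then b y else 0) * f i y)" for N :: nat
  define w where "w N = restr {y. \<not> norm (b y) \<le> real N} (f i)" for N :: nat
  define v where "v N = (\<lambda>y. b y * w N y)" for N :: nat
  have [measurable]: "b \<in> borel_measurable lebesgue" using b by (simp add: BMO_def loc_measurable)
  have fm: "f j \<in> borel_measurable lebesgue" for j using f[of j] by (simp add: Linf_c_def)
  have u: "u N \<in> Linf_c" for N
    unfolding u_def by (rule Linf_c_multiply[OF f, of _ "real N"]) auto
  have Q: "{y. \<not> norm (b y) \<le> real N} \<in> sets lebesgue" for N
  proof -
    have "{y \<in> space lebesgue. \<not> norm (b y) \<le> real N} \<in> sets lebesgue" by measurable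
    then show ?thesis by simp
  qed
  have w: "w N \<in> Linf_c" for N unfolding w_def by (rule restr_Linf_c[OF f Q])
  have bfL: "bf \<in> Lp_space (sj j)" and vL: "v N \<in> Lp_space (sj j)" for N j
    unfolding bf_def v_def by (rule Linf_c_in_Lp_space[OF f b sj], rule Linf_c_in_Lp_space[OF w b sj])
  have bfV: "bf \<in> var_Lp_space (ps j)" and vV: "v N \<in> var_Lp_space (ps j)" for N j
    unfolding bf_def v_def
    by (rule BMO_times_Linf_c_in_var_Lp_space[OF f b ps_ge_1 ps_le], rule BMO_times_Linf_c_in_var_Lp_space[OF w b ps_ge_1 ps_le])
  have uv: "(\<lambda>y. u N y + v N y) = bf" for N
    by (rule ext) (simp add: u_def v_def w_def bf_def restr_def)
  have vb: "norm (v N y) \<le> norm (bf y)" for N y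
    by (simp add: v_def w_def bf_def restr_def)
  have v0: "\<forall>\<^sub>F N in sequentially. v N y = 0" for y
  proof -
    obtain N0 :: nat where "norm (b y) \<le> real N0" using real_arch_simple by blast
    then show ?thesis unfolding eventually_sequentially
      by (intro exI[of _ N0]) (auto simp: v_def w_def restr_def)
  qed
  have vm: "v N \<in> borel_measurable lebesgue" for N using vL[of N i] by (simp add: Lp_space_def)
  have L: "(f(i := v N)) j \<in> Lp_space (sj j)" for N j using vL Linf_c_Lp_space[OF f] by simp
  have "AE x in lebesgue. \<forall>N. Te (f(i := \<lambda>y. u N y + v N y)) x = Te (f(i := u N)) x + Te (f(i := v N)) x"
    unfolding AE_all_countable by (intro allI Te_add Linf_c_Lp_space f u vL)
  moreover have "AE x in lebesgue. \<forall>N. kernel_integral K (f(i := \<lambda>y. u N y + v N y)) x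
      = kernel_integral K (f(i := u N)) x + kernel_integral K (f(i := v N)) x"
    unfolding AE_all_countable by (intro allI kernel_integral_add Linf_c_var_Lp_space f u vV)
  moreover have "AE x in lebesgue. \<forall>N. Te (f(i := u N)) x = kernel_integral K (f(i := u N)) x"
    unfolding AE_all_countable using f u by (intro allI Te_eq_kernel_integral) simp
  ultimately have "AE x in lebesgue. 0 \<le> norm (Te (f(i := bf)) x - kernel_integral K (f(i := bf)) x) \<and>
    (\<forall>N. norm (Te (f(i := bf)) x - kernel_integral K (f(i := bf)) x)
      \<le> norm (Te (f(i := v N)) x) + norm (kernel_integral K (f(i := v N)) x))"
    unfolding uv
  proof eventually_elim
    case (elim x)
    have "norm (Te (f(i := bf)) x - kernel_integral K (f(i := bf)) x)
      \<le> norm (Te (f(i := v N)) x) + norm (kernel_integral K (f(i := v N)) x)" for N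
    proof -
      have "Te (f(i := bf)) x - kernel_integral K (f(i := bf)) x = Te (f(i := v N)) x - kernel_integral K (f(i := v N)) x"
        using elim(1)[rule_format, of N] elim(2)[rule_format, of N] elim(3)[rule_format, of N] by simp
      then show ?thesis using norm_triangle_ineq4 by simp
    qed
    then show ?case by simp
  qed
  then have "AE x in lebesgue. norm (Te (f(i := bf)) x - kernel_integral K (f(i := bf)) x) = 0"
  proof (rule AE_zero_if_small_in_measure)
    have "AE x in lebesgue. integrable lebesgue (\<lambda>y. K x y * (\<Prod>j\<in>UNIV. (f(i := bf)) j (y $ j)))"
      using bfV Linf_c_var_Lp_space[OF f] by (intro kernel_integral_integrable_space) simp
    with kernel_section_measurable[OF K_loc]
    show "AE x in lebesgue. (\<lambda>N. norm (kernel_integral K (f(i := v N)) x)) \<longlonglongrightarrow> 0"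
    proof eventually_elim
      case (elim x)
      have "(\<lambda>N. LINT y|lebesgue. K x y * (\<Prod>j\<in>UNIV. (f(i := v N)) j (y $ j))) \<longlonglongrightarrow> (LINT y :: real^'n^'m|lebesgue. (0 :: complex))"
      proof (rule integral_dominated_convergence)
        show "integrable lebesgue (\<lambda>y. norm (K x y * (\<Prod>j\<in>UNIV. (f(i := bf)) j (y $ j))))"
          using elim(2) by (rule integrable_norm)
        have "(f(i := v N)) j \<in> borel_measurable lebesgue" for N j using vm fm by simp
        then show "(\<lambda>y. K x y * (\<Prod>j\<in>UNIV. (f(i := v N)) j (y $ j))) \<in> borel_measurable lebesgue" for N
          by (rule comm_integrand_measurable(2)[OF _ borel_measurable_const elim(1)])
        show "AE y in lebesgue. norm (K x y * (\<Prod>j\<in>UNIV. (f(i := v N)) j (y $ j)))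
            \<le> norm (K x y * (\<Prod>j\<in>UNIV. (f(i := bf)) j (y $ j)))" for N
          unfolding norm_mult prod_norm[symmetric] by (intro AE_I2 mult_left_mono prod_mono) (auto simp: vb)
        show "AE y in lebesgue. (\<lambda>N. K x y * (\<Prod>j\<in>UNIV. (f(i := v N)) j (y $ j))) \<longlonglongrightarrow> 0"
        proof (rule AE_I2)
          fix y :: "real^'n^'m"
          have "\<forall>\<^sub>F N in sequentially. K x y * (\<Prod>j\<in>UNIV. (f(i := v N)) j (y $ j)) = 0"
            using v0[of "y $ i"]
          proof eventually_elim
            case (elim N)
            then have "(\<Prod>j\<in>UNIV. (f(i := v N)) j (y $ j)) = 0" by (intro prod_zero bexI[of _ i]) auto
            then show ?case by simp
          qed
          then show "(\<lambda>N. K x y * (\<Prod>j\<in>UNIV. (f(i := v N)) j (y $ j))) \<longlonglongrightarrow> 0" by (rule tendsto_eventually)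
        qed
      qed simp
      then show ?case unfolding kernel_integral_def by (intro tendsto_norm_zero) simp
    qed
  next
    fix t :: real and N :: nat assume "0 < t"
    have [measurable]: "Te (f(i := v N)) \<in> borel_measurable lebesgue" by (rule Te_measurable[OF L])
    have "{x \<in> space lebesgue. t < norm (Te (f(i := v N)) x)} \<in> sets lebesgue" by measurable
    then show "{x. t < norm (Te (f(i := v N)) x)} \<in> sets lebesgue" by simp
  next
    fix t :: real assume t: "0 < t"
    \<comment> \<open>Only the i-th factor depends on N. Its norm tends to 0 by dominated
      convergence, and the weak type estimate converts this into convergence in measure.\<close>
    define P where "P N = (\<Prod>j\<in>UNIV. Lp_norm (sj j) ((f(i := v N)) j))" for N
    have "(\<lambda>N. LINT x|lebesgue. norm (v N x) powr sj i) \<longlonglongrightarrow> (LINT x :: real^'n|lebesgue. (0 :: real))"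
    proof (rule integral_dominated_convergence)
      show "integrable lebesgue (\<lambda>x. norm (bf x) powr sj i)" using bfL[of i] by (simp add: Lp_space_def)
      show "(\<lambda>x. norm (v N x) powr sj i) \<in> borel_measurable lebesgue" for N using vm[of N] by measurable
      show "AE x in lebesgue. norm (norm (v N x) powr sj i) \<le> norm (bf x) powr sj i" for N
        using vb sj[of i] by (intro AE_I2) (auto intro!: powr_mono2)
      show "AE x in lebesgue. (\<lambda>N. norm (v N x) powr sj i) \<longlonglongrightarrow> 0"
      proof (rule AE_I2)
        fix x
        have "\<forall>\<^sub>F N in sequentially. norm (v N x) powr sj i = 0"
          using v0[of x] by eventually_elim simp
        then show "(\<lambda>N. norm (v N x) powr sj i) \<longlonglongrightarrow> 0" by (rule tendsto_eventually)
      qed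
    qed simp
    then have "(\<lambda>N. Lp_norm (sj i) (v N)) \<longlonglongrightarrow> 0"
      unfolding Lp_norm_def using sj[of i]
      by (intro tendsto_zero_powrI[OF _ tendsto_const]) (auto intro!: always_eventually)
    then have "(\<lambda>N. Lp_norm (sj i) (v N) * (\<Prod>j\<in>UNIV - {i}. Lp_norm (sj j) (f j))) \<longlonglongrightarrow> 0"
      by (rule tendsto_mult_left_zero)
    moreover have "P N = Lp_norm (sj i) (v N) * (\<Prod>j\<in>UNIV - {i}. Lp_norm (sj j) (f j))" for N
    proof -
      have "P N = Lp_norm (sj i) ((f(i := v N)) i) * (\<Prod>j\<in>UNIV - {i}. Lp_norm (sj j) ((f(i := v N)) j))"
        unfolding P_def by (rule prod.remove) auto
      also have "(\<Prod>j\<in>UNIV - {i}. Lp_norm (sj j) ((f(i := v N)) j)) = (\<Prod>j\<in>UNIV - {i}. Lp_norm (sj j) (f j))"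
        by (intro prod.cong) auto
      finally show ?thesis by simp
    qed
    ultimately have "P \<longlonglongrightarrow> 0" by presburger
    then have "(\<lambda>N. \<bar>B\<bar> * P N / t) \<longlonglongrightarrow> 0"
      by (intro tendsto_divide_zero tendsto_mult_right_zero)
    then have "(\<lambda>N. (\<bar>B\<bar> * P N / t) powr r) \<longlonglongrightarrow> 0"
    proof (rule tendsto_zero_powrI[OF _ tendsto_const _ r_pos])
      have "0 \<le> P N" for N unfolding P_def by (intro prod_nonneg Lp_norm_nonneg)
      then show "\<forall>\<^sub>F N in sequentially. 0 \<le> \<bar>B\<bar> * P N / t" using t by (intro always_eventually allI) simp
    qed
    then have lim: "(\<lambda>N. ennreal ((\<bar>B\<bar> * P N / t) powr r)) \<longlonglongrightarrow> 0"
      using tendsto_ennrealI by fastforce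
    have "emeasure lebesgue {x. t < norm (Te (f(i := v N)) x)} \<le> ennreal ((\<bar>B\<bar> * P N / t) powr r)" for N
      unfolding P_def by (rule Te_weak_estimate[OF L t])
    then show "(\<lambda>N. emeasure lebesgue {x. t < norm (Te (f(i := v N)) x)}) \<longlonglongrightarrow> 0"
      by (intro tendsto_sandwich[OF _ _ tendsto_const lim]) (auto intro!: always_eventually)
  qed
  then show ?thesis by (simp add: bf_def)
qed

text \<open>For bounded entries with compact support both terms of each commutator entry converge
  absolutely for almost every x, so they may be merged under one integral and then summed over
  i.\<close>

lemma commutator_eq_comm_kernel_integral:
  assumes f: "\<And>j. f j \<in> Linf_c" and b: "\<And>i. b i \<in> BMO"
  shows "AE x in lebesgue. commutator Te b f x = comm_kernel_integral K b f x"
proof -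
  let ?g = "\<lambda>i. f(i := \<lambda>y. b i y * f i y)"
  have g: "(?g i) j \<in> var_Lp_space (ps j)" for i j
    using BMO_times_Linf_c_in_var_Lp_space[OF f b ps_ge_1 ps_le] Linf_c_var_Lp_space[OF f] by simp
  have "AE x in lebesgue. \<forall>i. Te (?g i) x = kernel_integral K (?g i) x"
    by (subst AE_all_countable) (intro allI Te_eq_kernel_integral_BMO f b)
  moreover have "AE x in lebesgue. \<forall>i. integrable lebesgue (\<lambda>y. K x y * (\<Prod>j\<in>UNIV. ?g i j (y $ j)))"
    by (subst AE_all_countable) (intro allI kernel_integral_integrable_space g)
  moreover have "AE x in lebesgue. integrable lebesgue (\<lambda>y. K x y * (\<Prod>j\<in>UNIV. f j (y $ j)))"
    by (intro kernel_integral_integrable_space Linf_c_var_Lp_space f)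
  ultimately show ?thesis
    using Te_eq_kernel_integral[of f, OF f]
  proof eventually_elim
    case (elim x)
    have P: "(\<Prod>j\<in>UNIV. ?g i j (y $ j)) = b i (y $ i) * (\<Prod>j\<in>UNIV. f j (y $ j))" for i y
    proof -
      have "(\<Prod>j\<in>UNIV. ?g i j (y $ j)) = ?g i i (y $ i) * (\<Prod>j\<in>UNIV - {i}. ?g i j (y $ j))"
        by (rule prod.remove) auto
      also have "(\<Prod>j\<in>UNIV - {i}. ?g i j (y $ j)) = (\<Prod>j\<in>UNIV - {i}. f j (y $ j))"
        by (intro prod.cong) auto
      finally show ?thesis by (simp add: prod.remove[of UNIV i])
    qed
    have ig: "integrable lebesgue (\<lambda>y. b i x * (K x y * (\<Prod>j\<in>UNIV. f j (y $ j))) - K x y * (\<Prod>j\<in>UNIV. ?g i j (y $ j)))" for i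
      using elim(2,3) by (intro Bochner_Integration.integrable_diff integrable_mult_right) auto
    have "commutator_entry Te b i f x = (LINT y|lebesgue. b i x * (K x y * (\<Prod>j\<in>UNIV. f j (y $ j))) - K x y * (\<Prod>j\<in>UNIV. ?g i j (y $ j)))" for i
    proof -
      have "(LINT y|lebesgue. b i x * (K x y * (\<Prod>j\<in>UNIV. f j (y $ j))) - K x y * (\<Prod>j\<in>UNIV. ?g i j (y $ j)))
        = (LINT y|lebesgue. b i x * (K x y * (\<Prod>j\<in>UNIV. f j (y $ j)))) - (LINT y|lebesgue. K x y * (\<Prod>j\<in>UNIV. ?g i j (y $ j)))"
        by (rule Bochner_Integration.integral_diff) (use elim(2,3) in auto)
      also have "\<dots> = b i x * kernel_integral K f x - kernel_integral K (?g i) x"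
        by (simp only: kernel_integral_def integral_mult_right_zero)
      also have "\<dots> = commutator_entry Te b i f x"
        unfolding commutator_entry_def using elim(1,4) by simp
      finally show ?thesis by simp
    qed
    then have "commutator Te b f x = (\<Sum>i\<in>UNIV. (LINT y|lebesgue. b i x * (K x y * (\<Prod>j\<in>UNIV. f j (y $ j))) - K x y * (\<Prod>j\<in>UNIV. ?g i j (y $ j))))"
      by (simp add: commutator_def)
    also have "\<dots> = (LINT y|lebesgue. (\<Sum>i\<in>UNIV. b i x * (K x y * (\<Prod>j\<in>UNIV. f j (y $ j))) - K x y * (\<Prod>j\<in>UNIV. ?g i j (y $ j))))"
      by (rule Bochner_Integration.integral_sum[symmetric]) (rule ig)
    also have "\<dots> = comm_kernel_integral K b f x"
      unfolding comm_kernel_integral_def P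
      by (intro Bochner_Integration.integral_cong refl) (simp add: sum_distrib_right sum_distrib_left algebra_simps)
    finally show ?case .
  qed
qed

end

section \<open>Bounds for the exponents and the continuous extension\<close>

text \<open>The modulus - C / ln t tends to 0 as t decreases to 0. Continuity is what turns
  essential bounds of the exponents into bounds at every point.\<close>

lemma log_Hoelder_continuous:
  fixes q :: "real^'n::finite \<Rightarrow> real"
  assumes "q \<in> log_Hoelder"
  shows "continuous_on UNIV q"
proof -
  obtain C where C: "\<And>x y. norm (x - y) \<le> 1/2 \<Longrightarrow> \<bar>q x - q y\<bar> \<le> - C / ln (norm (x - y))"
    using assms unfolding log_Hoelder_def by blast
  have "isCont q x" for x
  proof -
    have "((\<lambda>t. - C / ln t) \<longlongrightarrow> 0) (at_right (0::real))"
      by (rule tendsto_divide_0[OF tendsto_const filterlim_at_bot_imp_at_infinity[OF ln_at_0]])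
    moreover have "filterlim (\<lambda>y. norm (y - x)) (at_right 0) (at x)"
      unfolding filterlim_at
    proof
      show "((\<lambda>y. norm (y - x)) \<longlongrightarrow> 0) (at x)"
        by (intro tendsto_norm_zero LIM_zero tendsto_ident_at)
      show "\<forall>\<^sub>F y in at x. norm (y - x) \<in> {0<..} \<and> norm (y - x) \<noteq> 0"
        unfolding eventually_at_filter by (auto intro: always_eventually)
    qed
    ultimately have lim: "((\<lambda>y. - C / ln (norm (y - x))) \<longlongrightarrow> 0) (at x)"
      by (rule filterlim_compose)
    have "\<forall>\<^sub>F y in at x. norm (q y - q x) \<le> - C / ln (norm (y - x))"
      unfolding eventually_at
    proof (intro exI[of _ "1/2"] conjI ballI impI)
      fix y assume "y \<noteq> x \<and> dist y x < 1/2"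
      then have "norm (y - x) \<le> 1/2" by (simp add: dist_norm)
      then show "norm (q y - q x) \<le> - C / ln (norm (y - x))" using C[of y x] by simp
    qed simp
    then have "((\<lambda>y. q y - q x) \<longlongrightarrow> 0) (at x)" by (rule Lim_null_comparison[OF _ lim])
    then show ?thesis unfolding isCont_def by (simp add: LIM_zero_cancel)
  qed
  then show ?thesis by (simp add: continuous_at_imp_continuous_on)
qed

text \<open>The set where the bound fails is open and null, hence empty.\<close>

lemma continuous_AE_le_imp_le:
  fixes q :: "'a::euclidean_space \<Rightarrow> real"
  assumes q: "continuous_on UNIV q" and ae: "AE x in lebesgue. q x \<le> P"
  shows "q x \<le> P"
proof -
  have "open {x. P < q x}" using q by (intro open_Collect_less continuous_on_const)
  moreover from this have "{x. P < q x} \<in> null_sets lebesgue"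
    using ae by (subst AE_iff_null_sets) (auto simp: not_less borel_open)
  then have "negligible {x. P < q x}" by (simp add: negligible_iff_null_sets)
  ultimately have "{x. P < q x} = {}" using open_not_negligible by blast
  then show ?thesis by (auto simp: not_less)
qed

text \<open>Applied with \<open>c\<close> the conjugate of p0: log-Hoelder regularity is assumed for
  the quotient and returns to \<open>r\<close> by scaling, while the quotient being above 1 gives
  the lower bound \<open>c\<close>.\<close>

lemma exponent_bounds:
  fixes r :: "real^'n::finite \<Rightarrow> real"
  assumes r: "(\<lambda>x. r x / c) \<in> exponents_log" and c: "0 < c"
    and a: "0 < a" "ereal a < ereal (real CARD('n)) / ess_upper r"
  shows "r \<in> log_Hoelder" "r \<in> borel_measurable lebesgue"
    and "\<exists>P. (\<forall>x. r x \<in> {c..P}) \<and> a / real CARD('n) < 1 / P"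
proof -
  let ?n = "real CARD('n)"
  have rl: "(\<lambda>x. r x / c) \<in> log_Hoelder" and rm: "(\<lambda>x. r x / c) \<in> borel_measurable lebesgue" and "\<And>x. 1 < r x / c"
    using r by (auto simp: exponents_log_def exponents_def)
  then have rc: "c < r x" for x using c by (simp add: less_divide_eq split: if_splits)
  have "(\<lambda>x. c * (r x / c)) \<in> borel_measurable lebesgue" using rm by (intro borel_measurable_times) auto
  then show m: "r \<in> borel_measurable lebesgue" using c by simp
  have "continuous_on UNIV (\<lambda>x. c * (r x / c))"
    by (intro continuous_intros log_Hoelder_continuous[OF rl])
  then have cont: "continuous_on UNIV r" using c by simp
  have ae: "AE x in lebesgue. ereal (r x) \<le> ess_upper r" unfolding ess_upper_def by (rule esssup_AE)
  \<comment> \<open>A real value below the essential supremum excludes -\<infinity>; the value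
    \<infinity> is excluded by a > 0, since n / \<infinity> = 0. So \<open>ess_upper r\<close> is a
    real number.\<close>
  have "\<exists>x. ereal (r x) \<le> ess_upper r"
  proof (rule ccontr)
    assume "\<not> ?thesis"
    then have "AE x :: real^'n in lebesgue. False" using ae by simp
    then show False by (simp add: eventually_False ae_filter_eq_bot_iff)
  qed
  then obtain x0 where x0: "ereal (r x0) \<le> ess_upper r" ..
  have "ess_upper r \<noteq> \<infinity>" using a by auto
  with x0 obtain P where P: "ess_upper r = ereal P" by (cases "ess_upper r") auto
  have P0: "0 < P" using x0 rc[of x0] c unfolding P by simp
  have rP: "r x \<le> P" for x
    by (rule continuous_AE_le_imp_le[OF cont]) (use ae P in simp)
  have "a < ?n / P" using a(2) P0 unfolding P by simp
  then have "a / ?n < 1 / P" using P0 by (simp add: field_simps)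
  moreover have bd: "\<forall>x. r x \<in> {c..P}" using rP rc by (simp add: less_imp_le)
  ultimately show "\<exists>P. (\<forall>x. r x \<in> {c..P}) \<and> a / ?n < 1 / P" by blast
  obtain l where l: "((\<lambda>x. r x / c) \<longlongrightarrow> l) at_infinity" using rl unfolding log_Hoelder_def by blast
  have "(\<lambda>x. c * (r x / c)) \<in> log_Hoelder"
  proof (rule log_Hoelder_compose(1)[OF rl l, where a = 1 and b = "P / c" and B = c])
    show "r x / c \<in> {1..P / c}" for x using bd c by (simp add: divide_right_mono)
    show "\<bar>c * v - c * w\<bar> \<le> c * \<bar>v - w\<bar>" for v w
      using c by (simp add: right_diff_distrib[symmetric] abs_mult)
  qed (rule c)
  then show "r \<in> log_Hoelder" using c by simp
qed

lemma comm_kernel_integral_continuous_extension: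
  fixes K :: "real^'n::finite \<Rightarrow> real^'n^'m::finite \<Rightarrow> complex" and b :: "'m \<Rightarrow> 'n cfun"
  assumes "fractional_operator K A \<alpha> \<alpha>i ps pm pM q Te sj r B" and b: "\<And>i. b i \<in> BMO"
  shows "continuous_extension ps q (commutator Te b) (comm_kernel_integral K b)"
proof -
  interpret fractional_operator K A \<alpha> \<alpha>i ps pm pM q Te sj r B by fact
  show ?thesis
    unfolding continuous_extension_def
  proof (intro conjI allI impI)
    fix f :: "'m \<Rightarrow> 'n cfun" assume "\<forall>j. f j \<in> Linf_c"
    then have "f j \<in> Linf_c" for j by blast
    from commutator_eq_comm_kernel_integral[of f b, OF this b]
    show "AE x in lebesgue. comm_kernel_integral K b f x = commutator Te b f x"
      by eventually_elim simp
  next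
    fix f :: "'m \<Rightarrow> 'n cfun" assume "\<forall>j. f j \<in> var_Lp_space (ps j)"
    then show "comm_kernel_integral K b f \<in> var_Lp_space q"
      using comm_kernel_integral_in_space(1)[of b f] b by blast
  next
    fix F :: "nat \<Rightarrow> 'm \<Rightarrow> 'n cfun" and f assume F: "(\<forall>k j. F k j \<in> var_Lp_space (ps j)) \<and> (\<forall>j. f j \<in> var_Lp_space (ps j)) \<and>
        (\<forall>j. (\<lambda>k. var_Lp_norm (ps j) (\<lambda>x. F k j x - f j x)) \<longlonglongrightarrow> 0)"
    show "(\<lambda>k. var_Lp_norm q (\<lambda>x. comm_kernel_integral K b (F k) x - comm_kernel_integral K b f x)) \<longlonglongrightarrow> 0"
      by (rule comm_kernel_integral_continuous) (use F b in blast)+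
  qed
qed

theorem theorem3p2:
  fixes K :: "real^'n::finite \<Rightarrow> real^'n^'m::finite \<Rightarrow> complex"
    and T :: "('m \<Rightarrow> 'n cfun) \<Rightarrow> 'n cfun \<Rightarrow> complex"
    and Te :: "('m \<Rightarrow> 'n cfun) \<Rightarrow> 'n cfun"
    and p0 p0' \<alpha> :: real and c :: "nat \<Rightarrow> real" and \<alpha>i :: "'m \<Rightarrow> real"
    and ps :: "'m \<Rightarrow> real^'n \<Rightarrow> real" and p q :: "real^'n \<Rightarrow> real"
  assumes "CARD('m) \<ge> 2"
    and "1 < p0" and "1 / p0 + 1 / p0' = 1"
    and "generalized_kernel_operator p0 p0' \<alpha> c K T Te"
    and "summable (\<lambda>k. real k * c k)"
    and "\<And>i. (\<lambda>x. ps i x / p0') \<in> exponents_log"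
    and "\<And>i. 0 < \<alpha>i i \<and> ereal (\<alpha>i i) < ereal (real CARD('n)) / ess_upper (ps i)"
    and "\<alpha> = (\<Sum>i\<in>UNIV. \<alpha>i i)"
    and "\<And>x. 1 / p x = (\<Sum>i\<in>UNIV. 1 / ps i x)"
    and "\<And>x. 1 / q x = 1 / p x - \<alpha> / real CARD('n)"
    and "q \<in> exponents_B"
  shows "\<exists>C>0. \<forall>b. (\<forall>i. b i \<in> BMO) \<longrightarrow>
           (\<exists>S. continuous_extension ps q (commutator Te b) S \<and>
              (\<forall>f. (\<forall>j. f j \<in> var_Lp_space (ps j)) \<longrightarrow>
                 S f \<in> var_Lp_space q \<and>
                 var_Lp_norm q (S f)
                   \<le> C * BMO_tuple_norm b * (\<Prod>j\<in>UNIV. var_Lp_norm (ps j) (f j))))"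
proof -
  let ?n = "real CARD('n)"
  have p0': "1 < p0'"
  proof -
    have "1 / p0 < 1" "0 < 1 / p0" using assms(2) by simp_all
    then have "0 < 1 / p0'" "1 / p0' < 1" using assms(3) by linarith+
    then show ?thesis by (simp add: divide_less_eq split: if_splits)
  qed
  note gen = assms(4)[unfolded generalized_kernel_operator_def]
  obtain A where A: "0 < A" "\<And>x y. (x, y) \<in> off_diagonal \<Longrightarrow>
      norm (K x y) \<le> A * (\<Sum>j\<in>UNIV. norm (x - y $ j)) powr (- (real CARD('m) * ?n - \<alpha>))"
    using gen unfolding size_condition_def by blast
  obtain sj s where sj: "\<And>j. 1 \<le> sj j" "\<And>j. sj j \<le> p0'" and s: "1 / s = (\<Sum>j\<in>UNIV. 1 / sj j)"
    and ext: "weak_bounded_extension sj (s * ?n / (?n - s * \<alpha>)) T Te"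
    using gen by blast
  define r where "r = s * ?n / (?n - s * \<alpha>)"
  obtain B where B: "\<And>f. (\<And>j. f j \<in> Lp_space (sj j)) \<Longrightarrow>
      Te f \<in> weak_Lp_space r \<and> weak_Lp_norm r (Te f) \<le> B * (\<Prod>j\<in>UNIV. Lp_norm (sj j) (f j))"
    using ext unfolding weak_bounded_extension_def r_def by blast
  have \<alpha>i: "0 < \<alpha>i i" for i using assms(7) by blast
  have \<alpha>0: "0 < \<alpha>" unfolding assms(8) by (intro sum_pos \<alpha>i) auto
  \<comment> \<open>From \<alpha> p0' < m n and s_j \<le> p0' one gets \<alpha>/n < m/p0' \<le> 1/s.
    Hence s \<alpha> < n, so that r = s n / (n - s \<alpha>) is positive, and r/s = n / (n - s
    \<alpha>) > 1.\<close>
  have "\<alpha> / ?n < real CARD('m) / p0'"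
    using gen p0' by (simp add: field_simps)
  also have "\<dots> = (\<Sum>j\<in>(UNIV :: 'm set). 1 / p0')" by simp
  also have "\<dots> \<le> (\<Sum>j\<in>UNIV. 1 / sj j)"
    using sj p0' by (intro sum_mono divide_left_mono mult_pos_pos) (auto intro: less_le_trans[OF zero_less_one])
  finally have s1: "\<alpha> / ?n < 1 / s" unfolding s .
  moreover have "0 < \<alpha> / ?n" using \<alpha>0 by simp
  ultimately have s0: "0 < s" by (smt (verit) zero_less_divide_1_iff)
  have ns: "0 < ?n - s * \<alpha>" using s1 s0 by (simp add: field_simps)
  have r0: "0 < r" unfolding r_def using s0 ns by simp
  have r1: "1 < r * (\<Sum>j\<in>UNIV. 1 / sj j)"
    unfolding s[symmetric] r_def using s0 ns \<alpha>0 by (simp add: less_divide_eq)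
  have "\<exists>P. (\<forall>x. ps i x \<in> {p0'..P}) \<and> \<alpha>i i / ?n < 1 / P" for i
    by (rule exponent_bounds(3)[OF assms(6)]) (use p0' assms(7) in simp_all)
  then obtain pM where pM: "\<And>i x. ps i x \<in> {p0'..pM i}" "\<And>i. \<alpha>i i / ?n < 1 / pM i" by metis
  have op: "fractional_operator K A \<alpha> \<alpha>i ps (\<lambda>_. p0') pM q Te sj r B"
  proof unfold_locales
    show "(\<lambda>(x, y). K x y) locally_integrable_on off_diagonal" using gen by blast
    show "0 \<le> A" using A(1) by simp
    show "ps j \<in> log_Hoelder" "ps j \<in> borel_measurable lebesgue" for j
      by (rule exponent_bounds(1,2)[OF assms(6), of "\<alpha>i j"], use p0' assms(7)[of j] in simp_all)+
    show "1 / q x = (\<Sum>j\<in>UNIV. 1 / ps j x) - \<alpha> / ?n" for x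
      using assms(9,10) by simp
    show "1 < q x" "q \<in> borel_measurable lebesgue" for x
      using assms(11) by (auto simp: exponents_B_def exponents_def)
    show "multilinear_on eq_ae (\<lambda>j. Lp_space (sj j)) Te" "kernel_formula Te K"
      using gen ext unfolding weak_bounded_extension_def by blast+
  qed (fact A(2) assms(8) \<alpha>i pM p0' sj(1) r0 r1 B)+
  then interpret fractional_operator K A \<alpha> \<alpha>i ps "\<lambda>_. p0'" pM q Te sj r B .
  show ?thesis
  proof (intro exI[of _ C2] conjI allI impI C2_pos)
    fix b :: "'m \<Rightarrow> 'n cfun" assume "\<forall>i. b i \<in> BMO"
    then have b: "b i \<in> BMO" for i by blast
    show "\<exists>S. continuous_extension ps q (commutator Te b) S \<and>
              (\<forall>f. (\<forall>j. f j \<in> var_Lp_space (ps j)) \<longrightarrow>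
                 S f \<in> var_Lp_space q \<and>
                 var_Lp_norm q (S f)
                   \<le> C2 * BMO_tuple_norm b * (\<Prod>j\<in>UNIV. var_Lp_norm (ps j) (f j)))"
    \<comment> \<open>The absolutely convergent kernel integral is itself the continuous extension,
      so no limit over approximating tuples has to be taken.\<close>
    proof (intro exI[of _ "comm_kernel_integral K b"] conjI allI impI)
      show "continuous_extension ps q (commutator Te b) (comm_kernel_integral K b)"
        by (rule comm_kernel_integral_continuous_extension[OF op b])
    next
      fix f assume "\<forall>j. f j \<in> var_Lp_space (ps j)"
      then have f: "f j \<in> var_Lp_space (ps j)" for j by blast
      show "comm_kernel_integral K b f \<in> var_Lp_space q"
        and "var_Lp_norm q (comm_kernel_integral K b f) \<le> C2 * BMO_tuple_norm b * (\<Prod>j\<in>UNIV. var_Lp_norm (ps j) (f j))"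
        by (rule comm_kernel_integral_in_space[OF b f])+
    qed
  qed
qed

end
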